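(* Let $d,r,s$ be positive integers, let $b_0,\tilde b_0\in (l_0(\mathbb{Z}^d))^{r\times r}$, $b_1,\dots,b_s,\tilde b_1,\dots,\tilde b_s\in (l_0(\mathbb{Z}^d))^{1\times r}$ be finitely supported filters and let $\mathsf M_0,\dots,\mathsf M_s$ be $d\times d$ dilation matrices. Suppose $\psi^0,\tilde\psi^0\in(L_2(\mathbb{R}^d))^r$ are compactly supported standard $\mathsf M_0$-refinable vector functions (associated to $b_0$ and $\tilde b_0$ respectively) satisfying $$\widehat{\psi^0}(\mathsf M_0^{\mathsf T}\xi)=\widehat{b_0}(\xi)\widehat{\psi^0}(\xi),\qquad\widehat{\tilde\psi^0}(\mathsf M_0^{\mathsf T}\xi)=\widehat{\tilde b_0}(\xi)\widehat{\tilde\psi^0}(\xi),\qquad\xi\in\mathbb{R}^d,$$ and $\overline{\widehat{\psi^0}(0)}^{\mathsf T}\widehat{\tilde\psi^0}(0)=1$. Define $\psi^1,\dots,\psi^s,\tilde\psi^1,\dots,\tilde\psi^s\in L_2(\mathbb{R}^d)$ by $$\widehat{\psi^l}(\xi)=\widehat{b_l}(\mathsf M_0^{-\mathsf T}\xi)\widehat{\psi^0}(\mathsf M_0^{-\mathsf T}\xi),\qquad\widehat{\tilde\psi^l}(\xi)=\widehat{\tilde b_l}(\mathsf M_0^{-\mathsf T}\xi)\widehat{\tilde\psi^0}(\mathsf M_0^{-\mathsf T}\xi),\qquad\xi\in\mathbb{R}^d,\ l=1,\dots,s.$$ Then $(\{\psi^l!\mathsf M_l\}_{l=0}^s,\{\tilde\psi^l!\mathsf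 M_l\}_{l=0}^s)$ is a biorthogonal wavelet in $L_2(\mathbb{R}^d)$ with mixed dilation factors if the following conditions are satisfied: (i) $(\{b_l!\mathsf M_l\}_{l=0}^s,\{\tilde b_l!\mathsf M_l\}_{l=0}^s)$ is a biorthogonal wavelet filter bank with mixed dilation factors. (ii) $\{b_l!\mathsf M_l\}_{l=0}^s$ and $\{\tilde b_l!\mathsf M_l\}_{l=0}^s$ have stability in $l_2(\mathbb{Z}^d)$. (iii) $\langle\tilde\psi^0,\psi^0(\cdot-k)\rangle=\boldsymbol\delta(k)I_r$ for all $k\in\mathbb{Z}^d$. Conversely, if $(\{\psi^l!\mathsf M_l\}_{l=0}^s,\{\tilde\psi^l!\mathsf M_l\}_{l=0}^s)$ is a biorthogonal wavelet in $L_2(\mathbb{R}^d)$ with mixed dilation factors and in addition $$[\widehat{\psi^0},\widehat{\psi^0}](\xi)\ge C'I_r,\qquad[\widehat{\tilde\psi^0},\widehat{\tilde\psi^0}](\xi)\ge C'I_r\qquad\text{for a.e. }\xi\in\mathbb{R}^d$$ for some constant $C'>0$, then (i)–(iii) hold.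
   Context: A $d\times d$ dilation matrix is an integer matrix all of whose eigenvalues have modulus greater than $1$. $(l(\mathbb{Z}^d))^{p\times q}$: all sequences $\mathbb{Z}^d\to\mathbb{C}^{p\times q}$; $(l_0(\mathbb{Z}^d))^{p\times q}$: finitely supported ones; $(l_2(\mathbb{Z}^d))^{p\times q}$: square-summable ones. For a sequence $u$, $\widehat u(\xi):=\sum_{k}u(k)e^{-ik\cdot\xi}$. For functions, $\widehat f(\xi)=\int_{\mathbb{R}^d}f(x)e^{-ix\cdot\xi}dx$, extended to $L_2$ and tempered distributions and applied entrywise. $\overline A^{\mathsf T}$ is the conjugate transpose; $A\ge B$ for square matrices means $A-B$ is positive semidefinite; $\boldsymbol\delta(0)=1$, $\boldsymbol\delta(x)=0$ for $x\ne0$. Elements of $(L_2(\mathbb{R}^d))^r$ are column vectors. For matrix-valued $f,g$ with the same number of columns, $\langle f,g\rangle:=\int_{\mathbb{R}^d}f(x)\overline{g(x)}^{\mathsf T}dx$. The bracket product is $[f,g](\xi):=\sum_{k\in\mathbb{Z}^d}f(\xi+2\pi k)\overline{g(\xi+2\pi k)}^{\mathsf T}$. Standard refinable function: $b_0\in(l_0(\mathbb{Z}^d))^{r\times r}$ is assumed to satisfy, for some $C_0,C_b,\tau>0$, $u\in(l_0(\mathbb{Z}^d))^{r\times1}$ and some fixed matrix norm $|||\cdot|||$: $\log_2(|||\widehat{b_0}(0)|||+C_0)\le\tau$ and $\|\widehat{b_0}(\xi)\widehat u(\xi)-\widehat u(\mathsf M_0^{\mathsf T}\xi)\|\le C_b\|\xi\|^\tau$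 for $\xi\in[-\pi,\pi]^d$. The standard $\mathsf M_0$-refinable vector function associated to $b_0$ is then the compactly supported vector distribution $\psi^0$ with $\widehat{\psi^0}(\xi)=\lim_{n\to\infty}\left(\prod_{j=1}^n\widehat{b_0}((\mathsf M_0^{-\mathsf T})^j\xi)\right)\widehat u((\mathsf M_0^{-\mathsf T})^n\xi)$, where the matrix product is taken with factors $j=1,2,\dots,n$ from left to right (the limit is a bounded measurable function with $\widehat{\psi^0}(\xi)=\widehat u(\xi)+O(\|\xi\|^\tau)$ as $\xi\to0$). The same applies to $\tilde b_0$ and $\tilde\psi^0$. Dual framelet filter bank with mixed dilation factors: with $\Omega_l:=[\mathsf M_l^{-\mathsf T}\mathbb{Z}^d]\cap[0,1)^d$ and $\chi_E$ the indicator function of $E$, $\sum_{l=0}^s\chi_{\Omega_l}(\omega)\overline{\widehat{b_l}(\xi)}^{\mathsf T}\widehat{\tilde b_l}(\xi+2\pi\omega)=\boldsymbol\delta(\omega)I_r$ for a.e. $\xi\in\mathbb{R}^d$ and all $\omega\in\bigcup_{l=0}^s\Omega_l$. Operators: $[\mathcal S_{a,\mathsf M}u](n):=|\det(\mathsf M)|^{1/2}\sum_{k}u(k)a(n-\mathsf Mk)$, $[\mathcal T_{b,\mathsf M}u](n):=|\det(\mathsf M)|^{1/2}\sum_{k}u(k)\overline{b(k-\mathsf Mn)}^{\mathsf T}$; $\mathcal W:(l(\mathbb{Z}^d))^{1\times r}\to(l(\mathbb{Z}^d))^{1\times(s+r)}$, $\mathcal Wv=(\mathcal T_{b_1,\mathsf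 M_1}v,\dots,\mathcal T_{b_s,\mathsf M_s}v,\mathcal T_{b_0,\mathsf M_0}v)$; $\tilde{\mathcal V}(w_1,\dots,w_s,w_0)=\sum_{l=0}^s\mathcal S_{\tilde b_l,\mathsf M_l}w_l$ on $(l(\mathbb{Z}^d))^{1\times(s+r)}$. Biorthogonal wavelet filter bank with mixed dilation factors: a dual framelet filter bank with mixed dilation factors for which one (equivalently, each) of the following holds: $\mathcal W$ is surjective; $\tilde{\mathcal V}$ is injective; $\tilde{\mathcal V}\mathcal W$ and $\mathcal W\tilde{\mathcal V}$ are both identity operators. Stability in $l_2(\mathbb{Z}^d)$ of $\{b_l!\mathsf M_l\}_{l=0}^s$: with $v_{0,0}:=v$, $v_{l,j}:=\mathcal T_{b_l,\mathsf M_l}v_{0,j-1}$ and $\mathcal W_Jv:=(v_{1,1},\dots,v_{s,1},\dots,v_{1,J},\dots,v_{s,J},v_{0,J})$, there are positive constants $c_1,c_2$ with $c_1\|v\|^2\le\|\mathcal W_Jv\|^2\le c_2\|v\|^2$ ($l_2$ norms) for all $J\in\mathbb N$ and $v\in(l_2(\mathbb{Z}^d))^{1\times r}$; similarly for $\{\tilde b_l!\mathsf M_l\}_{l=0}^s$. For an invertible real matrix $U$ and $k\in\mathbb{R}^d$, $f_{U;k}(x):=|\det(U)|^{1/2}f(Ux-k)$. The affine system, with $\psi^0=(\psi^0_1,\dots,\psi^0_r)^{\mathsf T}$, is $$\mathrm{AS}(\{\psi^l!\mathsf M_l\}_{l=0}^s):=\{\psi^0_q(\cdot-k):q=1,\dots,r;k\in\mathbb{Z}^d\}\cup\{|\det(\mathsf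 M_0^{-1}\mathsf M_l)|^{\frac12}\psi^l_{\mathsf M_0^j;\mathsf M_0^{-1}\mathsf M_lk}:l=1,\dots,s;\ j\in\mathbb N_0;\ k\in\mathbb{Z}^d\}.$$ $(\{\psi^l!\mathsf M_l\}_{l=0}^s,\{\tilde\psi^l!\mathsf M_l\}_{l=0}^s)$ is a biorthogonal wavelet in $L_2(\mathbb{R}^d)$ with mixed dilation factors if $(\mathrm{AS}(\{\psi^l!\mathsf M_l\}_{l=0}^s),\mathrm{AS}(\{\tilde\psi^l!\mathsf M_l\}_{l=0}^s))$ is a pair of biorthogonal (Riesz) bases for $L_2(\mathbb{R}^d)$. *)

theory Defs
  imports "HOL-Analysis.Analysis"
begin

text \<open>
  The positive integers \<open>d\<close>, \<open>r\<close>, \<open>s\<close> are the cardinalities of the finite index types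
  \<open>'d\<close>, \<open>'r\<close>, \<open>'s\<close>. A \<open>p \<times> q\<close> matrix is an element of \<open>complex ^ 'q ^ 'p\<close>; in particular a
  \<open>1 \<times> r\<close> filter takes values in \<open>complex ^ 'r ^ 1\<close>. The index \<open>l = 0\<close> is kept apart
  (\<open>M0\<close>, \<open>b0\<close>, \<open>\<psi>0\<close>) and \<open>l = 1, \<dots>, s\<close> is the type \<open>'s\<close>. Sequences of row vectors take values
  in \<open>complex ^ 'p\<close> and are multiplied by matrices from the right with \<open>v*\<close>.
\<close>

section \<open>Matrices\<close>

definition rmat :: "int ^ 'n ^ 'm \<Rightarrow> real ^ 'n ^ 'm" where
  "rmat M = (\<chi> i j. real_of_int (M $ i $ j))"

definition rvec :: "int ^ 'n \<Rightarrow> real ^ 'n" where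
  "rvec k = (\<chi> i. real_of_int (k $ i))"

definition dilation_matrix :: "int ^ 'd ^ 'd \<Rightarrow> bool" where
  "dilation_matrix M \<longleftrightarrow>
     (\<forall>(z :: complex) (v :: complex ^ 'd).
        v \<noteq> 0 \<and> (\<chi> i j. complex_of_int (M $ i $ j)) *v v = z *s v \<longrightarrow> cmod z > 1)"

definition inv_transp :: "int ^ 'd ^ 'd \<Rightarrow> real ^ 'd ^ 'd" where
  "inv_transp M = matrix_inv (transpose (rmat M))"

text \<open>The operator \<open>^\<close> on matrices would be the componentwise power.\<close>

definition mat_pow :: "real ^ 'd ^ 'd \<Rightarrow> nat \<Rightarrow> real ^ 'd ^ 'd" where
  "mat_pow A j = (((**) A) ^^ j) (mat 1)"

definition abs_det :: "int ^ 'd ^ 'd \<Rightarrow> real" where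
  "abs_det M = \<bar>real_of_int (det M)\<bar>"

definition conj_transpose :: "complex ^ 'n ^ 'm \<Rightarrow> complex ^ 'm ^ 'n" where
  "conj_transpose A = (\<chi> i j. cnj (A $ j $ i))"

text \<open>\<open>outer x y\<close> is the product of the column \<open>x\<close> with the conjugate transpose of the column \<open>y\<close>.\<close>

definition outer :: "complex ^ 'm \<Rightarrow> complex ^ 'n \<Rightarrow> complex ^ 'n ^ 'm" where
  "outer x y = (\<chi> i j. x $ i * cnj (y $ j))"

definition positive_semidefinite :: "complex ^ 'n ^ 'n \<Rightarrow> bool" where
  "positive_semidefinite A \<longleftrightarrow>
     conj_transpose A = A \<and> (\<forall>x. 0 \<le> Re (\<Sum>i\<in>UNIV. cnj (x $ i) * (A *v x) $ i))"

definition loewner_ge :: "complex ^ 'n ^ 'n \<Rightarrow> complex ^ 'n ^ 'n \<Rightarrow> bool" where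
  "loewner_ge A B \<longleftrightarrow> positive_semidefinite (A - B)"

text \<open>A matrix norm is understood to be submultiplicative.\<close>

definition matrix_norm :: "(complex ^ 'n ^ 'n \<Rightarrow> real) \<Rightarrow> bool" where
  "matrix_norm N \<longleftrightarrow>
     (\<forall>A. 0 \<le> N A) \<and> (\<forall>A. N A = 0 \<longleftrightarrow> A = 0) \<and>
     (\<forall>c A. N (\<chi> i j. c * A $ i $ j) = cmod c * N A) \<and>
     (\<forall>A B. N (A + B) \<le> N A + N B) \<and> (\<forall>A B. N (A ** B) \<le> N A * N B)"

definition delta :: "'a :: zero \<Rightarrow> complex" where
  "delta x = (if x = 0 then 1 else 0)"

section \<open>Filters and the space \<open>L\<^sub>2\<close>\<close>

definition finitely_supported :: "(int ^ 'd \<Rightarrow> 'b :: zero) \<Rightarrow> bool" where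
  "finitely_supported u \<longleftrightarrow> finite {k. u k \<noteq> 0}"

text \<open>The Fourier series of a finitely supported sequence.\<close>

definition fseries :: "(int ^ 'd \<Rightarrow> complex ^ 'q ^ 'p) \<Rightarrow> real ^ 'd \<Rightarrow> complex ^ 'q ^ 'p" where
  "fseries u \<xi> = (\<chi> i j. \<Sum>k | u k \<noteq> 0. u k $ i $ j * cis (- (rvec k \<bullet> \<xi>)))"

definition l2_seq :: "(int ^ 'd \<Rightarrow> complex ^ 'p) \<Rightarrow> bool" where
  "l2_seq v \<longleftrightarrow> (\<lambda>k. (norm (v k))\<^sup>2) summable_on UNIV"

definition l2_norm_sq :: "(int ^ 'd \<Rightarrow> complex ^ 'p) \<Rightarrow> real" where
  "l2_norm_sq v = (\<Sum>\<^sub>\<infinity>k. (norm (v k))\<^sup>2)"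

definition L2_fun :: "(real ^ 'd \<Rightarrow> 'b :: euclidean_space) \<Rightarrow> bool" where
  "L2_fun f \<longleftrightarrow> f \<in> borel_measurable lebesgue \<and> integrable lebesgue (\<lambda>x. (norm (f x))\<^sup>2)"

definition L2_norm :: "(real ^ 'd \<Rightarrow> complex) \<Rightarrow> real" where
  "L2_norm f = sqrt (LINT x|lebesgue. (cmod (f x))\<^sup>2)"

definition L2_inner :: "(real ^ 'd \<Rightarrow> complex) \<Rightarrow> (real ^ 'd \<Rightarrow> complex) \<Rightarrow> complex" where
  "L2_inner f g = (LINT x|lebesgue. f x * cnj (g x))"

definition L2_inner_mat ::
    "(real ^ 'd \<Rightarrow> complex ^ 'm) \<Rightarrow> (real ^ 'd \<Rightarrow> complex ^ 'n) \<Rightarrow> complex ^ 'n ^ 'm" where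
  "L2_inner_mat f g = (LINT x|lebesgue. outer (f x) (g x))"

definition compactly_supported :: "(real ^ 'd \<Rightarrow> 'b :: zero) \<Rightarrow> bool" where
  "compactly_supported f \<longleftrightarrow> (\<exists>K. compact K \<and> (AE x in lebesgue. x \<notin> K \<longrightarrow> f x = 0))"

section \<open>Fourier transform\<close>

text \<open>
  The integral is meaningful for integrable functions, hence for compactly supported
  functions in \<open>L\<^sub>2\<close>; for these it is the continuous representative, with values at every point.
\<close>

definition fourier :: "(real ^ 'd \<Rightarrow> complex) \<Rightarrow> real ^ 'd \<Rightarrow> complex" where
  "fourier f \<xi> = (LINT x|lebesgue. f x * cis (- (x \<bullet> \<xi>)))"

definition fourier_vec :: "(real ^ 'd \<Rightarrow> complex ^ 'r) \<Rightarrow> real ^ 'd \<Rightarrow> complex ^ 'r" where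
  "fourier_vec f \<xi> = (\<chi> q. fourier (\<lambda>x. f x $ q) \<xi>)"

text \<open>
  The Fourier--Plancherel transform on \<open>L\<^sub>2\<close>: \<open>F\<close> is (a representative of) the transform
  of \<open>f\<close> if the Fourier integrals of the truncations of \<open>f\<close> to balls converge to \<open>F\<close> in \<open>L\<^sub>2\<close>.
\<close>

definition has_fourier_L2 :: "(real ^ 'd \<Rightarrow> complex) \<Rightarrow> (real ^ 'd \<Rightarrow> complex) \<Rightarrow> bool" where
  "has_fourier_L2 f F \<longleftrightarrow>
     L2_fun f \<and> L2_fun F \<and>
     ((\<lambda>R. \<integral>\<^sup>+ \<xi>. ennreal ((cmod (fourier (\<lambda>x. indicat_real (cball 0 R) x *\<^sub>R f x) \<xi> - F \<xi>))\<^sup>2) \<partial>lebesgue)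
        \<longlongrightarrow> 0) at_top"

definition bracket ::
    "(real ^ 'd \<Rightarrow> complex ^ 'm) \<Rightarrow> (real ^ 'd \<Rightarrow> complex ^ 'n) \<Rightarrow> real ^ 'd \<Rightarrow> complex ^ 'n ^ 'm" where
  "bracket f g \<xi> =
     (\<Sum>\<^sub>\<infinity>k::int ^ 'd. outer (f (\<xi> + (2 * pi) *\<^sub>R rvec k)) (g (\<xi> + (2 * pi) *\<^sub>R rvec k)))"

section \<open>Standard refinable functions\<close>

primrec mask_product :: "int ^ 'd ^ 'd \<Rightarrow> (int ^ 'd \<Rightarrow> complex ^ 'r ^ 'r) \<Rightarrow> real ^ 'd \<Rightarrow> nat
    \<Rightarrow> complex ^ 'r ^ 'r" where
  "mask_product M0 b0 \<xi> 0 = mat 1"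
| "mask_product M0 b0 \<xi> (Suc n) =
     mask_product M0 b0 \<xi> n ** fseries b0 (mat_pow (inv_transp M0) (Suc n) *v \<xi>)"

text \<open>
  The \<open>r \<times> 1\<close> matrix \<open>fseries u \<xi>\<close> is turned into a vector by \<open>column 1\<close>. A function \<open>\<psi>0\<close> is
  meant to be compactly supported and in \<open>L\<^sub>2\<close> here, so that \<open>fourier_vec\<close> is its transform.
\<close>

definition standard_refinable ::
    "int ^ 'd ^ 'd \<Rightarrow> (int ^ 'd \<Rightarrow> complex ^ 'r ^ 'r) \<Rightarrow> (real ^ 'd \<Rightarrow> complex ^ 'r) \<Rightarrow> bool" where
  "standard_refinable M0 b0 \<psi>0 \<longleftrightarrow>
     (\<exists>C0 Cb \<tau> :: real. \<exists>(u :: int ^ 'd \<Rightarrow> complex ^ 1 ^ 'r) N.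
        C0 > 0 \<and> Cb > 0 \<and> \<tau> > 0 \<and> finitely_supported u \<and> matrix_norm N \<and>
        log 2 (N (fseries b0 0) + C0) \<le> \<tau> \<and>
        (\<forall>\<xi>. (\<forall>i. - pi \<le> \<xi> $ i \<and> \<xi> $ i \<le> pi) \<longrightarrow>
           norm (fseries b0 \<xi> *v column 1 (fseries u \<xi>)
                   - column 1 (fseries u (transpose (rmat M0) *v \<xi>)))
             \<le> Cb * norm \<xi> powr \<tau>) \<and>
        (\<forall>\<xi>. (\<lambda>n. mask_product M0 b0 \<xi> n
                     *v column 1 (fseries u (mat_pow (inv_transp M0) n *v \<xi>)))
               \<longlonglongrightarrow> fourier_vec \<psi>0 \<xi>))"

section \<open>Filter banks with mixed dilation factors\<close>

definition Omega :: "int ^ 'd ^ 'd \<Rightarrow> (real ^ 'd) set" where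
  "Omega M = range (\<lambda>k. inv_transp M *v rvec k) \<inter> {\<omega>. \<forall>i. 0 \<le> \<omega> $ i \<and> \<omega> $ i < 1}"

definition dual_framelet_filter_bank ::
    "int ^ 'd ^ 'd \<Rightarrow> ('s :: finite \<Rightarrow> int ^ 'd ^ 'd)
     \<Rightarrow> (int ^ 'd \<Rightarrow> complex ^ 'r ^ 'r) \<Rightarrow> ('s \<Rightarrow> int ^ 'd \<Rightarrow> complex ^ 'r ^ 1)
     \<Rightarrow> (int ^ 'd \<Rightarrow> complex ^ 'r ^ 'r) \<Rightarrow> ('s \<Rightarrow> int ^ 'd \<Rightarrow> complex ^ 'r ^ 1) \<Rightarrow> bool" where
  "dual_framelet_filter_bank M0 M b0 b bt0 bt \<longleftrightarrow>
     (\<forall>\<omega> \<in> Omega M0 \<union> (\<Union>l. Omega (M l)). AE \<xi> in lebesgue.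
        indicat_real (Omega M0) \<omega> *\<^sub>R
          (conj_transpose (fseries b0 \<xi>) ** fseries bt0 (\<xi> + (2 * pi) *\<^sub>R \<omega>))
        + (\<Sum>l\<in>UNIV. indicat_real (Omega (M l)) \<omega> *\<^sub>R
          (conj_transpose (fseries (b l) \<xi>) ** fseries (bt l) (\<xi> + (2 * pi) *\<^sub>R \<omega>)))
        = mat (delta \<omega>))"

text \<open>
  For an invertible matrix \<open>M\<close> and a finitely supported filter, only finitely many terms of the
  following two sums are nonzero.
\<close>

definition subdivision ::
    "(int ^ 'd \<Rightarrow> complex ^ 'r ^ 'p) \<Rightarrow> int ^ 'd ^ 'd \<Rightarrow> (int ^ 'd \<Rightarrow> complex ^ 'p)
     \<Rightarrow> int ^ 'd \<Rightarrow> complex ^ 'r" where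
  "subdivision a M u n = sqrt (abs_det M) *\<^sub>R (\<Sum>\<^sub>\<infinity>k. u k v* a (n - M *v k))"

definition transition ::
    "(int ^ 'd \<Rightarrow> complex ^ 'r ^ 'p) \<Rightarrow> int ^ 'd ^ 'd \<Rightarrow> (int ^ 'd \<Rightarrow> complex ^ 'r)
     \<Rightarrow> int ^ 'd \<Rightarrow> complex ^ 'p" where
  "transition b M u n = sqrt (abs_det M) *\<^sub>R (\<Sum>\<^sub>\<infinity>k. u k v* conj_transpose (b (k - M *v n)))"

text \<open>
  In the coefficient space of \<open>1 \<times> (s + r)\<close> rows, the summand \<open>'s\<close> holds the coefficients
  \<open>w\<^sub>1, \<dots>, w\<^sub>s\<close> and the summand \<open>'r\<close> holds \<open>w\<^sub>0\<close>.
\<close>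

definition analysis_op ::
    "int ^ 'd ^ 'd \<Rightarrow> ('s :: finite \<Rightarrow> int ^ 'd ^ 'd)
     \<Rightarrow> (int ^ 'd \<Rightarrow> complex ^ 'r ^ 'r) \<Rightarrow> ('s \<Rightarrow> int ^ 'd \<Rightarrow> complex ^ 'r ^ 1)
     \<Rightarrow> (int ^ 'd \<Rightarrow> complex ^ 'r) \<Rightarrow> int ^ 'd \<Rightarrow> complex ^ ('s + 'r)" where
  "analysis_op M0 M b0 b v n =
     (\<chi> i. case i of Inl l \<Rightarrow> transition (b l) (M l) v n $ 1 | Inr q \<Rightarrow> transition b0 M0 v n $ q)"

definition synthesis_op ::
    "int ^ 'd ^ 'd \<Rightarrow> ('s :: finite \<Rightarrow> int ^ 'd ^ 'd)
     \<Rightarrow> (int ^ 'd \<Rightarrow> complex ^ 'r ^ 'r) \<Rightarrow> ('s \<Rightarrow> int ^ 'd \<Rightarrow> complex ^ 'r ^ 1)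
     \<Rightarrow> (int ^ 'd \<Rightarrow> complex ^ ('s + 'r)) \<Rightarrow> int ^ 'd \<Rightarrow> complex ^ 'r" where
  "synthesis_op M0 M bt0 bt w n =
     subdivision bt0 M0 (\<lambda>k. \<chi> q. w k $ Inr q) n
     + (\<Sum>l\<in>UNIV. subdivision (bt l) (M l) (\<lambda>k. \<chi> i. w k $ Inl l) n)"

definition biorthogonal_wavelet_filter_bank ::
    "int ^ 'd ^ 'd \<Rightarrow> ('s :: finite \<Rightarrow> int ^ 'd ^ 'd)
     \<Rightarrow> (int ^ 'd \<Rightarrow> complex ^ 'r ^ 'r) \<Rightarrow> ('s \<Rightarrow> int ^ 'd \<Rightarrow> complex ^ 'r ^ 1)
     \<Rightarrow> (int ^ 'd \<Rightarrow> complex ^ 'r ^ 'r) \<Rightarrow> ('s \<Rightarrow> int ^ 'd \<Rightarrow> complex ^ 'r ^ 1) \<Rightarrow> bool" where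
  "biorthogonal_wavelet_filter_bank M0 M b0 b bt0 bt \<longleftrightarrow>
     dual_framelet_filter_bank M0 M b0 b bt0 bt \<and>
     synthesis_op M0 M bt0 bt \<circ> analysis_op M0 M b0 b = id \<and>
     analysis_op M0 M b0 b \<circ> synthesis_op M0 M bt0 bt = id"

text \<open>
  The squared norm of the \<open>J\<close>-level coefficients \<open>(v\<^sub>1\<^sub>,\<^sub>1, \<dots>, v\<^sub>s\<^sub>,\<^sub>1, \<dots>, v\<^sub>1\<^sub>,\<^sub>J, \<dots>, v\<^sub>s\<^sub>,\<^sub>J, v\<^sub>0\<^sub>,\<^sub>J)\<close> of \<open>v\<close>,
  where the sequence \<open>v\<^sub>0\<^sub>,\<^sub>j\<close> is the \<open>j\<close>-th iterate of \<open>transition b0 M0\<close> applied to \<open>v\<close>.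
\<close>

definition multilevel_norm_sq ::
    "int ^ 'd ^ 'd \<Rightarrow> ('s :: finite \<Rightarrow> int ^ 'd ^ 'd)
     \<Rightarrow> (int ^ 'd \<Rightarrow> complex ^ 'r ^ 'r) \<Rightarrow> ('s \<Rightarrow> int ^ 'd \<Rightarrow> complex ^ 'r ^ 1)
     \<Rightarrow> nat \<Rightarrow> (int ^ 'd \<Rightarrow> complex ^ 'r) \<Rightarrow> real" where
  "multilevel_norm_sq M0 M b0 b J v =
     (\<Sum>j=1..J. \<Sum>l\<in>UNIV. l2_norm_sq (transition (b l) (M l) ((transition b0 M0 ^^ (j - 1)) v)))
     + l2_norm_sq ((transition b0 M0 ^^ J) v)"

definition l2_stable ::
    "int ^ 'd ^ 'd \<Rightarrow> ('s :: finite \<Rightarrow> int ^ 'd ^ 'd)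
     \<Rightarrow> (int ^ 'd \<Rightarrow> complex ^ 'r ^ 'r) \<Rightarrow> ('s \<Rightarrow> int ^ 'd \<Rightarrow> complex ^ 'r ^ 1) \<Rightarrow> bool" where
  "l2_stable M0 M b0 b \<longleftrightarrow>
     (\<exists>c1 > 0. \<exists>c2 > 0. \<forall>J \<ge> 1. \<forall>v. l2_seq v \<longrightarrow>
        c1 * l2_norm_sq v \<le> multilevel_norm_sq M0 M b0 b J v \<and>
        multilevel_norm_sq M0 M b0 b J v \<le> c2 * l2_norm_sq v)"

section \<open>Affine systems and biorthogonal wavelets\<close>

definition dilate_shift ::
    "real ^ 'd ^ 'd \<Rightarrow> real ^ 'd \<Rightarrow> (real ^ 'd \<Rightarrow> complex) \<Rightarrow> real ^ 'd \<Rightarrow> complex" where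
  "dilate_shift U k f x = sqrt \<bar>det U\<bar> *\<^sub>R f (U *v x - k)"

text \<open>
  The affine system as an indexed family, so that the elements of two systems correspond to each
  other: \<open>Inl (q, k)\<close> stands for the shifts of \<open>\<psi>0\<close>, \<open>Inr (l, j, k)\<close> for the dilates of \<open>\<psi> l\<close>.
\<close>

fun affine_system ::
    "int ^ 'd ^ 'd \<Rightarrow> ('s \<Rightarrow> int ^ 'd ^ 'd)
     \<Rightarrow> (real ^ 'd \<Rightarrow> complex ^ 'r) \<Rightarrow> ('s \<Rightarrow> real ^ 'd \<Rightarrow> complex)
     \<Rightarrow> ('r \<times> (int ^ 'd)) + ('s \<times> nat \<times> (int ^ 'd)) \<Rightarrow> real ^ 'd \<Rightarrow> complex" where
  "affine_system M0 M \<psi>0 \<psi> (Inl (q, k)) = (\<lambda>x. \<psi>0 (x - rvec k) $ q)"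
| "affine_system M0 M \<psi>0 \<psi> (Inr (l, j, k)) =
     (let A = matrix_inv (rmat M0) ** rmat (M l)
      in (\<lambda>x. sqrt \<bar>det A\<bar> *\<^sub>R dilate_shift (mat_pow (rmat M0) j) (A *v rvec k) (\<psi> l) x))"

text \<open>A Riesz basis: a Riesz sequence in \<open>L\<^sub>2\<close> with dense linear span.\<close>

definition riesz_basis_L2 :: "('i \<Rightarrow> real ^ 'd \<Rightarrow> complex) \<Rightarrow> bool" where
  "riesz_basis_L2 e \<longleftrightarrow>
     (\<forall>i. L2_fun (e i)) \<and>
     (\<forall>f. L2_fun f \<longrightarrow> (\<forall>\<epsilon>>0. \<exists>I c. finite I \<and> L2_norm (\<lambda>x. f x - (\<Sum>i\<in>I. c i * e i x)) < \<epsilon>)) \<and>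
     (\<exists>A>0. \<exists>B>0. \<forall>I c. finite I \<longrightarrow>
        A * (\<Sum>i\<in>I. (cmod (c i))\<^sup>2) \<le> (L2_norm (\<lambda>x. \<Sum>i\<in>I. c i * e i x))\<^sup>2 \<and>
        (L2_norm (\<lambda>x. \<Sum>i\<in>I. c i * e i x))\<^sup>2 \<le> B * (\<Sum>i\<in>I. (cmod (c i))\<^sup>2))"

definition biorthogonal_riesz_bases ::
    "('i \<Rightarrow> real ^ 'd \<Rightarrow> complex) \<Rightarrow> ('i \<Rightarrow> real ^ 'd \<Rightarrow> complex) \<Rightarrow> bool" where
  "biorthogonal_riesz_bases e et \<longleftrightarrow>
     riesz_basis_L2 e \<and> riesz_basis_L2 et \<and>
     (\<forall>i j. L2_inner (e i) (et j) = (if i = j then 1 else 0))"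

definition biorthogonal_wavelet ::
    "int ^ 'd ^ 'd \<Rightarrow> ('s \<Rightarrow> int ^ 'd ^ 'd)
     \<Rightarrow> (real ^ 'd \<Rightarrow> complex ^ 'r) \<Rightarrow> ('s \<Rightarrow> real ^ 'd \<Rightarrow> complex)
     \<Rightarrow> (real ^ 'd \<Rightarrow> complex ^ 'r) \<Rightarrow> ('s \<Rightarrow> real ^ 'd \<Rightarrow> complex) \<Rightarrow> bool" where
  "biorthogonal_wavelet M0 M \<psi>0 \<psi> \<psi>t0 \<psi>t \<longleftrightarrow>
     biorthogonal_riesz_bases (affine_system M0 M \<psi>0 \<psi>) (affine_system M0 M \<psi>t0 \<psi>t)"

end

theory Submission
  imports Defs "HOL-Probability.Probability" "HOL-Library.Groups_Big_Fun"
    "HOL-Computational_Algebra.Fundamental_Theorem_Algebra"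
begin

text \<open>
  By the refinement equations, a finite combination of an affine system up to level \<open>J\<close> is a
  combination of the shifts of \<open>\<psi>0\<close> dilated by \<open>M0\<^sup>J\<close>, whose coefficients arise from iterated
  synthesis. Synthesis with one filter bank inverts analysis with the other, so the biorthogonality of
  the shifts passes to the affine systems. The Bessel bound for the shifts of compactly supported
  functions together with the lower stability bound of the dual filter bank gives the upper Riesz
  bound, uniformly in \<open>J\<close>; duality gives the lower Riesz bound. Density holds because a function
  that is nearly orthogonal to all dilated shifts is small: averages of the shifts form an
  approximate identity, as the integral of one component of \<open>\<psi>0\<close> is not zero.

  Conversely, the elements of the affine system of level at most one give that the coefficient
  matrices of the filter banks are inverse to each other, and comparing Riesz bounds at level \<open>J\<close>
  gives stability. The dual framelet identity follows by testing the reproducing identity against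
  characters and averaging over large boxes.
\<close>

section \<open>The inner product of \<open>L\<^sub>2\<close>\<close>

text \<open>All work in the time domain uses finitely supported coefficients: no series of functions
  has to converge, and refinement equations that hold almost everywhere are used finitely often.
  Fourier transforms enter only to produce these equations, by a uniqueness statement proved with
  Gaussian averages instead of Plancherel's theorem. The obstacle is uniformity in the level.
  Iterating a one-level bound gives constants that depend on the level, so the upper Riesz bound has
  to come from stability; since analysis with one bank undoes synthesis with the other, each system
  is bounded through the bank of its partner. Density avoids orthogonal projections, because the
  union of the level spaces is not closed. A near minimiser of the distance replaces the projection,
  and its error must be sent to 0 before the dilation level grows, as the estimate contains a
  constant depending on that level. In the converse the stability constants are quotients of Riesz
  bounds. They hold first for finitely supported sequences; the passage to all square-summable ones
  halves the lower constant.\<close>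

lemma L2_funD:
  assumes "L2_fun f"
  shows "f \<in> borel_measurable lebesgue" "integrable lebesgue (\<lambda>x. (norm (f x))\<^sup>2)"
  using assms by (auto simp: L2_fun_def)

lemma L2_fun_bound:
  fixes f :: "real ^ 'd \<Rightarrow> 'b :: euclidean_space"
  assumes "f \<in> borel_measurable lebesgue" "integrable lebesgue g"
    and "\<And>x. (norm (f x))\<^sup>2 \<le> g x"
  shows "L2_fun f"
  unfolding L2_fun_def
proof
  show "integrable lebesgue (\<lambda>x. (norm (f x))\<^sup>2)"
    by (rule Bochner_Integration.integrable_bound[OF assms(2)])
       (use assms in \<open>auto intro!: AE_I2 order_trans[OF assms(3)]\<close>)
qed (fact assms)

lemma norm_add_sq_le:
  fixes a b :: "'b :: real_inner"
  shows "(norm (a + b))\<^sup>2 \<le> 2 * (norm a)\<^sup>2 + 2 * (norm b)\<^sup>2"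
proof -
  have "(norm (a + b))\<^sup>2 + (norm (a - b))\<^sup>2 = 2 * (norm a)\<^sup>2 + 2 * (norm b)\<^sup>2"
    by (simp add: power2_norm_eq_inner inner_add_left inner_add_right inner_diff_left
        inner_diff_right inner_commute)
  then show ?thesis
    using zero_le_power2[of "norm (a - b)"] by linarith
qed

lemma L2_fun_add:
  assumes "L2_fun f" "L2_fun g"
  shows "L2_fun (\<lambda>x. f x + g x)"
  by (rule L2_fun_bound[where g="\<lambda>x. 2 * (norm (f x))\<^sup>2 + 2 * (norm (g x))\<^sup>2"])
     (use assms[THEN L2_funD(1)] assms[THEN L2_funD(2)] in \<open>auto intro: norm_add_sq_le\<close>)

lemma L2_fun_cmul:
  fixes f :: "real ^ 'd \<Rightarrow> complex"
  assumes "L2_fun f"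
  shows "L2_fun (\<lambda>x. c * f x)"
  using assms by (auto simp: L2_fun_def norm_mult power_mult_distrib)

lemma L2_fun_zero [simp]: "L2_fun (\<lambda>x. 0 :: complex)"
  by (simp add: L2_fun_def)

lemma L2_fun_uminus:
  fixes f :: "real ^ 'd \<Rightarrow> complex"
  shows "L2_fun f \<Longrightarrow> L2_fun (\<lambda>x. - f x)"
  using L2_fun_cmul[of f "-1"] by simp

lemma L2_fun_diff:
  fixes f :: "real ^ 'd \<Rightarrow> complex"
  shows "L2_fun f \<Longrightarrow> L2_fun g \<Longrightarrow> L2_fun (\<lambda>x. f x - g x)"
  using L2_fun_add[OF _ L2_fun_uminus, of f g] by simp

lemma L2_fun_sum:
  fixes f :: "'i \<Rightarrow> real ^ 'd \<Rightarrow> complex"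
  assumes "\<And>i. i \<in> I \<Longrightarrow> L2_fun (f i)"
  shows "L2_fun (\<lambda>x. \<Sum>i\<in>I. f i x)"
  using assms by (induction I rule: infinite_finite_induct) (auto intro: L2_fun_add)

lemma mult_le_sum_squares:
  fixes a b :: real
  shows "a * b \<le> a\<^sup>2 + b\<^sup>2"
proof -
  have "0 \<le> (a - b)\<^sup>2" "0 \<le> a\<^sup>2 + b\<^sup>2" by simp_all
  then show ?thesis unfolding power2_diff by linarith
qed

lemma L2_integrable_mult:
  fixes f g :: "real ^ 'd \<Rightarrow> complex"
  assumes "L2_fun f" "L2_fun g"
  shows "integrable lebesgue (\<lambda>x. cmod (f x) * cmod (g x))"
    and "integrable lebesgue (\<lambda>x. f x * g x)"
    and "integrable lebesgue (\<lambda>x. f x * cnj (g x))"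
proof -
  have m: "f \<in> borel_measurable lebesgue" "g \<in> borel_measurable lebesgue"
    using assms by (auto simp: L2_fun_def)
  have i: "integrable lebesgue (\<lambda>x. (norm (f x))\<^sup>2 + (norm (g x))\<^sup>2)"
    using assms by (auto simp: L2_fun_def)
  show "integrable lebesgue (\<lambda>x. cmod (f x) * cmod (g x))"
    by (rule Bochner_Integration.integrable_bound[OF i])
       (use m in \<open>auto intro!: AE_I2 mult_le_sum_squares simp: abs_mult\<close>)
  show "integrable lebesgue (\<lambda>x. f x * g x)"
    by (rule Bochner_Integration.integrable_bound[OF i])
       (use m in \<open>auto intro!: AE_I2 mult_le_sum_squares simp: norm_mult\<close>)
  have "(\<lambda>x. cnj (g x)) \<in> borel_measurable lebesgue"
    by (rule borel_measurable_continuous_on[OF _ m(2)]) (auto intro: continuous_intros)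
  then show "integrable lebesgue (\<lambda>x. f x * cnj (g x))"
    by (intro Bochner_Integration.integrable_bound[OF i])
       (use m in \<open>auto intro!: AE_I2 mult_le_sum_squares simp: norm_mult\<close>)
qed

lemma L2_inner_add_left:
  assumes "L2_fun f" "L2_fun g" "L2_fun h"
  shows "L2_inner (\<lambda>x. f x + g x) h = L2_inner f h + L2_inner g h"
  using L2_integrable_mult(3)[OF assms(1,3)] L2_integrable_mult(3)[OF assms(2,3)]
  by (simp add: L2_inner_def ring_distribs)

lemma L2_inner_cmul_left: "L2_inner (\<lambda>x. c * f x) h = c * L2_inner f h"
  by (simp add: L2_inner_def mult.assoc)

lemma L2_inner_zero_left [simp]: "L2_inner (\<lambda>x. 0) h = 0"
  by (simp add: L2_inner_def)

lemma L2_inner_commute: "L2_inner g f = cnj (L2_inner f g)"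
proof -
  have "cnj (L2_inner f g) = (LINT x|lebesgue. cnj (f x * cnj (g x)))"
    unfolding L2_inner_def by (simp only: Bochner_Integration.integral_cnj)
  then show ?thesis by (simp add: L2_inner_def mult.commute)
qed

lemma L2_inner_diff_left:
  assumes "L2_fun f" "L2_fun g" "L2_fun h"
  shows "L2_inner (\<lambda>x. f x - g x) h = L2_inner f h - L2_inner g h"
  using L2_integrable_mult(3)[OF assms(1,3)] L2_integrable_mult(3)[OF assms(2,3)]
  by (simp add: L2_inner_def ring_distribs)

lemma L2_inner_sum_left:
  assumes "\<And>i. i \<in> I \<Longrightarrow> L2_fun (f i)" "L2_fun h"
  shows "L2_inner (\<lambda>x. \<Sum>i\<in>I. c i * f i x) h = (\<Sum>i\<in>I. c i * L2_inner (f i) h)"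
  using assms(1)
proof (induction I rule: infinite_finite_induct)
  case (insert i I)
  have "L2_inner (\<lambda>x. c i * f i x + (\<Sum>i\<in>I. c i * f i x)) h
      = L2_inner (\<lambda>x. c i * f i x) h + L2_inner (\<lambda>x. \<Sum>i\<in>I. c i * f i x) h"
    by (intro L2_inner_add_left L2_fun_cmul L2_fun_sum assms(2)) (use insert.prems in auto)
  with insert show ?case by (simp add: L2_inner_cmul_left)
qed auto

lemma L2_inner_sum_right:
  assumes "\<And>i. i \<in> I \<Longrightarrow> L2_fun (f i)" "L2_fun h"
  shows "L2_inner h (\<lambda>x. \<Sum>i\<in>I. c i * f i x) = (\<Sum>i\<in>I. cnj (c i) * L2_inner h (f i))"
proof -
  have "L2_inner h (\<lambda>x. \<Sum>i\<in>I. c i * f i x) = cnj (L2_inner (\<lambda>x. \<Sum>i\<in>I. c i * f i x) h)"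
    by (rule L2_inner_commute)
  also have "\<dots> = cnj (\<Sum>i\<in>I. c i * L2_inner (f i) h)"
    using L2_inner_sum_left[OF assms, of I] by simp
  also have "\<dots> = (\<Sum>i\<in>I. cnj (c i) * L2_inner h (f i))"
    by (simp add: L2_inner_commute[of h])
  finally show ?thesis .
qed

section \<open>The norm, Cauchy-Schwarz and the triangle inequality\<close>

lemma L2_norm_nonneg [simp]: "0 \<le> L2_norm f"
  by (simp add: L2_norm_def)

lemma L2_norm_sq: "(L2_norm f)\<^sup>2 = (LINT x|lebesgue. (cmod (f x))\<^sup>2)"
  by (simp add: L2_norm_def)

lemma L2_inner_self: "L2_inner f f = complex_of_real ((L2_norm f)\<^sup>2)"
  unfolding L2_norm_sq L2_inner_def
  by (simp only: complex_norm_square[symmetric] integral_complex_of_real)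

text \<open>The optimal \<open>t\<close> in a nonnegative quadratic gives the bound; the degenerate
  norms are treated apart because that \<open>t\<close> is the quotient of the norms. Moduli are
  integrated, rather than the product itself, since Fubini in \<open>approx_identity\<close> needs
  the absolute form.\<close>

lemma L2_cauchy_schwarz_nn:
  fixes f g :: "real ^ 'd \<Rightarrow> complex"
  assumes "L2_fun f" "L2_fun g"
  shows "(LINT x|lebesgue. cmod (f x) * cmod (g x)) \<le> L2_norm f * L2_norm g"
proof -
  let ?I = "LINT x|lebesgue. cmod (f x) * cmod (g x)"
  have I: "integrable lebesgue (\<lambda>x. cmod (f x) * cmod (g x))"
    by (rule L2_integrable_mult[OF assms])
  have i: "integrable lebesgue (\<lambda>x. (cmod (f x))\<^sup>2)" "integrable lebesgue (\<lambda>x. (cmod (g x))\<^sup>2)"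
    using assms by (auto simp: L2_fun_def)
  have quad: "2 * t * ?I \<le> (L2_norm f)\<^sup>2 + t\<^sup>2 * (L2_norm g)\<^sup>2" for t
  proof -
    have "2 * t * ?I = (LINT x|lebesgue. 2 * t * (cmod (f x) * cmod (g x)))" by simp
    also have "\<dots> \<le> (LINT x|lebesgue. (cmod (f x))\<^sup>2 + t\<^sup>2 * (cmod (g x))\<^sup>2)"
    proof (rule integral_mono)
      fix x
      have "0 \<le> (cmod (f x) - t * cmod (g x))\<^sup>2" by simp
      then show "2 * t * (cmod (f x) * cmod (g x)) \<le> (cmod (f x))\<^sup>2 + t\<^sup>2 * (cmod (g x))\<^sup>2"
        by (simp add: power2_diff power_mult_distrib algebra_simps)
    qed (use I i in auto)
    also have "\<dots> = (L2_norm f)\<^sup>2 + t\<^sup>2 * (L2_norm g)\<^sup>2"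
      using i by (simp add: L2_norm_sq)
    finally show ?thesis .
  qed
  show ?thesis
  proof (cases "L2_norm g = 0")
    case True
    have "?I \<le> 0"
    proof (rule ccontr)
      \<comment> \<open>The right side of \<open>quad\<close> no longer depends on \<open>t\<close>,
        and the \<open>t\<close> chosen below makes the left side exceed it by 1.\<close>
      assume "\<not> ?I \<le> 0"
      then show False
        using quad[of "((L2_norm f)\<^sup>2 + 1) / (2 * ?I)"] True by (simp add: divide_simps)
    qed
    with True show ?thesis by simp
  next
    case False
    then have "L2_norm g > 0" using L2_norm_nonneg[of g] by linarith
    show ?thesis
    proof (cases "L2_norm f = 0")
      case True
      have "?I \<le> e" if "e > 0" for e
      proof -
        have "2 * ?I \<le> t * (L2_norm g)\<^sup>2" if "t > 0" for t
        proof -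
          have "t * (2 * ?I) \<le> t * (t * (L2_norm g)\<^sup>2)"
            using quad[of t] True by (simp add: power2_eq_square ac_simps)
          then show ?thesis using that by simp
        qed
        from this[of "2 * e / (L2_norm g)\<^sup>2"] that \<open>L2_norm g > 0\<close> show ?thesis by simp
      qed
      then have "?I \<le> 0" using field_le_epsilon[of ?I 0] by simp
      with True show ?thesis by simp
    next
      case f: False
      then have "L2_norm f > 0" using L2_norm_nonneg[of f] by linarith
      have "2 * (L2_norm f / L2_norm g) * ?I \<le> 2 * (L2_norm f)\<^sup>2"
        using quad[of "L2_norm f / L2_norm g"] \<open>L2_norm g > 0\<close> by (simp add: power_divide)
      then show ?thesis
        using \<open>L2_norm f > 0\<close> \<open>L2_norm g > 0\<close> by (simp add: divide_simps power2_eq_square)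
    qed
  qed
qed

lemma L2_cauchy_schwarz:
  assumes "L2_fun f" "L2_fun g"
  shows "cmod (L2_inner f g) \<le> L2_norm f * L2_norm g"
proof -
  have "cmod (L2_inner f g) \<le> (LINT x|lebesgue. cmod (f x * cnj (g x)))"
    unfolding L2_inner_def by (rule integral_norm_bound)
  also have "\<dots> = (LINT x|lebesgue. cmod (f x) * cmod (g x))"
    by (simp add: norm_mult)
  finally show ?thesis using L2_cauchy_schwarz_nn[OF assms] by simp
qed

lemma L2_norm_add_sq:
  assumes "L2_fun f" "L2_fun g"
  shows "(L2_norm (\<lambda>x. f x + g x))\<^sup>2 = (L2_norm f)\<^sup>2 + (L2_norm g)\<^sup>2 + 2 * Re (L2_inner f g)"
proof -
  have "complex_of_real ((L2_norm (\<lambda>x. f x + g x))\<^sup>2) = L2_inner (\<lambda>x. f x + g x) (\<lambda>x. f x + g x)"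
    by (rule L2_inner_self[symmetric])
  also have "\<dots> = L2_inner f (\<lambda>x. f x + g x) + L2_inner g (\<lambda>x. f x + g x)"
    by (intro L2_inner_add_left L2_fun_add assms)
  also have "\<dots> = cnj (L2_inner (\<lambda>x. f x + g x) f) + cnj (L2_inner (\<lambda>x. f x + g x) g)"
    by (simp add: L2_inner_commute[of f "\<lambda>x. f x + g x"] L2_inner_commute[of g "\<lambda>x. f x + g x"])
  also have "\<dots> = cnj (L2_inner f f + L2_inner g f) + cnj (L2_inner f g + L2_inner g g)"
    by (simp only: L2_inner_add_left[OF assms assms(1)] L2_inner_add_left[OF assms assms(2)])
  finally have "Re (complex_of_real ((L2_norm (\<lambda>x. f x + g x))\<^sup>2))
      = Re (cnj (L2_inner f f + L2_inner g f) + cnj (L2_inner f g + L2_inner g g))" by simp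
  then show ?thesis
    by (simp add: L2_inner_self L2_inner_commute[of g f])
qed

lemma L2_norm_triangle:
  assumes "L2_fun f" "L2_fun g"
  shows "L2_norm (\<lambda>x. f x + g x) \<le> L2_norm f + L2_norm g"
proof (rule power2_le_imp_le)
  have "Re (L2_inner f g) \<le> L2_norm f * L2_norm g"
    using L2_cauchy_schwarz[OF assms] complex_Re_le_cmod order_trans by blast
  then show "(L2_norm (\<lambda>x. f x + g x))\<^sup>2 \<le> (L2_norm f + L2_norm g)\<^sup>2"
    by (simp add: L2_norm_add_sq[OF assms] power2_sum)
qed simp

lemma L2_norm_cmul: "L2_norm (\<lambda>x. c * f x) = cmod c * L2_norm f"
  by (simp add: L2_norm_def norm_mult power_mult_distrib real_sqrt_mult)

lemma L2_norm_minus_commute: "L2_norm (\<lambda>x. f x - g x) = L2_norm (\<lambda>x. g x - f x)"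
  by (simp add: L2_norm_def norm_minus_commute)

lemma L2_norm_zero [simp]: "L2_norm (\<lambda>x. 0) = 0"
  by (simp add: L2_norm_def)

lemma L2_norm_zeroD:
  assumes "L2_fun f" "L2_norm f = 0"
  shows "AE x in lebesgue. f x = 0"
proof -
  have "(LINT x|lebesgue. (cmod (f x))\<^sup>2) = 0"
    using assms(2) L2_norm_sq[of f] by simp
  then have "AE x in lebesgue. (cmod (f x))\<^sup>2 = 0"
    using integral_nonneg_eq_0_iff_AE[OF L2_funD(2)[OF assms(1)]] by simp
  then show ?thesis by simp
qed

section \<open>Linear substitutions\<close>

text \<open>With the other coordinates fixed, the shear only translates the coordinate
  \<open>m\<close>, and Lebesgue measure on the line is translation invariant. Splitting off that
  coordinate is Fubini for the product measure.\<close>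

lemma nn_integral_shear:
  fixes f :: "real ^ 'd \<Rightarrow> ennreal"
  assumes "m \<noteq> n" and f [measurable]: "f \<in> borel_measurable borel"
  shows "(\<integral>\<^sup>+x. f (\<chi> i. if i = m then x $ m + x $ n else x $ i) \<partial>lborel) = (\<integral>\<^sup>+x. f x \<partial>lborel)"
proof -
  interpret product_sigma_finite "\<lambda>_ :: real ^ 'd. lborel :: real measure" ..
  let ?B = "Basis - {axis m 1} :: (real ^ 'd) set"
  let ?P = "\<lambda>z :: real ^ 'd \<Rightarrow> real. \<Sum>b\<in>Basis. z b *\<^sub>R b"
  let ?T = "\<lambda>x :: real ^ 'd. \<chi> i. if i = m then x $ m + x $ n else x $ i"
  have lin: "linear ?T"
    by (rule linearI) (auto simp: algebra_simps plus_vec_def scaleR_vec_def vec_eq_iff)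
  have [measurable]: "?T \<in> borel_measurable borel"
    using lin by (intro borel_measurable_continuous_onI linear_continuous_on)
      (simp add: linear_conv_bounded_linear)
  have ax: "axis m 1 \<in> (Basis :: (real ^ 'd) set)" "axis n 1 \<in> (Basis :: (real ^ 'd) set)"
    "axis n 1 \<noteq> (axis m 1 :: real ^ 'd)"
    using \<open>m \<noteq> n\<close> by (auto simp: axis_in_Basis_iff axis_eq_axis)
  have B: "finite ?B" "axis m 1 \<notin> ?B" "insert (axis m 1) ?B = (Basis :: (real ^ 'd) set)"
    using ax by auto
  have comp: "?P z $ i = z (axis i 1)" for z i
  proof -
    have "?P z $ i = ?P z \<bullet> axis i 1" by (simp add: inner_axis)
    then show ?thesis by (simp add: inner_sum_left inner_Basis axis_in_Basis_iff if_distrib sum.delta cong: if_cong)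
  qed
  have T: "?T (?P (z(axis m 1 := y))) = ?P (z(axis m 1 := y + z (axis n 1)))" for z y
  proof (subst vec_eq_iff, rule allI)
    fix i
    show "?T (?P (z(axis m 1 := y))) $ i = ?P (z(axis m 1 := y + z (axis n 1))) $ i"
      unfolding vec_lambda_beta comp using \<open>m \<noteq> n\<close> by (auto simp: axis_eq_axis)
  qed
  have eq: "(\<integral>\<^sup>+x. g x \<partial>lborel) =
      (\<integral>\<^sup>+z. (\<integral>\<^sup>+y. g (?P (z(axis m 1 := y))) \<partial>lborel) \<partial>(\<Pi>\<^sub>M b\<in>?B. lborel))"
    if [measurable]: "g \<in> borel_measurable borel" for g :: "real ^ 'd \<Rightarrow> ennreal"
  proof -
    have "(\<integral>\<^sup>+x. g x \<partial>lborel) = (\<integral>\<^sup>+z. g (?P z) \<partial>(\<Pi>\<^sub>M b\<in>Basis. lborel))"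
      by (subst lborel_eq, subst nn_integral_distr) auto
    also have "\<dots> = (\<integral>\<^sup>+z. g (?P z) \<partial>(\<Pi>\<^sub>M b\<in>insert (axis m 1) ?B. lborel))"
      by (simp only: B)
    also have "\<dots> = (\<integral>\<^sup>+z. (\<integral>\<^sup>+y. g (?P (z(axis m 1 := y))) \<partial>lborel) \<partial>(\<Pi>\<^sub>M b\<in>?B. lborel))"
    proof (rule product_nn_integral_insert[OF B(1,2)])
      have "(\<lambda>z. g (?P z)) \<in> borel_measurable (\<Pi>\<^sub>M b\<in>Basis. lborel)" by measurable
      then show "(\<lambda>z. g (?P z)) \<in> borel_measurable (\<Pi>\<^sub>M b\<in>insert (axis m 1) ?B. lborel)"
        by (simp only: B)
    qed
    finally show ?thesis .
  qed
  have "(\<integral>\<^sup>+x. f (?T x) \<partial>lborel) =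
      (\<integral>\<^sup>+z. (\<integral>\<^sup>+y. f (?P (z(axis m 1 := y + z (axis n 1)))) \<partial>lborel) \<partial>(\<Pi>\<^sub>M b\<in>?B. lborel))"
    by (subst eq) (simp_all add: T)
  also have "\<dots> = (\<integral>\<^sup>+z. (\<integral>\<^sup>+y. f (?P (z(axis m 1 := y))) \<partial>lborel) \<partial>(\<Pi>\<^sub>M b\<in>?B. lborel))"
  proof (rule nn_integral_cong)
    fix z :: "real ^ 'd \<Rightarrow> real"
    have [measurable]: "(\<lambda>y. f (?P (z(axis m 1 := y)))) \<in> borel_measurable borel"
    proof -
      have "(\<lambda>y. ?P (z(axis m 1 := y))) \<in> borel_measurable borel"
      proof (intro borel_measurable_continuous_onI continuous_on_sum)
        fix b :: "real ^ 'd"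
        show "continuous_on UNIV (\<lambda>y. (z(axis m 1 := y)) b *\<^sub>R b)"
          by (cases "b = axis m 1") (auto intro!: continuous_intros)
      qed
      then show ?thesis by measurable
    qed
    show "(\<integral>\<^sup>+y. f (?P (z(axis m 1 := y + z (axis n 1)))) \<partial>lborel)
        = (\<integral>\<^sup>+y. f (?P (z(axis m 1 := y))) \<partial>lborel)"
      using nn_integral_real_affine[of "\<lambda>y. f (?P (z(axis m 1 := y)))" 1 "z (axis n 1)"]
      by (simp add: add.commute)
  qed
  also have "\<dots> = (\<integral>\<^sup>+x. f x \<partial>lborel)" by (rule eq[symmetric]) simp
  finally show ?thesis .
qed

lemma borel_measurable_matrix [measurable]: "(\<lambda>x. A *v x :: real ^ 'm) \<in> borel_measurable borel"
  for A :: "real ^ 'n ^ 'm"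
  by (intro borel_measurable_continuous_onI continuous_intros)

text \<open>Linear maps are composed of elementary ones and determinants multiply, so it suffices to
  treat coordinate scalings, swaps and shears.\<close>

lemma nn_integral_linear:
  fixes A :: "real ^ 'd ^ 'd" and f :: "real ^ 'd \<Rightarrow> ennreal"
  assumes f: "f \<in> borel_measurable borel" and "det A \<noteq> 0"
  shows "(\<integral>\<^sup>+x. f x \<partial>lborel) = ennreal \<bar>det A\<bar> * (\<integral>\<^sup>+x. f (A *v x) \<partial>lborel)"
proof -
  \<comment> \<open>The implication makes singular maps trivial. It survives composition because a
    nonzero determinant of the composition makes both factors nonsingular.\<close>
  define P where "P T \<longleftrightarrow> (det (matrix T) \<noteq> 0 \<longrightarrow> (\<forall>f \<in> borel_measurable borel.
    (\<integral>\<^sup>+x. f x \<partial>lborel) = ennreal \<bar>det (matrix T)\<bar> * (\<integral>\<^sup>+x. f (T x) \<partial>lborel)))"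
    for T :: "real ^ 'd \<Rightarrow> real ^ 'd"
  have "P ((*v) A)"
  proof (rule induct_linear_elementary[where P=P and f="(*v) A"])
    show "linear ((*v) A)" by simp
  next
    fix S T :: "real ^ 'd \<Rightarrow> real ^ 'd"
    assume lin: "linear S" "linear T" and "P S" "P T"
    show "P (S \<circ> T)"
      unfolding P_def
    proof (intro impI ballI)
      fix f :: "real ^ 'd \<Rightarrow> ennreal"
      assume nz: "det (matrix (S \<circ> T)) \<noteq> 0" and f: "f \<in> borel_measurable borel"
      have det: "det (matrix (S \<circ> T)) = det (matrix S) * det (matrix T)"
        using lin by (simp add: matrix_compose det_mul)
      have "S \<in> borel_measurable borel"
        using lin by (intro borel_measurable_continuous_onI linear_continuous_on)
          (simp add: linear_conv_bounded_linear)
      then have fS: "(\<lambda>x. f (S x)) \<in> borel_measurable borel" using f by measurable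
      show "(\<integral>\<^sup>+x. f x \<partial>lborel) = ennreal \<bar>det (matrix (S \<circ> T))\<bar> * (\<integral>\<^sup>+x. f ((S \<circ> T) x) \<partial>lborel)"
      proof -
        have nz': "det (matrix S) \<noteq> 0" "det (matrix T) \<noteq> 0" using nz det by auto
        have "(\<integral>\<^sup>+x. f x \<partial>lborel) = ennreal \<bar>det (matrix S)\<bar> * (\<integral>\<^sup>+x. f (S x) \<partial>lborel)"
          using \<open>P S\<close> nz' f unfolding P_def by blast
        also have "(\<integral>\<^sup>+x. f (S x) \<partial>lborel) = ennreal \<bar>det (matrix T)\<bar> * (\<integral>\<^sup>+x. f (S (T x)) \<partial>lborel)"
          using \<open>P T\<close> nz' fS unfolding P_def by blast
        finally show ?thesis by (simp add: det abs_mult ennreal_mult' mult.assoc)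
      qed
    qed
  next
    fix T :: "real ^ 'd \<Rightarrow> real ^ 'd" and i
    assume "linear T" "\<And>x. T x $ i = 0"
    then have "det (matrix T) = 0"
      by (intro det_zero_row(2)[of i]) (simp add: matrix_def row_def vec_eq_iff)
    then show "P T" by (simp add: P_def)
  next
    fix c :: "'d \<Rightarrow> real"
    let ?T = "\<lambda>x :: real ^ 'd. \<chi> i. c i * x $ i"
    have det: "det (matrix ?T) = prod c UNIV"
      by (simp add: matrix_def det_diagonal axis_def)
    show "P ?T"
      unfolding P_def det
    proof (intro impI ballI)
      fix f :: "real ^ 'd \<Rightarrow> ennreal"
      assume nz: "prod c UNIV \<noteq> 0" and f [measurable]: "f \<in> borel_measurable borel"
      define c' where "c' b = c (axis_index b)" for b :: "real ^ 'd"
      have c': "c' (axis i 1) = c i" for i by (simp add: c'_def axis_index_axis)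
      have Basis: "(Basis :: (real ^ 'd) set) = (\<lambda>i. axis i 1) ` UNIV"
        by (auto simp: Basis_vec_def)
      have inj: "inj (\<lambda>i. axis i 1 :: real ^ 'd)" by (simp add: inj_on_def axis_eq_axis)
      have T: "(0 + (\<Sum>j\<in>Basis. (c' j * (x \<bullet> j)) *\<^sub>R j)) = ?T x" for x
      proof -
        have "(0 + (\<Sum>j\<in>Basis. (c' j * (x \<bullet> j)) *\<^sub>R j)) = (\<Sum>i\<in>UNIV. (c i * x $ i) *\<^sub>R axis i 1)"
          unfolding Basis sum.reindex[OF inj] by (simp add: c' inner_axis)
        then show ?thesis by (simp add: vec_eq_iff axis_def if_distrib sum.delta cong: if_cong)
      qed
      have [measurable]: "?T \<in> borel_measurable borel"
        by (intro borel_measurable_continuous_onI continuous_intros)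
      have "lborel = density (distr lborel borel (\<lambda>x. 0 + (\<Sum>j\<in>Basis. (c' j * (x \<bullet> j)) *\<^sub>R j)))
          (\<lambda>_. (\<Prod>j\<in>Basis. \<bar>c' j\<bar>))"
        by (rule lborel_affine_euclidean) (use nz in \<open>auto simp: Basis c'\<close>)
      also have "(\<lambda>x. 0 + (\<Sum>j\<in>Basis. (c' j * (x \<bullet> j)) *\<^sub>R j)) = ?T"
        using T by (rule ext)
      also have "(\<Prod>j\<in>Basis. \<bar>c' j\<bar>) = \<bar>prod c UNIV\<bar>"
        unfolding Basis prod.reindex[OF inj] by (simp add: c' abs_prod)
      finally have "(\<integral>\<^sup>+x. f x \<partial>lborel) = (\<integral>\<^sup>+x. f x \<partial>density (distr lborel borel ?T) (\<lambda>_. \<bar>prod c UNIV\<bar>))"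
        by simp
      also have "\<dots> = ennreal \<bar>prod c UNIV\<bar> * (\<integral>\<^sup>+x. f (?T x) \<partial>lborel)"
        by (simp add: nn_integral_density nn_integral_distr nn_integral_cmult)
      finally show "(\<integral>\<^sup>+x. f x \<partial>lborel) = ennreal \<bar>prod c UNIV\<bar> * (\<integral>\<^sup>+x. f (?T x) \<partial>lborel)" .
    qed
  next
    fix m n :: 'd assume "m \<noteq> n"
    let ?T = "\<lambda>x :: real ^ 'd. \<chi> i. x $ Transposition.transpose m n i"
    have "matrix ?T = transpose (\<chi> i j. mat 1 $ i $ Transposition.transpose m n j)"
      by (auto simp: transpose_def axis_def mat_def matrix_def vec_eq_iff transpose_eq_iff)
    then have det: "\<bar>det (matrix ?T)\<bar> = 1"
      by (simp add: det_permute_columns permutes_swap_id sign_swap_id abs_mult \<open>m \<noteq> n\<close>)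
    have [measurable]: "?T \<in> borel_measurable borel"
      by (intro borel_measurable_continuous_onI continuous_intros)
    have "lborel = distr lborel borel ?T"
    proof (rule lborel_eqI)
      fix l u :: "real ^ 'd" assume le: "\<And>b. b \<in> Basis \<Longrightarrow> l \<bullet> b \<le> u \<bullet> b"
      have le': "l $ i \<le> u $ i" for i using le[of "axis i 1"] by (simp add: inner_axis axis_in_Basis_iff)
      have v: "?T -` box l u = box (?T l) (?T u)"
        by (auto simp: mem_box_cart) (metis transpose_involutory)+
      have Basis: "(Basis :: (real ^ 'd) set) = (\<lambda>i. axis i 1) ` UNIV"
        by (auto simp: Basis_vec_def)
      have inj: "inj (\<lambda>i. axis i 1 :: real ^ 'd)" by (simp add: inj_on_def axis_eq_axis)
      have "emeasure (distr lborel borel ?T) (box l u) = emeasure lborel (box (?T l) (?T u))"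
        by (subst emeasure_distr) (simp_all add: v)
      also have "\<dots> = (\<Prod>b\<in>Basis. (?T u - ?T l) \<bullet> b)"
        by (subst emeasure_lborel_box_eq) (auto simp: Basis inner_axis le')
      also have "\<dots> = ennreal (\<Prod>i\<in>UNIV. u $ Transposition.transpose m n i - l $ Transposition.transpose m n i)"
        unfolding Basis prod.reindex[OF inj] by (simp add: inner_axis)
      also have "(\<Prod>i\<in>UNIV. u $ Transposition.transpose m n i - l $ Transposition.transpose m n i)
          = (\<Prod>i\<in>UNIV. u $ i - l $ i)"
        using prod.permute[OF permutes_swap_id[of m UNIV n], where g="\<lambda>i. u $ i - l $ i"] by (simp add: o_def)
      also have "\<dots> = (\<Prod>b\<in>Basis. (u - l) \<bullet> b)"
        unfolding Basis prod.reindex[OF inj] by (simp add: inner_axis)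
      finally show "emeasure (distr lborel borel ?T) (box l u) = (\<Prod>b\<in>Basis. (u - l) \<bullet> b)" .
    qed simp
    then have "(\<integral>\<^sup>+x. f x \<partial>lborel) = (\<integral>\<^sup>+x. f (?T x) \<partial>lborel)" if "f \<in> borel_measurable borel" for f :: "real ^ 'd \<Rightarrow> ennreal"
      using that nn_integral_distr[of ?T lborel borel f] by simp
    then show "P ?T" unfolding P_def det ennreal_1 mult_1_left by blast
  next
    fix m n :: 'd assume "m \<noteq> n"
    let ?T = "\<lambda>x :: real ^ 'd. \<chi> i. if i = m then x $ m + x $ n else x $ i"
    have "matrix ?T = (\<chi> k. if k = m then row m (mat 1) + 1 *s row n (mat 1) else row k (mat 1))"
      using \<open>m \<noteq> n\<close> by (auto simp: matrix_def vec_eq_iff row_def mat_def axis_def)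
    then have det: "det (matrix ?T) = 1"
      using det_row_operation[OF \<open>m \<noteq> n\<close>, of "mat 1" 1] by simp
    show "P ?T"
      unfolding P_def det abs_one ennreal_1 mult_1_left
      by (intro impI ballI nn_integral_shear[OF \<open>m \<noteq> n\<close>, symmetric])
  qed
  then show ?thesis using assms unfolding P_def matrix_of_matrix_vector_mul by blast
qed

section \<open>Affine changes of variables for Lebesgue measure\<close>

lemma nn_integral_affine:
  fixes A :: "real ^ 'd ^ 'd" and f :: "real ^ 'd \<Rightarrow> ennreal"
  assumes [measurable]: "f \<in> borel_measurable borel" and "det A \<noteq> 0"
  shows "(\<integral>\<^sup>+x. f x \<partial>lborel) = ennreal \<bar>det A\<bar> * (\<integral>\<^sup>+x. f (A *v x - k) \<partial>lborel)"
proof -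
  have "(\<integral>\<^sup>+x. f x \<partial>lborel) = (\<integral>\<^sup>+x. f x \<partial>distr lborel borel ((+) (- k)))"
    by (simp add: lborel_distr_plus)
  also have "\<dots> = (\<integral>\<^sup>+x. f (- k + x) \<partial>lborel)"
    by (rule nn_integral_distr) auto
  also have "\<dots> = ennreal \<bar>det A\<bar> * (\<integral>\<^sup>+x. f (- k + A *v x) \<partial>lborel)"
    by (rule nn_integral_linear) (use assms in auto)
  finally show ?thesis by simp
qed

text \<open>An equality of measures, not only of integrals, is needed: it transfers null sets and so
  passes to the completion.\<close>

lemma lborel_affine_matrix:
  fixes A :: "real ^ 'd ^ 'd"
  assumes "det A \<noteq> 0"
  shows "lborel = density (distr lborel borel (\<lambda>x. A *v x - k)) (\<lambda>_. ennreal \<bar>det A\<bar>)"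
proof (rule measure_eqI)
  fix X :: "(real ^ 'd) set" assume "X \<in> sets lborel"
  then have [measurable]: "X \<in> sets borel" by simp
  have [measurable]: "(\<lambda>x. A *v x - k) \<in> borel_measurable borel" by measurable
  have "emeasure lborel X = (\<integral>\<^sup>+x. indicator X x \<partial>lborel)" by simp
  also have "\<dots> = ennreal \<bar>det A\<bar> * (\<integral>\<^sup>+x. indicator X (A *v x - k) \<partial>lborel)"
    by (rule nn_integral_affine) (use assms in auto)
  also have "\<dots> = emeasure (density (distr lborel borel (\<lambda>x. A *v x - k)) (\<lambda>_. ennreal \<bar>det A\<bar>)) X"
  proof -
    have "(\<integral>\<^sup>+x. indicator X (A *v x - k) \<partial>lborel) = (\<integral>\<^sup>+x. indicator X x \<partial>distr lborel borel (\<lambda>x. A *v x - k))"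
      by (rule nn_integral_distr[symmetric]) auto
    then show ?thesis by (simp add: emeasure_density nn_integral_cmult)
  qed
  finally show "emeasure lborel X
      = emeasure (density (distr lborel borel (\<lambda>x. A *v x - k)) (\<lambda>_. ennreal \<bar>det A\<bar>)) X" .
qed simp

context
  fixes A :: "real ^ 'd ^ 'd" and k :: "real ^ 'd" and T
  assumes det: "det A \<noteq> 0"
  defines "T \<equiv> \<lambda>x. A *v x - k"
begin

lemma T_borel [measurable]: "T \<in> borel \<rightarrow>\<^sub>M borel"
  unfolding T_def by measurable

text \<open>Borel measurability of \<open>T\<close> does not suffice between completed measures;
  preimages of null sets must be null as well.\<close>

lemma null_sets_affine: "null_sets lborel = null_sets (distr lebesgue lborel T)"
proof -
  have "emeasure lborel X = 0 \<longleftrightarrow> emeasure (distr lebesgue lborel T) X = 0" if X: "X \<in> sets borel" for X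
  proof -
    have "emeasure lborel X = 0 \<longleftrightarrow> emeasure (density (distr lborel borel T) (\<lambda>_. ennreal \<bar>det A\<bar>)) X = 0"
      unfolding T_def using lborel_affine_matrix[OF det, of k] by simp
    also have "\<dots> \<longleftrightarrow> emeasure (distr lebesgue lborel T) X = 0"
      using X det by (simp add: distr_completion emeasure_density nn_integral_cmult cong: distr_cong)
    finally show ?thesis .
  qed
  then show ?thesis by (auto simp: null_sets_def)
qed

lemma lebesgue_affine_matrix:
  "T \<in> lebesgue \<rightarrow>\<^sub>M lebesgue" "lebesgue = density (distr lebesgue lebesgue T) (\<lambda>_. ennreal \<bar>det A\<bar>)"
proof -
  show "T \<in> lebesgue \<rightarrow>\<^sub>M lebesgue"
    by (simp add: completion.measurable_completion2 null_sets_affine measurable_completion)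
  have "lebesgue = completion (density (distr lborel borel T) (\<lambda>_. ennreal \<bar>det A\<bar>))"
    unfolding T_def using lborel_affine_matrix[OF det, of k] by simp
  also have "\<dots> = density (completion (distr lebesgue lborel T)) (\<lambda>_. ennreal \<bar>det A\<bar>)"
    using det by (auto intro!: always_eventually completion_density_eq simp: distr_completion cong: distr_cong)
  also have "\<dots> = density (distr lebesgue lebesgue T) (\<lambda>_. ennreal \<bar>det A\<bar>)"
    by (subst completion.completion_distr_eq) (auto simp: null_sets_affine measurable_completion)
  finally show "lebesgue = density (distr lebesgue lebesgue T) (\<lambda>_. ennreal \<bar>det A\<bar>)" .
qed

end

lemma measurable_affine:
  fixes f :: "real ^ 'd \<Rightarrow> 'b :: topological_space"
  assumes "det A \<noteq> 0" "f \<in> borel_measurable lebesgue"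
  shows "(\<lambda>x. f (A *v x - k)) \<in> borel_measurable lebesgue"
  using measurable_comp[OF lebesgue_affine_matrix(1)[OF assms(1)] assms(2), of k] by (simp add: o_def)

lemma integral_affine:
  fixes f :: "real ^ 'd \<Rightarrow> 'b :: {banach, second_countable_topology}"
  assumes "det A \<noteq> 0" and f: "f \<in> borel_measurable lebesgue"
  shows "(LINT x|lebesgue. f x) = \<bar>det A\<bar> *\<^sub>R (LINT x|lebesgue. f (A *v x - k))"
proof -
  note T = lebesgue_affine_matrix[OF assms(1), of k]
  have "(LINT x|lebesgue. f x) = (LINT x|density (distr lebesgue lebesgue (\<lambda>x. A *v x - k)) (\<lambda>_. ennreal \<bar>det A\<bar>). f x)"
    using T(2) by simp
  also have "\<dots> = (LINT x|distr lebesgue lebesgue (\<lambda>x. A *v x - k). \<bar>det A\<bar> *\<^sub>R f x)"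
    by (rule integral_density) (use f in auto)
  also have "\<dots> = (LINT x|lebesgue. \<bar>det A\<bar> *\<^sub>R f (A *v x - k))"
    by (rule integral_distr) (use T f in auto)
  finally show ?thesis by simp
qed

lemma integrable_affine:
  fixes f :: "real ^ 'd \<Rightarrow> 'b :: {banach, second_countable_topology}"
  assumes "det A \<noteq> 0" and f: "integrable lebesgue f"
  shows "integrable lebesgue (\<lambda>x. f (A *v x - k))"
proof -
  note T = lebesgue_affine_matrix[OF assms(1), of k]
  have "integrable (density (distr lebesgue lebesgue (\<lambda>x. A *v x - k)) (\<lambda>_. ennreal \<bar>det A\<bar>)) f"
    using T(2) f by simp
  then have "integrable (distr lebesgue lebesgue (\<lambda>x. A *v x - k)) (\<lambda>x. \<bar>det A\<bar> *\<^sub>R f x)"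
    by (subst (asm) integrable_density) (use f in auto)
  then have "integrable lebesgue (\<lambda>x. \<bar>det A\<bar> *\<^sub>R f (A *v x - k))"
    by (subst (asm) integrable_distr_eq) (use T f in auto)
  from integrable_scaleR_right[OF this, of "inverse \<bar>det A\<bar>"] show ?thesis using assms(1) by simp
qed

lemma AE_affine:
  fixes A :: "real ^ 'd ^ 'd"
  assumes "det A \<noteq> 0" and "AE x in lebesgue. P x"
  shows "AE x in lebesgue. P (A *v x - k)"
proof -
  note T = lebesgue_affine_matrix[OF assms(1), of k]
  have "AE x in density (distr lebesgue lebesgue (\<lambda>x. A *v x - k)) (\<lambda>_. ennreal \<bar>det A\<bar>). P x"
    using assms(2) by (simp only: T(2)[symmetric])
  then have "AE x in distr lebesgue lebesgue (\<lambda>x. A *v x - k). P x"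
    by (subst (asm) AE_density) (use assms(1) in auto)
  then obtain N where N: "N \<in> null_sets (distr lebesgue lebesgue (\<lambda>x. A *v x - k))" "{x. \<not> P x} \<subseteq> N"
    by (auto simp: eventually_ae_filter)
  then have "(\<lambda>x. A *v x - k) -` N \<in> null_sets lebesgue"
    using T(1) by (auto simp: null_sets_def emeasure_distr measurable_def)
  then show ?thesis
    by (rule AE_I') (use N(2) in auto)
qed

section \<open>Locally finite coefficient matrices\<close>

definition fsupp :: "('k \<Rightarrow> complex) \<Rightarrow> bool" where
  "fsupp u \<longleftrightarrow> finite {k. u k \<noteq> 0}"

text \<open>\<open>Sum_any\<close> adds over the support and is 0 when the support is infinite.
  Lemmas about \<open>ips\<close> therefore ask for finite support of one factor and leave the other
  one arbitrary.\<close>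

definition ips :: "('k \<Rightarrow> complex) \<Rightarrow> ('k \<Rightarrow> complex) \<Rightarrow> complex" where
  "ips u v = Sum_any (\<lambda>k. u k * cnj (v k))"

definition nsq :: "('k \<Rightarrow> complex) \<Rightarrow> real" where
  "nsq u = Re (ips u u)"

definition syn :: "('i \<Rightarrow> 'k \<Rightarrow> complex) \<Rightarrow> ('i \<Rightarrow> complex) \<Rightarrow> 'k \<Rightarrow> complex" where
  "syn E w k = Sum_any (\<lambda>i. w i * E i k)"

definition ana :: "('i \<Rightarrow> 'k \<Rightarrow> complex) \<Rightarrow> ('k \<Rightarrow> complex) \<Rightarrow> 'i \<Rightarrow> complex" where
  "ana E v i = Sum_any (\<lambda>k. v k * cnj (E i k))"

text \<open>Finite rows make \<open>ana\<close>, and finite columns make \<open>syn\<close>,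
  meaningful on arbitrary sequences, on which the filter bank operators are defined.\<close>

definition loc_fin :: "('i \<Rightarrow> 'k \<Rightarrow> complex) \<Rightarrow> bool" where
  "loc_fin E \<longleftrightarrow> (\<forall>i. finite {k. E i k \<noteq> 0}) \<and> (\<forall>k. finite {i. E i k \<noteq> 0})"

definition biorth :: "('i \<Rightarrow> 'k \<Rightarrow> complex) \<Rightarrow> ('i \<Rightarrow> 'k \<Rightarrow> complex) \<Rightarrow> bool" where
  "biorth E Et \<longleftrightarrow> (\<forall>i j. Sum_any (\<lambda>k. E i k * cnj (Et j k)) = (if i = j then 1 else 0))"

definition reproducing :: "('i \<Rightarrow> 'k \<Rightarrow> complex) \<Rightarrow> ('i \<Rightarrow> 'k \<Rightarrow> complex) \<Rightarrow> bool" where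
  "reproducing E Et \<longleftrightarrow> (\<forall>k l. Sum_any (\<lambda>i. cnj (E i k) * Et i l) = (if k = l then 1 else 0))"

lemma Sum_any_eq: "finite S \<Longrightarrow> (\<And>k. k \<notin> S \<Longrightarrow> g k = 0) \<Longrightarrow> Sum_any g = sum g S"
  by (rule Sum_any.expand_superset) auto

lemma cnj_Sum_any: "cnj (Sum_any g) = Sum_any (\<lambda>k. cnj (g k))"
  by (simp add: Sum_any.expand_set)

lemma ips_eq: "finite S \<Longrightarrow> (\<And>k. k \<notin> S \<Longrightarrow> u k = 0) \<Longrightarrow> ips u v = (\<Sum>k\<in>S. u k * cnj (v k))"
  by (simp add: ips_def Sum_any_eq)

lemma ips_eq': "finite S \<Longrightarrow> (\<And>k. k \<notin> S \<Longrightarrow> v k = 0) \<Longrightarrow> ips u v = (\<Sum>k\<in>S. u k * cnj (v k))"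
  by (simp add: ips_def Sum_any_eq)

lemma nsq_eq:
  assumes "finite S" "\<And>k. k \<notin> S \<Longrightarrow> u k = 0"
  shows "nsq u = (\<Sum>k\<in>S. (cmod (u k))\<^sup>2)"
proof -
  have "ips u u = (\<Sum>k\<in>S. of_real ((cmod (u k))\<^sup>2))"
    using ips_eq[OF assms, where v=u] by (simp only: complex_norm_square)
  then show ?thesis by (simp add: nsq_def)
qed

lemma fsuppE:
  assumes "fsupp u"
  obtains S where "finite S" "\<And>k. k \<notin> S \<Longrightarrow> u k = 0"
  using assms by (force simp: fsupp_def)

lemma fsuppI: "finite S \<Longrightarrow> (\<And>k. k \<notin> S \<Longrightarrow> u k = 0) \<Longrightarrow> fsupp u"
  unfolding fsupp_def by (rule finite_subset[of _ S]) auto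

lemma nsq_nonneg: "0 \<le> nsq u"
proof (cases "fsupp u")
  case True
  then obtain S where S: "finite S" "\<And>k. k \<notin> S \<Longrightarrow> u k = 0" by (metis fsuppE)
  show ?thesis using nsq_eq[of S u, OF S] by (simp add: sum_nonneg)
next
  \<comment> \<open>A sum over an infinite support is 0 by convention.\<close>
  case False
  then have "ips u u = 0" by (simp add: ips_def fsupp_def)
  then show ?thesis by (simp add: nsq_def)
qed

lemma biorth_commute: "biorth E Et \<Longrightarrow> biorth Et E"
  unfolding biorth_def
proof (intro allI)
  fix i j assume "\<forall>i j. Sum_any (\<lambda>k. E i k * cnj (Et j k)) = (if i = j then 1 else 0)"
  then have "cnj (Sum_any (\<lambda>k. E j k * cnj (Et i k))) = (if i = j then 1 else 0)" by simp
  then show "Sum_any (\<lambda>k. Et i k * cnj (E j k)) = (if i = j then 1 else 0)"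
    unfolding cnj_Sum_any by (simp add: mult.commute)
qed

lemma reproducing_commute: "reproducing E Et \<Longrightarrow> reproducing Et E"
  unfolding reproducing_def
proof (intro allI)
  fix k l assume "\<forall>k l. Sum_any (\<lambda>i. cnj (E i k) * Et i l) = (if k = l then 1 else 0)"
  then have "cnj (Sum_any (\<lambda>i. cnj (E i l) * Et i k)) = (if k = l then 1 else 0)" by simp
  then show "Sum_any (\<lambda>i. cnj (Et i k) * E i l) = (if k = l then 1 else 0)"
    unfolding cnj_Sum_any by (simp add: mult.commute)
qed

lemma Sum_any_delta_mult:
  fixes w :: "'i \<Rightarrow> 'a :: comm_semiring_1"
  shows "Sum_any (\<lambda>j. w j * (if j = i then 1 else 0)) = w i"
    "Sum_any (\<lambda>j. w j * (if i = j then 1 else 0)) = w i"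
    "Sum_any (\<lambda>j. (if j = i then 1 else 0) * w j) = w i"
    "Sum_any (\<lambda>j. (if i = j then 1 else 0) * w j) = w i"
  by ((subst Sum_any_eq[of "{i}"], simp_all)+)

text \<open>Row \<open>i\<close> of \<open>E\<close> meets finitely many \<open>k\<close>, and these
  meet finitely many \<open>j\<close>; on these finite sets the sums can be exchanged for an
  arbitrary \<open>w\<close>.\<close>

lemma ana_syn_eq:
  assumes E: "loc_fin E" and Et: "loc_fin Et"
  shows "ana E (syn Et w) i = Sum_any (\<lambda>j. w j * Sum_any (\<lambda>k. Et j k * cnj (E i k)))"
proof -
  define S where "S = {k. E i k \<noteq> 0}"
  define T where "T = (\<Union>k\<in>S. {j. Et j k \<noteq> 0})"
  have S: "finite S" using E by (simp add: S_def loc_fin_def)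
  have T: "finite T" unfolding T_def using Et S by (auto simp: loc_fin_def)
  have "ana E (syn Et w) i = (\<Sum>k\<in>S. syn Et w k * cnj (E i k))"
    unfolding ana_def by (rule Sum_any_eq[OF S]) (auto simp: S_def)
  also have "\<dots> = (\<Sum>k\<in>S. (\<Sum>j\<in>T. w j * Et j k) * cnj (E i k))"
  proof (rule sum.cong)
    fix k assume "k \<in> S"
    then have "syn Et w k = (\<Sum>j\<in>T. w j * Et j k)"
      unfolding syn_def by (intro Sum_any_eq[OF T]) (auto simp: T_def)
    then show "syn Et w k * cnj (E i k) = (\<Sum>j\<in>T. w j * Et j k) * cnj (E i k)" by simp
  qed simp
  also have "\<dots> = (\<Sum>j\<in>T. w j * (\<Sum>k\<in>S. Et j k * cnj (E i k)))"
    unfolding sum_distrib_right sum_distrib_left by (subst sum.swap) (simp add: mult.assoc)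
  also have "\<dots> = (\<Sum>j\<in>T. w j * Sum_any (\<lambda>k. Et j k * cnj (E i k)))"
    by (intro sum.cong refl arg_cong2[where f="(*)"] Sum_any_eq[symmetric] S) (auto simp: S_def)
  also have "\<dots> = Sum_any (\<lambda>j. w j * Sum_any (\<lambda>k. Et j k * cnj (E i k)))"
  proof (rule Sum_any_eq[OF T, symmetric])
    fix j assume "j \<notin> T"
    then have "(\<lambda>k. Et j k * cnj (E i k)) = (\<lambda>k. 0)" by (auto simp: T_def S_def fun_eq_iff)
    then show "w j * Sum_any (\<lambda>k. Et j k * cnj (E i k)) = 0" by (simp only: Sum_any.neutral mult_zero_right)
  qed
  finally show ?thesis .
qed

text \<open>Transposing and conjugating both matrices exchanges analysis and synthesis, which
  reduces this to \<open>ana_syn_eq\<close>.\<close>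

lemma syn_ana_eq:
  assumes E: "loc_fin E" and Et: "loc_fin Et"
  shows "syn Et (ana E v) l = Sum_any (\<lambda>k. v k * Sum_any (\<lambda>i. cnj (E i k) * Et i l))"
proof -
  let ?F = "\<lambda>k i. cnj (E i k)" and ?G = "\<lambda>k i. cnj (Et i k)"
  have lf: "loc_fin ?F" "loc_fin ?G" using E Et by (auto simp: loc_fin_def)
  have "ana ?G (syn ?F v) l = Sum_any (\<lambda>k. v k * Sum_any (\<lambda>i. ?F k i * cnj (?G l i)))"
    by (rule ana_syn_eq[OF lf(2,1)])
  then show ?thesis by (simp add: ana_def syn_def)
qed

lemma ana_syn:
  assumes "loc_fin E" "loc_fin Et" "biorth E Et"
  shows "ana E (syn Et w) = w"
  using biorth_commute[OF assms(3)]
  by (auto simp: ana_syn_eq[OF assms(1,2)] biorth_def Sum_any_delta_mult)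

lemma syn_ana:
  assumes "loc_fin E" "loc_fin Et" "reproducing E Et"
  shows "syn Et (ana E v) = v"
  using assms(3) by (auto simp: syn_ana_eq[OF assms(1,2)] reproducing_def Sum_any_delta_mult)

text \<open>Unit sequences pick out single matrix entries.\<close>

lemma biorthI:
  assumes "loc_fin E" "loc_fin Et" "\<And>w. ana E (syn Et w) = w"
  shows "biorth E Et"
proof (rule biorth_commute, unfold biorth_def, intro allI)
  fix i j
  have "ana E (syn Et (\<lambda>k. if k = i then 1 else 0)) j = (if j = i then 1 else 0)"
    by (simp only: assms(3))
  then show "Sum_any (\<lambda>k. Et i k * cnj (E j k)) = (if i = j then 1 else 0)"
    unfolding ana_syn_eq[OF assms(1,2)] Sum_any_delta_mult by (cases "i = j") auto
qed

lemma reproducingI: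
  assumes "loc_fin E" "loc_fin Et" "\<And>v. syn Et (ana E v) = v"
  shows "reproducing E Et"
proof (unfold reproducing_def, intro allI)
  fix i j
  have "syn Et (ana E (\<lambda>k. if k = i then 1 else 0)) j = (if j = i then 1 else 0)"
    by (simp only: assms(3))
  then show "Sum_any (\<lambda>k. cnj (E k i) * Et k j) = (if i = j then 1 else 0)"
    unfolding syn_ana_eq[OF assms(1,2)] Sum_any_delta_mult by (cases "i = j") auto
qed

lemma fsupp_syn:
  assumes "loc_fin E" "fsupp w"
  shows "fsupp (syn E w)"
proof -
  obtain S where S: "finite S" "\<And>k. k \<notin> S \<Longrightarrow> w k = 0" using fsuppE[OF assms(2)] by blast
  show ?thesis
  proof (rule fsuppI)
    show "finite (\<Union>i\<in>S. {k. E i k \<noteq> 0})" using S assms(1) by (auto simp: loc_fin_def)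
    fix k assume "k \<notin> (\<Union>i\<in>S. {k. E i k \<noteq> 0})"
    then have "(\<lambda>i. w i * E i k) = (\<lambda>i. 0)" using S(2) by (auto simp: fun_eq_iff)
    then show "syn E w k = 0" by (simp only: syn_def Sum_any.neutral)
  qed
qed

lemma fsupp_ana:
  assumes "loc_fin E" "fsupp v"
  shows "fsupp (ana E v)"
proof -
  have "loc_fin (\<lambda>k i. cnj (E i k))" using assms(1) by (auto simp: loc_fin_def)
  moreover have "ana E v = syn (\<lambda>k i. cnj (E i k)) v" by (rule ext) (simp add: syn_def ana_def)
  ultimately show ?thesis using fsupp_syn assms(2) by metis
qed

text \<open>Synthesis and analysis are adjoint. The sequence \<open>v\<close> is arbitrary because
  it will also hold the conjugated values of infinitely many functions at one point.\<close>

lemma ips_syn: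
  assumes E: "loc_fin E" and w: "fsupp w"
  shows "ips (syn E w) v = ips w (ana E v)"
proof -
  from w obtain S where S: "finite S" "\<And>k. k \<notin> S \<Longrightarrow> w k = 0" by (metis fsuppE)
  define T where "T = (\<Union>i\<in>S. {k. E i k \<noteq> 0})"
  have T: "finite T" using S E by (auto simp: loc_fin_def T_def)
  have syn: "syn E w k = (\<Sum>i\<in>S. w i * E i k)" for k
    unfolding syn_def by (rule Sum_any_eq[OF S(1)]) (simp add: S(2))
  have ana: "ana E v i = (\<Sum>k\<in>T. v k * cnj (E i k))" if "i \<in> S" for i
    unfolding ana_def by (rule Sum_any_eq[OF T]) (use that in \<open>auto simp: T_def\<close>)
  have "ips (syn E w) v = (\<Sum>k\<in>T. syn E w k * cnj (v k))"
    by (rule ips_eq[OF T]) (auto simp: syn T_def intro!: sum.neutral)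
  also have "\<dots> = (\<Sum>i\<in>S. \<Sum>k\<in>T. w i * E i k * cnj (v k))"
    unfolding syn sum_distrib_right by (rule sum.swap)
  also have "\<dots> = (\<Sum>i\<in>S. w i * cnj (ana E v i))"
    by (intro sum.cong refl) (simp add: ana sum_distrib_left ac_simps)
  also have "\<dots> = ips w (ana E v)"
    by (rule ips_eq[OF S, symmetric])
  finally show ?thesis .
qed

lemma ips_syn_syn:
  assumes "loc_fin E" "loc_fin Et" "biorth E Et" "fsupp w"
  shows "ips (syn E w) (syn Et w') = ips w w'"
  using assms by (simp add: ips_syn ana_syn)

section \<open>Multilevel decompositions\<close>

type_synonym ('s, 'r, 'z) aindex = "('r \<times> 'z) + ('s \<times> nat \<times> 'z)"

definition comb :: "('r \<times> 'z \<Rightarrow> complex) \<Rightarrow> ('s \<times> 'z \<Rightarrow> complex) \<Rightarrow> ('s + 'r) \<times> 'z \<Rightarrow> complex" where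
  "comb u h = (\<lambda>(\<iota>, k). case \<iota> of Inl l \<Rightarrow> h (l, k) | Inr q \<Rightarrow> u (q, k))"

definition low :: "(('s + 'r) \<times> 'z \<Rightarrow> 'r \<times> 'z \<Rightarrow> complex) \<Rightarrow> ('r \<times> 'z \<Rightarrow> complex) \<Rightarrow> 'r \<times> 'z \<Rightarrow> complex" where
  "low E v = (\<lambda>(q, k). ana E v (Inr q, k))"

definition high :: "(('s + 'r) \<times> 'z \<Rightarrow> 'r \<times> 'z \<Rightarrow> complex) \<Rightarrow> ('r \<times> 'z \<Rightarrow> complex) \<Rightarrow> 's \<times> 'z \<Rightarrow> complex" where
  "high E v = (\<lambda>(l, k). ana E v (Inl l, k))"

definition detail :: "(('s, 'r, 'z) aindex \<Rightarrow> complex) \<Rightarrow> nat \<Rightarrow> 's \<times> 'z \<Rightarrow> complex" where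
  "detail c j = (\<lambda>(l, k). c (Inr (l, j, k)))"

text \<open>\<open>lev E c j\<close> holds the coefficients, in the shifts of level \<open>j\<close>, of the combination with
  coefficients \<open>c\<close> of the elements of an affine system below level \<open>j\<close>.\<close>

primrec lev :: "(('s + 'r) \<times> 'z \<Rightarrow> 'r \<times> 'z \<Rightarrow> complex) \<Rightarrow> (('s, 'r, 'z) aindex \<Rightarrow> complex) \<Rightarrow> nat
    \<Rightarrow> 'r \<times> 'z \<Rightarrow> complex" where
  "lev E c 0 = (\<lambda>\<kappa>. c (Inl \<kappa>))"
| "lev E c (Suc j) = syn E (comb (lev E c j) (detail c j))"

text \<open>The counterpart of \<open>multilevel_norm_sq\<close> for flattened, finitely supported
  sequences, as shown in \<open>multilevel_flat\<close>.\<close>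

definition ml :: "(('s + 'r) \<times> 'z \<Rightarrow> 'r \<times> 'z \<Rightarrow> complex) \<Rightarrow> nat \<Rightarrow> ('r \<times> 'z \<Rightarrow> complex) \<Rightarrow> real" where
  "ml E J u = (\<Sum>j=1..J. nsq (high E ((low E ^^ (j - 1)) u))) + nsq ((low E ^^ J) u)"

lemma comb_low_high: "comb (low E v) (high E v) = ana E v"
  by (auto simp: comb_def low_def high_def split: sum.split)

lemma low_syn:
  assumes "loc_fin E" "loc_fin Et" "biorth E Et"
  shows "low E (syn Et (comb u h)) = u" "high E (syn Et (comb u h)) = h"
  using assms by (auto simp: low_def high_def ana_syn comb_def)

lemma fsupp_comb: "fsupp u \<Longrightarrow> fsupp h \<Longrightarrow> fsupp (comb u h)"
proof -
  assume "fsupp u" "fsupp h"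
  then obtain S T where S: "finite S" "\<And>k. k \<notin> S \<Longrightarrow> u k = 0" and T: "finite T" "\<And>k. k \<notin> T \<Longrightarrow> h k = 0"
    by (metis fsuppE)
  show ?thesis
    by (rule fsuppI[of "(\<lambda>(q, k). (Inr q, k)) ` S \<union> (\<lambda>(l, k). (Inl l, k)) ` T"])
       (use S T in \<open>force simp: comb_def split: sum.splits\<close>)+
qed

lemma fsupp_comp_inj: "fsupp u \<Longrightarrow> inj f \<Longrightarrow> fsupp (\<lambda>x. u (f x))"
  unfolding fsupp_def using finite_vimageI[of "{k. u k \<noteq> 0}" f] by (simp add: vimage_def)

lemma fsupp_low: "loc_fin E \<Longrightarrow> fsupp v \<Longrightarrow> fsupp (low E v)"
  using fsupp_comp_inj[OF fsupp_ana, of E v "\<lambda>(q, k). (Inr q, k)"]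
  by (auto simp: low_def inj_on_def case_prod_beta')

lemma fsupp_high: "loc_fin E \<Longrightarrow> fsupp v \<Longrightarrow> fsupp (high E v)"
  using fsupp_comp_inj[OF fsupp_ana, of E v "\<lambda>(q, k). (Inl q, k)"]
  by (auto simp: high_def inj_on_def case_prod_beta')

lemma fsupp_detail: "fsupp c \<Longrightarrow> fsupp (detail c j)"
  using fsupp_comp_inj[of c "\<lambda>(l, k). Inr (l, j, k)"]
  by (auto simp: detail_def inj_on_def case_prod_beta')

lemma fsupp_lev: "loc_fin E \<Longrightarrow> fsupp c \<Longrightarrow> fsupp (lev E c j)"
proof (induction j)
  case 0
  then show ?case using fsupp_comp_inj[of c Inl] by simp
qed (auto intro!: fsupp_syn fsupp_comb fsupp_detail)

lemma ips_comb:
  assumes "fsupp u" "fsupp h"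
  shows "ips (comb u h) (comb u' h') = ips u u' + ips h h'"
proof -
  from assms obtain S T where S: "finite S" "\<And>k. k \<notin> S \<Longrightarrow> u k = 0" and T: "finite T" "\<And>k. k \<notin> T \<Longrightarrow> h k = 0"
    by (metis fsuppE)
  let ?f = "\<lambda>(q, k). (Inr q, k)" and ?g = "\<lambda>(l, k). (Inl l, k)"
  have inj: "inj_on ?f S" "inj_on ?g T" by (auto simp: inj_on_def)
  have "ips (comb u h) (comb u' h') = (\<Sum>k\<in>?f ` S \<union> ?g ` T. comb u h k * cnj (comb u' h' k))"
    by (rule ips_eq) (use S T in \<open>force simp: comb_def split: sum.splits\<close>)+
  also have "\<dots> = (\<Sum>k\<in>?f ` S. comb u h k * cnj (comb u' h' k)) + (\<Sum>k\<in>?g ` T. comb u h k * cnj (comb u' h' k))"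
    by (rule sum.union_disjoint) (use S T in auto)
  also have "\<dots> = (\<Sum>k\<in>S. u k * cnj (u' k)) + (\<Sum>k\<in>T. h k * cnj (h' k))"
    unfolding sum.reindex[OF inj(1)] sum.reindex[OF inj(2)]
    by (intro arg_cong2[where f="(+)"] sum.cong refl) (auto simp: comb_def)
  finally show ?thesis by (simp add: ips_eq[OF S] ips_eq[OF T])
qed

text \<open>Biorthogonality preserves the pairing in each synthesis step, and the input of a step
  splits into the previous level and its details.\<close>

lemma ips_lev_Suc:
  assumes "loc_fin E" "loc_fin Et" "biorth E Et" "fsupp c"
  shows "ips (lev E c J) (lev Et c' J) = ips (\<lambda>\<kappa>. c (Inl \<kappa>)) (\<lambda>\<kappa>. c' (Inl \<kappa>)) + (\<Sum>j<J. ips (detail c j) (detail c' j))"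
proof (induction J)
  case (Suc J)
  have f: "fsupp (lev E c J)" "fsupp (detail c J)"
    using assms by (auto intro: fsupp_lev fsupp_detail)
  have "ips (lev E c (Suc J)) (lev Et c' (Suc J)) = ips (lev E c J) (lev Et c' J) + ips (detail c J) (detail c' J)"
    using assms f by (simp add: ips_syn_syn fsupp_comb ips_comb)
  with Suc show ?case by simp
qed simp

text \<open>Regrouping by scale. Only \<open>c\<close> has to stop below \<open>J\<close>;
  \<open>c'\<close> will later hold values of the whole affine system.\<close>

lemma ips_aindex:
  assumes "fsupp c" and J: "\<And>l j k. j \<ge> J \<Longrightarrow> c (Inr (l, j, k)) = 0"
  shows "ips c c' = ips (\<lambda>\<kappa>. c (Inl \<kappa>)) (\<lambda>\<kappa>. c' (Inl \<kappa>)) + (\<Sum>j<J. ips (detail c j) (detail c' j))"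
proof -
  define S where "S = {\<kappa>. c (Inl \<kappa>) \<noteq> 0}"
  define T where "T j = {\<mu>. detail c j \<mu> \<noteq> 0}" for j
  have S: "finite S" "\<And>\<kappa>. \<kappa> \<notin> S \<Longrightarrow> c (Inl \<kappa>) = 0"
    using fsupp_comp_inj[OF assms(1), of Inl] by (auto simp: S_def fsupp_def)
  have T: "finite (T j)" "\<And>\<kappa>. \<kappa> \<notin> T j \<Longrightarrow> detail c j \<kappa> = 0" for j
    using fsupp_detail[OF assms(1), of j] by (auto simp: T_def fsupp_def)
  let ?g = "\<lambda>j (l, k). Inr (l, j, k)"
  let ?F = "\<lambda>i. c i * cnj (c' i)"
  have inj: "inj_on Inl S" "\<And>j. inj_on (?g j) (T j)" by (auto simp: inj_on_def)
  have 0: "c i = 0" if "i \<notin> Inl ` S \<union> (\<Union>j<J. ?g j ` T j)" for i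
  proof (cases i)
    case (Inl \<kappa>)
    then have "\<kappa> \<notin> S" using that by blast
    then show ?thesis using S(2) Inl by simp
  next
    case (Inr t)
    obtain l j k where t: "t = (l, j, k)" by (cases t)
    show ?thesis
    proof (cases "j < J")
      case True
      then have "(l, k) \<notin> T j" using that Inr t by (auto simp: image_iff)
      then show ?thesis using T(2) Inr t by (force simp: detail_def)
    next
      case False
      then show ?thesis using J Inr t by simp
    qed
  qed
  have "ips c c' = sum ?F (Inl ` S \<union> (\<Union>j<J. ?g j ` T j))"
    by (rule ips_eq) (use S T 0 in auto)
  also have "\<dots> = sum ?F (Inl ` S) + sum ?F (\<Union>j<J. ?g j ` T j)"
    by (rule sum.union_disjoint) (use S T in auto)
  also have "sum ?F (\<Union>j<J. ?g j ` T j) = (\<Sum>j<J. sum ?F (?g j ` T j))"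
    by (rule sum.UNION_disjoint) (use T in auto)
  also have "(\<Sum>j<J. sum ?F (?g j ` T j)) = (\<Sum>j<J. ips (detail c j) (detail c' j))"
  proof (rule sum.cong)
    fix j
    have "ips (detail c j) (detail c' j) = (\<Sum>k\<in>T j. detail c j k * cnj (detail c' j k))"
      by (rule ips_eq[OF T(1)]) (rule T(2))
    then show "sum ?F (?g j ` T j) = ips (detail c j) (detail c' j)"
      unfolding sum.reindex[OF inj(2)] by (simp add: detail_def case_prod_beta' o_def)
  qed simp
  also have "sum ?F (Inl ` S) = ips (\<lambda>\<kappa>. c (Inl \<kappa>)) (\<lambda>\<kappa>. c' (Inl \<kappa>))"
    using ips_eq[of S "\<lambda>\<kappa>. c (Inl \<kappa>)", OF S] by (simp add: sum.reindex[OF inj(1)])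
  finally show ?thesis .
qed

lemma ips_lev:
  assumes "loc_fin E" "loc_fin Et" "biorth E Et" "fsupp c" "\<And>l j k. j \<ge> J \<Longrightarrow> c (Inr (l, j, k)) = 0"
  shows "ips (lev E c J) (lev Et c' J) = ips c c'"
  using ips_lev_Suc[OF assms(1-4)] ips_aindex[OF assms(4,5)] by simp

text \<open>Peels off the finest level, which analysis meets first.\<close>

lemma ml_Suc: "ml E (Suc J) u = nsq (high E u) + ml E J (low E u)"
proof -
  have "(\<Sum>j=1..Suc J. nsq (high E ((low E ^^ (j - 1)) u)))
      = nsq (high E u) + (\<Sum>j=2..Suc J. nsq (high E ((low E ^^ (j - 1)) u)))"
    by (simp add: sum.atLeast_Suc_atMost numeral_2_eq_2)
  also have "(\<Sum>j=2..Suc J. nsq (high E ((low E ^^ (j - 1)) u)))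
      = (\<Sum>j=1..J. nsq (high E ((low E ^^ j) u)))"
    using sum.shift_bounds_cl_Suc_ivl[of "\<lambda>j. nsq (high E ((low E ^^ (j - 1)) u))" 1 J]
    by (simp add: numeral_2_eq_2)
  also have "\<dots> = (\<Sum>j=1..J. nsq (high E ((low E ^^ (j - 1)) (low E u))))"
  proof (rule sum.cong)
    fix j assume "j \<in> {1..J}"
    then obtain i where "j = Suc i" by (cases j) auto
    then show "nsq (high E ((low E ^^ j) u)) = nsq (high E ((low E ^^ (j - 1)) (low E u)))"
      by (simp add: funpow_swap1)
  qed simp
  finally show ?thesis by (simp add: ml_def funpow_swap1)
qed

text \<open>Analysis with \<open>E\<close> strips the synthesis steps with \<open>Et\<close> in
  reverse order and returns the details unchanged. In this way a stability bound for one bank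
  controls synthesis with the other.\<close>

lemma ml_lev:
  assumes "loc_fin E" "loc_fin Et" "biorth E Et"
  shows "ml E J (lev Et c J) = nsq (\<lambda>\<kappa>. c (Inl \<kappa>)) + (\<Sum>j<J. nsq (detail c j))"
proof (induction J)
  case 0
  then show ?case by (simp add: ml_def)
next
  case (Suc J)
  have "ml E (Suc J) (lev Et c (Suc J)) = nsq (detail c J) + ml E J (lev Et c J)"
    by (simp add: ml_Suc low_syn[OF assms])
  with Suc show ?case by simp
qed

lemma ml_lev_nsq:
  assumes "loc_fin E" "loc_fin Et" "biorth E Et" "fsupp c" "\<And>l j k. j \<ge> J \<Longrightarrow> c (Inr (l, j, k)) = 0"
  shows "ml E J (lev Et c J) = nsq c"
proof -
  have "nsq c = nsq (\<lambda>\<kappa>. c (Inl \<kappa>)) + (\<Sum>j<J. nsq (detail c j))"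
    using ips_aindex[OF assms(4,5), where c'=c] by (simp add: nsq_def)
  then show ?thesis using ml_lev[OF assms(1-3)] by simp
qed

text \<open>Analysis starts at level \<open>J\<close>, whereas the affine system counts scales from
  the coarsest one: the details of scale \<open>j\<close> appear after \<open>J - 1 - j\<close>
  low-pass steps.\<close>

definition decomp :: "(('s + 'r) \<times> 'z \<Rightarrow> 'r \<times> 'z \<Rightarrow> complex) \<Rightarrow> nat \<Rightarrow> ('r \<times> 'z \<Rightarrow> complex)
    \<Rightarrow> ('s, 'r, 'z) aindex \<Rightarrow> complex" where
  "decomp E J u i = (case i of Inl \<kappa> \<Rightarrow> (low E ^^ J) u \<kappa>
     | Inr (l, j, k) \<Rightarrow> if j < J then high E ((low E ^^ (J - 1 - j)) u) (l, k) else 0)"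

text \<open>Perfect reconstruction, one level at a time: after \<open>j\<close> synthesis steps,
  \<open>J - j\<close> low-pass steps are still to be undone.\<close>

lemma lev_decomp:
  assumes "loc_fin E" "loc_fin Et" "reproducing E Et" "j \<le> J"
  shows "lev Et (decomp E J u) j = (low E ^^ (J - j)) u"
  using assms(4)
proof (induction j)
  case 0
  then show ?case by (simp add: decomp_def)
next
  case (Suc j)
  define v where "v = (low E ^^ (J - Suc j)) u"
  have eq: "J - j = Suc (J - Suc j)" using Suc.prems by simp
  have "detail (decomp E J u) j = high E v"
    using Suc.prems by (auto simp: detail_def decomp_def v_def)
  moreover have "lev Et (decomp E J u) j = low E v"
    using Suc by (simp add: v_def eq)
  ultimately have "lev Et (decomp E J u) (Suc j) = syn Et (ana E v)"
    by (simp add: comb_low_high)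
  then show ?case using syn_ana[OF assms(1-3)] by (simp add: v_def)
qed

lemma fsupp_low_iter: "loc_fin E \<Longrightarrow> fsupp v \<Longrightarrow> fsupp ((low E ^^ n) v)"
  by (induction n) (auto intro: fsupp_low)

lemma fsupp_decomp:
  assumes "loc_fin E" "fsupp u"
  shows "fsupp (decomp E J u)"
proof -
  define S where "S = {\<kappa>. (low E ^^ J) u \<kappa> \<noteq> 0}"
  define T where "T j = {\<kappa>. high E ((low E ^^ (J - 1 - j)) u) \<kappa> \<noteq> 0}" for j
  have S: "finite S" using fsupp_low_iter[OF assms] by (simp add: S_def fsupp_def)
  have T: "finite (T j)" for j
    using fsupp_high[OF assms(1) fsupp_low_iter[OF assms]] by (simp add: T_def fsupp_def)
  show ?thesis
    by (rule fsuppI[of "Inl ` S \<union> (\<Union>j<J. (\<lambda>(l, k). Inr (l, j, k)) ` T j)"])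
       (use S T in \<open>auto simp: decomp_def S_def T_def image_iff split: sum.splits\<close>)
qed

section \<open>Dilation matrices\<close>

lemma det_rmat: "det (rmat M) = real_of_int (det M)"
  unfolding det_def by (simp add: rmat_def)

lemma abs_det_eq: "abs_det M = \<bar>det (rmat M)\<bar>"
  by (simp add: abs_det_def det_rmat)

lemma rmat_mult_rvec: "rmat M *v rvec k = rvec (M *v k)"
  by (simp add: rmat_def rvec_def matrix_vector_mult_def vec_eq_iff)

lemma rvec_simps: "rvec (a + b) = rvec a + rvec b" "rvec (a - b) = rvec a - rvec b" "rvec 0 = 0"
  by (simp_all add: rvec_def vec_eq_iff)

lemma rvec_eq_iff [simp]: "rvec a = rvec b \<longleftrightarrow> a = b"
  by (simp add: rvec_def vec_eq_iff)

text \<open>A vanishing determinant would make 0 an eigenvalue.\<close>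

lemma dilation_matrix_det:
  fixes M :: "int ^ 'd ^ 'd"
  assumes "dilation_matrix M"
  shows "det (rmat M) \<noteq> 0"
proof
  assume 0: "det (rmat M) = 0"
  let ?C = "\<chi> i j. complex_of_int (M $ i $ j)"
  have "det ?C = complex_of_real (det (rmat M))"
    unfolding det_def by (simp add: rmat_def)
  then have "det ?C = 0" using 0 by simp
  then have "\<not> invertible ?C" by (simp add: invertible_det_nz)
  then have "\<not> (\<forall>x. ?C *v x = 0 \<longrightarrow> x = 0)"
    by (meson invertible_left_inverse matrix_left_invertible_ker)
  then obtain v where "?C *v v = 0" "v \<noteq> 0" by blast
  moreover have "0 = 0 *s v" by (simp add: vec_eq_iff)
  ultimately have "cmod 0 > 1" using assms unfolding dilation_matrix_def by metis
  then show False by simp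
qed

lemma inj_int_matrix:
  fixes M :: "int ^ 'd ^ 'd"
  assumes "det (rmat M) \<noteq> 0"
  shows "inj ((*v) M)"
proof (rule injI)
  fix a b assume "M *v a = M *v b"
  then have "rmat M *v rvec a = rmat M *v rvec b" by (simp add: rmat_mult_rvec)
  moreover have "inj ((*v) (rmat M))"
    using assms by (simp add: inj_matrix_vector_mult invertible_det_nz)
  ultimately show "a = b" by (metis injD rvec_eq_iff)
qed

lemma matrix_inv_mult:
  fixes A :: "real ^ 'd ^ 'd"
  assumes "det A \<noteq> 0"
  shows "A ** matrix_inv A = mat 1" "matrix_inv A ** A = mat 1"
proof -
  have "\<exists>B. A ** B = mat 1 \<and> B ** A = mat 1"
    using assms by (simp add: invertible_det_nz[symmetric] invertible_def)
  then have "A ** matrix_inv A = mat 1 \<and> matrix_inv A ** A = mat 1"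
    unfolding matrix_inv_def by (rule someI_ex)
  then show "A ** matrix_inv A = mat 1" "matrix_inv A ** A = mat 1" by auto
qed

lemma inv_transp:
  assumes "det (rmat M) \<noteq> 0"
  shows "transpose (rmat M) *v (inv_transp M *v x) = x" "inv_transp M *v (transpose (rmat M) *v x) = x"
proof -
  show "transpose (rmat M) *v (inv_transp M *v x) = x" "inv_transp M *v (transpose (rmat M) *v x) = x"
    using matrix_inv_mult[of "transpose (rmat M)"] assms
    unfolding inv_transp_def matrix_vector_mul_assoc det_transpose by simp_all
qed

lemma det_mat_pow: "det (mat_pow A j) = det A ^ j"
  by (induction j) (simp_all add: mat_pow_def det_mul)

lemma mat_pow_Suc: "mat_pow A (Suc j) = A ** mat_pow A j"
  by (simp add: mat_pow_def)

lemma mat_pow_Suc': "mat_pow A (Suc j) = mat_pow A j ** A"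
  by (induction j) (simp_all add: mat_pow_def matrix_mul_assoc)

lemma mat_pow_0: "mat_pow A 0 = mat 1"
  by (simp add: mat_pow_def)

lemma mat_pow_add: "mat_pow A (i + j) = mat_pow A i ** mat_pow A j"
  by (induction i) (simp_all add: mat_pow_Suc mat_pow_0 matrix_mul_assoc)

section \<open>Powers of the inverse of a dilation matrix\<close>

lemma contraction_tendsto_0:
  fixes x :: "nat \<Rightarrow> real"
  assumes c: "0 \<le> c" "c < 1" and x: "\<And>n. 0 \<le> x n" "\<And>n. x (Suc n) \<le> c * x n + w n" and w: "w \<longlonglongrightarrow> 0"
  shows "x \<longlonglongrightarrow> 0"
proof (rule LIMSEQ_I)
  fix e :: real assume "e > 0"
  define d where "d = e * (1 - c) / 2"
  have "d > 0" using c \<open>e > 0\<close> by (simp add: d_def)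
  then obtain N where N: "\<And>n. n \<ge> N \<Longrightarrow> w n < d"
    using LIMSEQ_D[OF w, of d] by (force simp: abs_less_iff)
  have step: "x (N + m) \<le> c ^ m * x N + e / 2" for m
  proof (induction m)
    case 0
    then show ?case using \<open>e > 0\<close> by simp
  next
    case (Suc m)
    have "x (N + Suc m) \<le> c * x (N + m) + d"
      using x(2)[of "N + m"] N[of "N + m"] by simp
    also have "\<dots> \<le> c * (c ^ m * x N + e / 2) + d"
      using Suc c by (intro add_right_mono mult_left_mono) auto
    also have "\<dots> = c ^ Suc m * x N + e / 2" by (simp add: d_def field_simps)
    finally show ?case .
  qed
  have "(\<lambda>m. c ^ m * x N) \<longlonglongrightarrow> 0 * x N"
    using c by (intro tendsto_mult tendsto_const LIMSEQ_power_zero) auto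
  then obtain K where K: "\<And>m. m \<ge> K \<Longrightarrow> c ^ m * x N < e / 2"
    using LIMSEQ_D[of "\<lambda>m. c ^ m * x N" 0 "e / 2"] \<open>e > 0\<close> by (force simp: abs_less_iff)
  show "\<exists>no. \<forall>n\<ge>no. norm (x n - 0) < e"
  proof (intro exI allI impI)
    fix n assume "n \<ge> N + K"
    then have "K \<le> n - N" "N + (n - N) = n" by auto
    then have "x n < e" using step[of "n - N"] K[of "n - N"] by simp
    then show "norm (x n - 0) < e" using x(1)[of n] by simp
  qed
qed

text \<open>Induction on the degree of an annihilating polynomial takes the place of a Jordan form.
  A root \<open>z\<close> is split off: either it lies inside the unit disc and its factor acts as a
  contraction, or it is not an eigenvalue and its factor can be cancelled.\<close>

lemma power_tendsto_0_of_annihilated: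
  fixes T :: "complex ^ 'd \<Rightarrow> complex ^ 'd"
  assumes add: "\<And>x y. T (x + y) = T x + T y" and sc: "\<And>c x. T (c *s x) = c *s T x"
    and ev: "\<And>z v. v \<noteq> 0 \<Longrightarrow> T v = z *s v \<Longrightarrow> cmod z < 1"
    and p: "p \<noteq> 0" "(\<Sum>k\<le>degree p. coeff p k *s (T ^^ k) v) = 0"
  shows "(\<lambda>n. (T ^^ n) v) \<longlonglongrightarrow> 0"
  using p
proof (induction "degree p" arbitrary: p v)
  case 0
  then obtain c where "p = [:c:]" "c \<noteq> 0" by (metis degree_eq_zeroE pCons_0_0)
  then have "v = 0" using "0.prems" by simp
  moreover have "T 0 = 0" using sc[of 0 0] by simp
  then have "(T ^^ n) 0 = 0" for n by (induction n) auto
  ultimately show ?case by simp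
next
  case (Suc m)
  have lin: "(T ^^ n) (x + y) = (T ^^ n) x + (T ^^ n) y" "(T ^^ n) (c *s x) = c *s (T ^^ n) x" for n x y c
    by (induction n) (simp_all add: add sc)
  obtain z where z: "poly p z = 0"
    using fundamental_theorem_of_algebra[of p] Suc.hyps(2)
    by (metis constant_degree nat.distinct(1))
  then obtain q where q: "p = [:- z, 1:] * q" by (auto simp: poly_eq_0_iff_dvd elim: dvdE)
  then have "q \<noteq> 0" using Suc.prems by auto
  then have deg: "degree p = Suc (degree q)" "degree q = m"
    using Suc.hyps(2) by (auto simp: q degree_mult_eq simp del: mult_pCons_left)
  define Q where "Q x = (\<Sum>k\<le>degree q. coeff q k *s (T ^^ k) x)" for x
  have Q_T: "T (Q x) = Q (T x)" for x
  proof -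
    have "T (\<Sum>k\<in>A. f k) = (\<Sum>k\<in>A. T (f k))" if "finite A" for A :: "nat set" and f
      using that
    proof (induction A)
      case empty
      show ?case using sc[of 0 0] by simp
    qed (simp add: add)
    then show ?thesis by (simp add: Q_def sc funpow_swap1)
  qed
  have Q_add: "Q (x - c *s y) = Q x - c *s Q y" for x y c
  proof -
    have "(T ^^ k) (x - c *s y) = (T ^^ k) x - c *s (T ^^ k) y" for k
    proof -
      have "(T ^^ k) (x + (- c) *s y) = (T ^^ k) x + (- c) *s (T ^^ k) y" by (simp only: lin)
      moreover have "a + (- c) *s b = a - c *s b" for a b :: "complex ^ 'd" by (simp add: vec_eq_iff)
      ultimately show ?thesis by (simp only:)
    qed
    then have "Q (x - c *s y) = (\<Sum>k\<le>degree q. coeff q k *s (T ^^ k) x - c *s (coeff q k *s (T ^^ k) y))"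
      unfolding Q_def by (intro sum.cong refl) (simp add: vec_eq_iff right_diff_distrib)
    then show ?thesis unfolding Q_def sum_subtractf vec.scale_sum_right .
  qed
  have coeff: "coeff p (Suc k) = coeff q k - z * coeff q (Suc k)" "coeff p 0 = - z * coeff q 0" for k
    by (simp_all add: q)
  \<comment> \<open>Coefficient by coefficient, this is the factorisation of \<open>p\<close>
    applied to \<open>T\<close>: the annihilation of \<open>v\<close> becomes
    \<open>Q (T v) = z *s Q v\<close>.\<close>
  have "0 = (\<Sum>k\<le>Suc (degree q). coeff p k *s (T ^^ k) v)" using Suc.prems(2) deg by simp
  also have "\<dots> = coeff p 0 *s v + (\<Sum>k\<le>degree q. coeff p (Suc k) *s (T ^^ Suc k) v)"
    by (subst sum.atMost_Suc_shift) simp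
  also have "\<dots> = (\<Sum>k\<le>degree q. coeff q k *s (T ^^ Suc k) v)
      - z *s (coeff q 0 *s v + (\<Sum>k\<le>degree q. coeff q (Suc k) *s (T ^^ Suc k) v))"
  proof -
    have "coeff p 0 *s v + (\<Sum>k\<le>degree q. coeff p (Suc k) *s X k) = (\<Sum>k\<le>degree q. coeff q k *s X k)
      - z *s (coeff q 0 *s v + (\<Sum>k\<le>degree q. coeff q (Suc k) *s X k))" for X :: "nat \<Rightarrow> complex ^ 'd"
    proof -
      have "(\<Sum>k\<le>degree q. (coeff q k - z * coeff q (Suc k)) *s X k)
          = (\<Sum>k\<le>degree q. coeff q k *s X k) - (\<Sum>k\<le>degree q. (z * coeff q (Suc k)) *s X k)"
        unfolding sum_subtractf[symmetric] by (intro sum.cong refl) (simp add: vec_eq_iff left_diff_distrib)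
      also have "(\<Sum>k\<le>degree q. (z * coeff q (Suc k)) *s X k) = z *s (\<Sum>k\<le>degree q. coeff q (Suc k) *s X k)"
        unfolding vec.scale_sum_right by (intro sum.cong refl) (simp add: vec_eq_iff)
      finally show ?thesis unfolding coeff by (simp add: vec_eq_iff distrib_left)
    qed
    then show ?thesis .
  qed
  also have "coeff q 0 *s v + (\<Sum>k\<le>degree q. coeff q (Suc k) *s (T ^^ Suc k) v)
      = (\<Sum>k\<le>Suc (degree q). coeff q k *s (T ^^ k) v)"
    by (subst sum.atMost_Suc_shift) simp
  also have "\<dots> = Q v" by (simp add: Q_def coeff_eq_0)
  also have "(\<Sum>k\<le>degree q. coeff q k *s (T ^^ Suc k) v) = Q (T v)"
    by (simp add: Q_def funpow_swap1)
  finally have Qv: "Q (T v) = z *s Q v" by simp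
  then have ker: "T (Q v) = z *s Q v" by (simp add: Q_T)
  show ?case
  proof (cases "cmod z < 1")
    \<comment> \<open>Here \<open>w\<close> is annihilated by \<open>q\<close>, and the orbit of
      \<open>v\<close> is a contraction driven by the orbit of \<open>w\<close>, which tends to 0 by
      induction.\<close>
    case True
    define w where "w = T v - z *s v"
    have "Q w = 0" using Qv by (simp add: w_def Q_add)
    then have w0: "(\<lambda>n. (T ^^ n) w) \<longlonglongrightarrow> 0"
      using Suc.hyps(1)[of q w] deg \<open>q \<noteq> 0\<close> by (simp add: Q_def)
    have "T v = z *s v + w" by (simp add: w_def)
    then have step: "(T ^^ Suc n) v = z *s (T ^^ n) v + (T ^^ n) w" for n
      using lin(1)[of n "z *s v" w] by (simp add: funpow_swap1 lin(2))
    have sn: "norm (z *s x) = cmod z * norm x" for x :: "complex ^ 'd"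
      by (simp add: norm_vec_def norm_mult L2_set_right_distrib)
    have "(\<lambda>n. norm ((T ^^ n) v)) \<longlonglongrightarrow> 0"
    proof (rule contraction_tendsto_0[of "cmod z"])
      show "norm ((T ^^ Suc n) v) \<le> cmod z * norm ((T ^^ n) v) + norm ((T ^^ n) w)" for n
        unfolding step sn[symmetric] by (rule norm_triangle_ineq)
      show "(\<lambda>n. norm ((T ^^ n) w)) \<longlonglongrightarrow> 0" using w0 tendsto_norm_zero by blast
    qed (use True in auto)
    then show ?thesis by (rule tendsto_norm_zero_cancel)
  next
    \<comment> \<open>Otherwise \<open>Q v\<close> would be an eigenvector whose eigenvalue has
      modulus at least 1.\<close>
    case False
    then have "Q v = 0" using ev[of "Q v" z] ker by blast
    then show ?thesis using Suc.hyps(1)[of q v] deg \<open>q \<noteq> 0\<close> by (simp add: Q_def)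
  qed
qed

text \<open>More vectors of an orbit than the dimension are dependent. Dependence over the reals is
  enough, so \<open>D\<close> is the real dimension.\<close>

lemma ex_annihilating_poly:
  fixes T :: "complex ^ 'd \<Rightarrow> complex ^ 'd"
  shows "\<exists>p. p \<noteq> 0 \<and> (\<Sum>k\<le>degree p. coeff p k *s (T ^^ k) v) = 0"
proof -
  let ?f = "\<lambda>k. (T ^^ k) v"
  define D where "D = DIM(complex ^ 'd)"
  have "\<exists>a :: nat \<Rightarrow> real. (\<exists>k\<le>D. a k \<noteq> 0) \<and> (\<Sum>k\<le>D. a k *\<^sub>R ?f k) = 0"
  proof (cases "inj_on ?f {..D}")
    case True
    then have "card (?f ` {..D}) = Suc D" by (simp add: card_image)
    then have "dependent (?f ` {..D})"
      using independent_bound[of "?f ` {..D}"] by (auto simp: D_def)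
    then obtain u where u: "(\<Sum>x\<in>?f ` {..D}. u x *\<^sub>R x) = 0" "\<exists>x\<in>?f ` {..D}. u x \<noteq> 0"
      by (auto simp: dependent_finite)
    show ?thesis
      by (rule exI[of _ "\<lambda>k. u (?f k)"]) (use u True in \<open>auto simp: sum.reindex\<close>)
  next
    \<comment> \<open>Dependence is a property of sets, which do not see a repeated vector; a
      repetition is turned into a difference of two powers instead.\<close>
    case False
    then obtain i j where ij: "i \<le> D" "j \<le> D" "i \<noteq> j" "?f i = ?f j" by (auto simp: inj_on_def)
    let ?a = "\<lambda>k. (if k = i then 1 else 0) - (if k = j then 1 else 0) :: real"
    have "(\<Sum>k\<le>D. ?a k *\<^sub>R ?f k) = (\<Sum>k\<le>D. (if k = i then ?f k else 0)) - (\<Sum>k\<le>D. (if k = j then ?f k else 0))"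
      unfolding sum_subtractf[symmetric] by (rule sum.cong) auto
    also have "\<dots> = 0" using ij by simp
    finally show ?thesis using ij by (intro exI[of _ ?a]) auto
  qed
  then obtain a where a: "\<exists>k\<le>D. a k \<noteq> 0" "(\<Sum>k\<le>D. a k *\<^sub>R ?f k) = 0" by blast
  define p where "p = (\<Sum>k\<le>D. monom (complex_of_real (a k)) k)"
  have coeff: "coeff p k = (if k \<le> D then complex_of_real (a k) else 0)" for k
    by (simp add: p_def coeff_sum)
  have "p \<noteq> 0" using a(1) coeff by (metis coeff_0 of_real_eq_0_iff)
  moreover have "(\<Sum>k\<le>degree p. coeff p k *s ?f k) = (\<Sum>k\<le>D. coeff p k *s ?f k)"
  proof -
    have "degree p \<le> D" by (rule degree_le) (simp add: coeff)
    then show ?thesis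
      by (intro sum.mono_neutral_left) (auto simp: coeff_eq_0)
  qed
  moreover have "\<dots> = (\<Sum>k\<le>D. a k *\<^sub>R ?f k)"
    by (rule sum.cong) (simp_all add: coeff vec_eq_iff, simp_all add: scaleR_conv_of_real)
  ultimately show ?thesis using a(2) by metis
qed

text \<open>Eigenvalues of the inverse are reciprocals of eigenvalues of \<open>M\<close>, hence
  inside the unit disc. They may be complex, so the orbit is followed among complex vectors. The
  Euclidean norm need not be contracted by \<open>B\<close> itself, so the convergence has to come
  from the spectrum.\<close>

lemma dilation_inverse_power_tendsto_0:
  fixes M :: "int ^ 'd ^ 'd"
  assumes M: "dilation_matrix M" and B: "\<And>x. rmat M *v (B *v x) = x"
  shows "(\<lambda>n. mat_pow B n *v x) \<longlonglongrightarrow> 0"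
proof -
  define BC :: "complex ^ 'd ^ 'd" where "BC = (\<chi> i j. complex_of_real (B $ i $ j))"
  define MC :: "complex ^ 'd ^ 'd" where "MC = (\<chi> i j. complex_of_int (M $ i $ j))"
  define e :: "real ^ 'd \<Rightarrow> complex ^ 'd" where "e y = (\<chi> i. complex_of_real (y $ i))" for y
  have Be: "BC *v e y = e (B *v y)" for y
    by (simp add: BC_def e_def vec_eq_iff matrix_vector_mult_def)
  have "rmat M ** B = mat 1"
    by (simp add: matrix_eq B matrix_vector_mul_assoc[symmetric])
  then have MB: "MC ** BC = mat 1"
  proof -
    have "(MC ** BC) $ i $ j = complex_of_real ((rmat M ** B) $ i $ j)" for i j
      by (simp add: MC_def BC_def matrix_matrix_mult_def rmat_def)
    then show ?thesis using \<open>rmat M ** B = mat 1\<close> by (simp add: vec_eq_iff mat_def)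
  qed
  then have MB': "MC *v (BC *v v) = v" for v by (simp add: matrix_vector_mul_assoc)
  have pow: "((*v) BC ^^ n) (e x) = e (mat_pow B n *v x)" for n
    by (induction n) (simp_all add: mat_pow_0 mat_pow_Suc Be matrix_vector_mul_assoc)
  obtain p where p: "p \<noteq> 0" "(\<Sum>k\<le>degree p. coeff p k *s ((*v) BC ^^ k) (e x)) = 0"
    using ex_annihilating_poly[of "(*v) BC" "e x"] by blast
  have "(\<lambda>n. ((*v) BC ^^ n) (e x)) \<longlonglongrightarrow> 0"
  proof (rule power_tendsto_0_of_annihilated[OF _ _ _ p])
    fix z v assume v: "v \<noteq> 0" "BC *v v = z *s v"
    have "v = z *s (MC *v v)" using MB'[of v] v(2) by (simp add: vector_scalar_commute)
    then have "z \<noteq> 0" using v(1) by auto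
    then have "MC *v v = inverse z *s v"
      using \<open>v = z *s (MC *v v)\<close> by (metis left_inverse vector_smult_assoc vector_smult_lid)
    then have "1 < cmod (inverse z)"
      using M v(1) unfolding dilation_matrix_def MC_def by blast
    then show "cmod z < 1" by (simp add: norm_inverse one_less_inverse_iff)
  qed (simp_all add: matrix_vector_right_distrib vector_scalar_commute)
  then have lim: "(\<lambda>n. e (mat_pow B n *v x)) \<longlonglongrightarrow> 0" by (simp add: pow)
  show ?thesis
  proof (rule vec_tendstoI)
    fix i
    have "(\<lambda>n. e (mat_pow B n *v x) $ i) \<longlonglongrightarrow> 0 $ i" by (rule tendsto_vec_nth[OF lim])
    then have "(\<lambda>n. complex_of_real ((mat_pow B n *v x) $ i)) \<longlonglongrightarrow> complex_of_real 0" by (simp add: e_def)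
    then show "(\<lambda>n. (mat_pow B n *v x) $ i) \<longlonglongrightarrow> 0 $ i"
      by (simp only: tendsto_of_real_iff zero_index)
  qed
qed

section \<open>Filters as coefficient matrices\<close>

text \<open>The row \<open>(\<iota>, k)\<close> is the filter of the channel \<open>\<iota>\<close>
  shifted by \<open>D \<iota> *v k\<close>. With the determinant factor, \<open>syn\<close> and
  \<open>ana\<close> of this matrix are subdivision and transition.\<close>

definition fcoef :: "('x \<Rightarrow> int ^ 'd ^ 'd) \<Rightarrow> ('x \<Rightarrow> int ^ 'd \<Rightarrow> complex ^ 'r)
    \<Rightarrow> 'x \<times> (int ^ 'd) \<Rightarrow> 'r \<times> (int ^ 'd) \<Rightarrow> complex" where
  "fcoef D f = (\<lambda>(\<iota>, k) (p, n). complex_of_real (sqrt (abs_det (D \<iota>))) * f \<iota> (n - D \<iota> *v k) $ p)"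

definition flat :: "(int ^ 'd \<Rightarrow> complex ^ 'x) \<Rightarrow> 'x \<times> (int ^ 'd) \<Rightarrow> complex" where
  "flat w = (\<lambda>(\<iota>, k). w k $ \<iota>)"

definition unflat :: "('x \<times> (int ^ 'd) \<Rightarrow> complex) \<Rightarrow> int ^ 'd \<Rightarrow> complex ^ 'x" where
  "unflat c = (\<lambda>k. \<chi> \<iota>. c (\<iota>, k))"

lemma flat_unflat [simp]: "flat (unflat c) = c"
  by (auto simp: flat_def unflat_def)

lemma unflat_flat [simp]: "unflat (flat w) = w"
  by (auto simp: flat_def unflat_def)

lemma flat_eq_iff: "flat v = flat w \<longleftrightarrow> v = w"
  by (metis unflat_flat)

text \<open>Each row of \<open>b0\<close> counts as a scalar channel of its own; these channels
  share the dilation \<open>M0\<close>.\<close>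

definition dil :: "int ^ 'd ^ 'd \<Rightarrow> ('s \<Rightarrow> int ^ 'd ^ 'd) \<Rightarrow> 's + 'r \<Rightarrow> int ^ 'd ^ 'd" where
  "dil M0 M = case_sum M (\<lambda>_. M0)"

definition fil :: "(int ^ 'd \<Rightarrow> complex ^ 'r ^ 'r) \<Rightarrow> ('s \<Rightarrow> int ^ 'd \<Rightarrow> complex ^ 'r ^ 1)
    \<Rightarrow> 's + 'r \<Rightarrow> int ^ 'd \<Rightarrow> complex ^ 'r" where
  "fil b0 b = case_sum (\<lambda>l n. b l n $ 1) (\<lambda>q n. b0 n $ q)"

lemma finite_translated:
  fixes m :: "'a :: group_add"
  shows "finite {n. P n} \<Longrightarrow> finite {n. P (n - m)}"
  using finite_vimageI[of "{n. P n}" "\<lambda>n. n - m"] by (simp add: vimage_def inj_on_def)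

lemma finite_lattice_preimage:
  fixes D :: "int ^ 'd ^ 'd"
  assumes "det (rmat D) \<noteq> 0" "finite {n. P n}"
  shows "finite {k. P (n - D *v k)}"
proof -
  have "inj (\<lambda>k. n - D *v k)" using inj_int_matrix[OF assms(1)] by (auto simp: inj_on_def)
  from finite_vimageI[OF assms(2) this] show ?thesis by (simp add: vimage_def)
qed

text \<open>Rows are finite because the filters are; columns are finite because an invertible
  \<open>D \<iota>\<close> maps distinct shifts to distinct positions.\<close>

lemma loc_fin_fcoef:
  fixes D :: "'x :: finite \<Rightarrow> int ^ 'd ^ 'd" and f :: "'x \<Rightarrow> int ^ 'd \<Rightarrow> complex ^ 'r"
  assumes D: "\<And>\<iota>. det (rmat (D \<iota>)) \<noteq> 0" and f: "\<And>\<iota>. finite {n. f \<iota> n \<noteq> 0}"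
  shows "loc_fin (fcoef D f)"
  unfolding loc_fin_def
proof (intro conjI allI)
  fix i :: "'x \<times> (int ^ 'd)"
  obtain \<iota> k where i: "i = (\<iota>, k)" by (cases i)
  show "finite {\<kappa>. fcoef D f i \<kappa> \<noteq> 0}"
    by (rule finite_subset[of _ "UNIV \<times> {n. f \<iota> (n - D \<iota> *v k) \<noteq> 0}"])
       (auto simp: fcoef_def i intro: finite_translated[OF f])
next
  fix \<kappa> :: "'r \<times> (int ^ 'd)"
  obtain p n where \<kappa>: "\<kappa> = (p, n)" by (cases \<kappa>)
  show "finite {i. fcoef D f i \<kappa> \<noteq> 0}"
    by (rule finite_subset[of _ "\<Union>\<iota>. {\<iota>} \<times> {k. f \<iota> (n - D \<iota> *v k) \<noteq> 0}"])
       (auto simp: fcoef_def \<kappa> intro: finite_lattice_preimage[OF D f])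
qed

lemma infsum_finite_supp:
  fixes f :: "'a \<Rightarrow> 'b :: {comm_monoid_add, t2_space}"
  assumes "finite S" "\<And>x. x \<notin> S \<Longrightarrow> f x = 0"
  shows "(\<Sum>\<^sub>\<infinity>x. f x) = (\<Sum>x\<in>S. f x)"
proof -
  have "(\<Sum>\<^sub>\<infinity>x. f x) = (\<Sum>\<^sub>\<infinity>x\<in>S. f x)"
    by (rule infsum_cong_neutral) (use assms in auto)
  then show ?thesis using assms(1) by simp
qed

lemma transition_component:
  fixes f :: "int ^ 'd \<Rightarrow> complex ^ 'r ^ 'p"
  assumes "finite {n. f n \<noteq> 0}"
  shows "transition f M v n $ i
    = Sum_any (\<lambda>\<kappa>. flat v \<kappa> * cnj (case \<kappa> of (p, m) \<Rightarrow> of_real (sqrt (abs_det M)) * f (m - M *v n) $ i $ p))"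
proof -
  define S where "S = {m. f (m - M *v n) \<noteq> 0}"
  have S: "finite S" unfolding S_def by (rule finite_translated[OF assms])
  have "transition f M v n = sqrt (abs_det M) *\<^sub>R (\<Sum>k\<in>S. v k v* conj_transpose (f (k - M *v n)))"
    unfolding transition_def
    by (intro arg_cong2[where f="(*\<^sub>R)"] refl infsum_finite_supp[OF S])
       (simp add: S_def conj_transpose_def vector_matrix_mult_def vec_eq_iff)
  then have "transition f M v n $ i = sqrt (abs_det M) *\<^sub>R (\<Sum>k\<in>S. \<Sum>p\<in>UNIV. cnj (f (k - M *v n) $ i $ p) * v k $ p)"
    by (simp add: vector_matrix_mult_def conj_transpose_def mult.commute)
  also have "\<dots> = (\<Sum>p\<in>UNIV. \<Sum>k\<in>S. v k $ p * cnj (of_real (sqrt (abs_det M)) * f (k - M *v n) $ i $ p))"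
    by (subst sum.swap) (simp add: scaleR_conv_of_real sum_distrib_left ac_simps)
  also have "\<dots> = (\<Sum>\<kappa>\<in>UNIV \<times> S. flat v \<kappa> * cnj (case \<kappa> of (p, m) \<Rightarrow> of_real (sqrt (abs_det M)) * f (m - M *v n) $ i $ p))"
    unfolding sum.cartesian_product by (intro sum.cong refl) (auto simp: flat_def)
  also have "\<dots> = Sum_any (\<lambda>\<kappa>. flat v \<kappa> * cnj (case \<kappa> of (p, m) \<Rightarrow> of_real (sqrt (abs_det M)) * f (m - M *v n) $ i $ p))"
    by (rule Sum_any_eq[symmetric]) (use S in \<open>auto simp: S_def\<close>)
  finally show ?thesis .
qed

lemma subdivision_component:
  fixes f :: "int ^ 'd \<Rightarrow> complex ^ 'r ^ 'p"
  assumes "finite S" "\<And>k. k \<notin> S \<Longrightarrow> f (n - M *v k) = 0"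
  shows "subdivision f M u n $ p
    = (\<Sum>k\<in>S. \<Sum>q\<in>UNIV. u k $ q * (of_real (sqrt (abs_det M)) * f (n - M *v k) $ q $ p))"
proof -
  have "subdivision f M u n = sqrt (abs_det M) *\<^sub>R (\<Sum>k\<in>S. u k v* f (n - M *v k))"
    unfolding subdivision_def
    by (intro arg_cong2[where f="(*\<^sub>R)"] refl infsum_finite_supp[OF assms(1)])
       (simp add: assms(2) vector_matrix_mult_def vec_eq_iff)
  then have "subdivision f M u n $ p = sqrt (abs_det M) *\<^sub>R (\<Sum>k\<in>S. \<Sum>q\<in>UNIV. f (n - M *v k) $ q $ p * u k $ q)"
    by (simp add: vector_matrix_mult_def mult.commute)
  then show ?thesis by (simp add: scaleR_conv_of_real sum_distrib_left ac_simps)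
qed

section \<open>The filter bank operators in terms of \<open>syn\<close> and
  \<open>ana\<close>\<close>

locale filters =
  fixes M0 :: "int ^ 'd ^ 'd" and M :: "'s :: finite \<Rightarrow> int ^ 'd ^ 'd"
    and b0 :: "int ^ 'd \<Rightarrow> complex ^ 'r ^ 'r" and b :: "'s \<Rightarrow> int ^ 'd \<Rightarrow> complex ^ 'r ^ 1"
  assumes det_M0: "det (rmat M0) \<noteq> 0" and det_M: "\<And>l. det (rmat (M l)) \<noteq> 0"
    and fin0: "finite {k. b0 k \<noteq> 0}" and fin: "\<And>l. finite {k. b l k \<noteq> 0}"
begin

definition E :: "('s + 'r) \<times> (int ^ 'd) \<Rightarrow> 'r \<times> (int ^ 'd) \<Rightarrow> complex" where
  "E = fcoef (dil M0 M) (fil b0 b)"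

lemma loc_fin: "loc_fin E"
  unfolding E_def
proof (rule loc_fin_fcoef)
  fix \<iota> :: "'s + 'r"
  show "det (rmat (dil M0 M \<iota>)) \<noteq> 0" by (cases \<iota>) (auto simp: dil_def det_M0 det_M)
  show "finite {n. fil b0 b \<iota> n \<noteq> 0}"
  proof (cases \<iota>)
    case (Inl l)
    then show ?thesis by (auto simp: fil_def intro: finite_subset[OF _ fin[of l]])
  next
    case (Inr q)
    then show ?thesis by (auto simp: fil_def intro: finite_subset[OF _ fin0])
  qed
qed

lemma transition_low: "flat (transition b0 M0 v) = low E (flat v)"
proof (rule ext, clarify)
  fix q k
  show "flat (transition b0 M0 v) (q, k) = low E (flat v) (q, k)"
    by (simp add: flat_def[of "transition b0 M0 v"] transition_component[OF fin0] low_def ana_def E_def fcoef_def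
        dil_def fil_def case_prod_beta')
qed

lemma transition_high: "transition (b l) (M l) v k $ 1 = high E (flat v) (l, k)"
  by (simp add: transition_component[OF fin] high_def ana_def E_def fcoef_def
      dil_def fil_def case_prod_beta')

lemma flat_analysis: "flat (analysis_op M0 M b0 b v) = ana E (flat v)"
proof (rule ext, clarify)
  fix \<iota> k
  show "flat (analysis_op M0 M b0 b v) (\<iota>, k) = ana E (flat v) (\<iota>, k)"
  proof (cases \<iota>)
    case (Inl l)
    then show ?thesis by (simp add: flat_def[of "analysis_op _ _ _ _ _"] analysis_op_def transition_high high_def)
  next
    case (Inr q)
    have "transition b0 M0 v k $ q = low E (flat v) (q, k)"
      using fun_cong[OF transition_low, of v "(q, k)"] by (simp add: flat_def[of "transition b0 M0 v"])
    then show ?thesis using Inr by (simp add: flat_def[of "analysis_op _ _ _ _ _"] analysis_op_def low_def)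
  qed
qed

lemma flat_synthesis: "flat (synthesis_op M0 M b0 b w) = syn E (flat w)"
proof (rule ext, clarify)
  fix p n
  \<comment> \<open>The shifts whose filter, in some channel, reaches the position
    \<open>n\<close>.\<close>
  define T where "T = {k. b0 (n - M0 *v k) \<noteq> 0} \<union> (\<Union>l. {k. b l (n - M l *v k) \<noteq> 0})"
  have T: "finite T"
    unfolding T_def
    by (intro finite_UnI finite_UN_I finite_lattice_preimage[OF det_M0 fin0] finite_lattice_preimage[OF det_M fin]) simp
  have T0: "b0 (n - M0 *v k) = 0" "b l (n - M l *v k) = 0" if "k \<notin> T" for k l
    using that by (auto simp: T_def)
  have "syn E (flat w) (p, n) = (\<Sum>i\<in>UNIV \<times> T. flat w i * E i (p, n))"
    unfolding syn_def
  proof (rule Sum_any_eq)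
    fix i :: "('s + 'r) \<times> (int ^ 'd)" assume i: "i \<notin> UNIV \<times> T"
    obtain \<iota> k where "i = (\<iota>, k)" by (cases i)
    with i T0[of k] show "flat w i * E i (p, n) = 0"
      by (cases \<iota>) (auto simp: E_def fcoef_def fil_def dil_def)
  qed (use T in simp)
  also have "\<dots> = (\<Sum>\<iota>\<in>UNIV. \<Sum>k\<in>T. w k $ \<iota> * E (\<iota>, k) (p, n))"
    unfolding sum.cartesian_product by (intro sum.cong refl) (auto simp: flat_def)
  also have "\<dots> = (\<Sum>l\<in>UNIV. \<Sum>k\<in>T. w k $ Inl l * E (Inl l, k) (p, n)) + (\<Sum>q\<in>UNIV. \<Sum>k\<in>T. w k $ Inr q * E (Inr q, k) (p, n))"
    by (subst UNIV_Plus_UNIV[symmetric], subst sum.Plus) auto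
  also have "(\<Sum>l\<in>UNIV. \<Sum>k\<in>T. w k $ Inl l * E (Inl l, k) (p, n))
      = (\<Sum>l\<in>UNIV. subdivision (b l) (M l) (\<lambda>k. \<chi> i. w k $ Inl l) n $ p)"
    by (subst subdivision_component[OF T]) (auto simp: T0 E_def fcoef_def dil_def fil_def UNIV_1)
  also have "(\<Sum>q\<in>UNIV. \<Sum>k\<in>T. w k $ Inr q * E (Inr q, k) (p, n))
      = subdivision b0 M0 (\<lambda>k. \<chi> q. w k $ Inr q) n $ p"
    by (subst sum.swap, subst subdivision_component[OF T]) (auto simp: T0 E_def fcoef_def dil_def fil_def)
  finally show "flat (synthesis_op M0 M b0 b w) (p, n) = syn E (flat w) (p, n)"
    by (simp add: flat_def[of "synthesis_op _ _ _ _ _"] synthesis_op_def add.commute)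
qed

lemma l2_norm_sq_flat:
  fixes w :: "int ^ 'd \<Rightarrow> complex ^ 'x"
  assumes "fsupp (flat w)"
  shows "l2_norm_sq w = nsq (flat w)" "l2_seq w"
proof -
  obtain S where S: "finite S" "\<And>\<kappa>. \<kappa> \<notin> S \<Longrightarrow> flat w \<kappa> = 0" using fsuppE[OF assms] by blast
  define T where "T = snd ` S"
  have T: "finite T" using S by (simp add: T_def)
  have w0: "w k = 0" if "k \<notin> T" for k
  proof -
    have "w k $ \<iota> = 0" for \<iota>
    proof -
      have "(\<iota>, k) \<notin> S" using that by (force simp: T_def)
      from S(2)[OF this] show ?thesis by (simp add: flat_def)
    qed
    then show ?thesis by (simp add: vec_eq_iff)
  qed
  have sq: "(norm x)\<^sup>2 = (\<Sum>\<iota>\<in>UNIV. (cmod (x $ \<iota>))\<^sup>2)" for x :: "complex ^ 'x"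
    by (simp add: norm_vec_def L2_set_def sum_nonneg)
  have "l2_norm_sq w = (\<Sum>k\<in>T. (norm (w k))\<^sup>2)"
    unfolding l2_norm_sq_def by (rule infsum_finite_supp[OF T]) (simp add: w0)
  also have "\<dots> = (\<Sum>\<kappa>\<in>UNIV \<times> T. (cmod (flat w \<kappa>))\<^sup>2)"
    unfolding sq by (subst sum.swap, subst sum.cartesian_product) (auto simp: flat_def intro!: sum.cong)
  also have "\<dots> = nsq (flat w)"
  proof (rule nsq_eq[symmetric])
    fix \<kappa> :: "'x \<times> (int ^ 'd)" assume "\<kappa> \<notin> UNIV \<times> T"
    then show "flat w \<kappa> = 0" by (cases \<kappa>) (simp add: flat_def w0)
  qed (use T in simp)
  finally show "l2_norm_sq w = nsq (flat w)" .
  have "(\<lambda>k. (norm (w k))\<^sup>2) summable_on UNIV \<longleftrightarrow> (\<lambda>k. (norm (w k))\<^sup>2) summable_on T"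
    by (rule summable_on_cong_neutral) (auto simp: w0)
  then show "l2_seq w" using T by (simp add: l2_seq_def)
qed

lemma flat_transition_iter: "flat ((transition b0 M0 ^^ j) v) = (low E ^^ j) (flat v)"
  by (induction j) (simp_all add: transition_low)

lemma sum_l2_norm_high:
  assumes "fsupp (flat v)"
  shows "(\<Sum>l\<in>UNIV. l2_norm_sq (transition (b l) (M l) v)) = nsq (high E (flat v))"
proof -
  obtain S where S: "finite S" "\<And>\<kappa>. \<kappa> \<notin> S \<Longrightarrow> high E (flat v) \<kappa> = 0"
    using fsuppE[OF fsupp_high[OF loc_fin assms]] by blast
  define T where "T = snd ` S"
  have T: "finite T" using S by (simp add: T_def)
  have 0: "high E (flat v) (l, k) = 0" if "k \<notin> T" for l k
    by (rule S(2)) (use that in \<open>force simp: T_def\<close>)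
  have n1: "norm x = cmod (x $ 1)" for x :: "complex ^ 1"
    by (simp add: norm_vec_def L2_set_def UNIV_1)
  have "l2_norm_sq (transition (b l) (M l) v) = (\<Sum>k\<in>T. (cmod (high E (flat v) (l, k)))\<^sup>2)" for l
    unfolding l2_norm_sq_def n1 transition_high by (rule infsum_finite_supp[OF T]) (simp add: 0)
  moreover have "nsq (high E (flat v)) = (\<Sum>\<kappa>\<in>UNIV \<times> T. (cmod (high E (flat v) \<kappa>))\<^sup>2)"
    by (rule nsq_eq) (use T 0 in auto)
  ultimately show ?thesis by (simp add: sum.cartesian_product case_prod_beta')
qed

lemma multilevel_flat:
  assumes "fsupp (flat v)"
  shows "multilevel_norm_sq M0 M b0 b J v = ml E J (flat v)"
proof -
  have "fsupp (flat ((transition b0 M0 ^^ j) v))" for j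
    unfolding flat_transition_iter by (rule fsupp_low_iter[OF loc_fin assms])
  then show ?thesis
    by (simp add: multilevel_norm_sq_def ml_def sum_l2_norm_high l2_norm_sq_flat flat_transition_iter)
qed

end

lemma biorthogonal_filter_bankD:
  assumes "filters M0 M b0 b" "filters M0 M bt0 bt" "biorthogonal_wavelet_filter_bank M0 M b0 b bt0 bt"
  shows "biorth (filters.E M0 M b0 b) (filters.E M0 M bt0 bt)"
    "reproducing (filters.E M0 M b0 b) (filters.E M0 M bt0 bt)"
proof -
  interpret f: filters M0 M b0 b by fact
  interpret ft: filters M0 M bt0 bt by fact
  have id: "synthesis_op M0 M bt0 bt \<circ> analysis_op M0 M b0 b = id"
    "analysis_op M0 M b0 b \<circ> synthesis_op M0 M bt0 bt = id"
    using assms(3) by (auto simp: biorthogonal_wavelet_filter_bank_def)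
  show "biorth f.E ft.E"
  proof (rule biorthI[OF f.loc_fin ft.loc_fin])
    fix w
    have "flat (analysis_op M0 M b0 b (synthesis_op M0 M bt0 bt (unflat w))) = w"
      using fun_cong[OF id(2), of "unflat w"] by simp
    then show "ana f.E (syn ft.E w) = w" by (simp add: f.flat_analysis ft.flat_synthesis)
  qed
  show "reproducing f.E ft.E"
  proof (rule reproducingI[OF f.loc_fin ft.loc_fin])
    fix v
    have "flat (synthesis_op M0 M bt0 bt (analysis_op M0 M b0 b (unflat v))) = v"
      using fun_cong[OF id(1), of "unflat v"] by simp
    then show "syn ft.E (ana f.E v) = v" by (simp add: f.flat_analysis ft.flat_synthesis)
  qed
qed

lemma analysis_synthesis_id:
  assumes "filters M0 M b0 b" "filters M0 M bt0 bt"
    and "biorth (filters.E M0 M b0 b) (filters.E M0 M bt0 bt)"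
    and "reproducing (filters.E M0 M b0 b) (filters.E M0 M bt0 bt)"
  shows "synthesis_op M0 M bt0 bt \<circ> analysis_op M0 M b0 b = id"
    "analysis_op M0 M b0 b \<circ> synthesis_op M0 M bt0 bt = id"
proof -
  interpret f: filters M0 M b0 b by fact
  interpret ft: filters M0 M bt0 bt by fact
  show "synthesis_op M0 M bt0 bt \<circ> analysis_op M0 M b0 b = id"
  proof
    fix v
    have "flat (synthesis_op M0 M bt0 bt (analysis_op M0 M b0 b v)) = flat v"
      by (simp add: f.flat_analysis ft.flat_synthesis syn_ana[OF f.loc_fin ft.loc_fin assms(4)])
    then show "(synthesis_op M0 M bt0 bt \<circ> analysis_op M0 M b0 b) v = id v" by (simp add: flat_eq_iff)
  qed
  show "analysis_op M0 M b0 b \<circ> synthesis_op M0 M bt0 bt = id"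
  proof
    fix w
    have "flat (analysis_op M0 M b0 b (synthesis_op M0 M bt0 bt w)) = flat w"
      by (simp add: f.flat_analysis ft.flat_synthesis ana_syn[OF f.loc_fin ft.loc_fin assms(3)])
    then show "(analysis_op M0 M b0 b \<circ> synthesis_op M0 M bt0 bt) w = id w" by (simp add: flat_eq_iff)
  qed
qed

section \<open>Density of continuous functions and continuity of translations\<close>

lemma L2_fun_ae:
  fixes f g :: "real ^ 'd \<Rightarrow> complex"
  assumes "L2_fun f" "AE x in lebesgue. f x = g x"
  shows "L2_fun g"
proof -
  have g: "g \<in> borel_measurable lebesgue"
    using borel_measurable_AE[OF L2_funD(1)[OF assms(1)] assms(2)] .
  have "integrable lebesgue (\<lambda>x. (norm (g x))\<^sup>2) \<longleftrightarrow> integrable lebesgue (\<lambda>x. (norm (f x))\<^sup>2)"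
    by (rule integrable_cong_AE) (use g L2_funD(1)[OF assms(1)] assms(2) in auto)
  with g show ?thesis using L2_funD(2)[OF assms(1)] by (simp add: L2_fun_def)
qed

lemma L2_norm_cong_ae:
  assumes "f \<in> borel_measurable lebesgue" "AE x in lebesgue. f x = g x"
  shows "L2_norm f = L2_norm g"
proof -
  have "g \<in> borel_measurable lebesgue" using borel_measurable_AE[OF assms] .
  then have "(LINT x|lebesgue. (cmod (f x))\<^sup>2) = (LINT x|lebesgue. (cmod (g x))\<^sup>2)"
    by (intro integral_cong_AE) (use assms in auto)
  then show ?thesis by (simp add: L2_norm_def)
qed

lemma borel_measurable_cnj:
  "f \<in> borel_measurable M \<Longrightarrow> (\<lambda>x. cnj (f x)) \<in> borel_measurable M"
  by (rule borel_measurable_continuous_on[where f=cnj]) (auto intro: continuous_intros)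

lemma L2_inner_cong_ae:
  assumes "L2_fun f" "L2_fun g"
    and "AE x in lebesgue. f x = f' x" "AE x in lebesgue. g x = g' x"
  shows "L2_inner f g = L2_inner f' g'"
proof -
  have m: "f \<in> borel_measurable lebesgue" "g \<in> borel_measurable lebesgue"
    "f' \<in> borel_measurable lebesgue" "g' \<in> borel_measurable lebesgue"
    using L2_funD(1) assms L2_fun_ae by blast+
  show ?thesis
    unfolding L2_inner_def
  proof (rule integral_cong_AE)
    show "AE x in lebesgue. f x * cnj (g x) = f' x * cnj (g' x)"
      using assms(3,4) by eventually_elim simp
  qed (use m in \<open>auto intro!: borel_measurable_times borel_measurable_cnj\<close>)
qed

lemma L2_borel_rep:
  fixes f :: "real ^ 'd \<Rightarrow> complex"
  assumes "L2_fun f"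
  shows "\<exists>g \<in> borel_measurable borel. L2_fun g \<and> (AE x in lebesgue. f x = g x)"
proof -
  have "(\<lambda>x. Re (f x)) \<in> borel_measurable lebesgue" "(\<lambda>x. Im (f x)) \<in> borel_measurable lebesgue"
    using L2_funD(1)[OF assms] by measurable
  from this[THEN completion_ex_borel_measurable_real]
  obtain r i where ri: "r \<in> borel_measurable borel" "AE x in lborel. Re (f x) = r x"
    "i \<in> borel_measurable borel" "AE x in lborel. Im (f x) = i x"
    by auto
  define g where "g x = Complex (r x) (i x)" for x
  have g: "g = (\<lambda>x. complex_of_real (r x) + \<i> * complex_of_real (i x))"
    by (simp add: g_def Complex_eq fun_eq_iff)
  have "AE x in lborel. f x = g x"
    using ri(2,4) by eventually_elim (simp add: g_def complex_eq_iff)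
  then have ae: "AE x in lebesgue. f x = g x" by (rule AE_completion)
  moreover have "g \<in> borel_measurable borel" unfolding g using ri by measurable
  ultimately show ?thesis using L2_fun_ae[OF assms ae] by blast
qed

definition Cc_fun :: "(real ^ 'd \<Rightarrow> complex) \<Rightarrow> bool" where
  "Cc_fun f \<longleftrightarrow> continuous_on UNIV f \<and> (\<exists>R. \<forall>x. norm x > R \<longrightarrow> f x = 0)"

lemma Cc_fun_bounded:
  assumes "Cc_fun f"
  obtains R C where "\<And>x. norm x > R \<Longrightarrow> f x = 0" "\<And>x. cmod (f x) \<le> C" "R > 0" "C > 0"
proof -
  obtain R where R: "\<And>x. norm x > R \<Longrightarrow> f x = 0" using assms by (auto simp: Cc_fun_def)
  have "compact (f ` cball 0 R)"
    using assms by (intro compact_continuous_image) (auto simp: Cc_fun_def intro: continuous_on_subset)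
  then have "bounded (f ` cball 0 R)" by (rule compact_imp_bounded)
  then obtain C where C: "\<And>x. x \<in> cball 0 R \<Longrightarrow> cmod (f x) \<le> C"
    unfolding bounded_iff by blast
  have "cmod (f x) \<le> max C 1" for x
    using R[of x] C[of x] by (cases "norm x > R") (auto simp: le_max_iff_disj)
  then show ?thesis using R by (intro that[of "max R 1" "max C 1"]) auto
qed

lemma Cc_fun_borel: "Cc_fun f \<Longrightarrow> f \<in> borel_measurable borel"
  by (auto simp: Cc_fun_def intro: borel_measurable_continuous_onI)

lemma borel_lebesgue: "f \<in> borel_measurable borel \<Longrightarrow> f \<in> borel_measurable lebesgue"
  by (rule measurable_completion) simp

lemma integrable_indicator_cball: "integrable lebesgue (\<lambda>x :: real ^ 'd. c * indicat_real (cball 0 R) x)"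
  by (intro integrable_mult_right integrable_real_indicator) (simp_all add: emeasure_lborel_cball_finite[unfolded infinity_ennreal_def])

lemma Cc_fun_integrable:
  assumes "Cc_fun f"
  shows "L2_fun f" "integrable lebesgue f"
proof -
  obtain R C where RC: "\<And>x. norm x > R \<Longrightarrow> f x = 0" "\<And>x. cmod (f x) \<le> C" "R > 0" "C > 0"
    using Cc_fun_bounded[OF assms] by metis
  have m: "f \<in> borel_measurable lebesgue" using assms Cc_fun_borel borel_lebesgue by blast
  show "L2_fun f"
  proof (rule L2_fun_bound[OF m integrable_indicator_cball[of "C\<^sup>2" R]])
    fix x show "(cmod (f x))\<^sup>2 \<le> C\<^sup>2 * indicat_real (cball 0 R) x"
      using RC by (cases "norm x > R") (auto simp: indicator_def power_mono)
  qed
  show "integrable lebesgue f"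
  proof (rule Bochner_Integration.integrable_bound[OF integrable_indicator_cball[of C R] m])
    show "AE x in lebesgue. cmod (f x) \<le> norm (C * indicat_real (cball 0 R) x)"
    proof (rule AE_I2)
      fix x show "cmod (f x) \<le> norm (C * indicat_real (cball 0 R) x)"
        using RC by (cases "norm x > R") (auto simp: indicator_def)
    qed
  qed
qed

lemma L2_norm_tendsto_0:
  fixes f :: "nat \<Rightarrow> real ^ 'd \<Rightarrow> complex"
  assumes "\<And>n. f n \<in> borel_measurable lebesgue" "integrable lebesgue g"
    and "\<And>n. AE x in lebesgue. (cmod (f n x))\<^sup>2 \<le> g x" and "AE x in lebesgue. (\<lambda>n. f n x) \<longlonglongrightarrow> 0"
  shows "(\<lambda>n. L2_norm (f n)) \<longlonglongrightarrow> 0"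
proof -
  have "(\<lambda>n. LINT x|lebesgue. (cmod (f n x))\<^sup>2) \<longlonglongrightarrow> (LINT x|(lebesgue :: (real ^ 'd) measure). 0)"
  proof (rule integral_dominated_convergence[where w=g])
    show "AE x in lebesgue. (\<lambda>n. (cmod (f n x))\<^sup>2) \<longlonglongrightarrow> 0"
      using assms(4)
    proof eventually_elim
      fix x assume "(\<lambda>n. f n x) \<longlonglongrightarrow> 0"
      then have "(\<lambda>n. (cmod (f n x))\<^sup>2) \<longlonglongrightarrow> (cmod 0)\<^sup>2" by (intro tendsto_intros)
      then show "(\<lambda>n. (cmod (f n x))\<^sup>2) \<longlonglongrightarrow> 0" by simp
    qed
    show "AE x in lebesgue. norm ((cmod (f n x))\<^sup>2) \<le> g x" for n using assms(3)[of n] by simp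
  qed (use assms in auto)
  then have "(\<lambda>n. sqrt (LINT x|lebesgue. (cmod (f n x))\<^sup>2)) \<longlonglongrightarrow> sqrt 0"
    by (intro tendsto_real_sqrt) simp
  then show ?thesis by (simp add: L2_norm_def)
qed

text \<open>The continuous approximants of a measurable function converge only pointwise. Clipping
  their values and cutting off their supports keeps the limit and supplies a dominating
  function.\<close>

lemma Cc_dense_bounded:
  fixes f :: "real ^ 'd \<Rightarrow> complex"
  assumes f: "f \<in> borel_measurable lebesgue" and c: "c > 0" "\<And>x. cmod (f x) \<le> c"
    and R: "\<And>x. norm x > R \<Longrightarrow> f x = 0" and "e > 0"
  shows "\<exists>g. Cc_fun g \<and> L2_norm (\<lambda>x. f x - g x) < e"
proof -
  have "f measurable_on UNIV"
    using f by (simp add: measurable_on_iff_borel_measurable)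
  then obtain N g where N: "negligible N" and g: "\<And>n. continuous_on UNIV (g n)"
    and lim: "\<And>x. x \<notin> N \<Longrightarrow> (\<lambda>n. g n x) \<longlonglongrightarrow> f x"
    by (auto simp: measurable_on_def)
  \<comment> \<open>\<open>clip\<close> retracts onto the disc of radius \<open>c\<close>, and
    \<open>cut\<close> is 1 wherever \<open>f\<close> may be nonzero. Both are continuous and leave
    \<open>f\<close> unchanged.\<close>
  define clip where "clip z = z /\<^sub>R max 1 (cmod z / c)" for z
  define cut where "cut x = max 0 (min 1 (R + 1 - norm x))" for x :: "real ^ 'd"
  define h where "h n x = cut x *\<^sub>R clip (g n x)" for n x
  have max_pos: "max 1 (cmod z / c) \<noteq> 0" for z by (smt (verit) max.cobounded1)
  have clip_cont: "isCont clip z" for z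
    unfolding clip_def by (intro continuous_intros max_pos) (use c in auto)
  have clip_le: "cmod (clip z) \<le> c" for z
  proof (cases "cmod z \<le> c")
    case True
    then have "max 1 (cmod z / c) = 1" using c by simp
    then show ?thesis using True by (simp add: clip_def)
  next
    case False
    then have "max 1 (cmod z / c) = cmod z / c" using c by (simp add: max_def field_simps)
    then show ?thesis using False c by (simp add: clip_def)
  qed
  have clip_f: "clip (f x) = f x" for x
    using c(1) c(2)[of x] by (simp add: clip_def max_def)
  have cut: "0 \<le> cut x" "cut x \<le> 1" for x by (auto simp: cut_def)
  have cut0: "cut x = 0" if "norm x > R + 1" for x using that by (simp add: cut_def)
  have cut1: "cut x *\<^sub>R f x = f x" for x
    using R[of x] by (cases "norm x > R") (auto simp: cut_def)
  have hc: "continuous_on UNIV (h n)" for n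
  proof -
    have "continuous_on UNIV (\<lambda>x. clip (g n x))"
      using g[of n] clip_cont continuous_on_compose2[of UNIV clip UNIV "g n"]
      by (auto simp: continuous_on_eq_continuous_at)
    moreover have "continuous_on UNIV cut" unfolding cut_def by (intro continuous_intros)
    ultimately show ?thesis unfolding h_def by (intro continuous_intros)
  qed
  have h: "Cc_fun (h n)" for n
    unfolding Cc_fun_def using hc cut0 by (auto simp: h_def intro!: exI[of _ "R + 1"])
  have h_le: "cmod (h n x) \<le> c" for n x
  proof -
    have "cmod (h n x) \<le> 1 * c" unfolding h_def norm_scaleR
      by (intro mult_mono) (use cut[of x] clip_le in auto)
    then show ?thesis by simp
  qed
  have "(\<lambda>n. L2_norm (\<lambda>x. f x - h n x)) \<longlonglongrightarrow> 0"
  proof (rule L2_norm_tendsto_0)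
    show "(\<lambda>x. f x - h n x) \<in> borel_measurable lebesgue" for n
      using f borel_lebesgue[OF Cc_fun_borel[OF h]] by (intro borel_measurable_diff)
    show "integrable lebesgue (\<lambda>x :: real ^ 'd. (2 * c)\<^sup>2 * indicat_real (cball 0 (R + 1)) x)"
      by (rule integrable_indicator_cball)
    show "AE x in lebesgue. (cmod (f x - h n x))\<^sup>2 \<le> (2 * c)\<^sup>2 * indicat_real (cball 0 (R + 1)) x" for n
    proof (rule AE_I2)
      fix x
      show "(cmod (f x - h n x))\<^sup>2 \<le> (2 * c)\<^sup>2 * indicat_real (cball 0 (R + 1)) x"
      proof (cases "norm x > R + 1")
        case True
        then show ?thesis using R[of x] cut0[of x] by (simp add: h_def)
      next
        case False
        have "cmod (f x - h n x) \<le> 2 * c"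
          using norm_triangle_ineq4[of "f x" "h n x"] c(2)[of x] h_le[of n x] by simp
        then have "(cmod (f x - h n x))\<^sup>2 \<le> (2 * c)\<^sup>2" by (rule power_mono) simp
        then show ?thesis using False by (simp add: indicator_def)
      qed
    qed
    have "AE x in lebesgue. x \<notin> N" using N by (simp add: negligible_iff_null_sets AE_not_in)
    then show "AE x in lebesgue. (\<lambda>n. f x - h n x) \<longlonglongrightarrow> 0"
    proof eventually_elim
      fix x assume "x \<notin> N"
      then have "(\<lambda>n. cut x *\<^sub>R clip (g n x)) \<longlonglongrightarrow> cut x *\<^sub>R clip (f x)"
        by (intro tendsto_intros isCont_tendsto_compose[OF clip_cont] lim)
      then have "(\<lambda>n. f x - h n x) \<longlonglongrightarrow> f x - f x"
        unfolding clip_f cut1 h_def by (intro tendsto_intros)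
      then show "(\<lambda>n. f x - h n x) \<longlonglongrightarrow> 0" by simp
    qed
  qed
  from LIMSEQ_D[OF this \<open>e > 0\<close>] obtain n where "L2_norm (\<lambda>x. f x - h n x) < e" by auto
  with h show ?thesis by blast
qed

lemma Cc_dense:
  fixes f :: "real ^ 'd \<Rightarrow> complex"
  assumes f: "L2_fun f" and "e > 0"
  shows "\<exists>g. Cc_fun g \<and> L2_norm (\<lambda>x. f x - g x) < e"
proof -
  define t where "t n x = (if norm x \<le> real n \<and> cmod (f x) \<le> real n then f x else 0)" for n x
  have fm: "f \<in> borel_measurable lebesgue" using f by (simp add: L2_fun_def)
  have [measurable]: "(\<lambda>x :: real ^ 'd. norm x) \<in> borel_measurable lebesgue"
    by (rule borel_lebesgue) simp
  have tm: "t n \<in> borel_measurable lebesgue" for n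
    unfolding t_def using fm by measurable
  have "(\<lambda>n. L2_norm (\<lambda>x. f x - t n x)) \<longlonglongrightarrow> 0"
  proof (rule L2_norm_tendsto_0)
    show "(\<lambda>x. f x - t n x) \<in> borel_measurable lebesgue" for n
      using fm tm by (intro borel_measurable_diff)
    show "integrable lebesgue (\<lambda>x. (cmod (f x))\<^sup>2)" by (rule L2_funD(2)[OF f])
    show "AE x in lebesgue. (cmod (f x - t n x))\<^sup>2 \<le> (cmod (f x))\<^sup>2" for n
      by (auto simp: t_def)
    show "AE x in lebesgue. (\<lambda>n. f x - t n x) \<longlonglongrightarrow> 0"
    proof (rule AE_I2)
      fix x
      obtain N where N: "norm x + cmod (f x) \<le> real N" using real_arch_simple by blast
      have "f x - t n x = 0" if "n \<ge> N" for n
      proof -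
        have "real N \<le> real n" using that by simp
        then have "norm x \<le> real n \<and> cmod (f x) \<le> real n"
          using N norm_ge_zero[of x] norm_ge_zero[of "f x"] by linarith
        then show ?thesis by (simp add: t_def)
      qed
      then have "eventually (\<lambda>n. f x - t n x = 0) sequentially"
        by (auto simp: eventually_sequentially)
      then show "(\<lambda>n. f x - t n x) \<longlonglongrightarrow> 0" by (rule tendsto_eventually)
    qed
  qed
  from LIMSEQ_D[OF this, of "e / 2"] \<open>e > 0\<close>
  obtain n0 where n0: "L2_norm (\<lambda>x. f x - t n x) < e / 2" if "n \<ge> n0" for n by auto
  \<comment> \<open>\<open>Suc\<close>, because \<open>Cc_dense_bounded\<close> asks for a positive
    bound.\<close>
  define n where "n = Suc n0"
  have n: "L2_norm (\<lambda>x. f x - t n x) < e / 2" "n > 0" using n0[of n] by (auto simp: n_def)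
  have "\<exists>g. Cc_fun g \<and> L2_norm (\<lambda>x. t n x - g x) < e / 2"
    by (rule Cc_dense_bounded[OF tm, of "real n" _ "real n"]) (use n \<open>e > 0\<close> in \<open>auto simp: t_def\<close>)
  then obtain g where g: "Cc_fun g" "L2_norm (\<lambda>x. t n x - g x) < e / 2" by blast
  have tL: "L2_fun (t n)"
    by (rule L2_fun_bound[OF tm L2_funD(2)[OF f]]) (auto simp: t_def)
  have "L2_norm (\<lambda>x. (f x - t n x) + (t n x - g x)) \<le> L2_norm (\<lambda>x. f x - t n x) + L2_norm (\<lambda>x. t n x - g x)"
    by (intro L2_norm_triangle L2_fun_diff f tL Cc_fun_integrable[OF g(1)])
  then show ?thesis using g n by (intro exI[of _ g]) simp
qed

section \<open>Unitary dilations and translations\<close>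

lemma L2_fun_dilate_shift:
  assumes "det A \<noteq> 0" "L2_fun f"
  shows "L2_fun (dilate_shift A k f)"
proof -
  have "L2_fun (\<lambda>x. f (A *v x - k))"
    unfolding L2_fun_def using measurable_affine[OF assms(1) L2_funD(1)[OF assms(2)]]
      integrable_affine[OF assms(1) L2_funD(2)[OF assms(2)]] by auto
  from L2_fun_cmul[OF this, of "complex_of_real (sqrt \<bar>det A\<bar>)"] show ?thesis
    by (simp add: dilate_shift_def[abs_def] scaleR_conv_of_real)
qed

lemma L2_inner_dilate_shift:
  assumes "det A \<noteq> 0" "L2_fun f" "L2_fun g"
  shows "L2_inner (dilate_shift A k f) (dilate_shift A k g) = L2_inner f g"
proof -
  have m: "(\<lambda>x. f x * cnj (g x)) \<in> borel_measurable lebesgue"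
    using L2_integrable_mult(3)[OF assms(2,3)] by auto
  have sq: "complex_of_real (sqrt \<bar>det A\<bar>) * (a * (complex_of_real (sqrt \<bar>det A\<bar>) * b))
      = \<bar>det A\<bar> *\<^sub>R (a * b)" for a b
  proof -
    have "complex_of_real (sqrt \<bar>det A\<bar>) * complex_of_real (sqrt \<bar>det A\<bar>) = of_real \<bar>det A\<bar>"
      by (simp only: of_real_mult[symmetric] real_sqrt_mult_self abs_abs)
    then show ?thesis by (simp add: scaleR_conv_of_real)
  qed
  have "L2_inner (dilate_shift A k f) (dilate_shift A k g)
      = (LINT x|lebesgue. \<bar>det A\<bar> *\<^sub>R (f (A *v x - k) * cnj (g (A *v x - k))))"
    unfolding L2_inner_def dilate_shift_def
    by (intro Bochner_Integration.integral_cong refl)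
       (simp add: scaleR_conv_of_real mult.assoc sq[unfolded scaleR_conv_of_real])
  also have "\<dots> = \<bar>det A\<bar> *\<^sub>R (LINT x|lebesgue. f (A *v x - k) * cnj (g (A *v x - k)))" by simp
  also have "\<dots> = L2_inner f g"
    unfolding L2_inner_def by (rule integral_affine[OF assms(1) m, symmetric])
  finally show ?thesis .
qed

lemma L2_norm_inner: "L2_norm f = sqrt (Re (L2_inner f f))"
  by (simp add: L2_inner_self)

lemma L2_norm_dilate_shift:
  assumes "det A \<noteq> 0" "L2_fun f"
  shows "L2_norm (dilate_shift A k f) = L2_norm f"
  using L2_inner_dilate_shift[OF assms assms(2)] by (simp add: L2_norm_inner)

lemma dilate_shift_1: "dilate_shift (mat 1) k f = (\<lambda>x. f (x - k))"
  by (simp add: dilate_shift_def fun_eq_iff)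

lemma L2_translate:
  assumes "L2_fun f"
  shows "L2_fun (\<lambda>x. f (x - k))" "L2_norm (\<lambda>x. f (x - k)) = L2_norm f"
  using L2_fun_dilate_shift[of "mat 1" f k] L2_norm_dilate_shift[of "mat 1" f k] assms
  by (simp_all add: dilate_shift_1)

lemma L2_norm_bounded_supp:
  fixes f :: "real ^ 'd \<Rightarrow> complex"
  assumes "f \<in> borel_measurable lebesgue" "c \<ge> 0" "\<And>x. cmod (f x) \<le> c" "\<And>x. norm x > R \<Longrightarrow> f x = 0"
  shows "L2_norm f \<le> c * sqrt (measure lebesgue (cball (0 :: real ^ 'd) R))"
proof -
  have "(LINT x|lebesgue. (cmod (f x))\<^sup>2) \<le> (LINT x|lebesgue. c\<^sup>2 * indicat_real (cball (0 :: real ^ 'd) R) x)"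
  proof (rule integral_mono)
    show le: "(cmod (f x))\<^sup>2 \<le> c\<^sup>2 * indicat_real (cball 0 R) x" for x
      using assms(3)[of x] assms(4)[of x] by (cases "norm x > R") (auto simp: indicator_def power_mono)
    show "integrable lebesgue (\<lambda>x. (cmod (f x))\<^sup>2)"
      by (rule L2_funD(2)[OF L2_fun_bound[OF assms(1) integrable_indicator_cball[of "c\<^sup>2" R] le]])
  qed (rule integrable_indicator_cball)
  also have "\<dots> = c\<^sup>2 * measure lebesgue (cball (0 :: real ^ 'd) R)" by simp
  finally have "L2_norm f \<le> sqrt (c\<^sup>2 * measure lebesgue (cball (0 :: real ^ 'd) R))"
    by (simp add: L2_norm_def)
  then show ?thesis using assms(2) by (simp add: real_sqrt_mult)
qed

lemma translation_continuous_Cc: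
  fixes f :: "real ^ 'd \<Rightarrow> complex"
  assumes f: "Cc_fun f" and "e > 0"
  shows "\<exists>d>0. \<forall>h. norm h < d \<longrightarrow> L2_norm (\<lambda>x. f (x - h) - f x) < e"
proof -
  obtain R C where RC: "\<And>x. norm x > R \<Longrightarrow> f x = 0" "\<And>x. cmod (f x) \<le> C" "R > 0" "C > 0"
    using Cc_fun_bounded[OF f] by metis
  define V where "V = sqrt (measure lebesgue (cball (0 :: real ^ 'd) (R + 1)))"
  \<comment> \<open>The added 1 makes \<open>\<eta> * V\<close> strictly smaller than
    \<open>e\<close>.\<close>
  define \<eta> where "\<eta> = e / (V + 1)"
  have V: "V \<ge> 0" by (simp add: V_def)
  have \<eta>: "\<eta> > 0" using \<open>e > 0\<close> V by (simp add: \<eta>_def)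
  \<comment> \<open>This ball contains both \<open>x\<close> and \<open>x - h\<close> whenever
    \<open>norm x \<le> R + 1\<close>, as \<open>norm h < 1\<close> below.\<close>
  have "uniformly_continuous_on (cball 0 (R + 2)) f"
    using f by (intro compact_uniformly_continuous) (auto simp: Cc_fun_def intro: continuous_on_subset)
  then obtain d where d: "d > 0"
    "\<And>x y. x \<in> cball 0 (R + 2) \<Longrightarrow> y \<in> cball 0 (R + 2) \<Longrightarrow> dist y x < d \<Longrightarrow> dist (f y) (f x) < \<eta>"
    using \<eta> unfolding uniformly_continuous_on_def by metis
  show ?thesis
  proof (intro exI conjI allI impI)
    show "min d 1 > 0" using d by simp
    fix h :: "real ^ 'd" assume h: "norm h < min d 1"
    have tri: "norm x \<le> norm (x - h) + 1" "norm (x - h) \<le> norm x + 1" for x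
      using norm_triangle_sub[of x h] norm_triangle_ineq4[of x h] h by auto
    have 0: "f (x - h) - f x = 0" if "norm x > R + 1" for x
      using RC(1)[of x] RC(1)[of "x - h"] tri[of x] that by simp
    have le: "cmod (f (x - h) - f x) \<le> \<eta>" for x
    proof (cases "norm x > R + 1")
      case True
      then show ?thesis using 0[of x] \<eta> by simp
    next
      case False
      then have "dist (f (x - h)) (f x) < \<eta>"
        using tri[of x] h by (intro d(2)) (auto simp: dist_norm norm_minus_commute)
      then show ?thesis by (simp add: dist_norm)
    qed
    have m: "(\<lambda>x. f (x - h) - f x) \<in> borel_measurable lebesgue"
      using L2_funD(1)[OF L2_fun_diff[OF L2_translate(1)]] Cc_fun_integrable(1)[OF f] by blast
    have "L2_norm (\<lambda>x. f (x - h) - f x) \<le> \<eta> * V"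
      unfolding V_def by (rule L2_norm_bounded_supp[OF m _ le 0]) (use \<eta> in auto)
    also have "\<dots> < e" using \<open>e > 0\<close> V by (simp add: \<eta>_def field_simps)
    finally show "L2_norm (\<lambda>x. f (x - h) - f x) < e" .
  qed
qed

lemma translation_continuous:
  fixes f :: "real ^ 'd \<Rightarrow> complex"
  assumes f: "L2_fun f" and "e > 0"
  shows "\<exists>d>0. \<forall>h. norm h < d \<longrightarrow> L2_norm (\<lambda>x. f (x - h) - f x) < e"
proof -
  obtain g where g: "Cc_fun g" "L2_norm (\<lambda>x. f x - g x) < e / 3"
    using Cc_dense[OF f, of "e / 3"] \<open>e > 0\<close> by auto
  have gL: "L2_fun g" by (rule Cc_fun_integrable[OF g(1)])
  obtain d where d: "d > 0" "\<And>h. norm h < d \<Longrightarrow> L2_norm (\<lambda>x. g (x - h) - g x) < e / 3"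
    using translation_continuous_Cc[OF g(1), of "e / 3"] \<open>e > 0\<close> by auto
  show ?thesis
  proof (intro exI conjI allI impI)
    fix h :: "real ^ 'd" assume h: "norm h < d"
    have fg: "L2_fun (\<lambda>x. f x - g x)" "L2_fun (\<lambda>x. g x - f x)" by (intro L2_fun_diff f gL)+
    note tr = L2_translate[OF fg(1), of h]
    have gg: "L2_fun (\<lambda>x. g (x - h) - g x)" by (intro L2_fun_diff L2_translate gL)
    have "L2_norm (\<lambda>x. f (x - h) - f x)
        = L2_norm (\<lambda>x. (f (x - h) - g (x - h)) + ((g (x - h) - g x) + (g x - f x)))" by simp
    also have "\<dots> \<le> L2_norm (\<lambda>x. f (x - h) - g (x - h)) + L2_norm (\<lambda>x. (g (x - h) - g x) + (g x - f x))"
      by (intro L2_norm_triangle tr(1) L2_fun_add gg fg)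
    also have "L2_norm (\<lambda>x. (g (x - h) - g x) + (g x - f x)) \<le> L2_norm (\<lambda>x. g (x - h) - g x) + L2_norm (\<lambda>x. g x - f x)"
      by (intro L2_norm_triangle gg fg)
    also have "L2_norm (\<lambda>x. g x - f x) = L2_norm (\<lambda>x. f x - g x)" by (rule L2_norm_minus_commute)
    finally show "L2_norm (\<lambda>x. f (x - h) - f x) < e" using tr(2) g(2) d(2)[OF h] by simp
  qed (fact d)
qed

lemma continuous_inner_translate:
  fixes f g :: "real ^ 'd \<Rightarrow> complex"
  assumes f: "L2_fun f" and g: "L2_fun g"
  shows "continuous_on UNIV (\<lambda>h. L2_inner (\<lambda>x. f (x - h)) g)"
  unfolding continuous_on_iff
proof (intro ballI allI impI)
  fix h :: "real ^ 'd" and e :: real assume "e > 0"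
  have gn: "L2_norm g + 1 > 0" using L2_norm_nonneg[of g] by linarith
  obtain d where d: "d > 0" "\<And>h. norm h < d \<Longrightarrow> L2_norm (\<lambda>x. f (x - h) - f x) < e / (L2_norm g + 1)"
    using translation_continuous[OF f, of "e / (L2_norm g + 1)"] \<open>e > 0\<close> gn by auto
  show "\<exists>d>0. \<forall>h'\<in>UNIV. dist h' h < d \<longrightarrow> dist (L2_inner (\<lambda>x. f (x - h')) g) (L2_inner (\<lambda>x. f (x - h)) g) < e"
  proof (intro exI conjI ballI impI)
    fix h' assume h': "dist h' h < d"
    have D: "L2_fun (\<lambda>x. f (x - h') - f (x - h))" by (intro L2_fun_diff L2_translate f)
    have "L2_inner (\<lambda>x. f (x - h')) g - L2_inner (\<lambda>x. f (x - h)) g = L2_inner (\<lambda>x. f (x - h') - f (x - h)) g"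
      by (rule L2_inner_diff_left[symmetric]) (intro L2_translate f g)+
    then have "dist (L2_inner (\<lambda>x. f (x - h')) g) (L2_inner (\<lambda>x. f (x - h)) g)
        \<le> L2_norm (\<lambda>x. f (x - h') - f (x - h)) * L2_norm g"
      using L2_cauchy_schwarz[OF D g] by (simp add: dist_norm)
    also have "L2_norm (\<lambda>x. f (x - h') - f (x - h)) = L2_norm (\<lambda>x. f (x - (h' - h)) - f x)"
      using L2_translate(2)[OF L2_fun_diff[OF L2_translate(1)[OF f, of "h' - h"] f], of h] by (simp add: algebra_simps)
    also have "L2_norm (\<lambda>x. f (x - (h' - h)) - f x) * L2_norm g \<le> e / (L2_norm g + 1) * L2_norm g"
      using d(2)[of "h' - h"] h' by (intro mult_right_mono) (auto simp: dist_norm)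
    also have "\<dots> < e" using gn \<open>e > 0\<close> by (simp add: field_simps)
    finally show "dist (L2_inner (\<lambda>x. f (x - h')) g) (L2_inner (\<lambda>x. f (x - h)) g) < e" .
  qed (fact d)
qed

section \<open>The Bessel bound for integer shifts\<close>

lemma finite_int_box: "finite {m :: int ^ 'd. \<forall>i. \<bar>m $ i\<bar> \<le> c}"
proof (rule finite_subset)
  show "{m :: int ^ 'd. \<forall>i. \<bar>m $ i\<bar> \<le> c} \<subseteq> (\<lambda>f. \<chi> i. f i) ` (PiE UNIV (\<lambda>_. {- c..c}))"
  proof
    fix m :: "int ^ 'd" assume "m \<in> {m. \<forall>i. \<bar>m $ i\<bar> \<le> c}"
    then show "m \<in> (\<lambda>f. \<chi> i. f i) ` (PiE UNIV (\<lambda>_. {- c..c}))"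
      by (intro image_eqI[of _ _ "\<lambda>i. m $ i"]) (auto simp: abs_le_iff minus_le_iff)
  qed
qed (auto intro!: finite_imageI finite_PiE)

text \<open>Subtracting the integer part of \<open>x\<close> moves all these lattice points into one
  fixed box.\<close>

lemma lattice_ball_bound:
  fixes R :: real
  shows "\<exists>N. \<forall>x :: real ^ 'd. finite {k :: int ^ 'd. norm (x - rvec k) \<le> R} \<and> card {k :: int ^ 'd. norm (x - rvec k) \<le> R} \<le> N"
proof -
  define c where "c = \<lceil>R\<rceil> + 1"
  define F where "F = {m :: int ^ 'd. \<forall>i. \<bar>m $ i\<bar> \<le> c}"
  have F: "finite F" unfolding F_def by (rule finite_int_box)
  show ?thesis
  proof (intro exI allI)
    fix x :: "real ^ 'd"
    let ?k0 = "\<chi> i. \<lfloor>x $ i\<rfloor>"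
    have sub: "{k :: int ^ 'd. norm (x - rvec k) \<le> R} \<subseteq> (\<lambda>m. ?k0 + m) ` F"
    proof
      fix k :: "int ^ 'd" assume "k \<in> {k. norm (x - rvec k) \<le> R}"
      then have k: "\<bar>x $ i - real_of_int (k $ i)\<bar> \<le> R" for i
        using component_le_norm_cart[of "x - rvec k" i] by (simp add: rvec_def)
      have "\<bar>k $ i - \<lfloor>x $ i\<rfloor>\<bar> \<le> c" for i
        using k[of i] unfolding c_def by linarith
      then show "k \<in> (\<lambda>m. ?k0 + m) ` F"
        by (intro image_eqI[of _ _ "k - ?k0"]) (auto simp: F_def)
    qed
    have "card {k :: int ^ 'd. norm (x - rvec k) \<le> R} \<le> card ((\<lambda>m. ?k0 + m) ` F)"
      by (rule card_mono[OF _ sub]) (use F in auto)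
    also have "\<dots> \<le> card F" by (rule card_image_le[OF F])
    finally show "finite {k :: int ^ 'd. norm (x - rvec k) \<le> R} \<and> card {k :: int ^ 'd. norm (x - rvec k) \<le> R} \<le> card F"
      using finite_subset[OF sub] F by auto
  qed
qed

definition shifts :: "('r \<Rightarrow> real ^ 'd \<Rightarrow> complex) \<Rightarrow> 'r \<times> (int ^ 'd) \<Rightarrow> real ^ 'd \<Rightarrow> complex" where
  "shifts \<phi> = (\<lambda>(q, k) x. \<phi> q (x - rvec k))"

text \<open>At any point only boundedly many shifts are nonzero, so Cauchy-Schwarz for that many
  terms bounds the squared sum by the sum of squares, which is then integrated.\<close>

lemma bessel_shifts:
  fixes \<phi> :: "'r :: finite \<Rightarrow> real ^ 'd \<Rightarrow> complex"
  assumes \<phi>: "\<And>q. L2_fun (\<phi> q)" and R: "\<And>q x. norm x > R \<Longrightarrow> \<phi> q x = 0"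
  shows "\<exists>B>0. \<forall>S u. finite S \<longrightarrow> (L2_norm (\<lambda>x. \<Sum>\<kappa>\<in>S. u \<kappa> * shifts \<phi> \<kappa> x))\<^sup>2 \<le> B * (\<Sum>\<kappa>\<in>S. (cmod (u \<kappa>))\<^sup>2)"
proof -
  obtain N where N: "\<And>x :: real ^ 'd. finite {k :: int ^ 'd. norm (x - rvec k) \<le> R}"
    "\<And>x :: real ^ 'd. card {k :: int ^ 'd. norm (x - rvec k) \<le> R} \<le> N"
    using lattice_ball_bound[of R] by blast
  define C where "C = real (CARD('r) * N)"
  define G where "G = (\<Sum>q\<in>UNIV. (L2_norm (\<phi> q))\<^sup>2)"
  have C: "C \<ge> 0" and G: "G \<ge> 0" by (auto simp: C_def G_def sum_nonneg)
  have sL: "L2_fun (shifts \<phi> \<kappa>)" for \<kappa>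
    by (cases \<kappa>) (simp add: shifts_def L2_translate \<phi>)
  have sn: "(L2_norm (shifts \<phi> \<kappa>))\<^sup>2 \<le> G" for \<kappa>
  proof (cases \<kappa>)
    case (Pair q k)
    have "(L2_norm (\<phi> q))\<^sup>2 \<le> G" unfolding G_def by (rule member_le_sum) auto
    then show ?thesis by (simp add: Pair shifts_def L2_translate \<phi>)
  qed
  have pt: "(cmod (\<Sum>\<kappa>\<in>S. u \<kappa> * shifts \<phi> \<kappa> x))\<^sup>2 \<le> C * (\<Sum>\<kappa>\<in>S. (cmod (u \<kappa>))\<^sup>2 * (cmod (shifts \<phi> \<kappa> x))\<^sup>2)"
    if S: "finite S" for S u x
  proof -
    define T where "T = S \<inter> UNIV \<times> {k. norm (x - rvec k) \<le> R}"
    have T: "finite T" using S by (simp add: T_def)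
    have 0: "shifts \<phi> \<kappa> x = 0" if "\<kappa> \<in> S - T" for \<kappa>
      using that R by (cases \<kappa>) (auto simp: T_def shifts_def not_le)
    have "card T \<le> card (UNIV \<times> {k. norm (x - rvec k) \<le> R} :: ('r \<times> (int ^ 'd)) set)"
      by (rule card_mono) (auto simp: T_def N)
    also have "\<dots> \<le> CARD('r) * N" using N by (simp add: card_cartesian_product)
    finally have cT: "real (card T) \<le> C" unfolding C_def by (simp only: of_nat_le_iff)
    have "cmod (\<Sum>\<kappa>\<in>S. u \<kappa> * shifts \<phi> \<kappa> x) = cmod (\<Sum>\<kappa>\<in>T. u \<kappa> * shifts \<phi> \<kappa> x)"
      by (intro arg_cong[where f=cmod] sum.mono_neutral_right S) (auto simp: 0, auto simp: T_def)
    also have "\<dots> \<le> (\<Sum>\<kappa>\<in>T. cmod (u \<kappa> * shifts \<phi> \<kappa> x))" by (rule norm_sum)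
    finally have "(cmod (\<Sum>\<kappa>\<in>S. u \<kappa> * shifts \<phi> \<kappa> x))\<^sup>2 \<le> (\<Sum>\<kappa>\<in>T. cmod (u \<kappa> * shifts \<phi> \<kappa> x))\<^sup>2"
      by (rule power_mono) simp
    also have "\<dots> \<le> (\<Sum>\<kappa>\<in>T. (cmod (u \<kappa> * shifts \<phi> \<kappa> x))\<^sup>2) * card T"
      by (rule sum_squared_le_sum_of_squares)
    also have "\<dots> \<le> (\<Sum>\<kappa>\<in>S. (cmod (u \<kappa> * shifts \<phi> \<kappa> x))\<^sup>2) * C"
      by (intro mult_mono cT sum_mono2 S) (auto simp: T_def intro: sum_nonneg)
    finally show ?thesis by (simp add: norm_mult power_mult_distrib mult.commute)
  qed
  show ?thesis
  proof (intro exI conjI allI impI)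
    \<comment> \<open>The 1 keeps the constant positive even if all generators vanish.\<close>
    show "C * G + 1 > 0" using C G by (smt (verit) mult_nonneg_nonneg)
    fix S :: "('r \<times> (int ^ 'd)) set" and u assume S: "finite S"
    have int: "integrable lebesgue (\<lambda>x. C * (\<Sum>\<kappa>\<in>S. (cmod (u \<kappa>))\<^sup>2 * (cmod (shifts \<phi> \<kappa> x))\<^sup>2))"
      using L2_funD(2)[OF sL] by (intro integrable_mult_right Bochner_Integration.integrable_sum)
    have "(L2_norm (\<lambda>x. \<Sum>\<kappa>\<in>S. u \<kappa> * shifts \<phi> \<kappa> x))\<^sup>2
        \<le> (LINT x|lebesgue. C * (\<Sum>\<kappa>\<in>S. (cmod (u \<kappa>))\<^sup>2 * (cmod (shifts \<phi> \<kappa> x))\<^sup>2))"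
      unfolding L2_norm_sq
      by (intro integral_mono int pt S L2_funD(2) L2_fun_sum L2_fun_cmul sL)
    also have "\<dots> = C * (\<Sum>\<kappa>\<in>S. (cmod (u \<kappa>))\<^sup>2 * (L2_norm (shifts \<phi> \<kappa>))\<^sup>2)"
      using L2_funD(2)[OF sL] by (simp add: L2_norm_sq)
    also have "\<dots> \<le> C * (\<Sum>\<kappa>\<in>S. (cmod (u \<kappa>))\<^sup>2 * G)"
      by (intro mult_left_mono sum_mono sn C) auto
    also have "\<dots> = C * G * (\<Sum>\<kappa>\<in>S. (cmod (u \<kappa>))\<^sup>2)" by (simp add: sum_distrib_left ac_simps)
    also have "\<dots> \<le> (C * G + 1) * (\<Sum>\<kappa>\<in>S. (cmod (u \<kappa>))\<^sup>2)"
      by (intro mult_right_mono) (auto intro: sum_nonneg)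
    finally show "(L2_norm (\<lambda>x. \<Sum>\<kappa>\<in>S. u \<kappa> * shifts \<phi> \<kappa> x))\<^sup>2 \<le> (C * G + 1) * (\<Sum>\<kappa>\<in>S. (cmod (u \<kappa>))\<^sup>2)" .
  qed
qed

section \<open>Approximate identities\<close>

lemma LINT_lborel: "f \<in> borel_measurable borel \<Longrightarrow> (LINT x|lebesgue. f x) = (LINT x|lborel. f x)"
  for f :: "real ^ 'd \<Rightarrow> 'b :: {banach, second_countable_topology}"
  by (rule integral_completion) simp

lemma integrable_lborel: "f \<in> borel_measurable borel \<Longrightarrow> integrable lebesgue f \<longleftrightarrow> integrable lborel f"
  for f :: "real ^ 'd \<Rightarrow> 'b :: {banach, second_countable_topology}"
  by (rule integrable_completion) simp

text \<open>Bounds the effect of averaging \<open>f\<close> over the translates by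
  \<open>B *v y\<close> with weight \<open>\<kappa>\<close>. It tends to 0 when \<open>B\<close>
  contracts every vector to 0, for any integrable weight.\<close>

definition approx_error :: "(real ^ 'd \<Rightarrow> complex) \<Rightarrow> (real ^ 'd \<Rightarrow> complex) \<Rightarrow> real ^ 'd ^ 'd \<Rightarrow> real" where
  "approx_error \<kappa> f B = (LINT y|lborel. cmod (\<kappa> y) * L2_norm (\<lambda>x. f (x - B *v y) - f x))"

lemma L2_norm_translate_diff_continuous:
  fixes f :: "real ^ 'd \<Rightarrow> complex"
  assumes f: "L2_fun f"
  shows "continuous_on UNIV (\<lambda>h. L2_norm (\<lambda>x. f (x - h) - f x))"
proof -
  have "L2_norm (\<lambda>x. f (x - h) - f x) = sqrt (2 * (L2_norm f)\<^sup>2 - 2 * Re (L2_inner (\<lambda>x. f (x - h)) f))" for h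
  proof -
    note t = L2_translate[OF f, of h]
    have "(L2_norm (\<lambda>x. f (x - h) + - f x))\<^sup>2
        = (L2_norm (\<lambda>x. f (x - h)))\<^sup>2 + (L2_norm (\<lambda>x. - f x))\<^sup>2 + 2 * Re (L2_inner (\<lambda>x. f (x - h)) (\<lambda>x. - f x))"
      by (rule L2_norm_add_sq[OF t(1) L2_fun_uminus[OF f]])
    moreover have "L2_norm (\<lambda>x. - f x) = L2_norm f" by (simp add: L2_norm_def)
    moreover have "L2_inner (\<lambda>x. f (x - h)) (\<lambda>x. - f x) = - L2_inner (\<lambda>x. f (x - h)) f"
      by (simp add: L2_inner_def)
    ultimately have "(L2_norm (\<lambda>x. f (x - h) - f x))\<^sup>2 = 2 * (L2_norm f)\<^sup>2 - 2 * Re (L2_inner (\<lambda>x. f (x - h)) f)"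
      using t(2) by simp
    then show ?thesis by (metis L2_norm_nonneg real_sqrt_unique)
  qed
  then show ?thesis using continuous_inner_translate[OF f f] by (auto intro!: continuous_intros)
qed

lemma approx_error_tendsto_0:
  fixes f :: "real ^ 'd \<Rightarrow> complex"
  assumes f: "L2_fun f" and \<kappa>: "integrable lborel \<kappa>" and B: "\<And>y. (\<lambda>n. B n *v y) \<longlonglongrightarrow> 0"
  shows "(\<lambda>n. approx_error \<kappa> f (B n)) \<longlonglongrightarrow> 0"
proof -
  let ?D = "\<lambda>h. L2_norm (\<lambda>x. f (x - h) - f x)"
  have Dc: "continuous_on UNIV ?D" by (rule L2_norm_translate_diff_continuous[OF f])
  have Dm [measurable]: "?D \<in> borel_measurable borel"
    by (rule borel_measurable_continuous_onI[OF Dc])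
  have Dle: "?D h \<le> 2 * L2_norm f" for h
  proof -
    have "L2_norm (\<lambda>x. f (x - h) + - f x) \<le> L2_norm (\<lambda>x. f (x - h)) + L2_norm (\<lambda>x. - f x)"
      by (intro L2_norm_triangle L2_translate f L2_fun_uminus)
    moreover have "L2_norm (\<lambda>x. - f x) = L2_norm f" by (simp add: L2_norm_def)
    ultimately show ?thesis using L2_translate(2)[OF f, of h] by simp
  qed
  have km [measurable]: "\<kappa> \<in> borel_measurable borel" using \<kappa> by auto
  have "(\<lambda>n. LINT y|lborel. cmod (\<kappa> y) * ?D (B n *v y)) \<longlonglongrightarrow> (LINT y|(lborel :: (real ^ 'd) measure). 0)"
  proof (rule integral_dominated_convergence[where w="\<lambda>y. 2 * L2_norm f * cmod (\<kappa> y)"])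
    show "integrable lborel (\<lambda>y. 2 * L2_norm f * cmod (\<kappa> y))" using \<kappa> by auto
    show "AE y in lborel. (\<lambda>n. cmod (\<kappa> y) * ?D (B n *v y)) \<longlonglongrightarrow> 0"
    proof (rule AE_I2)
      fix y
      have "(\<lambda>n. ?D (B n *v y)) \<longlonglongrightarrow> ?D 0"
      proof (rule isCont_tendsto_compose[OF _ B])
        show "isCont ?D 0" using Dc by (simp add: continuous_on_eq_continuous_at)
      qed
      then have "(\<lambda>n. cmod (\<kappa> y) * ?D (B n *v y)) \<longlonglongrightarrow> cmod (\<kappa> y) * 0"
        by (intro tendsto_intros) simp
      then show "(\<lambda>n. cmod (\<kappa> y) * ?D (B n *v y)) \<longlonglongrightarrow> 0" by simp
    qed
    show "AE y in lborel. norm (cmod (\<kappa> y) * ?D (B n *v y)) \<le> 2 * L2_norm f * cmod (\<kappa> y)" for n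
    proof (rule AE_I2)
      fix y show "norm (cmod (\<kappa> y) * ?D (B n *v y)) \<le> 2 * L2_norm f * cmod (\<kappa> y)"
        using mult_left_mono[OF Dle[of "B n *v y"] norm_ge_zero[of "\<kappa> y"]] by (simp add: abs_mult ac_simps)
    qed
    show "(\<lambda>y. cmod (\<kappa> y) * ?D (B n *v y)) \<in> borel_measurable lborel" for n
      using measurable_compose[OF borel_measurable_matrix Dm, of "B n"] by simp
  qed simp
  then show ?thesis by (simp add: approx_error_def)
qed

text \<open>Averaging the translates of \<open>f\<close> changes the pairing with \<open>g\<close>
  by at most the first term; Fubini then moves the average onto \<open>g\<close>, which leaves the
  second. The kernel is a Gaussian for uniqueness of transforms and a component of the refinable
  function for density.\<close>

lemma approx_identity:
  fixes f g \<kappa> :: "real ^ 'd \<Rightarrow> complex"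
  assumes f: "L2_fun f" "f \<in> borel_measurable borel" and g: "L2_fun g" "g \<in> borel_measurable borel"
    and \<kappa>: "integrable lborel \<kappa>"
  shows "cmod ((LINT y|lborel. \<kappa> y) * L2_inner f g)
    \<le> L2_norm g * approx_error \<kappa> f B + cmod (LINT t|lborel. f t * (LINT y|lborel. \<kappa> y * cnj (g (t + B *v y))))"
proof -
  note [measurable] = f(2) g(2)
  have [measurable]: "\<kappa> \<in> borel_measurable borel" using \<kappa> by auto
  have [measurable]: "cnj \<in> borel_measurable borel" by (intro borel_measurable_continuous_onI continuous_intros)
  define F where "F y = L2_inner (\<lambda>x. f (x - B *v y)) g" for y
  define D where "D y = L2_norm (\<lambda>x. f (x - B *v y) - f x)" for y
  have Fm [measurable]: "F \<in> borel_measurable borel"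
  proof -
    have "(\<lambda>h. L2_inner (\<lambda>x. f (x - h)) g) \<in> borel_measurable borel"
      by (rule borel_measurable_continuous_onI[OF continuous_inner_translate[OF f(1) g(1)]])
    from measurable_compose[OF borel_measurable_matrix this, of B] show ?thesis by (simp add: F_def[abs_def])
  qed
  have Dm [measurable]: "D \<in> borel_measurable borel"
    using measurable_compose[OF borel_measurable_matrix
      borel_measurable_continuous_onI[OF L2_norm_translate_diff_continuous[OF f(1)]], of B]
    by (simp add: D_def[abs_def])
  have Fle: "cmod (F y) \<le> L2_norm f * L2_norm g" for y
    unfolding F_def using L2_cauchy_schwarz[OF L2_translate(1)[OF f(1)] g(1)] L2_translate(2)[OF f(1)] by metis
  have Dle: "D y \<le> 2 * L2_norm f" for y
  proof -
    have "L2_norm (\<lambda>x. f (x - B *v y) + - f x) \<le> L2_norm (\<lambda>x. f (x - B *v y)) + L2_norm (\<lambda>x. - f x)"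
      by (intro L2_norm_triangle L2_translate f L2_fun_uminus)
    moreover have "L2_norm (\<lambda>x. - f x) = L2_norm f" by (simp add: L2_norm_def)
    ultimately show ?thesis using L2_translate(2)[OF f(1), of "B *v y"] by (simp add: D_def)
  qed
  have FD: "cmod (L2_inner f g - F y) \<le> D y * L2_norm g" for y
  proof -
    have "L2_inner f g - F y = - L2_inner (\<lambda>x. f (x - B *v y) - f x) g"
      unfolding F_def by (subst L2_inner_diff_left) (auto intro: L2_translate f g)
    then show ?thesis
      using L2_cauchy_schwarz[OF L2_fun_diff[OF L2_translate(1)[OF f(1)] f(1)] g(1), of "B *v y"]
      by (simp add: D_def)
  qed
  have iF: "integrable lborel (\<lambda>y. \<kappa> y * F y)"
  proof (rule Bochner_Integration.integrable_bound[of _ "\<lambda>y. (L2_norm f * L2_norm g) * cmod (\<kappa> y)"])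
    show "AE y in lborel. norm (\<kappa> y * F y) \<le> norm (L2_norm f * L2_norm g * cmod (\<kappa> y))"
    proof (rule AE_I2)
      fix y show "norm (\<kappa> y * F y) \<le> norm (L2_norm f * L2_norm g * cmod (\<kappa> y))"
        using mult_left_mono[OF Fle[of y] norm_ge_zero[of "\<kappa> y"]] by (simp add: norm_mult abs_mult ac_simps)
    qed
  qed (use \<kappa> in auto)
  have iD: "integrable lborel (\<lambda>y. cmod (\<kappa> y) * D y)"
  proof (rule Bochner_Integration.integrable_bound[of _ "\<lambda>y. (2 * L2_norm f) * cmod (\<kappa> y)"])
    show "AE y in lborel. norm (cmod (\<kappa> y) * D y) \<le> norm (2 * L2_norm f * cmod (\<kappa> y))"
    proof (rule AE_I2)
      fix y
      have "0 \<le> D y" by (simp add: D_def)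
      then show "norm (cmod (\<kappa> y) * D y) \<le> norm (2 * L2_norm f * cmod (\<kappa> y))"
        using mult_left_mono[OF Dle[of y] norm_ge_zero[of "\<kappa> y"]] by (simp add: norm_mult abs_mult ac_simps)
    qed
  qed (use \<kappa> in auto)
  have "(LINT y|lborel. \<kappa> y) * L2_inner f g - (LINT y|lborel. \<kappa> y * F y)
      = (LINT y|lborel. \<kappa> y * (L2_inner f g - F y))"
    using iF \<kappa> by (simp add: right_diff_distrib)
  also have "cmod \<dots> \<le> (LINT y|lborel. cmod (\<kappa> y * (L2_inner f g - F y)))"
    by (rule integral_norm_bound)
  also have "\<dots> \<le> (LINT y|lborel. L2_norm g * (cmod (\<kappa> y) * D y))"
  proof (rule integral_mono)
    have "integrable lborel (\<lambda>y. \<kappa> y * L2_inner f g - \<kappa> y * F y)" using iF \<kappa> by auto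
    then show "integrable lborel (\<lambda>y. cmod (\<kappa> y * (L2_inner f g - F y)))" by (simp add: right_diff_distrib)
    show "integrable lborel (\<lambda>y. L2_norm g * (cmod (\<kappa> y) * D y))" using iD by auto
    show "cmod (\<kappa> y * (L2_inner f g - F y)) \<le> L2_norm g * (cmod (\<kappa> y) * D y)" for y
      using mult_left_mono[OF FD[of y] norm_ge_zero[of "\<kappa> y"]] by (simp add: norm_mult ac_simps)
  qed
  also have "\<dots> = L2_norm g * approx_error \<kappa> f B" by (simp add: approx_error_def D_def)
  finally have main: "cmod ((LINT y|lborel. \<kappa> y) * L2_inner f g - (LINT y|lborel. \<kappa> y * F y))
      \<le> L2_norm g * approx_error \<kappa> f B" .
  define H where "H y t = \<kappa> y * (f t * cnj (g (t + B *v y)))" for y t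
  have gt: "L2_fun (\<lambda>t. g (t + B *v y))" "L2_norm (\<lambda>t. g (t + B *v y)) = L2_norm g" for y
    using L2_translate[OF g(1), of "- (B *v y)"] by simp_all
  have Fy: "F y = (LINT t|lborel. f t * cnj (g (t + B *v y)))" for y
  proof -
    have "F y = (LINT t|lborel. f (t - B *v y) * cnj (g t))"
      unfolding F_def L2_inner_def by (rule LINT_lborel) measurable
    also have "\<dots> = (LINT t|distr lborel borel ((+) (B *v y)). f (t - B *v y) * cnj (g t))"
      by (simp add: lborel_distr_plus)
    also have "\<dots> = (LINT t|lborel. f t * cnj (g (t + B *v y)))"
      by (subst integral_distr) (auto simp: add.commute)
    finally show ?thesis .
  qed
  have Hm: "case_prod H \<in> borel_measurable (lborel \<Otimes>\<^sub>M lborel)"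
  proof -
    have "(\<lambda>p :: (real ^ 'd) \<times> (real ^ 'd). snd p + B *v fst p) \<in> borel_measurable (lborel \<Otimes>\<^sub>M lborel)"
      by measurable
    then show ?thesis unfolding H_def by measurable
  qed
  have "integrable (lborel \<Otimes>\<^sub>M lborel) (case_prod H)"
  proof (rule lborel_pair.Fubini_integrable[OF Hm])
    show "AE y in lborel. integrable lborel (\<lambda>t. case (y, t) of (y, t) \<Rightarrow> H y t)"
    proof (rule AE_I2)
      fix y
      have "integrable lebesgue (\<lambda>t. f t * cnj (g (t + B *v y)))"
        by (rule L2_integrable_mult(3)[OF f(1) gt(1)])
      then have "integrable lborel (\<lambda>t. f t * cnj (g (t + B *v y)))"
        by (subst (asm) integrable_lborel) measurable
      then show "integrable lborel (\<lambda>t. case (y, t) of (y, t) \<Rightarrow> H y t)" by (simp add: H_def)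
    qed
    \<comment> \<open>For each \<open>y\<close> the inner integral is at most the product of the two
      norms, whatever the translation, so only the integrable kernel remains.\<close>
    show "integrable lborel (\<lambda>y. LINT t|lborel. norm (case (y, t) of (y, t) \<Rightarrow> H y t))"
    proof (rule Bochner_Integration.integrable_bound[of _ "\<lambda>y. (L2_norm f * L2_norm g) * cmod (\<kappa> y)"])
      show "AE y in lborel. norm (LINT t|lborel. norm (case (y, t) of (y, t) \<Rightarrow> H y t))
          \<le> norm (L2_norm f * L2_norm g * cmod (\<kappa> y))"
      proof (rule AE_I2)
        fix y
        have "(LINT t|lborel. cmod (f t) * cmod (g (t + B *v y))) = (LINT t|lebesgue. cmod (f t) * cmod (g (t + B *v y)))"
          by (rule LINT_lborel[symmetric]) measurable
        also have "\<dots> \<le> L2_norm f * L2_norm g"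
          using L2_cauchy_schwarz_nn[OF f(1) gt(1)[of y]] gt(2)[of y] by simp
        finally have le: "(LINT t|lborel. cmod (f t) * cmod (g (t + B *v y))) \<le> L2_norm f * L2_norm g" .
        have "(LINT t|lborel. cmod (H y t)) = cmod (\<kappa> y) * (LINT t|lborel. cmod (f t) * cmod (g (t + B *v y)))"
          by (simp add: H_def norm_mult)
        moreover have "0 \<le> (LINT t|lborel. cmod (f t) * cmod (g (t + B *v y)))"
          by (rule Bochner_Integration.integral_nonneg) simp
        ultimately show "norm (LINT t|lborel. norm (case (y, t) of (y, t) \<Rightarrow> H y t))
          \<le> norm (L2_norm f * L2_norm g * cmod (\<kappa> y))"
          using mult_left_mono[OF le norm_ge_zero[of "\<kappa> y"]] by (simp add: abs_mult ac_simps)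
      qed
      show "(\<lambda>y. LINT t|lborel. norm (case (y, t) of (y, t) \<Rightarrow> H y t)) \<in> borel_measurable lborel"
      proof (rule lborel.borel_measurable_lebesgue_integral)
        show "(\<lambda>(x, y). norm (case (x, y) of (y, t) \<Rightarrow> H y t)) \<in> borel_measurable (lborel \<Otimes>\<^sub>M lborel)"
          using measurable_compose[OF Hm borel_measurable_norm] by (simp add: case_prod_beta')
      qed
    qed (use \<kappa> in auto)
  qed
  then have "(LINT t|lborel. LINT y|lborel. H y t) = (LINT y|lborel. LINT t|lborel. H y t)"
    by (rule lborel_pair.Fubini_integral)
  moreover have "(LINT y|lborel. LINT t|lborel. H y t) = (LINT y|lborel. \<kappa> y * F y)"
    by (simp add: H_def Fy)
  moreover have "(LINT y|lborel. H y t) = f t * (LINT y|lborel. \<kappa> y * cnj (g (t + B *v y)))" for t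
  proof -
    have "(LINT y|lborel. H y t) = (LINT y|lborel. f t * (\<kappa> y * cnj (g (t + B *v y))))"
      by (intro Bochner_Integration.integral_cong) (auto simp: H_def)
    then show ?thesis by simp
  qed
  ultimately have "(LINT y|lborel. \<kappa> y * F y) = (LINT t|lborel. f t * (LINT y|lborel. \<kappa> y * cnj (g (t + B *v y))))"
    by simp
  then show ?thesis
    using main norm_triangle_sub[of "(LINT y|lborel. \<kappa> y) * L2_inner f g" "LINT y|lborel. \<kappa> y * F y"] by simp
qed

section \<open>Uniqueness of Fourier transforms\<close>

lemma lborel_prod_integral:
  fixes f :: "real ^ 'd \<Rightarrow> real \<Rightarrow> complex"
  assumes f: "\<And>b. b \<in> Basis \<Longrightarrow> integrable lborel (f b)"
  shows "integrable lborel (\<lambda>x. \<Prod>b\<in>Basis. f b (x \<bullet> b))"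
    and "(LINT x|lborel. (\<Prod>b\<in>Basis. f b (x \<bullet> b))) = (\<Prod>b\<in>Basis. (LINT t|lborel. f b t))"
proof -
  interpret product_sigma_finite "\<lambda>_ :: real ^ 'd. lborel :: real measure" ..
  let ?P = "\<lambda>z :: real ^ 'd \<Rightarrow> real. \<Sum>b\<in>Basis. z b *\<^sub>R b"
  have fm: "\<And>b. b \<in> Basis \<Longrightarrow> f b \<in> borel_measurable borel" using borel_measurable_integrable[OF f] by simp
  have m: "(\<lambda>x. \<Prod>b\<in>Basis. f b (x \<bullet> b)) \<in> borel_measurable borel"
    by (intro borel_measurable_prod measurable_compose[OF _ fm]) auto
  have P: "?P \<in> measurable (\<Pi>\<^sub>M b\<in>Basis. lborel) borel" by measurable
  have eq: "(\<Prod>b\<in>Basis. f b (?P z \<bullet> b)) = (\<Prod>b\<in>Basis. f b (z b))" for z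
    by (intro prod.cong refl) (simp add: inner_sum_left inner_Basis if_distrib cong: if_cong)
  show "integrable lborel (\<lambda>x. \<Prod>b\<in>Basis. f b (x \<bullet> b))"
    by (subst lborel_eq, subst integrable_distr_eq[OF P m], unfold eq)
       (intro product_integrable_prod f, auto)
  show "(LINT x|lborel. (\<Prod>b\<in>Basis. f b (x \<bullet> b))) = (\<Prod>b\<in>Basis. (LINT t|lborel. f b t))"
    by (subst lborel_eq, subst integral_distr[OF P m], unfold eq)
       (intro product_integral_prod f, auto)
qed

text \<open>A product of one-dimensional densities: its transform is again a product, read off from
  the characteristic function of the normal distribution.\<close>

definition gaussian :: "real ^ 'd \<Rightarrow> complex" where
  "gaussian x = (\<Prod>b\<in>Basis. complex_of_real (std_normal_density (x \<bullet> b)))"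

lemma std_normal_cis:
  "integrable lborel (\<lambda>t. complex_of_real (std_normal_density t) * cis (- (a * t)))"
  "(LINT t|lborel. complex_of_real (std_normal_density t) * cis (- (a * t))) = complex_of_real (exp (- (a\<^sup>2) / 2))"
proof -
  have [measurable]: "cis \<in> borel_measurable borel"
    by (intro borel_measurable_continuous_onI continuous_intros)
  have "integrable lborel (\<lambda>t. std_normal_density t)" by simp
  then show "integrable lborel (\<lambda>t. complex_of_real (std_normal_density t) * cis (- (a * t)))"
    by (rule Bochner_Integration.integrable_bound) (auto simp: norm_mult)
  have "complex_of_real (exp (- (a\<^sup>2) / 2)) = char std_normal_distribution (- a)"
    by (simp add: char_std_normal_distribution)
  also have "\<dots> = (LINT t|lborel. std_normal_density t *\<^sub>R iexp (- a * t))"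
    unfolding char_def by (rule integral_density) (auto simp: normal_density_nonneg)
  also have "\<dots> = (LINT t|lborel. complex_of_real (std_normal_density t) * cis (- (a * t)))"
    by (intro Bochner_Integration.integral_cong) (auto simp: scaleR_conv_of_real cis_conv_exp)
  finally show "(LINT t|lborel. complex_of_real (std_normal_density t) * cis (- (a * t))) = complex_of_real (exp (- (a\<^sup>2) / 2))"
    by simp
qed

lemma cis_sum: "finite S \<Longrightarrow> cis (\<Sum>b\<in>S. f b) = (\<Prod>b\<in>S. cis (f b))"
  by (induction S rule: finite_induct) (simp_all add: cis_mult[symmetric])

lemma gaussian_fourier:
  "integrable lborel (\<lambda>\<xi>. gaussian \<xi> * cis (- (x \<bullet> \<xi>)))"
  "(LINT \<xi>|lborel. gaussian \<xi> * cis (- (x \<bullet> \<xi>))) = complex_of_real ((sqrt (2 * pi)) ^ CARD('d)) * gaussian x"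
  for x :: "real ^ 'd"
proof -
  let ?f = "\<lambda>b t. complex_of_real (std_normal_density t) * cis (- ((x \<bullet> b) * t))"
  have eq: "gaussian \<xi> * cis (- (x \<bullet> \<xi>)) = (\<Prod>b\<in>Basis. ?f b (\<xi> \<bullet> b))" for \<xi>
  proof -
    have "cis (- (x \<bullet> \<xi>)) = (\<Prod>b\<in>Basis. cis (- ((x \<bullet> b) * (\<xi> \<bullet> b))))"
      by (subst euclidean_inner, subst sum_negf[symmetric], rule cis_sum) simp
    then show ?thesis by (simp add: gaussian_def prod.distrib)
  qed
  show "integrable lborel (\<lambda>\<xi>. gaussian \<xi> * cis (- (x \<bullet> \<xi>)))"
    unfolding eq by (rule lborel_prod_integral(1)[OF std_normal_cis(1)])
  have "(LINT \<xi>|lborel. gaussian \<xi> * cis (- (x \<bullet> \<xi>))) = (\<Prod>b\<in>Basis. (LINT t|lborel. ?f b t))"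
    unfolding eq by (rule lborel_prod_integral(2)[OF std_normal_cis(1)])
  also have "\<dots> = (\<Prod>b\<in>Basis. complex_of_real (sqrt (2 * pi)) * complex_of_real (std_normal_density (x \<bullet> b)))"
  proof -
    have "sqrt (2 * pi) * std_normal_density t = exp (- t\<^sup>2 / 2)" for t
      by (simp add: std_normal_density_def)
    then show ?thesis
      unfolding std_normal_cis(2) of_real_mult[symmetric] by simp
  qed
  also have "\<dots> = complex_of_real ((sqrt (2 * pi)) ^ CARD('d)) * gaussian x"
    by (simp add: gaussian_def prod.distrib)
  finally show "(LINT \<xi>|lborel. gaussian \<xi> * cis (- (x \<bullet> \<xi>))) = complex_of_real ((sqrt (2 * pi)) ^ CARD('d)) * gaussian x" .
qed

lemma gaussian_integrable: "integrable lborel gaussian"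
  using gaussian_fourier(1)[of 0] by simp

lemma gaussian_integral: "(LINT x|lborel. gaussian (x :: real ^ 'd)) \<noteq> 0"
proof -
  have "(LINT x|lborel. gaussian (x :: real ^ 'd)) = complex_of_real ((sqrt (2 * pi)) ^ CARD('d)) * gaussian (0 :: real ^ 'd)"
    using gaussian_fourier(2)[of "0 :: real ^ 'd"] by simp
  moreover have "gaussian (0 :: real ^ 'd) \<noteq> 0"
    by (simp add: gaussian_def std_normal_density_def)
  ultimately show ?thesis by simp
qed

lemma gaussian_borel [measurable]: "gaussian \<in> borel_measurable borel"
  using borel_measurable_integrable[OF gaussian_integrable] by simp

lemma cmod_gaussian_le: "cmod (gaussian x) \<le> 1" for x :: "real ^ 'd"
proof -
  have "cmod (gaussian x) = (\<Prod>b\<in>Basis. \<bar>std_normal_density (x \<bullet> b)\<bar>)"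
    by (simp add: gaussian_def prod_norm[symmetric])
  also have "\<dots> \<le> (\<Prod>b\<in>(Basis :: (real ^ 'd) set). 1)"
  proof (rule prod_mono, intro conjI)
    fix b
    have "sqrt 1 \<le> sqrt (2 * pi)" using pi_gt3 by (subst real_sqrt_le_iff) simp
    then have "exp (- ((x \<bullet> b)\<^sup>2 / 2)) \<le> sqrt (2 * pi)"
      using order_trans[of "exp (- ((x \<bullet> b)\<^sup>2 / 2))" 1] by simp
    then show "\<bar>std_normal_density (x \<bullet> b)\<bar> \<le> 1"
      unfolding std_normal_density_def by (simp add: abs_mult)
  qed simp
  finally show ?thesis by simp
qed

lemma gaussian_L2: "L2_fun gaussian"
proof (rule L2_fun_bound)
  show "gaussian \<in> borel_measurable lebesgue" by (rule borel_lebesgue) simp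
  show "integrable lebesgue (\<lambda>x. cmod (gaussian x))"
    by (subst integrable_lborel) (auto intro: integrable_norm gaussian_integrable)
  show "(cmod (gaussian x))\<^sup>2 \<le> cmod (gaussian x)" for x :: "real ^ 'd"
    using mult_left_mono[OF cmod_gaussian_le[of x], of "cmod (gaussian x)"] by (simp add: power2_eq_square)
qed

text \<open>By density, one copy of \<open>g\<close> in its inner product with itself can be
  replaced by a test function.\<close>

lemma L2_zero_if_orthogonal_Cc:
  fixes g :: "real ^ 'd \<Rightarrow> complex"
  assumes g: "L2_fun g" and 0: "\<And>f. Cc_fun f \<Longrightarrow> L2_inner f g = 0"
  shows "AE x in lebesgue. g x = 0"
proof (rule L2_norm_zeroD[OF g])
  have "(L2_norm g)\<^sup>2 \<le> e" if e: "e > 0" for e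
  proof -
    have n: "L2_norm g + 1 > 0" using L2_norm_nonneg[of g] by linarith
    obtain f where f: "Cc_fun f" "L2_norm (\<lambda>x. g x - f x) < e / (L2_norm g + 1)"
      using Cc_dense[OF g divide_pos_pos[OF e n]] by blast
    have fL: "L2_fun f" by (rule Cc_fun_integrable[OF f(1)])
    have "complex_of_real ((L2_norm g)\<^sup>2) = L2_inner g g - L2_inner f g" by (simp add: L2_inner_self 0[OF f(1)])
    also have "\<dots> = L2_inner (\<lambda>x. g x - f x) g" by (rule L2_inner_diff_left[symmetric]) (fact g fL)+
    finally have "cmod (complex_of_real ((L2_norm g)\<^sup>2)) \<le> L2_norm (\<lambda>x. g x - f x) * L2_norm g"
      using L2_cauchy_schwarz[OF L2_fun_diff[OF g fL] g] by simp
    also have "\<dots> \<le> e / (L2_norm g + 1) * L2_norm g" using f(2) by (intro mult_right_mono) auto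
    also have "\<dots> \<le> e" using n e by (simp add: field_simps)
    finally show ?thesis by (simp add: norm_power)
  qed
  then have "(L2_norm g)\<^sup>2 \<le> 0" using field_le_epsilon[of "(L2_norm g)\<^sup>2" 0] by simp
  then show "L2_norm g = 0" by simp
qed

lemma mat_scale: "mat s *v x = s *\<^sub>R x" for x :: "real ^ 'd"
  by (simp add: vec_eq_iff matrix_vector_mult_def mat_def if_distrib if_distribR cong: if_cong)

lemma det_mat_scale: "det (mat s :: real ^ 'd ^ 'd) = s ^ CARD('d)"
  by (subst det_diagonal) (simp_all add: mat_def)

lemma truncation_integrable:
  fixes h :: "real ^ 'd \<Rightarrow> complex"
  assumes h: "L2_fun h"
  shows "L2_fun (\<lambda>x. indicat_real (cball 0 R) x *\<^sub>R h x)"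
    "integrable lebesgue (\<lambda>x. indicat_real (cball 0 R) x *\<^sub>R h x)"
proof -
  have i: "(\<lambda>x :: real ^ 'd. indicat_real (cball 0 R) x) \<in> borel_measurable lebesgue"
    by (intro borel_lebesgue borel_measurable_indicator) simp
  show "L2_fun (\<lambda>x. indicat_real (cball 0 R) x *\<^sub>R h x)"
    by (rule L2_fun_bound[OF _ L2_funD(2)[OF h]])
       (use i L2_funD(1)[OF h] in \<open>auto simp: indicator_def\<close>)
  have "L2_fun (\<lambda>x :: real ^ 'd. complex_of_real (indicat_real (cball 0 R) x))"
    using i integrable_indicator_cball[of 1 R]
    by (intro L2_fun_bound[where g="\<lambda>x. 1 * indicat_real (cball 0 R) x"]) (auto simp: indicator_def)
  from L2_integrable_mult(2)[OF this h]
  show "integrable lebesgue (\<lambda>x. indicat_real (cball 0 R) x *\<^sub>R h x)"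
    by (simp add: scaleR_conv_of_real)
qed

text \<open>Pairing the transforms with modulated Gaussians and applying Fubini shows that the
  Gaussian averages of \<open>h\<close> vanish at every scale and centre. Such averages form an
  approximate identity, so \<open>h\<close> vanishes.\<close>

lemma fourier_zero:
  fixes h :: "real ^ 'd \<Rightarrow> complex"
  assumes h: "L2_fun h" and hm [measurable]: "h \<in> borel_measurable borel"
    and lim: "(\<lambda>n. \<integral>\<^sup>+\<xi>. ennreal ((cmod (fourier (\<lambda>x. indicat_real (cball 0 (real n)) x *\<^sub>R h x) \<xi>))\<^sup>2) \<partial>lborel) \<longlonglongrightarrow> 0"
  shows "AE x in lebesgue. h x = 0"
proof -
  have [measurable]: "cis \<in> borel_measurable borel" "cnj \<in> borel_measurable borel"
    by (intro borel_measurable_continuous_onI continuous_intros)+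
  have [measurable]: "(\<lambda>x :: real ^ 'd. s *\<^sub>R x - t) \<in> borel_measurable borel" for s t by simp
  define hn where "hn n x = indicat_real (cball 0 (real n)) x *\<^sub>R h x" for n x
  define F where "F n \<xi> = fourier (hn n) \<xi>" for n \<xi>
  have hnm [measurable]: "hn n \<in> borel_measurable borel" for n
    unfolding hn_def by (intro borel_measurable_scaleR borel_measurable_indicator hm) simp
  have hni: "integrable lborel (hn n)" for n
    using truncation_integrable(2)[OF h, of "real n"] integrable_lborel[OF hnm[of n]] by (simp add: hn_def[abs_def])
  have gs: "L2_fun (\<lambda>\<xi> :: real ^ 'd. gaussian (s *\<^sub>R \<xi> - t))" "integrable lborel (\<lambda>\<xi> :: real ^ 'd. gaussian (s *\<^sub>R \<xi> - t))"
    if "s > 0" for s t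
  proof -
    have d: "det (mat s :: real ^ 'd ^ 'd) \<noteq> 0" using that by (simp add: det_mat_scale)
    have gi: "integrable lebesgue (gaussian :: real ^ 'd \<Rightarrow> complex)"
      using gaussian_integrable integrable_lborel[OF gaussian_borel] by blast
    from integrable_affine[OF d this, of t]
    show "integrable lborel (\<lambda>\<xi> :: real ^ 'd. gaussian (s *\<^sub>R \<xi> - t))"
      unfolding mat_scale by (subst (asm) integrable_lborel) measurable
    show "L2_fun (\<lambda>\<xi> :: real ^ 'd. gaussian (s *\<^sub>R \<xi> - t))"
      unfolding L2_fun_def
      using measurable_affine[OF d L2_funD(1)[OF gaussian_L2], of t] integrable_affine[OF d L2_funD(2)[OF gaussian_L2], of t]
      unfolding mat_scale by simp
  qed
  have key: "(LINT x|lborel. h x * gaussian (inverse s *\<^sub>R x - inverse s *\<^sub>R t)) = 0" if s: "s > 0" for s t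
  proof -
    \<comment> \<open>Modulation by \<open>t\<close> and dilation by \<open>s\<close> in frequency
      become translation by \<open>t\<close> and dilation by \<open>inverse s\<close> in
      space.\<close>
    define w where "w \<xi> = cis (t \<bullet> \<xi>) * gaussian (s *\<^sub>R \<xi>)" for \<xi> :: "real ^ 'd"
    define K where "K z = (LINT \<xi>|lborel. gaussian (s *\<^sub>R \<xi>) * cis (- (z \<bullet> \<xi>)))" for z :: "real ^ 'd"
    have wm [measurable]: "w \<in> borel_measurable borel" unfolding w_def by measurable
    have wg: "cmod (w \<xi>) = cmod (gaussian (s *\<^sub>R \<xi>))" for \<xi> by (simp add: w_def norm_mult)
    define c where "c = complex_of_real ((sqrt (2 * pi)) ^ CARD('d)) / of_real (s ^ CARD('d))"
    have c: "c \<noteq> 0" using s by (simp add: c_def)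
    have K: "K z = c * gaussian (inverse s *\<^sub>R z)" for z
    proof -
      let ?\<phi> = "\<lambda>\<eta>. gaussian \<eta> * cis (- ((inverse s *\<^sub>R z) \<bullet> \<eta>))"
      have d: "det (mat s :: real ^ 'd ^ 'd) \<noteq> 0" using s by (simp add: det_mat_scale)
      have m: "?\<phi> \<in> borel_measurable borel" by measurable
      have "(LINT \<eta>|lebesgue. ?\<phi> \<eta>) = \<bar>det (mat s :: real ^ 'd ^ 'd)\<bar> *\<^sub>R (LINT \<xi>|lebesgue. ?\<phi> (mat s *v \<xi> - 0))"
        by (rule integral_affine[OF d borel_lebesgue[OF m]])
      also have "(\<lambda>\<xi>. ?\<phi> (mat s *v \<xi> - 0)) = (\<lambda>\<xi>. gaussian (s *\<^sub>R \<xi>) * cis (- (z \<bullet> \<xi>)))"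
        using s by (auto simp: mat_scale mult.assoc[symmetric])
      also have "(LINT \<xi>|lebesgue. gaussian (s *\<^sub>R \<xi>) * cis (- (z \<bullet> \<xi>))) = K z"
        unfolding K_def by (rule LINT_lborel) measurable
      also have "(LINT \<eta>|lebesgue. ?\<phi> \<eta>) = complex_of_real ((sqrt (2 * pi)) ^ CARD('d)) * gaussian (inverse s *\<^sub>R z)"
        by (subst LINT_lborel[OF m]) (rule gaussian_fourier(2))
      finally show ?thesis using s by (simp add: c_def det_mat_scale scaleR_conv_of_real field_simps)
    qed
    \<comment> \<open>The multiplication formula: the transform is moved from the truncation of
      \<open>h\<close> to the Gaussian.\<close>
    have I: "(LINT \<xi>|lborel. F n \<xi> * w \<xi>) = (LINT x|lborel. hn n x * K (x - t))"
      "integrable lborel (\<lambda>\<xi>. F n \<xi> * w \<xi>)" for n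
    proof -
      define H where "H \<xi> x = hn n x * cis (- (x \<bullet> \<xi>)) * w \<xi>" for \<xi> x
      have Hm: "case_prod H \<in> borel_measurable (lborel \<Otimes>\<^sub>M lborel)"
        unfolding H_def by measurable
      have nH: "norm (H \<xi> x) = cmod (hn n x) * cmod (w \<xi>)" for \<xi> x
        by (simp add: H_def norm_mult)
      have Hi: "integrable (lborel \<Otimes>\<^sub>M lborel) (case_prod H)"
      proof (rule lborel_pair.Fubini_integrable[OF Hm])
        show "AE \<xi> in lborel. integrable lborel (\<lambda>x. case (\<xi>, x) of (\<xi>, x) \<Rightarrow> H \<xi> x)"
        proof (rule AE_I2)
          fix \<xi>
          show "integrable lborel (\<lambda>x. case (\<xi>, x) of (\<xi>, x) \<Rightarrow> H \<xi> x)"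
          proof (rule Bochner_Integration.integrable_bound[of _ "\<lambda>x. cmod (hn n x) * cmod (w \<xi>)"])
            show "integrable lborel (\<lambda>x. cmod (hn n x) * cmod (w \<xi>))" using hni[of n] by auto
            show "(\<lambda>x. case (\<xi>, x) of (\<xi>, x) \<Rightarrow> H \<xi> x) \<in> borel_measurable lborel"
              unfolding H_def prod.case by measurable
          qed (simp add: nH)
        qed
        have "(\<lambda>\<xi>. LINT x|lborel. norm (case (\<xi>, x) of (\<xi>, x) \<Rightarrow> H \<xi> x)) = (\<lambda>\<xi>. (LINT x|lborel. cmod (hn n x)) * cmod (gaussian (s *\<^sub>R \<xi>)))"
          by (simp add: nH wg)
        then show "integrable lborel (\<lambda>\<xi>. LINT x|lborel. norm (case (\<xi>, x) of (\<xi>, x) \<Rightarrow> H \<xi> x))"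
          using integrable_norm[OF gs(2)[OF s, of 0]] by simp
      qed
      have Fw: "(LINT x|lborel. H \<xi> x) = F n \<xi> * w \<xi>" for \<xi>
      proof -
        have "F n \<xi> = (LINT x|lborel. hn n x * cis (- (x \<bullet> \<xi>)))"
          unfolding F_def fourier_def by (rule LINT_lborel) measurable
        then show ?thesis by (simp add: H_def)
      qed
      have HK: "(LINT \<xi>|lborel. H \<xi> x) = hn n x * K (x - t)" for x
      proof -
        have "H \<xi> x = hn n x * (gaussian (s *\<^sub>R \<xi>) * cis (- ((x - t) \<bullet> \<xi>)))" for \<xi>
        proof -
          have "cis (- ((x - t) \<bullet> \<xi>)) = cis (- (x \<bullet> \<xi>)) * cis (t \<bullet> \<xi>)"
            by (simp add: cis_mult inner_diff_left)
          then show ?thesis by (simp add: H_def w_def)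
        qed
        then show ?thesis by (simp add: K_def)
      qed
      have "(LINT x|lborel. LINT \<xi>|lborel. H \<xi> x) = (LINT \<xi>|lborel. LINT x|lborel. H \<xi> x)"
        by (rule lborel_pair.Fubini_integral[OF Hi])
      then show "(LINT \<xi>|lborel. F n \<xi> * w \<xi>) = (LINT x|lborel. hn n x * K (x - t))"
        by (simp add: Fw HK)
      show "integrable lborel (\<lambda>\<xi>. F n \<xi> * w \<xi>)"
        using lborel_pair.integrable_fst[OF Hi] by (simp add: Fw)
    qed
    have Fm [measurable]: "F n \<in> borel_measurable borel" for n
    proof -
      have "(\<lambda>\<xi>. LINT x|lborel. hn n x * cis (- (x \<bullet> \<xi>))) \<in> borel_measurable lborel"
        by (rule lborel.borel_measurable_lebesgue_integral) measurable
      moreover have "F n = (\<lambda>\<xi>. LINT x|lborel. hn n x * cis (- (x \<bullet> \<xi>)))"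
        unfolding F_def fourier_def by (rule ext, rule LINT_lborel) measurable
      ultimately show ?thesis by simp
    qed
    have "(\<lambda>n. LINT \<xi>|lborel. F n \<xi> * w \<xi>) \<longlonglongrightarrow> 0"
    proof -
      define W where "W = (\<integral>\<^sup>+\<xi>. (ennreal (cmod (w \<xi>)))\<^sup>2 \<partial>lborel)"
      have "integrable lebesgue (\<lambda>\<xi> :: real ^ 'd. (cmod (gaussian (s *\<^sub>R \<xi>)))\<^sup>2)"
        using L2_funD(2)[OF gs(1)[OF s, of 0]] by simp
      then have "integrable lborel (\<lambda>\<xi> :: real ^ 'd. (cmod (gaussian (s *\<^sub>R \<xi>)))\<^sup>2)"
        by (subst (asm) integrable_lborel) measurable
      then have W: "W < top"
        unfolding W_def wg by (simp add: ennreal_power integrable_iff_bounded top.not_eq_extremum)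
      \<comment> \<open>Cauchy-Schwarz bounds the pairing by the integral that tends to 0. Extended
        integrals are used because square integrability of \<open>F n\<close> has not been
        established.\<close>
      have "ennreal ((cmod (LINT \<xi>|lborel. F n \<xi> * w \<xi>))\<^sup>2) \<le> W * (\<integral>\<^sup>+\<xi>. ennreal ((cmod (F n \<xi>))\<^sup>2) \<partial>lborel)" for n
      proof -
        have "ennreal (cmod (LINT \<xi>|lborel. F n \<xi> * w \<xi>)) \<le> (\<integral>\<^sup>+\<xi>. ennreal (cmod (F n \<xi> * w \<xi>)) \<partial>lborel)"
          by (rule integral_norm_bound_ennreal[OF I(2)])
        also have "\<dots> = (\<integral>\<^sup>+\<xi>. ennreal (cmod (F n \<xi>)) * ennreal (cmod (w \<xi>)) \<partial>lborel)"
          by (simp add: norm_mult ennreal_mult)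
        finally have "(ennreal (cmod (LINT \<xi>|lborel. F n \<xi> * w \<xi>)))\<^sup>2
            \<le> (\<integral>\<^sup>+\<xi>. ennreal (cmod (F n \<xi>)) * ennreal (cmod (w \<xi>)) \<partial>lborel)\<^sup>2"
          by (intro power_mono) auto
        also have "\<dots> \<le> (\<integral>\<^sup>+\<xi>. (ennreal (cmod (F n \<xi>)))\<^sup>2 \<partial>lborel) * W"
          unfolding W_def by (rule Cauchy_Schwarz_nn_integral) measurable
        finally show ?thesis by (simp add: ennreal_power mult.commute)
      qed
      then have le: "\<forall>\<^sub>F n in sequentially. ennreal ((cmod (LINT \<xi>|lborel. F n \<xi> * w \<xi>))\<^sup>2)
          \<le> W * (\<integral>\<^sup>+\<xi>. ennreal ((cmod (F n \<xi>))\<^sup>2) \<partial>lborel)" by (intro always_eventually allI)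
      have lim0: "(\<lambda>n. W * (\<integral>\<^sup>+\<xi>. ennreal ((cmod (F n \<xi>))\<^sup>2) \<partial>lborel)) \<longlonglongrightarrow> W * 0"
        using lim unfolding F_def hn_def by (intro ennreal_tendsto_cmult W)
      have "(\<lambda>n. ennreal ((cmod (LINT \<xi>|lborel. F n \<xi> * w \<xi>))\<^sup>2)) \<longlonglongrightarrow> ennreal 0"
        using tendsto_sandwich[OF _ le tendsto_const[of 0]] lim0 by simp
      then have "(\<lambda>n. (cmod (LINT \<xi>|lborel. F n \<xi> * w \<xi>))\<^sup>2) \<longlonglongrightarrow> 0"
        by (rule tendsto_ennrealD) auto
      then have "(\<lambda>n. sqrt ((cmod (LINT \<xi>|lborel. F n \<xi> * w \<xi>))\<^sup>2)) \<longlonglongrightarrow> sqrt 0"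
        by (rule tendsto_real_sqrt)
      then show ?thesis by (simp add: tendsto_norm_zero_cancel)
    qed
    \<comment> \<open>In space the truncation is removed by dominated convergence; comparing both
      limits of one sequence gives 0.\<close>
    moreover have "(\<lambda>n. LINT x|lborel. hn n x * K (x - t)) \<longlonglongrightarrow> (LINT x|lborel. h x * K (x - t))"
    proof (rule integral_dominated_convergence[where w="\<lambda>x. cmod (h x) * cmod (K (x - t))"])
      have Kx: "K (x - t) = c * gaussian (inverse s *\<^sub>R x - inverse s *\<^sub>R t)" for x
        by (simp add: K scaleR_diff_right)
      have "L2_fun (\<lambda>x. K (x - t))"
        unfolding Kx using s by (intro L2_fun_cmul gs) simp
      from L2_integrable_mult(1)[OF h this]
      have "integrable lebesgue (\<lambda>x. cmod (h x) * cmod (K (x - t)))" .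
      then show "integrable lborel (\<lambda>x. cmod (h x) * cmod (K (x - t)))"
        unfolding Kx by (subst (asm) integrable_lborel) measurable
      show "AE x in lborel. (\<lambda>n. hn n x * K (x - t)) \<longlonglongrightarrow> h x * K (x - t)"
      proof (rule AE_I2)
        fix x :: "real ^ 'd"
        obtain N :: nat where N: "norm x \<le> real N" using real_arch_simple by blast
        have "hn n x = h x" if "n \<ge> N" for n
        proof -
          have "norm x \<le> real n" using N that by (meson of_nat_le_iff order_trans)
          then show ?thesis by (simp add: hn_def)
        qed
        then have "eventually (\<lambda>n. hn n x * K (x - t) = h x * K (x - t)) sequentially"
          by (auto simp: eventually_sequentially)
        then show "(\<lambda>n. hn n x * K (x - t)) \<longlonglongrightarrow> h x * K (x - t)" by (rule tendsto_eventually)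
      qed
      show "AE x in lborel. norm (hn n x * K (x - t)) \<le> cmod (h x) * cmod (K (x - t))" for n
        by (intro AE_I2) (auto simp: hn_def norm_mult indicator_def)
      show "(\<lambda>x. h x * K (x - t)) \<in> borel_measurable lborel"
        "(\<lambda>x. hn n x * K (x - t)) \<in> borel_measurable lborel" for n
        unfolding Kx by measurable
    qed
    ultimately have "(LINT x|lborel. h x * K (x - t)) = 0"
      unfolding I(1) by (rule LIMSEQ_unique[symmetric])
    moreover have "(LINT x|lborel. h x * K (x - t)) = c * (LINT x|lborel. h x * gaussian (inverse s *\<^sub>R x - inverse s *\<^sub>R t))"
      by (simp add: K scaleR_diff_right mult.left_commute)
    ultimately show ?thesis using c by simp
  qed
  \<comment> \<open>The substitution \<open>x = t + s *\<^sub>R y\<close> recentres the average. The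
    double conjugation matches the shape of \<open>approx_identity\<close> for the function
    \<open>cnj (h x)\<close>.\<close>
  have inner0: "(LINT y|lborel. gaussian y * cnj (cnj (h (t + mat s *v y)))) = 0" if s: "s > 0" for s t
  proof -
    let ?f = "\<lambda>x. h x * gaussian (inverse s *\<^sub>R x - inverse s *\<^sub>R t)"
    have d: "det (mat s :: real ^ 'd ^ 'd) \<noteq> 0" using s by (simp add: det_mat_scale)
    have m: "?f \<in> borel_measurable borel" by measurable
    have eq: "(\<lambda>y. ?f (mat s *v y - (- t))) = (\<lambda>y. gaussian y * cnj (cnj (h (t + mat s *v y))))"
      using s by (auto simp: mat_scale scaleR_add_right mult.commute add.commute)
    have "0 = (LINT x|lebesgue. ?f x)" using key[OF s, of t] LINT_lborel[OF m] by simp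
    also have "\<dots> = \<bar>det (mat s :: real ^ 'd ^ 'd)\<bar> *\<^sub>R (LINT y|lebesgue. ?f (mat s *v y - (- t)))"
      by (rule integral_affine[OF d borel_lebesgue[OF m]])
    finally have "(LINT y|lebesgue. gaussian y * cnj (cnj (h (t + mat s *v y)))) = 0"
      using d unfolding eq by simp
    moreover have "(LINT y|lebesgue. gaussian y * cnj (cnj (h (t + mat s *v y))))
        = (LINT y|lborel. gaussian y * cnj (cnj (h (t + mat s *v y))))"
    proof (rule LINT_lborel)
      have "(\<lambda>y. h (t + mat s *v y)) \<in> borel_measurable borel" by measurable
      then show "(\<lambda>y. gaussian y * cnj (cnj (h (t + mat s *v y)))) \<in> borel_measurable borel"
        by simp
    qed
    ultimately show ?thesis by simp
  qed
  have hc: "L2_fun (\<lambda>x. cnj (h x))" "(\<lambda>x. cnj (h x)) \<in> borel_measurable borel"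
  proof -
    show m: "(\<lambda>x. cnj (h x)) \<in> borel_measurable borel" by measurable
    show "L2_fun (\<lambda>x. cnj (h x))"
      by (rule L2_fun_bound[OF borel_lebesgue[OF m] L2_funD(2)[OF h]]) simp
  qed
  have "AE x in lebesgue. cnj (h x) = 0"
  proof (rule L2_zero_if_orthogonal_Cc[OF hc(1)])
    fix f :: "real ^ 'd \<Rightarrow> complex" assume f: "Cc_fun f"
    define B :: "nat \<Rightarrow> real ^ 'd ^ 'd" where "B n = mat (1 / real (Suc n))" for n
    have fL: "L2_fun f" by (rule Cc_fun_integrable[OF f])
    have "(\<lambda>n. B n *v y) \<longlonglongrightarrow> 0" for y
    proof -
      have "(\<lambda>n. (1 / real (Suc n)) *\<^sub>R y) \<longlonglongrightarrow> 0 *\<^sub>R y"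
        by (intro tendsto_intros LIMSEQ_Suc lim_1_over_n)
      then show ?thesis by (simp add: B_def mat_scale)
    qed
    from approx_error_tendsto_0[OF fL gaussian_integrable this]
    have "(\<lambda>n. L2_norm (\<lambda>x. cnj (h x)) * approx_error gaussian f (B n)) \<longlonglongrightarrow> L2_norm (\<lambda>x. cnj (h x)) * 0"
      by (intro tendsto_intros)
    moreover have "cmod ((LINT y|lborel. gaussian (y :: real ^ 'd)) * L2_inner f (\<lambda>x. cnj (h x)))
        \<le> L2_norm (\<lambda>x. cnj (h x)) * approx_error gaussian f (B n)" for n
      using approx_identity[OF fL Cc_fun_borel[OF f] hc gaussian_integrable, of "B n"] inner0[of "1 / real (Suc n)"]
      by (simp add: B_def)
    ultimately have "cmod ((LINT y|lborel. gaussian (y :: real ^ 'd)) * L2_inner f (\<lambda>x. cnj (h x))) \<le> 0"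
      by (intro LIMSEQ_le_const) auto
    then show "L2_inner f (\<lambda>x. cnj (h x)) = 0" using gaussian_integral[where 'd='d] by simp
  qed
  then show ?thesis by simp
qed

text \<open>For large radii truncation leaves \<open>g\<close> unchanged, so the hypothesis says
  that the transforms of the truncations of \<open>f - g\<close> tend to 0. This is the form in
  which \<open>has_fourier_L2\<close> provides it.\<close>

lemma fourier_unique:
  fixes f g :: "real ^ 'd \<Rightarrow> complex"
  assumes f: "L2_fun f" and g: "L2_fun g" and supp: "\<And>x. norm x > R0 \<Longrightarrow> g x = 0"
    and lim: "((\<lambda>R. \<integral>\<^sup>+\<xi>. ennreal ((cmod (fourier (\<lambda>x. indicat_real (cball 0 R) x *\<^sub>R f x) \<xi> - fourier g \<xi>))\<^sup>2) \<partial>lebesgue) \<longlongrightarrow> 0) at_top"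
  shows "AE x in lebesgue. f x = g x"
proof -
  obtain h where h: "h \<in> borel_measurable borel" "L2_fun h" "AE x in lebesgue. f x - g x = h x"
    using L2_borel_rep[OF L2_fun_diff[OF f g]] by blast
  have ic: "integrable lebesgue (\<lambda>x. u x * cis (- (x \<bullet> \<xi>)))" if "integrable lebesgue u" for u :: "real ^ 'd \<Rightarrow> complex" and \<xi>
  proof (rule Bochner_Integration.integrable_bound[OF that])
    have "(\<lambda>x. cis (- (x \<bullet> \<xi>))) \<in> borel_measurable lebesgue"
      by (intro borel_lebesgue borel_measurable_continuous_onI continuous_intros)
    then show "(\<lambda>x. u x * cis (- (x \<bullet> \<xi>))) \<in> borel_measurable lebesgue" using that by auto
  qed (auto simp: norm_mult)
  have eq: "fourier (\<lambda>x. indicat_real (cball 0 R) x *\<^sub>R h x) \<xi>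
      = fourier (\<lambda>x. indicat_real (cball 0 R) x *\<^sub>R f x) \<xi> - fourier g \<xi>" if R: "R \<ge> R0" for R \<xi>
  proof -
    have gR: "indicat_real (cball 0 R) x *\<^sub>R g x = g x" for x
      using supp[of x] R by (cases "norm x > R") (auto simp: indicator_def)
    have gi: "integrable lebesgue g"
      using truncation_integrable(2)[OF g, of R] unfolding gR .
    have "fourier (\<lambda>x. indicat_real (cball 0 R) x *\<^sub>R f x) \<xi> - fourier g \<xi>
        = (LINT x|lebesgue. (indicat_real (cball 0 R) x *\<^sub>R f x) * cis (- (x \<bullet> \<xi>)) - g x * cis (- (x \<bullet> \<xi>)))"
      unfolding fourier_def
      by (rule Bochner_Integration.integral_diff[symmetric]) (intro ic truncation_integrable(2) f gi)+
    also have "\<dots> = (LINT x|lebesgue. (indicat_real (cball 0 R) x *\<^sub>R h x) * cis (- (x \<bullet> \<xi>)))"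
    proof (rule integral_cong_AE)
      show "AE x in lebesgue. (indicat_real (cball 0 R) x *\<^sub>R f x) * cis (- (x \<bullet> \<xi>)) - g x * cis (- (x \<bullet> \<xi>))
          = (indicat_real (cball 0 R) x *\<^sub>R h x) * cis (- (x \<bullet> \<xi>))"
        using h(3)
      proof eventually_elim
        fix x assume "f x - g x = h x"
        then have "indicat_real (cball 0 R) x *\<^sub>R h x = indicat_real (cball 0 R) x *\<^sub>R f x - g x"
          using gR[of x] by (metis scaleR_diff_right)
        then show "(indicat_real (cball 0 R) x *\<^sub>R f x) * cis (- (x \<bullet> \<xi>)) - g x * cis (- (x \<bullet> \<xi>))
          = (indicat_real (cball 0 R) x *\<^sub>R h x) * cis (- (x \<bullet> \<xi>))"
          by (simp add: left_diff_distrib)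
      qed
    qed (use ic[OF truncation_integrable(2)[OF f]] ic[OF gi] ic[OF truncation_integrable(2)[OF h(2)]] in auto)
    finally show ?thesis by (simp add: fourier_def)
  qed
  let ?a = "\<lambda>R. \<integral>\<^sup>+\<xi>. ennreal ((cmod (fourier (\<lambda>x. indicat_real (cball 0 R) x *\<^sub>R h x) \<xi>))\<^sup>2) \<partial>lborel"
  have "eventually (\<lambda>R. (\<integral>\<^sup>+\<xi>. ennreal ((cmod (fourier (\<lambda>x. indicat_real (cball 0 R) x *\<^sub>R f x) \<xi> - fourier g \<xi>))\<^sup>2) \<partial>lebesgue) = ?a R) at_top"
    using eventually_ge_at_top[of R0] by eventually_elim (simp add: eq nn_integral_completion)
  then have "(?a \<longlongrightarrow> 0) at_top" using lim by (rule Lim_transform_eventually[rotated])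
  then have "(\<lambda>n. ?a (real n)) \<longlonglongrightarrow> 0"
    by (rule filterlim_compose[OF _ filterlim_real_sequentially])
  from fourier_zero[OF h(2,1) this] h(3) show ?thesis
    by eventually_elim simp
qed

section \<open>Finite linear combinations\<close>

text \<open>Written as a pairing, with two conjugations that cancel, so that the algebra of
  \<open>ips\<close> applies at each point \<open>x\<close>.\<close>

definition lc :: "('k \<Rightarrow> complex) \<Rightarrow> ('k \<Rightarrow> real ^ 'd \<Rightarrow> complex) \<Rightarrow> real ^ 'd \<Rightarrow> complex" where
  "lc u e x = ips u (\<lambda>\<kappa>. cnj (e \<kappa> x))"

lemma lc_eq:
  assumes "finite S" "\<And>\<kappa>. \<kappa> \<notin> S \<Longrightarrow> u \<kappa> = 0"
  shows "lc u e = (\<lambda>x. \<Sum>\<kappa>\<in>S. u \<kappa> * e \<kappa> x)"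
  using assms by (auto simp: lc_def ips_eq[OF assms])

lemma fsupp_lcE:
  assumes "fsupp u"
  obtains S where "finite S" "\<And>\<kappa>. \<kappa> \<notin> S \<Longrightarrow> u \<kappa> = 0" "\<And>e. lc u e = (\<lambda>x. \<Sum>\<kappa>\<in>S. u \<kappa> * e \<kappa> x)"
    "nsq u = (\<Sum>\<kappa>\<in>S. (cmod (u \<kappa>))\<^sup>2)"
proof -
  obtain S where S: "finite S" "\<And>k. k \<notin> S \<Longrightarrow> u k = 0" using fsuppE[OF assms] by blast
  show ?thesis using that[OF S] S by (simp add: lc_eq nsq_eq)
qed

lemma lc_L2:
  assumes "fsupp u" "\<And>\<kappa>. L2_fun (e \<kappa>)"
  shows "L2_fun (lc u e)"
proof -
  obtain S where lcS: "lc u e = (\<lambda>x. \<Sum>\<kappa>\<in>S. u \<kappa> * e \<kappa> x)" using fsupp_lcE[OF assms(1)] by metis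
  show ?thesis unfolding lcS by (intro L2_fun_sum L2_fun_cmul assms)
qed

lemma lc_restrict:
  assumes "finite I"
  shows "lc (\<lambda>i. if i \<in> I then c i else 0) e = (\<lambda>x. \<Sum>i\<in>I. c i * e i x)"
    "fsupp (\<lambda>i. if i \<in> I then c i else 0)" "nsq (\<lambda>i. if i \<in> I then c i else 0) = (\<Sum>i\<in>I. (cmod (c i))\<^sup>2)"
proof -
  show "lc (\<lambda>i. if i \<in> I then c i else 0) e = (\<lambda>x. \<Sum>i\<in>I. c i * e i x)"
    by (subst lc_eq[OF assms]) (auto intro!: sum.cong)
  show "fsupp (\<lambda>i. if i \<in> I then c i else 0)" by (rule fsuppI[OF assms]) simp
  show "nsq (\<lambda>i. if i \<in> I then c i else 0) = (\<Sum>i\<in>I. (cmod (c i))\<^sup>2)"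
    by (subst nsq_eq[OF assms]) (auto intro!: sum.cong)
qed

lemma lc_inner:
  assumes u: "fsupp u" "fsupp v" and e: "\<And>\<kappa>. L2_fun (e \<kappa>)" "\<And>\<kappa>. L2_fun (e' \<kappa>)"
    and bi: "\<And>\<kappa> \<kappa>'. L2_inner (e \<kappa>) (e' \<kappa>') = (if \<kappa> = \<kappa>' then 1 else 0)"
  shows "L2_inner (lc u e) (lc v e') = ips u v"
proof -
  obtain S where S: "finite S" "\<And>\<kappa>. \<kappa> \<notin> S \<Longrightarrow> u \<kappa> = 0" and lcS: "lc u e = (\<lambda>x. \<Sum>\<kappa>\<in>S. u \<kappa> * e \<kappa> x)"
    using fsupp_lcE[OF u(1)] by metis
  obtain T where T: "finite T" "\<And>\<kappa>. \<kappa> \<notin> T \<Longrightarrow> v \<kappa> = 0" and lcT: "lc v e' = (\<lambda>x. \<Sum>\<kappa>\<in>T. v \<kappa> * e' \<kappa> x)"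
    using fsupp_lcE[OF u(2)] by metis
  have vL: "L2_fun (lc v e')" by (rule lc_L2[OF u(2) e(2)])
  have "L2_inner (lc u e) (lc v e') = (\<Sum>\<kappa>\<in>S. u \<kappa> * L2_inner (e \<kappa>) (lc v e'))"
    unfolding lcS by (rule L2_inner_sum_left[OF e(1) vL])
  also have "\<dots> = (\<Sum>\<kappa>\<in>S. u \<kappa> * cnj (v \<kappa>))"
  proof (intro sum.cong refl)
    fix \<kappa>
    have "L2_inner (e \<kappa>) (lc v e') = (\<Sum>\<kappa>'\<in>T. cnj (v \<kappa>') * L2_inner (e \<kappa>) (e' \<kappa>'))"
      unfolding lcT by (rule L2_inner_sum_right[OF e(2) e(1)])
    also have "\<dots> = (\<Sum>\<kappa>'\<in>T. if \<kappa> = \<kappa>' then cnj (v \<kappa>') else 0)" by (intro sum.cong refl) (simp add: bi)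
    also have "\<dots> = cnj (v \<kappa>)" using T by simp
    finally show "u \<kappa> * L2_inner (e \<kappa>) (lc v e') = u \<kappa> * cnj (v \<kappa>)" by simp
  qed
  also have "\<dots> = ips u v" using ips_eq[of S u, OF S] by simp
  finally show ?thesis .
qed

text \<open>Adjointness, applied to the values of the functions at one point.\<close>

lemma lc_syn:
  assumes "loc_fin E" "fsupp w"
  shows "lc (syn E w) e = lc w (\<lambda>i. lc (E i) e)"
proof
  fix x
  have "ana E (\<lambda>\<kappa>. cnj (e \<kappa> x)) i = cnj (lc (E i) e x)" for i
    by (simp add: ana_def lc_def ips_def cnj_Sum_any mult.commute)
  then have "ana E (\<lambda>\<kappa>. cnj (e \<kappa> x)) = (\<lambda>i. cnj (lc (E i) e x))" by (rule ext)
  then show "lc (syn E w) e x = lc w (\<lambda>i. lc (E i) e) x"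
    unfolding lc_def[of "syn E w"] lc_def[of w] ips_syn[OF assms] by simp
qed

lemma lc_comb:
  assumes "fsupp u" "fsupp h"
  shows "lc (comb u h) G x = lc u (\<lambda>(q, k). G (Inr q, k)) x + lc h (\<lambda>(l, k). G (Inl l, k)) x"
proof -
  have "(\<lambda>i. cnj (G i x)) = comb (\<lambda>(q, k). cnj (G (Inr q, k) x)) (\<lambda>(l, k). cnj (G (Inl l, k) x))"
    by (auto simp: comb_def split: sum.split)
  then show ?thesis by (simp add: lc_def ips_comb[OF assms] case_prod_beta')
qed

lemma lc_cong_ae:
  assumes "fsupp u" "\<And>\<kappa>. AE x in lebesgue. e \<kappa> x = e' \<kappa> x"
  shows "AE x in lebesgue. lc u e x = lc u e' x"
proof -
  obtain S where S: "finite S" "\<And>\<kappa>. \<kappa> \<notin> S \<Longrightarrow> u \<kappa> = 0" using fsuppE[OF assms(1)] by blast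
  have "AE x in lebesgue. \<forall>\<kappa>\<in>S. e \<kappa> x = e' \<kappa> x"
    using S(1) assms(2) by (intro AE_finite_allI) auto
  then show ?thesis by eventually_elim (simp add: lc_eq[of S u] S)
qed

section \<open>Refinable functions and their affine systems\<close>

text \<open>The generators are Borel representatives that vanish at every point outside a ball. The
  refinement equation stays almost everywhere, which finite combinations respect, and is assumed for
  the unshifted generators; translation gives the others.\<close>

locale refinable = filters M0 M b0 b
  for M0 :: "int ^ 'd ^ 'd" and M :: "'s :: finite \<Rightarrow> int ^ 'd ^ 'd"
    and b0 :: "int ^ 'd \<Rightarrow> complex ^ 'r ^ 'r" and b :: "'s \<Rightarrow> int ^ 'd \<Rightarrow> complex ^ 'r ^ 1" +
  fixes \<phi> :: "'r \<Rightarrow> real ^ 'd \<Rightarrow> complex" and R :: real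
  assumes phi_L2: "\<And>q. L2_fun (\<phi> q)" and phi_borel: "\<And>q. \<phi> q \<in> borel_measurable borel"
    and phi_supp: "\<And>q x. norm x > R \<Longrightarrow> \<phi> q x = 0"
    and refine0: "\<And>q. AE x in lebesgue.
      \<phi> q x = lc (E (Inr q, 0)) (\<lambda>\<kappa>. dilate_shift (rmat M0) 0 (shifts \<phi> \<kappa>)) x"
begin

definition Dj :: "nat \<Rightarrow> (real ^ 'd \<Rightarrow> complex) \<Rightarrow> real ^ 'd \<Rightarrow> complex" where
  "Dj j = dilate_shift (mat_pow (rmat M0) j) 0"

definition Lv :: "nat \<Rightarrow> 'r \<times> (int ^ 'd) \<Rightarrow> real ^ 'd \<Rightarrow> complex" where
  "Lv j \<kappa> = Dj j (shifts \<phi> \<kappa>)"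

text \<open>The wavelets of scale 0 (\<open>Inl\<close>) and the shifts in refined form
  (\<open>Inr\<close>), indexed like the rows of \<open>E\<close>.\<close>

definition el :: "('s + 'r) \<times> (int ^ 'd) \<Rightarrow> real ^ 'd \<Rightarrow> complex" where
  "el i = lc (E i) (Lv 1)"

text \<open>Built from filter coefficients, so that every wavelet is by definition a finite
  combination of functions of one level. It agrees with \<open>affine_system\<close> almost
  everywhere, by \<open>refinable_representative\<close>.\<close>

definition AS :: "('s, 'r, int ^ 'd) aindex \<Rightarrow> real ^ 'd \<Rightarrow> complex" where
  "AS i = (case i of Inl \<kappa> \<Rightarrow> shifts \<phi> \<kappa> | Inr (l, j, k) \<Rightarrow> Dj j (el (Inl l, k)))"

lemma AS_simps: "AS (Inl \<kappa>) = shifts \<phi> \<kappa>" "AS (Inr (l, j, k)) = Dj j (el (Inl l, k))"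
  by (auto simp: AS_def)

lemma det_pow: "det (mat_pow (rmat M0) j) \<noteq> 0"
  by (simp add: det_mat_pow det_M0)

lemma Dj_0: "Dj 0 f = f"
  by (simp add: Dj_def mat_pow_0 dilate_shift_1)

lemma Dj_L2: "L2_fun f \<Longrightarrow> L2_fun (Dj j f)"
  unfolding Dj_def by (rule L2_fun_dilate_shift[OF det_pow])

lemma Dj_inner: "L2_fun f \<Longrightarrow> L2_fun g \<Longrightarrow> L2_inner (Dj j f) (Dj j g) = L2_inner f g"
  unfolding Dj_def by (rule L2_inner_dilate_shift[OF det_pow])

lemma Dj_norm: "L2_fun f \<Longrightarrow> L2_norm (Dj j f) = L2_norm f"
  unfolding Dj_def by (rule L2_norm_dilate_shift[OF det_pow])

lemma Dj_Dj: "Dj i (Dj j f) = Dj (j + i) f"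
  by (auto simp: Dj_def dilate_shift_def mat_pow_add det_mul abs_mult real_sqrt_mult matrix_vector_mul_assoc mult.commute)

lemma Dj_lc: "fsupp u \<Longrightarrow> Dj j (lc u e) = lc u (\<lambda>\<kappa>. Dj j (e \<kappa>))"
proof -
  assume "fsupp u"
  then obtain S where S: "finite S" "\<And>\<kappa>. \<kappa> \<notin> S \<Longrightarrow> u \<kappa> = 0" using fsuppE by blast
  show ?thesis
    by (rule ext) (use S in \<open>simp add: lc_eq Dj_def dilate_shift_def scaleR_sum_right\<close>)
qed

lemma Dj_ae: "AE x in lebesgue. f x = g x \<Longrightarrow> AE x in lebesgue. Dj j f x = Dj j g x"
proof -
  assume "AE x in lebesgue. f x = g x"
  from AE_affine[OF det_pow this, of j 0] show "AE x in lebesgue. Dj j f x = Dj j g x"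
    unfolding Dj_def dilate_shift_def by eventually_elim simp
qed

lemma shifts_L2: "L2_fun (shifts \<phi> \<kappa>)"
  by (cases \<kappa>) (simp add: shifts_def L2_translate phi_L2)

lemma Lv_L2: "L2_fun (Lv j \<kappa>)"
  unfolding Lv_def by (rule Dj_L2[OF shifts_L2])

lemma Lv_0: "Lv 0 = shifts \<phi>"
  by (rule ext) (simp add: Lv_def Dj_0)

lemma Dj_Lv: "Dj i (Lv j \<kappa>) = Lv (j + i) \<kappa>"
  by (simp add: Lv_def Dj_Dj)

lemma fsupp_E: "fsupp (E i)"
  using loc_fin unfolding loc_fin_def fsupp_def by blast

lemma el_L2: "L2_fun (el i)"
  unfolding el_def by (rule lc_L2[OF fsupp_E Lv_L2])

lemma AS_L2: "L2_fun (AS i)"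
  by (auto simp: AS_def shifts_L2 Dj_L2 el_L2 split: sum.split prod.split)

lemma AS_Inr: "AS (Inr (l, j, k)) = lc (E (Inl l, k)) (Lv (Suc j))"
  by (simp add: AS_simps el_def Dj_lc[OF fsupp_E] Dj_Lv)

lemma Lv_apply: "Lv j (q, k) x = sqrt \<bar>det (mat_pow (rmat M0) j)\<bar> *\<^sub>R \<phi> q (mat_pow (rmat M0) j *v x - rvec k)"
  by (simp add: Lv_def Dj_def dilate_shift_def shifts_def)

text \<open>A translation that becomes integral at level \<open>j\<close> permutes the functions of
  that level, hence it only moves coefficients.\<close>

lemma translate_lc_Lv:
  assumes "fsupp u" and t: "mat_pow (rmat M0) j *v t = rvec m"
  shows "lc u (Lv j) (x - t) = lc (\<lambda>(p, n). u (p, n - m)) (Lv j) x"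
proof -
  obtain S where S: "finite S" "\<And>\<kappa>. \<kappa> \<notin> S \<Longrightarrow> u \<kappa> = 0" using fsuppE[OF assms(1)] by blast
  let ?h = "\<lambda>(p, n). (p, n + m)"
  have inj: "inj_on ?h S" by (auto simp: inj_on_def)
  have 0: "(case \<kappa> of (p, n) \<Rightarrow> u (p, n - m)) = 0" if "\<kappa> \<notin> ?h ` S" for \<kappa>
  proof -
    obtain p n where \<kappa>: "\<kappa> = (p, n)" by (cases \<kappa>)
    have "(p, n - m) \<notin> S"
    proof
      assume "(p, n - m) \<in> S"
      then have "?h (p, n - m) \<in> ?h ` S" by (rule imageI)
      then show False using that \<kappa> by simp
    qed
    then show ?thesis using S(2) \<kappa> by simp
  qed
  have "lc (\<lambda>(p, n). u (p, n - m)) (Lv j) x = (\<Sum>\<kappa>\<in>?h ` S. (case \<kappa> of (p, n) \<Rightarrow> u (p, n - m)) * Lv j \<kappa> x)"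
    by (subst lc_eq[of "?h ` S"]) (use S 0 in auto)
  also have "\<dots> = (\<Sum>\<kappa>\<in>S. u \<kappa> * Lv j \<kappa> (x - t))"
    unfolding sum.reindex[OF inj]
    by (intro sum.cong refl) (auto simp: Lv_apply matrix_vector_mult_diff_distrib t rvec_simps algebra_simps)
  also have "\<dots> = lc u (Lv j) (x - t)" using S by (simp add: lc_eq)
  finally show ?thesis ..
qed

lemma refine1: "AE x in lebesgue. shifts \<phi> (q, k) x = el (Inr q, k) x"
proof -
  have L1: "Lv 1 = (\<lambda>\<kappa>. dilate_shift (rmat M0) 0 (shifts \<phi> \<kappa>))"
    by (rule ext) (simp add: Lv_def Dj_def mat_pow_def)
  have "AE x in lebesgue. \<phi> q x = lc (E (Inr q, 0)) (Lv 1) x"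
    unfolding L1 by (rule refine0)
  from AE_affine[of "mat 1", OF _ this, of "rvec k"]
  have "AE x in lebesgue. \<phi> q (x - rvec k) = lc (E (Inr q, 0)) (Lv 1) (x - rvec k)" by simp
  moreover have "lc (E (Inr q, 0)) (Lv 1) (x - rvec k) = el (Inr q, k) x" for x
  proof -
    have "mat_pow (rmat M0) 1 *v rvec k = rvec (M0 *v k)"
      by (simp add: mat_pow_def rmat_mult_rvec)
    from translate_lc_Lv[OF fsupp_E this] 
    have "lc (E (Inr q, 0)) (Lv 1) (x - rvec k) = lc (\<lambda>(p, n). E (Inr q, 0) (p, n - M0 *v k)) (Lv 1) x" .
    also have "(\<lambda>(p, n). E (Inr q, 0) (p, n - M0 *v k)) = E (Inr q, k)"
      by (auto simp: E_def fcoef_def dil_def fil_def)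
    finally show ?thesis by (simp add: el_def)
  qed
  ultimately show ?thesis by (simp add: shifts_def)
qed

lemma refine: "AE x in lebesgue. Lv j (q, k) x = lc (E (Inr q, k)) (Lv (Suc j)) x"
  using Dj_ae[OF refine1[of q k], of j]
  by (simp add: Lv_def[symmetric] el_def Dj_lc[OF fsupp_E] Dj_Lv)

text \<open>One synthesis step refines the combination of level \<open>J\<close> and adds the
  details of scale \<open>J\<close>; summing these steps gives the affine combination.\<close>

lemma lc_lev_aux:
  assumes "fsupp c"
  shows "AE x in lebesgue. lc (lev E c J) (Lv J) x
    = lc (\<lambda>\<kappa>. c (Inl \<kappa>)) (\<lambda>\<kappa>. AS (Inl \<kappa>)) x + (\<Sum>j<J. lc (detail c j) (\<lambda>(l, k). AS (Inr (l, j, k))) x)"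
proof (induction J)
  case 0
  then show ?case by (simp add: AS_simps Lv_0)
next
  case (Suc J)
  have f: "fsupp (lev E c J)" "fsupp (detail c J)"
    using assms loc_fin by (auto intro: fsupp_lev fsupp_detail)
  have eq: "lc (lev E c (Suc J)) (Lv (Suc J)) x
      = lc (lev E c J) (\<lambda>(q, k). lc (E (Inr q, k)) (Lv (Suc J))) x + lc (detail c J) (\<lambda>(l, k). AS (Inr (l, J, k))) x" for x
    by (simp only: lev.simps lc_syn[OF loc_fin fsupp_comb[OF f]] lc_comb[OF f] AS_Inr)
  have "AE x in lebesgue. lc (lev E c J) (Lv J) x = lc (lev E c J) (\<lambda>(q, k). lc (E (Inr q, k)) (Lv (Suc J))) x"
    by (rule lc_cong_ae[OF f(1)]) (auto intro: refine split: prod.split)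
  then show ?case using Suc by eventually_elim (simp add: eq del: lev.simps)
qed

lemma lc_lev:
  assumes "fsupp c" "\<And>l j k. j \<ge> J \<Longrightarrow> c (Inr (l, j, k)) = 0"
  shows "AE x in lebesgue. lc (lev E c J) (Lv J) x = lc c AS x"
proof -
  have "lc c AS x = lc (\<lambda>\<kappa>. c (Inl \<kappa>)) (\<lambda>\<kappa>. AS (Inl \<kappa>)) x + (\<Sum>j<J. lc (detail c j) (\<lambda>(l, k). AS (Inr (l, j, k))) x)" for x
  proof -
    have "detail (\<lambda>i. cnj (AS i x)) j = (\<lambda>\<kappa>. cnj ((case \<kappa> of (l, k) \<Rightarrow> AS (Inr (l, j, k))) x))" for j
      by (auto simp: detail_def)
    then show ?thesis using ips_aindex[of c J "\<lambda>i. cnj (AS i x)", OF assms] by (simp add: lc_def)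
  qed
  then show ?thesis using lc_lev_aux[OF assms(1), of J] by simp
qed

text \<open>Dilations are unitary, so the constant of level 0 serves every level.\<close>

lemma bessel_Lv: "\<exists>B>0. \<forall>J u. fsupp u \<longrightarrow> (L2_norm (lc u (Lv J)))\<^sup>2 \<le> B * nsq u"
proof -
  obtain B where B: "B > 0" "\<And>S u. finite S \<Longrightarrow>
      (L2_norm (\<lambda>x. \<Sum>\<kappa>\<in>S. u \<kappa> * shifts \<phi> \<kappa> x))\<^sup>2 \<le> B * (\<Sum>\<kappa>\<in>S. (cmod (u \<kappa>))\<^sup>2)"
    using bessel_shifts[of \<phi> R, OF phi_L2 phi_supp] by blast
  have "(L2_norm (lc u (Lv J)))\<^sup>2 \<le> B * nsq u" if u: "fsupp u" for u J
  proof -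
    obtain S where S: "finite S" "\<And>\<kappa>. \<kappa> \<notin> S \<Longrightarrow> u \<kappa> = 0" using fsuppE[OF u] by blast
    have "lc u (Lv J) = Dj J (lc u (shifts \<phi>))"
      by (simp add: Dj_lc[OF u] Lv_def[abs_def])
    then have "L2_norm (lc u (Lv J)) = L2_norm (lc u (shifts \<phi>))"
      by (simp add: Dj_norm lc_L2[OF u shifts_L2])
    then show ?thesis
      using B(2)[OF S(1), of u] using S by (simp add: lc_eq nsq_eq)
  qed
  with B(1) show ?thesis by blast
qed

end

section \<open>Density of the multiresolution spaces\<close>

text \<open>Compares \<open>x0\<close> with the competitors \<open>x0 + c * y\<close>; an exact
  minimiser need not exist in \<open>X\<close>. Closure is asked for up to null sets because
  combinations of different levels can be added only after refining them almost everywhere.\<close>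

lemma near_orthogonal:
  fixes f :: "real ^ 'd \<Rightarrow> complex"
  assumes XL: "\<And>x. x \<in> X \<Longrightarrow> L2_fun x"
    and cl: "\<And>x y c. x \<in> X \<Longrightarrow> y \<in> X \<Longrightarrow> \<exists>z\<in>X. AE t in lebesgue. z t = x t + c * y t"
    and f: "L2_fun f" and d: "\<And>x. x \<in> X \<Longrightarrow> d \<le> (L2_norm (\<lambda>t. f t - x t))\<^sup>2"
    and x0: "x0 \<in> X" "(L2_norm (\<lambda>t. f t - x0 t))\<^sup>2 \<le> d + \<eta>" and y: "y \<in> X" and "\<eta> \<ge> 0"
  shows "cmod (L2_inner y (\<lambda>t. f t - x0 t)) \<le> sqrt \<eta> * L2_norm y"
proof -
  let ?g = "\<lambda>t. f t - x0 t"
  have gL: "L2_fun ?g" by (intro L2_fun_diff f XL x0)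
  have yL: "L2_fun y" by (rule XL[OF y])
  show ?thesis
  proof (cases "L2_norm y = 0")
    case True
    then show ?thesis using L2_cauchy_schwarz[OF yL gL] by simp
  next
    case False
    define N where "N = (L2_norm y)\<^sup>2"
    have N: "N > 0" using False by (simp add: N_def)
    define p where "p = L2_inner ?g y"
    \<comment> \<open>The coefficient of the orthogonal projection of the remainder onto
      \<open>y\<close>, which lowers the distance most.\<close>
    define c where "c = p / of_real N"
    obtain z where z: "z \<in> X" "AE t in lebesgue. z t = x0 t + c * y t" using cl[OF x0(1) y] by blast
    have cyL: "L2_fun (\<lambda>t. - (c * y t))" by (intro L2_fun_uminus L2_fun_cmul yL)
    have zae: "AE t in lebesgue. f t - z t = ?g t + - (c * y t)"
      using z(2) by eventually_elim (simp add: algebra_simps)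
    have "d \<le> (L2_norm (\<lambda>t. f t - z t))\<^sup>2" by (rule d[OF z(1)])
    also have "L2_norm (\<lambda>t. f t - z t) = L2_norm (\<lambda>t. ?g t + - (c * y t))"
      by (rule L2_norm_cong_ae[OF L2_funD(1)[OF L2_fun_diff[OF f XL[OF z(1)]]] zae])
    also have "(L2_norm (\<lambda>t. ?g t + - (c * y t)))\<^sup>2
        = (L2_norm ?g)\<^sup>2 + (L2_norm (\<lambda>t. - (c * y t)))\<^sup>2 + 2 * Re (L2_inner ?g (\<lambda>t. - (c * y t)))"
      by (rule L2_norm_add_sq[OF gL cyL])
    also have "L2_norm (\<lambda>t. - (c * y t)) = cmod c * L2_norm y"
      using L2_norm_cmul[of "- c" y] by simp
    also have "L2_inner ?g (\<lambda>t. - (c * y t)) = - (cnj c * p)"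
    proof -
      have "L2_inner ?g (\<lambda>t. (- c) * y t) = cnj (L2_inner (\<lambda>t. (- c) * y t) ?g)" by (rule L2_inner_commute)
      also have "\<dots> = cnj (- c * L2_inner y ?g)" by (simp only: L2_inner_cmul_left)
      also have "\<dots> = - (cnj c * p)" by (simp add: p_def L2_inner_commute[of ?g y])
      finally show ?thesis by simp
    qed
    also have "cnj c * p = of_real ((cmod p)\<^sup>2 / N)"
      by (simp only: c_def complex_cnj_divide complex_cnj_complex_of_real times_divide_eq_left times_divide_eq_right of_real_divide
          complex_norm_square mult.commute)
    also have "(cmod c * L2_norm y)\<^sup>2 = (cmod p)\<^sup>2 / N"
    proof -
      have "(cmod c * L2_norm y)\<^sup>2 = (cmod p / N)\<^sup>2 * N"
      proof -
        have "cmod c = cmod p / N" using N by (simp add: c_def norm_divide)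
        then show ?thesis by (simp only: power_mult_distrib N_def[symmetric])
      qed
      then show ?thesis using N by (simp add: power2_eq_square)
    qed
    finally have "d \<le> (L2_norm ?g)\<^sup>2 - (cmod p)\<^sup>2 / N" by simp
    then have "(cmod p)\<^sup>2 / N \<le> \<eta>" using x0(2) by linarith
    then have "(cmod p)\<^sup>2 \<le> \<eta> * N" using N by (simp add: field_simps)
    also have "\<dots> = (sqrt \<eta> * L2_norm y)\<^sup>2" using \<open>\<eta> \<ge> 0\<close> by (simp add: N_def power_mult_distrib)
    finally have "cmod p \<le> sqrt \<eta> * L2_norm y" by (rule power2_le_imp_le) (simp add: \<open>\<eta> \<ge> 0\<close>)
    moreover have "cmod (L2_inner y ?g) = cmod p" by (simp add: p_def L2_inner_commute[of y ?g])
    ultimately show ?thesis by simp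
  qed
qed

lemma lc_lin:
  assumes "fsupp u" "fsupp v"
  shows "fsupp (\<lambda>\<kappa>. u \<kappa> + c * v \<kappa>)" "lc (\<lambda>\<kappa>. u \<kappa> + c * v \<kappa>) e x = lc u e x + c * lc v e x"
proof -
  obtain S where S: "finite S" "\<And>\<kappa>. \<kappa> \<notin> S \<Longrightarrow> u \<kappa> = 0" using fsuppE[OF assms(1)] by metis
  obtain T where T: "finite T" "\<And>\<kappa>. \<kappa> \<notin> T \<Longrightarrow> v \<kappa> = 0" using fsuppE[OF assms(2)] by metis
  have fin: "finite (S \<union> T)" using S T by simp
  show "fsupp (\<lambda>\<kappa>. u \<kappa> + c * v \<kappa>)" by (rule fsuppI[OF fin]) (use S T in auto)
  have "lc w e x = (\<Sum>\<kappa>\<in>S \<union> T. w \<kappa> * e \<kappa> x)" if "\<And>\<kappa>. \<kappa> \<notin> S \<union> T \<Longrightarrow> w \<kappa> = 0" for w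
    using lc_eq[of "S \<union> T" w e] fin that by simp
  then show "lc (\<lambda>\<kappa>. u \<kappa> + c * v \<kappa>) e x = lc u e x + c * lc v e x"
    using S T by (simp add: distrib_right sum.distrib sum_distrib_left mult.assoc)
qed

section \<open>The union of the level spaces\<close>

context refinable
begin

definition X :: "(real ^ 'd \<Rightarrow> complex) set" where
  "X = {lc u (Lv J) | u J. fsupp u}"

text \<open>Refining is synthesis with zero details.\<close>

lemma raise_level:
  assumes "fsupp u"
  shows "\<exists>u'. fsupp u' \<and> (AE x in lebesgue. lc u (Lv J) x = lc u' (Lv (J + n)) x)"
proof (induction n)
  case 0
  show ?case using assms by (intro exI[of _ u]) simp
next
  case (Suc n)
  then obtain u' where u': "fsupp u'" "AE x in lebesgue. lc u (Lv J) x = lc u' (Lv (J + n)) x" by blast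
  define w where "w = comb u' (\<lambda>_ :: 's \<times> (int ^ 'd). 0)"
  have f0: "fsupp (\<lambda>_ :: 's \<times> (int ^ 'd). 0)" by (simp add: fsupp_def)
  have w: "fsupp w" unfolding w_def by (rule fsupp_comb[OF u'(1) f0])
  have eq: "lc (syn E w) (Lv (Suc (J + n))) x = lc u' (\<lambda>(q, k). lc (E (Inr q, k)) (Lv (Suc (J + n)))) x" for x
  proof -
    have "lc (\<lambda>_ :: 's \<times> (int ^ 'd). 0) e x = 0" for e by (simp add: lc_def ips_def)
    then show ?thesis
      using lc_comb[OF u'(1) f0, of "\<lambda>i. lc (E i) (Lv (Suc (J + n)))" x]
      unfolding lc_syn[OF loc_fin w] unfolding w_def by simp
  qed
  have "AE x in lebesgue. lc u' (Lv (J + n)) x = lc u' (\<lambda>(q, k). lc (E (Inr q, k)) (Lv (Suc (J + n)))) x"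
    by (rule lc_cong_ae[OF u'(1)]) (auto intro: refine split: prod.split)
  with u'(2) have "AE x in lebesgue. lc u (Lv J) x = lc (syn E w) (Lv (J + Suc n)) x"
    by eventually_elim (simp add: eq)
  then show ?case using fsupp_syn[OF loc_fin w] by blast
qed

lemma X_L2: "x \<in> X \<Longrightarrow> L2_fun x"
  by (auto simp: X_def intro: lc_L2 Lv_L2)

lemma X_lin:
  assumes "x \<in> X" "y \<in> X"
  shows "\<exists>z\<in>X. AE t in lebesgue. z t = x t + c * y t"
proof -
  obtain u J where x: "x = lc u (Lv J)" "fsupp u" using assms(1) by (auto simp: X_def)
  obtain v K where y: "y = lc v (Lv K)" "fsupp v" using assms(2) by (auto simp: X_def)
  obtain u' where u': "fsupp u'" "AE t in lebesgue. x t = lc u' (Lv (J + K)) t"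
    using raise_level[OF x(2), of J K] by (auto simp: x)
  obtain v' where v': "fsupp v'" "AE t in lebesgue. y t = lc v' (Lv (J + K)) t"
    using raise_level[OF y(2), of K J] by (auto simp: y add.commute)
  have "lc (\<lambda>\<kappa>. u' \<kappa> + c * v' \<kappa>) (Lv (J + K)) \<in> X"
    using lc_lin(1)[OF u'(1) v'(1)] by (auto simp: X_def)
  moreover have "AE t in lebesgue. lc (\<lambda>\<kappa>. u' \<kappa> + c * v' \<kappa>) (Lv (J + K)) t = x t + c * y t"
    using u'(2) v'(2) by eventually_elim (simp add: lc_lin[OF u'(1) v'(1)])
  ultimately show ?thesis by blast
qed

definition invM :: "real ^ 'd ^ 'd" where "invM = matrix_inv (rmat M0)"

lemma invM: "rmat M0 *v (invM *v x) = x" "invM *v (rmat M0 *v x) = x"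
  using matrix_inv_mult[OF det_M0] by (simp_all add: invM_def matrix_vector_mul_assoc)

lemma mat_pow_invM: "mat_pow (rmat M0) n *v (mat_pow invM n *v x) = x"
  "mat_pow invM n *v (mat_pow (rmat M0) n *v x) = x"
proof -
  have "mat_pow (rmat M0) n *v (mat_pow invM n *v x) = x \<and> mat_pow invM n *v (mat_pow (rmat M0) n *v x) = x" for x
  proof (induction n arbitrary: x)
    case (Suc n)
    have "mat_pow (rmat M0) (Suc n) *v (mat_pow invM (Suc n) *v x) = x"
      unfolding mat_pow_Suc'[of "rmat M0"] mat_pow_Suc[of invM] by (simp add: matrix_vector_mul_assoc[symmetric] invM Suc)
    moreover have "mat_pow invM (Suc n) *v (mat_pow (rmat M0) (Suc n) *v x) = x"
      unfolding mat_pow_Suc[of "rmat M0"] mat_pow_Suc'[of invM] by (simp add: matrix_vector_mul_assoc[symmetric] invM Suc)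
    ultimately show ?case by simp
  qed (simp add: mat_pow_0)
  then show "mat_pow (rmat M0) n *v (mat_pow invM n *v x) = x" "mat_pow invM n *v (mat_pow (rmat M0) n *v x) = x"
    by auto
qed

text \<open>Raised to level \<open>m\<close>, a function of level \<open>n\<close> can be translated
  along the lattice of level \<open>m\<close> without leaving \<open>X\<close>.\<close>

lemma translate_X:
  assumes "m \<ge> n"
  shows "\<exists>y\<in>X. AE x in lebesgue. Lv n (q, 0) (x - mat_pow invM m *v rvec k) = y x"
proof -
  define u where "u \<kappa> = (if \<kappa> = (q, 0) then 1 else 0 :: complex)" for \<kappa> :: "'r \<times> (int ^ 'd)"
  have u: "fsupp u" by (simp add: fsupp_def u_def)
  have Lu: "lc u (Lv n) = Lv n (q, 0)"
    by (subst lc_eq[of "{(q, 0)}"]) (auto simp: u_def)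
  obtain u' where u': "fsupp u'" "AE x in lebesgue. lc u (Lv n) x = lc u' (Lv m) x"
    using raise_level[OF u, of n "m - n"] assms by auto
  have "mat_pow (rmat M0) m *v (mat_pow invM m *v rvec k) = rvec k" by (rule mat_pow_invM)
  note tr = translate_lc_Lv[OF u'(1) this]
  have "fsupp (\<lambda>(p, n). u' (p, n - k))"
    using fsupp_comp_inj[OF u'(1), of "\<lambda>(p, n). (p, n - k)"] by (auto simp: inj_on_def case_prod_beta')
  then have "lc (\<lambda>(p, n). u' (p, n - k)) (Lv m) \<in> X" by (auto simp: X_def)
  moreover have "AE x in lebesgue. Lv n (q, 0) (x - mat_pow invM m *v rvec k) = lc (\<lambda>(p, n). u' (p, n - k)) (Lv m) x"
    using AE_affine[of "mat 1", OF _ u'(2), of "mat_pow invM m *v rvec k"] by (simp add: Lu tr)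
  ultimately show ?thesis by blast
qed

text \<open>The rounding errors stay in the unit cube, and \<open>mat_pow invM m\<close> shrinks
  this cube uniformly, since it shrinks each coordinate vector.\<close>

lemma lattice_approx:
  assumes M0: "dilation_matrix M0"
  shows "(\<lambda>m. mat_pow invM m *v rvec (\<chi> i. \<lfloor>(mat_pow (rmat M0) m *v t) $ i\<rfloor>)) \<longlonglongrightarrow> t"
proof -
  define r where "r m = (\<chi> i. frac ((mat_pow (rmat M0) m *v t) $ i))" for m
  have fl: "rvec (\<chi> i. \<lfloor>(mat_pow (rmat M0) m *v t) $ i\<rfloor>) = mat_pow (rmat M0) m *v t - r m" for m
    by (simp add: rvec_def r_def vec_eq_iff frac_def)
  have "(\<lambda>m. \<Sum>i\<in>UNIV. norm (mat_pow invM m *v axis i 1)) \<longlonglongrightarrow> (\<Sum>i\<in>(UNIV :: 'd set). norm (0 :: real ^ 'd))"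
    using dilation_inverse_power_tendsto_0[OF M0 invM(1)] by (intro tendsto_intros)
  then have lim: "(\<lambda>m. \<Sum>i\<in>UNIV. norm (mat_pow invM m *v axis i 1)) \<longlonglongrightarrow> 0" by simp
  have le: "norm (mat_pow invM m *v r m) \<le> (\<Sum>i\<in>UNIV. norm (mat_pow invM m *v axis i 1))" for m
  proof -
    have "r m = (\<Sum>i\<in>UNIV. (r m $ i) *\<^sub>R axis i 1)"
      by (simp add: vec_eq_iff axis_def if_distrib sum.delta cong: if_cong)
    then have "mat_pow invM m *v r m = mat_pow invM m *v (\<Sum>i\<in>UNIV. (r m $ i) *\<^sub>R axis i 1)" by simp
    also have "\<dots> = (\<Sum>i\<in>UNIV. (r m $ i) *\<^sub>R (mat_pow invM m *v axis i 1))"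
      unfolding linear_sum[OF matrix_vector_mul_linear] matrix_vector_mult_scaleR ..
    finally have "norm (mat_pow invM m *v r m) \<le> (\<Sum>i\<in>UNIV. norm ((r m $ i) *\<^sub>R (mat_pow invM m *v axis i 1)))"
      using norm_sum by metis
    also have "\<dots> \<le> (\<Sum>i\<in>UNIV. norm (mat_pow invM m *v axis i 1))"
    proof (rule sum_mono)
      fix i
      have "\<bar>r m $ i\<bar> \<le> 1" using frac_lt_1[of "(mat_pow (rmat M0) m *v t) $ i"] by (simp add: r_def)
      then show "norm ((r m $ i) *\<^sub>R (mat_pow invM m *v axis i 1)) \<le> norm (mat_pow invM m *v axis i 1)"
        using mult_right_mono[of "\<bar>r m $ i\<bar>" 1 "norm (mat_pow invM m *v axis i 1)"] by simp
    qed
    finally show ?thesis .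
  qed
  have "(\<lambda>m. mat_pow invM m *v r m) \<longlonglongrightarrow> 0"
    by (rule tendsto_norm_zero_cancel, rule tendsto_sandwich[OF _ _ tendsto_const lim]) (auto simp: le)
  then have "(\<lambda>m. t - mat_pow invM m *v r m) \<longlonglongrightarrow> t - 0" by (intro tendsto_intros)
  then show ?thesis by (simp add: fl matrix_vector_mult_diff_distrib mat_pow_invM)
qed

text \<open>If the distance \<open>dd\<close> were positive, a near minimiser \<open>x0\<close>
  would leave a remainder \<open>g\<close> almost orthogonal to \<open>X\<close>. The averages of
  \<open>g\<close> in \<open>approx_identity\<close> are pairings with translates of dilates of
  \<open>\<phi> q\<close>, hence small. So \<open>g\<close> is almost orthogonal to \<open>f\<close>
  too, and therefore small itself.\<close>

lemma X_dense_Cc: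
  assumes M0: "dilation_matrix M0" and a: "(LINT x|lebesgue. \<phi> q x) \<noteq> 0"
    and f: "Cc_fun f" and e: "e > 0"
  shows "\<exists>x\<in>X. (L2_norm (\<lambda>t. f t - x t))\<^sup>2 < e"
proof (rule ccontr)
  assume "\<not> ?thesis"
  then have dist_e: "e \<le> (L2_norm (\<lambda>t. f t - x t))\<^sup>2" if "x \<in> X" for x using that by (meson not_le)
  define dd where "dd = (INF x\<in>X. (L2_norm (\<lambda>t. f t - x t))\<^sup>2)"
  have zero: "(\<lambda>_. 0) \<in> X"
  proof -
    have "lc (\<lambda>_. 0) (Lv 0) = (\<lambda>_. 0)" by (rule ext) (simp add: lc_def ips_def)
    moreover have "fsupp (\<lambda>_ :: 'r \<times> (int ^ 'd). 0)" by (simp add: fsupp_def)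
    ultimately show ?thesis unfolding X_def by (metis (mono_tags, lifting) mem_Collect_eq)
  qed
  have bdd: "bdd_below ((\<lambda>x. (L2_norm (\<lambda>t. f t - x t))\<^sup>2) ` X)" by (rule bdd_belowI[of _ 0]) auto
  have dd_le: "dd \<le> (L2_norm (\<lambda>t. f t - x t))\<^sup>2" if "x \<in> X" for x
    unfolding dd_def by (rule cINF_lower[OF bdd that])
  have dd_e: "e \<le> dd" unfolding dd_def by (rule cINF_greatest) (use zero dist_e in auto)
  have dd_f: "dd \<le> (L2_norm f)\<^sup>2" using dd_le[OF zero] by simp
  have fL: "L2_fun f" and fi: "integrable lebesgue f" by (rule Cc_fun_integrable[OF f])+
  have fb: "f \<in> borel_measurable borel" by (rule Cc_fun_borel[OF f])
  have \<phi>i: "integrable lborel (\<phi> q)"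
  proof -
    have "indicat_real (cball 0 R) x *\<^sub>R \<phi> q x = \<phi> q x" for x
      using phi_supp[of x q] by (cases "norm x > R") (auto simp: indicator_def)
    then have "integrable lebesgue (\<phi> q)" using truncation_integrable(2)[OF phi_L2[of q], of R] by simp
    then show ?thesis using integrable_lborel[OF phi_borel] by blast
  qed
  define a where "a = cmod (LINT y|lborel. \<phi> q y)"
  have a0: "a > 0" using a LINT_lborel[OF phi_borel[of q]] by (simp add: a_def)
  define F where "F = L2_norm f"
  have F: "F \<ge> 0" by (simp add: F_def)
  define \<epsilon> where "\<epsilon> n = approx_error (\<phi> q) f (mat_pow invM n)" for n
  have \<epsilon>: "\<epsilon> \<longlonglongrightarrow> 0"
    unfolding \<epsilon>_def by (rule approx_error_tendsto_0[OF fL \<phi>i dilation_inverse_power_tendsto_0[OF M0 invM(1)]])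
  define dt where "dt n = \<bar>det (mat_pow (rmat M0) n)\<bar>" for n
  have dt: "dt n > 0" for n using det_pow[of n] by (simp add: dt_def)
  define C where "C n = (LINT t|lborel. cmod (f t)) * (sqrt (dt n) * L2_norm (\<phi> q))" for n
  \<comment> \<open>\<open>\<eta>\<close> measures how near \<open>x0\<close> is to a minimiser and
    \<open>n\<close> is the dilation level. The two are kept independent because \<open>C n\<close>
    depends on \<open>n\<close>.\<close>
  have bound: "a * dd \<le> (F + 1) * \<epsilon> n + C n * sqrt \<eta> + a * (sqrt \<eta> * (2 * F + 1))"
    if \<eta>: "0 < \<eta>" "\<eta> \<le> 1" for n \<eta>
  proof -
    have "\<exists>x0\<in>X. (L2_norm (\<lambda>t. f t - x0 t))\<^sup>2 < dd + \<eta>"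
      using cINF_less_iff[of X "\<lambda>x. (L2_norm (\<lambda>t. f t - x t))\<^sup>2" "dd + \<eta>", OF _ bdd] zero \<eta>(1)
      unfolding dd_def by auto
    then obtain x0 where x0: "x0 \<in> X" "(L2_norm (\<lambda>t. f t - x0 t))\<^sup>2 \<le> dd + \<eta>" by force
    define g where "g t = f t - x0 t" for t
    have x0L: "L2_fun x0" by (rule X_L2[OF x0(1)])
    have gL: "L2_fun g" unfolding g_def by (intro L2_fun_diff fL x0L)
    have orth: "cmod (L2_inner y g) \<le> sqrt \<eta> * L2_norm y" if "y \<in> X" for y
      unfolding g_def by (rule near_orthogonal[OF X_L2 X_lin fL dd_le x0 that]) (use \<eta> in auto)
    have gn: "L2_norm g \<le> F + 1"
    proof (rule power2_le_imp_le)
      have "(L2_norm g)\<^sup>2 \<le> F\<^sup>2 + 1" using x0(2) dd_f \<eta> by (simp add: g_def[abs_def] F_def)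
      also have "\<dots> \<le> (F + 1)\<^sup>2" using F by (simp add: power2_eq_square algebra_simps)
      finally show "(L2_norm g)\<^sup>2 \<le> (F + 1)\<^sup>2" .
    qed (use F in simp)
    obtain g' where g': "g' \<in> borel_measurable borel" "L2_fun g'" "AE x in lebesgue. g x = g' x"
      using L2_borel_rep[OF gL] by blast
    define H where "H t = (LINT y|lborel. \<phi> q y * cnj (g' (t + mat_pow invM n *v y)))" for t
    have Dn: "L2_fun (Dj n (\<phi> q))" by (rule Dj_L2[OF phi_L2])
    have Lv0: "Lv n (q, 0) = Dj n (\<phi> q)" by (simp add: Lv_def shifts_def rvec_simps)
    \<comment> \<open>The substitution turns the average around \<open>t\<close> into a pairing with
      the translate by \<open>t\<close> of the dilated generator.\<close>
    have H: "H t = of_real (sqrt (dt n)) * L2_inner (\<lambda>x. Dj n (\<phi> q) (x - t)) g" for t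
    proof -
      let ?A = "mat_pow (rmat M0) n"
      let ?f = "\<lambda>y. \<phi> q y * cnj (g' (t + mat_pow invM n *v y))"
      have m: "?f \<in> borel_measurable borel"
      proof -
        have "(\<lambda>y. g' (t + mat_pow invM n *v y)) \<in> borel_measurable borel" using g'(1) by measurable
        then show ?thesis using phi_borel by (intro borel_measurable_times borel_measurable_cnj)
      qed
      have "H t = (LINT y|lebesgue. ?f y)" unfolding H_def by (rule LINT_lborel[OF m, symmetric])
      also have "\<dots> = dt n *\<^sub>R (LINT x|lebesgue. ?f (?A *v x - ?A *v t))"
        unfolding dt_def by (rule integral_affine[OF det_pow borel_lebesgue[OF m]])
      also have "(\<lambda>x. ?f (?A *v x - ?A *v t)) = (\<lambda>x. \<phi> q (?A *v (x - t)) * cnj (g' x))"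
        by (simp add: matrix_vector_mult_diff_distrib mat_pow_invM)
      also have "dt n *\<^sub>R (LINT x|lebesgue. \<phi> q (?A *v (x - t)) * cnj (g' x))
          = of_real (sqrt (dt n)) * L2_inner (\<lambda>x. Dj n (\<phi> q) (x - t)) g'"
      proof -
        have "L2_inner (\<lambda>x. Dj n (\<phi> q) (x - t)) g' = of_real (sqrt (dt n)) * (LINT x|lebesgue. \<phi> q (?A *v (x - t)) * cnj (g' x))"
          unfolding L2_inner_def Dj_def dilate_shift_def dt_def by (simp add: scaleR_conv_of_real mult.assoc)
        moreover have "complex_of_real (sqrt (dt n)) * complex_of_real (sqrt (dt n)) = of_real (dt n)"
          using dt[of n] by (simp only: of_real_mult[symmetric] real_sqrt_mult_self abs_of_pos)
        ultimately show ?thesis by (simp add: scaleR_conv_of_real mult.assoc[symmetric])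
      qed
      also have "L2_inner (\<lambda>x. Dj n (\<phi> q) (x - t)) g' = L2_inner (\<lambda>x. Dj n (\<phi> q) (x - t)) g"
        by (rule L2_inner_cong_ae[symmetric, OF L2_translate(1)[OF Dn] gL _ g'(3)]) simp
      finally show ?thesis .
    qed
    \<comment> \<open>For lattice translates of levels \<open>m \<ge> n\<close> this is near
      orthogonality to \<open>X\<close>; an arbitrary \<open>t\<close> is a limit of such
      translates, and the pairing is continuous in \<open>t\<close>.\<close>
    have orthD: "cmod (L2_inner (\<lambda>x. Dj n (\<phi> q) (x - t)) g) \<le> sqrt \<eta> * L2_norm (\<phi> q)" for t
    proof -
      define tm where "tm m = mat_pow invM m *v rvec (\<chi> i. \<lfloor>(mat_pow (rmat M0) m *v t) $ i\<rfloor>)" for m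
      have tm: "tm \<longlonglongrightarrow> t" unfolding tm_def by (rule lattice_approx[OF M0])
      have "isCont (\<lambda>h. L2_inner (\<lambda>x. Dj n (\<phi> q) (x - h)) g) t"
        using continuous_inner_translate[OF Dn gL] by (simp add: continuous_on_eq_continuous_at)
      then have "(\<lambda>m. L2_inner (\<lambda>x. Dj n (\<phi> q) (x - tm m)) g) \<longlonglongrightarrow> L2_inner (\<lambda>x. Dj n (\<phi> q) (x - t)) g"
        by (rule isCont_tendsto_compose[OF _ tm])
      then have lim: "(\<lambda>m. cmod (L2_inner (\<lambda>x. Dj n (\<phi> q) (x - tm m)) g)) \<longlonglongrightarrow> cmod (L2_inner (\<lambda>x. Dj n (\<phi> q) (x - t)) g)"
        by (rule tendsto_norm)
      have "cmod (L2_inner (\<lambda>x. Dj n (\<phi> q) (x - tm m)) g) \<le> sqrt \<eta> * L2_norm (\<phi> q)" if m: "m \<ge> n" for m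
      proof -
        obtain y where y: "y \<in> X" "AE x in lebesgue. Dj n (\<phi> q) (x - tm m) = y x"
          using translate_X[OF m, of q] unfolding Lv0 tm_def by blast
        note tL = L2_translate[OF Dn, of "tm m"]
        have "L2_inner (\<lambda>x. Dj n (\<phi> q) (x - tm m)) g = L2_inner y g"
          by (rule L2_inner_cong_ae[OF tL(1) gL y(2)]) simp
        moreover have "L2_norm y = L2_norm (\<phi> q)"
          using L2_norm_cong_ae[OF L2_funD(1)[OF tL(1)] y(2)] tL(2) Dj_norm[OF phi_L2] by simp
        ultimately show ?thesis using orth[OF y(1)] by simp
      qed
      then show ?thesis by (intro LIMSEQ_le_const2[OF lim]) blast
    qed
    have Hle: "cmod (H t) \<le> sqrt (dt n) * L2_norm (\<phi> q) * sqrt \<eta>" for t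
    proof -
      have "cmod (H t) = sqrt (dt n) * cmod (L2_inner (\<lambda>x. Dj n (\<phi> q) (x - t)) g)"
        using dt[of n] by (simp add: H norm_mult)
      also have "\<dots> \<le> sqrt (dt n) * (sqrt \<eta> * L2_norm (\<phi> q))"
        using dt[of n] by (intro mult_left_mono orthD) auto
      finally show ?thesis by (simp add: ac_simps)
    qed
    \<comment> \<open>The bound on \<open>H\<close> is uniform in \<open>t\<close> without decay;
      integrability of \<open>f\<close>, a continuous function of bounded support, closes the
      estimate.\<close>
    have "cmod (LINT t|lborel. f t * H t) \<le> C n * sqrt \<eta>"
    proof -
      define c where "c = sqrt (dt n) * L2_norm (\<phi> q) * sqrt \<eta>"
      have fi': "integrable lborel (\<lambda>t. cmod (f t))" using fi integrable_lborel[OF fb] by auto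
      have Hm: "H \<in> borel_measurable borel"
      proof -
        have "(\<lambda>t. L2_inner (\<lambda>x. Dj n (\<phi> q) (x - t)) g) \<in> borel_measurable borel"
          by (rule borel_measurable_continuous_onI[OF continuous_inner_translate[OF Dn gL]])
        then show ?thesis unfolding H[abs_def] by measurable
      qed
      have le: "cmod (f t * H t) \<le> c * cmod (f t)" for t
        using mult_left_mono[OF Hle[of t] norm_ge_zero[of "f t"]] by (simp add: norm_mult c_def ac_simps)
      have int: "integrable lborel (\<lambda>t. f t * H t)"
        by (rule Bochner_Integration.integrable_bound[of _ "\<lambda>t. c * cmod (f t)"])
           (use fi' fb Hm le in \<open>auto intro!: AE_I2 order_trans[OF le]\<close>)
      have "cmod (LINT t|lborel. f t * H t) \<le> (LINT t|lborel. cmod (f t * H t))" by (rule integral_norm_bound)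
      also have "\<dots> \<le> (LINT t|lborel. c * cmod (f t))"
        by (rule integral_mono) (use int fi' le in auto)
      also have "\<dots> = C n * sqrt \<eta>" by (simp add: C_def c_def)
      finally show ?thesis .
    qed
    moreover have "cmod ((LINT y|lborel. \<phi> q y) * L2_inner f g')
        \<le> L2_norm g' * \<epsilon> n + cmod (LINT t|lborel. f t * H t)"
      unfolding \<epsilon>_def H_def by (rule approx_identity[OF fL fb g'(2,1) \<phi>i])
    moreover have "L2_inner f g' = L2_inner f g"
      by (rule L2_inner_cong_ae[symmetric, OF fL gL _ g'(3)]) simp
    moreover have "L2_norm g' = L2_norm g"
      using L2_norm_cong_ae[OF L2_funD(1)[OF gL] g'(3)] by simp
    moreover have "L2_norm g * \<epsilon> n \<le> (F + 1) * \<epsilon> n"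
      by (rule mult_right_mono[OF gn]) (simp add: \<epsilon>_def approx_error_def)
    ultimately have fg: "a * cmod (L2_inner f g) \<le> (F + 1) * \<epsilon> n + C n * sqrt \<eta>"
      by (simp add: a_def norm_mult)
    have "L2_norm x0 \<le> 2 * F + 1"
    proof -
      have "x0 = (\<lambda>t. f t + - g t)" by (simp add: g_def)
      then have "L2_norm x0 \<le> L2_norm f + L2_norm (\<lambda>t. - g t)"
        using L2_norm_triangle[OF fL L2_fun_uminus[OF gL]] by simp
      moreover have "L2_norm (\<lambda>t. - g t) = L2_norm g" by (simp add: L2_norm_def)
      ultimately show ?thesis using gn by (simp add: F_def)
    qed
    then have "sqrt \<eta> * L2_norm x0 \<le> sqrt \<eta> * (2 * F + 1)" using \<eta> by (intro mult_left_mono) auto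
    then have xg: "cmod (L2_inner x0 g) \<le> sqrt \<eta> * (2 * F + 1)" using orth[OF x0(1)] by linarith
    \<comment> \<open>Pairing \<open>g\<close> with \<open>g = f - x0\<close>: the part with
      \<open>f\<close> is bounded by \<open>fg\<close>, the part with \<open>x0\<close> by near
      orthogonality.\<close>
    have "complex_of_real ((L2_norm g)\<^sup>2) = L2_inner f g - L2_inner x0 g"
    proof -
      have "L2_inner g g = L2_inner (\<lambda>t. f t - x0 t) g" by (simp add: g_def[abs_def])
      then show ?thesis by (simp add: L2_inner_self L2_inner_diff_left[OF fL x0L gL])
    qed
    then have "(L2_norm g)\<^sup>2 \<le> cmod (L2_inner f g) + cmod (L2_inner x0 g)"
      by (metis norm_triangle_ineq4 norm_of_real abs_of_nonneg zero_le_power2)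
    moreover have "dd \<le> (L2_norm g)\<^sup>2" using dd_le[OF x0(1)] by (simp add: g_def[abs_def])
    ultimately have "dd \<le> cmod (L2_inner f g) + sqrt \<eta> * (2 * F + 1)" using xg by linarith
    then have "a * dd \<le> a * (cmod (L2_inner f g) + sqrt \<eta> * (2 * F + 1))"
      using a0 by (intro mult_left_mono) auto
    then show ?thesis using fg by (simp add: distrib_left)
  qed
  \<comment> \<open>First \<open>\<eta> \<rightarrow> 0\<close> with \<open>n\<close> fixed, as
    \<open>C n\<close> contains the determinant of the dilation; only afterwards may
    \<open>n\<close> grow.\<close>
  have "a * dd \<le> (F + 1) * \<epsilon> n" for n
  proof -
    have "(\<lambda>k. 1 / real (Suc k)) \<longlonglongrightarrow> 0" by (intro LIMSEQ_Suc lim_1_over_n)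
    then have "(\<lambda>k. (F + 1) * \<epsilon> n + C n * sqrt (1 / real (Suc k)) + a * (sqrt (1 / real (Suc k)) * (2 * F + 1)))
        \<longlonglongrightarrow> (F + 1) * \<epsilon> n + C n * sqrt 0 + a * (sqrt 0 * (2 * F + 1))"
      by (intro tendsto_intros)
    then have lim: "(\<lambda>k. (F + 1) * \<epsilon> n + C n * sqrt (1 / real (Suc k)) + a * (sqrt (1 / real (Suc k)) * (2 * F + 1)))
        \<longlonglongrightarrow> (F + 1) * \<epsilon> n" by simp
    show ?thesis
      by (rule LIMSEQ_le_const[OF lim]) (intro exI[of _ 0] allI impI bound, auto)
  qed
  moreover have "(\<lambda>n. (F + 1) * \<epsilon> n) \<longlonglongrightarrow> (F + 1) * 0" by (intro tendsto_intros \<epsilon>)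
  ultimately have "a * dd \<le> (F + 1) * 0" by (intro LIMSEQ_le_const) auto
  then show False using a0 dd_e e by (simp add: mult_le_0_iff)
qed

lemma X_dense:
  assumes M0: "dilation_matrix M0" and a: "(LINT x|lebesgue. \<phi> q x) \<noteq> 0"
    and f: "L2_fun f" and e: "e > 0"
  shows "\<exists>x\<in>X. L2_norm (\<lambda>t. f t - x t) < e"
proof -
  obtain g where g: "Cc_fun g" "L2_norm (\<lambda>x. f x - g x) < e / 2" using Cc_dense[OF f, of "e / 2"] e by auto
  obtain x where x: "x \<in> X" "(L2_norm (\<lambda>t. g t - x t))\<^sup>2 < (e / 2)\<^sup>2"
    using X_dense_Cc[OF M0 a g(1), of "(e / 2)\<^sup>2"] e by auto
  have gx: "L2_norm (\<lambda>t. g t - x t) < e / 2" by (rule power2_less_imp_less[OF x(2)]) (use e in simp)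
  have gL: "L2_fun g" by (rule Cc_fun_integrable[OF g(1)])
  have "L2_norm (\<lambda>t. (f t - g t) + (g t - x t)) \<le> L2_norm (\<lambda>t. f t - g t) + L2_norm (\<lambda>t. g t - x t)"
    by (intro L2_norm_triangle L2_fun_diff f gL X_L2 x)
  then show ?thesis using g(2) gx x(1) by (intro bexI[of _ x]) simp_all
qed

end

section \<open>Biorthogonal wavelets from filter banks\<close>

text \<open>\<open>J \<ge> 1\<close> is included because \<open>l2_stable\<close> speaks about such
  levels.\<close>

lemma fsupp_level_bound:
  assumes "fsupp (c :: ('s, 'r, 'z) aindex \<Rightarrow> complex)"
  shows "\<exists>J\<ge>1. \<forall>l j k. j \<ge> J \<longrightarrow> c (Inr (l, j, k)) = 0"
proof -
  obtain S where S: "finite S" "\<And>i. i \<notin> S \<Longrightarrow> c i = 0" using fsuppE[OF assms] by metis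
  define lv :: "('s, 'r, 'z) aindex \<Rightarrow> nat" where "lv i = (case i of Inl _ \<Rightarrow> 0 | Inr (l, j, k) \<Rightarrow> j)" for i
  have "c (Inr (l, j, k)) = 0" if "j \<ge> Suc (Max (insert 0 (lv ` S)))" for l j k
  proof (rule S(2), rule notI)
    assume "Inr (l, j, k) \<in> S"
    then have "lv (Inr (l, j, k)) \<le> Max (insert 0 (lv ` S))" using S(1) by (intro Max_ge) auto
    then show False using that by (simp add: lv_def)
  qed
  then show ?thesis by (intro exI[of _ "Suc (Max (insert 0 (lv ` S)))"]) auto
qed

lemma ex_lc_sum:
  assumes "fsupp u"
  shows "\<exists>S. finite S \<and> lc u e = (\<lambda>x. \<Sum>\<kappa>\<in>S. u \<kappa> * e \<kappa> x) \<and> nsq u = (\<Sum>\<kappa>\<in>S. (cmod (u \<kappa>))\<^sup>2)"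
  by (rule fsupp_lcE[OF assms]) blast

text \<open>Finite index sets with arbitrary coefficients become finitely supported coefficient
  functions, on which \<open>syn\<close> and \<open>ana\<close> act.\<close>

lemma riesz_basis_lc:
  "riesz_basis_L2 e \<longleftrightarrow>
     (\<forall>i. L2_fun (e i)) \<and>
     (\<forall>f. L2_fun f \<longrightarrow> (\<forall>\<epsilon>>0. \<exists>c. fsupp c \<and> L2_norm (\<lambda>x. f x - lc c e x) < \<epsilon>)) \<and>
     (\<exists>A>0. \<exists>B>0. \<forall>c. fsupp c \<longrightarrow>
        A * nsq c \<le> (L2_norm (lc c e))\<^sup>2 \<and> (L2_norm (lc c e))\<^sup>2 \<le> B * nsq c)"
proof -
  \<comment> \<open>With \<open>P\<close> abstract, the same equivalence serves the density clause
    and, through negation, the universally quantified bounds.\<close>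
  have 1: "(\<exists>I c. finite I \<and> P (\<lambda>x. \<Sum>i\<in>I. c i * e i x) (\<Sum>i\<in>I. (cmod (c i))\<^sup>2))
      \<longleftrightarrow> (\<exists>c. fsupp c \<and> P (lc c e) (nsq c))" (is "?l \<longleftrightarrow> ?r") for P
  proof
    assume ?l
    then obtain I c where "finite I" "P (\<lambda>x. \<Sum>i\<in>I. c i * e i x) (\<Sum>i\<in>I. (cmod (c i))\<^sup>2)" by blast
    then show ?r by (intro exI[of _ "\<lambda>i. if i \<in> I then c i else 0"]) (simp add: lc_restrict)
  next
    assume ?r
    then obtain c where c: "fsupp c" "P (lc c e) (nsq c)" by blast
    obtain S where "finite S" "lc c e = (\<lambda>x. \<Sum>\<kappa>\<in>S. c \<kappa> * e \<kappa> x)" "nsq c = (\<Sum>\<kappa>\<in>S. (cmod (c \<kappa>))\<^sup>2)"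
      using ex_lc_sum[OF c(1), of e] by blast
    then show ?l using c(2) by (intro exI[of _ S] exI[of _ c]) simp
  qed
  have 2: "(\<forall>I c. finite I \<longrightarrow> P (\<lambda>x. \<Sum>i\<in>I. c i * e i x) (\<Sum>i\<in>I. (cmod (c i))\<^sup>2))
      \<longleftrightarrow> (\<forall>c. fsupp c \<longrightarrow> P (lc c e) (nsq c))" for P
    using 1[of "\<lambda>a b. \<not> P a b"] by blast
  show ?thesis
    unfolding riesz_basis_L2_def
    unfolding 1[of "\<lambda>g n. L2_norm (\<lambda>x. f x - g x) < \<epsilon>" for f \<epsilon>]
      2[of "\<lambda>g n. A * n \<le> (L2_norm g)\<^sup>2 \<and> (L2_norm g)\<^sup>2 \<le> B * n" for A B] ..
qed

definition kd :: "'k \<Rightarrow> 'k \<Rightarrow> complex" where "kd i = (\<lambda>j. if j = i then 1 else 0)"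

lemma fsupp_kd: "fsupp (kd i)"
  by (simp add: fsupp_def kd_def)

lemma lc_kd: "lc (kd i) e = e i"
  by (subst lc_eq[of "{i}"]) (auto simp: kd_def)

lemma ips_kd: "ips (kd i) v = cnj (v i)" "ips u (kd i) = u i"
  by (subst ips_eq[of "{i}"], simp_all add: kd_def) (subst ips_eq'[of "{i}"], simp_all)

text \<open>The roles of the two halves can be exchanged by \<open>swapped\<close>, so one-sided
  statements are proved once and used for both systems.\<close>

locale refinable_pair = R: refinable M0 M b0 b \<phi> R + Rt: refinable M0 M bt0 bt \<phi>t Rt
  for M0 :: "int ^ 'd ^ 'd" and M :: "'s :: finite \<Rightarrow> int ^ 'd ^ 'd"
    and b0 :: "int ^ 'd \<Rightarrow> complex ^ 'r ^ 'r" and b :: "'s \<Rightarrow> int ^ 'd \<Rightarrow> complex ^ 'r ^ 1"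
    and bt0 :: "int ^ 'd \<Rightarrow> complex ^ 'r ^ 'r" and bt :: "'s \<Rightarrow> int ^ 'd \<Rightarrow> complex ^ 'r ^ 1"
    and \<phi> \<phi>t :: "'r \<Rightarrow> real ^ 'd \<Rightarrow> complex" and R Rt :: real
begin

text \<open>The Bessel bound sees the coefficients at level \<open>J\<close>. Analysis with the dual
  bank recovers exactly \<open>c\<close> from them, so \<open>ml\<close> equals \<open>nsq c\<close>
  and the lower stability constant of the dual bank compares the two norms for all \<open>J\<close>
  at once.\<close>

lemma AS_upper_bound:
  assumes bi: "biorth Rt.E R.E" and "c1 > 0"
    and stab: "\<And>J u. J \<ge> 1 \<Longrightarrow> fsupp u \<Longrightarrow> c1 * nsq u \<le> ml Rt.E J u"
  shows "\<exists>B>0. \<forall>c. fsupp c \<longrightarrow> (L2_norm (lc c R.AS))\<^sup>2 \<le> B * nsq c"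
proof -
  obtain B where B: "B > 0" "\<And>J u. fsupp u \<Longrightarrow> (L2_norm (lc u (R.Lv J)))\<^sup>2 \<le> B * nsq u"
    using R.bessel_Lv by blast
  have "(L2_norm (lc c R.AS))\<^sup>2 \<le> B / c1 * nsq c" if c: "fsupp c" for c
  proof -
    obtain J where J: "J \<ge> 1" "\<And>l j k. j \<ge> J \<Longrightarrow> c (Inr (l, j, k)) = 0" using fsupp_level_bound[OF c] by blast
    define u where "u = lev R.E c J"
    have u: "fsupp u" unfolding u_def by (rule fsupp_lev[OF R.loc_fin c])
    have ae: "AE x in lebesgue. lc u (R.Lv J) x = lc c R.AS x" unfolding u_def by (rule R.lc_lev[OF c J(2)])
    have "L2_norm (lc c R.AS) = L2_norm (lc u (R.Lv J))"
      by (rule L2_norm_cong_ae[OF L2_funD(1)[OF lc_L2[OF u R.Lv_L2]] ae, symmetric])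
    then have "(L2_norm (lc c R.AS))\<^sup>2 \<le> B * nsq u" using B(2)[OF u] by simp
    also have "\<dots> \<le> B * (ml Rt.E J u / c1)"
      using stab[OF J(1) u] B(1) \<open>c1 > 0\<close> by (intro mult_left_mono) (auto simp: field_simps)
    also have "ml Rt.E J u = nsq c"
      unfolding u_def by (rule ml_lev_nsq[OF Rt.loc_fin R.loc_fin bi c J(2)])
    finally show ?thesis by simp
  qed
  then show ?thesis using B(1) \<open>c1 > 0\<close> by (intro exI[of _ "B / c1"]) auto
qed

text \<open>Analysing the coefficients of an element of \<open>R.X\<close> with the dual bank
  rewrites it as a finite affine combination.\<close>

lemma AS_dense:
  assumes rep: "reproducing Rt.E R.E" and M0: "dilation_matrix M0" and a: "(LINT x|lebesgue. \<phi> q x) \<noteq> 0"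
    and f: "L2_fun f" and e: "e > 0"
  shows "\<exists>c. fsupp c \<and> L2_norm (\<lambda>x. f x - lc c R.AS x) < e"
proof -
  obtain y where y: "y \<in> R.X" "L2_norm (\<lambda>t. f t - y t) < e" using R.X_dense[OF M0 a f e] by blast
  then obtain u J where u: "fsupp u" "y = lc u (R.Lv J)" by (auto simp: R.X_def)
  define c where "c = decomp Rt.E J u"
  have c: "fsupp c" unfolding c_def by (rule fsupp_decomp[OF Rt.loc_fin u(1)])
  have "lev R.E c J = u"
    using lev_decomp[OF Rt.loc_fin R.loc_fin rep, of J J u] by (simp add: c_def)
  moreover have "AE x in lebesgue. lc (lev R.E c J) (R.Lv J) x = lc c R.AS x"
    by (rule R.lc_lev[OF c]) (simp add: c_def decomp_def)
  ultimately have "AE x in lebesgue. f x - y x = f x - lc c R.AS x"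
    by (simp add: u(2))
  from L2_norm_cong_ae[OF L2_funD(1)[OF L2_fun_diff[OF f R.X_L2[OF y(1)]]] this]
  have "L2_norm (\<lambda>x. f x - lc c R.AS x) < e" using y(2) by simp
  with c show ?thesis by blast
qed

lemma Lv_biorth:
  assumes base: "\<And>\<kappa> \<kappa>'. L2_inner (shifts \<phi> \<kappa>) (shifts \<phi>t \<kappa>') = (if \<kappa> = \<kappa>' then 1 else 0)"
  shows "L2_inner (R.Lv j \<kappa>) (Rt.Lv j \<kappa>') = (if \<kappa> = \<kappa>' then 1 else 0)"
  unfolding R.Lv_def Rt.Lv_def using R.Dj_inner[OF R.shifts_L2 Rt.shifts_L2, of j] base by simp

text \<open>Both combinations are synthesised up to a common level, where the dilated shifts are
  biorthogonal.\<close>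

lemma AS_inner:
  assumes base: "\<And>\<kappa> \<kappa>'. L2_inner (shifts \<phi> \<kappa>) (shifts \<phi>t \<kappa>') = (if \<kappa> = \<kappa>' then 1 else 0)"
    and bi: "biorth R.E Rt.E" and c: "fsupp c" "fsupp c'"
  shows "L2_inner (lc c R.AS) (lc c' Rt.AS) = ips c c'"
proof -
  obtain J1 where J1: "\<And>l j k. j \<ge> J1 \<Longrightarrow> c (Inr (l, j, k)) = 0" using fsupp_level_bound[OF c(1)] by blast
  obtain J2 where J2: "\<And>l j k. j \<ge> J2 \<Longrightarrow> c' (Inr (l, j, k)) = 0" using fsupp_level_bound[OF c(2)] by blast
  define J where "J = J1 + J2"
  have J: "\<And>l j k. j \<ge> J \<Longrightarrow> c (Inr (l, j, k)) = 0" "\<And>l j k. j \<ge> J \<Longrightarrow> c' (Inr (l, j, k)) = 0"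
    using J1 J2 by (auto simp: J_def)
  have f: "fsupp (lev R.E c J)" "fsupp (lev Rt.E c' J)"
    using c R.loc_fin Rt.loc_fin by (auto intro: fsupp_lev)
  have "L2_inner (lc c R.AS) (lc c' Rt.AS) = L2_inner (lc (lev R.E c J) (R.Lv J)) (lc (lev Rt.E c' J) (Rt.Lv J))"
    by (rule L2_inner_cong_ae[symmetric, OF lc_L2[OF f(1) R.Lv_L2] lc_L2[OF f(2) Rt.Lv_L2]])
       (rule R.lc_lev[OF c(1) J(1)], assumption, rule Rt.lc_lev[OF c(2) J(2)], assumption)
  also have "\<dots> = ips (lev R.E c J) (lev Rt.E c' J)"
    by (rule lc_inner[OF f R.Lv_L2 Rt.Lv_L2 Lv_biorth[OF base]])
  also have "\<dots> = ips c c'" by (rule ips_lev[OF R.loc_fin Rt.loc_fin bi c(1) J(1)])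
  finally show ?thesis .
qed

lemma riesz_basis_AS:
  assumes base: "\<And>\<kappa> \<kappa>'. L2_inner (shifts \<phi> \<kappa>) (shifts \<phi>t \<kappa>') = (if \<kappa> = \<kappa>' then 1 else 0)"
    and bi: "biorth R.E Rt.E" and rep: "reproducing Rt.E R.E"
    and M0: "dilation_matrix M0" and a: "(LINT x|lebesgue. \<phi> q x) \<noteq> 0"
    and upper: "B > 0" "\<And>c. fsupp c \<Longrightarrow> (L2_norm (lc c R.AS))\<^sup>2 \<le> B * nsq c"
    and upper_t: "Bt > 0" "\<And>c. fsupp c \<Longrightarrow> (L2_norm (lc c Rt.AS))\<^sup>2 \<le> Bt * nsq c"
  shows "riesz_basis_L2 R.AS"
  unfolding riesz_basis_lc
proof (intro conjI allI impI)
  show "L2_fun (R.AS i)" for i by (rule R.AS_L2)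
  show "\<exists>c. fsupp c \<and> L2_norm (\<lambda>x. f x - lc c R.AS x) < \<epsilon>" if "L2_fun f" "\<epsilon> > 0" for f \<epsilon>
    by (rule AS_dense[OF rep M0 a that])
  \<comment> \<open>Duality: \<open>nsq c\<close> is the pairing of the two combinations with the
    same coefficients, and the upper bound of the dual system absorbs one factor.\<close>
  have "1 / Bt * nsq c \<le> (L2_norm (lc c R.AS))\<^sup>2" if c: "fsupp c" for c
  proof (cases "nsq c = 0")
    case False
    then have n: "nsq c > 0" using nsq_nonneg[of c] by linarith
    have "nsq c = Re (L2_inner (lc c R.AS) (lc c Rt.AS))"
      by (simp add: AS_inner[OF base bi c c] nsq_def)
    also have "\<dots> \<le> L2_norm (lc c R.AS) * L2_norm (lc c Rt.AS)"
      by (rule order_trans[OF complex_Re_le_cmod L2_cauchy_schwarz[OF lc_L2[OF c R.AS_L2] lc_L2[OF c Rt.AS_L2]]])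
    finally have "(nsq c)\<^sup>2 \<le> (L2_norm (lc c R.AS) * L2_norm (lc c Rt.AS))\<^sup>2"
      using nsq_nonneg[of c] by (intro power_mono) auto
    also have "\<dots> \<le> (L2_norm (lc c R.AS))\<^sup>2 * (Bt * nsq c)"
      unfolding power_mult_distrib by (intro mult_left_mono upper_t c) auto
    finally have "nsq c * nsq c \<le> (L2_norm (lc c R.AS))\<^sup>2 * Bt * nsq c"
      by (simp add: power2_eq_square ac_simps)
    then have "nsq c \<le> (L2_norm (lc c R.AS))\<^sup>2 * Bt" using n by simp
    then show ?thesis using upper_t(1) by (simp add: field_simps)
  qed simp
  then show "\<exists>A>0. \<exists>B>0. \<forall>c. fsupp c \<longrightarrow>
        A * nsq c \<le> (L2_norm (lc c R.AS))\<^sup>2 \<and> (L2_norm (lc c R.AS))\<^sup>2 \<le> B * nsq c"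
    using upper upper_t(1) by (intro exI[of _ "1 / Bt"] conjI exI[of _ B]) auto
qed

lemma swapped: "refinable_pair M0 M bt0 bt b0 b \<phi>t \<phi> Rt R"
  by unfold_locales

lemma base_swap:
  assumes "\<And>\<kappa> \<kappa>'. L2_inner (shifts \<phi> \<kappa>) (shifts \<phi>t \<kappa>') = (if \<kappa> = \<kappa>' then 1 else 0)"
  shows "L2_inner (shifts \<phi>t \<kappa>) (shifts \<phi> \<kappa>') = (if \<kappa> = \<kappa>' then 1 else 0)"
  by (subst L2_inner_commute) (simp add: assms)

theorem biorthogonal_wavelet_AS:
  assumes base: "\<And>\<kappa> \<kappa>'. L2_inner (shifts \<phi> \<kappa>) (shifts \<phi>t \<kappa>') = (if \<kappa> = \<kappa>' then 1 else 0)"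
    and bi: "biorth R.E Rt.E" and rep: "reproducing R.E Rt.E"
    and M0: "dilation_matrix M0"
    and a: "(LINT x|lebesgue. \<phi> q x) \<noteq> 0" "(LINT x|lebesgue. \<phi>t qt x) \<noteq> 0"
    and stab: "c1 > 0" "\<And>J u. J \<ge> 1 \<Longrightarrow> fsupp u \<Longrightarrow> c1 * nsq u \<le> ml R.E J u"
    and stabt: "c2 > 0" "\<And>J u. J \<ge> 1 \<Longrightarrow> fsupp u \<Longrightarrow> c2 * nsq u \<le> ml Rt.E J u"
  shows "biorthogonal_riesz_bases R.AS Rt.AS"
proof -
  obtain B where B: "B > 0" "\<And>c. fsupp c \<Longrightarrow> (L2_norm (lc c R.AS))\<^sup>2 \<le> B * nsq c"
    using AS_upper_bound[OF biorth_commute[OF bi] stabt] by blast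
  obtain Bt where Bt: "Bt > 0" "\<And>c. fsupp c \<Longrightarrow> (L2_norm (lc c Rt.AS))\<^sup>2 \<le> Bt * nsq c"
    using refinable_pair.AS_upper_bound[OF swapped bi stab] by blast
  have "riesz_basis_L2 R.AS"
    by (rule riesz_basis_AS[OF base bi reproducing_commute[OF rep] M0 a(1) B Bt])
  moreover have "riesz_basis_L2 Rt.AS"
    by (rule refinable_pair.riesz_basis_AS[OF swapped base_swap[OF base] biorth_commute[OF bi] rep M0 a(2) Bt B])
  moreover have "L2_inner (R.AS i) (Rt.AS j) = (if i = j then 1 else 0)" for i j
    using AS_inner[OF base bi fsupp_kd[of i] fsupp_kd[of j]] by (simp add: lc_kd ips_kd) (simp add: kd_def)
  ultimately show ?thesis by (auto simp: biorthogonal_riesz_bases_def)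
qed

section \<open>Filter banks from biorthogonal wavelets\<close>

context
  assumes brb: "biorthogonal_riesz_bases R.AS Rt.AS"
begin

lemma AS_biorth: "L2_inner (R.AS i) (Rt.AS j) = (if i = j then 1 else 0)"
  using brb by (auto simp: biorthogonal_riesz_bases_def)

lemma shifts_biorth: "L2_inner (shifts \<phi> \<kappa>) (shifts \<phi>t \<kappa>') = (if \<kappa> = \<kappa>' then 1 else 0)"
  using AS_biorth[of "Inl \<kappa>" "Inl \<kappa>'"] by (simp add: R.AS_simps Rt.AS_simps)

text \<open>Labels the shifts and the wavelets of scale 0 by the rows of \<open>E\<close>, in
  agreement with \<open>el\<close>.\<close>

definition ix :: "('s + 'r) \<times> (int ^ 'd) \<Rightarrow> ('s, 'r, int ^ 'd) aindex" where
  "ix i = (case i of (Inl l, k) \<Rightarrow> Inr (l, 0, k) | (Inr q, k) \<Rightarrow> Inl (q, k))"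

lemma ix_inj: "ix i = ix j \<longleftrightarrow> i = j"
  by (auto simp: ix_def split: prod.splits sum.splits)

lemma el_AS: "AE x in lebesgue. R.AS (ix i) x = R.el i x"
proof (cases i)
  case (Pair \<iota> k)
  show ?thesis
  proof (cases \<iota>)
    case (Inl l)
    then show ?thesis by (simp add: Pair ix_def R.AS_simps R.Dj_0)
  next
    case (Inr q)
    then show ?thesis using R.refine1[of q k] by (simp add: Pair ix_def R.AS_simps)
  qed
qed

lemma el_AS_t: "AE x in lebesgue. Rt.AS (ix i) x = Rt.el i x"
proof (cases i)
  case (Pair \<iota> k)
  show ?thesis
  proof (cases \<iota>)
    case (Inl l)
    then show ?thesis by (simp add: Pair ix_def Rt.AS_simps Rt.Dj_0)
  next
    case (Inr q)
    then show ?thesis using Rt.refine1[of q k] by (simp add: Pair ix_def Rt.AS_simps)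
  qed
qed

lemma el_biorth: "L2_inner (R.el i) (Rt.el j) = (if i = j then 1 else 0)"
proof -
  have "L2_inner (R.el i) (Rt.el j) = L2_inner (R.AS (ix i)) (Rt.AS (ix j))"
    by (rule L2_inner_cong_ae[symmetric, OF R.AS_L2 Rt.AS_L2 el_AS el_AS_t])
  then show ?thesis by (simp add: AS_biorth ix_inj)
qed

text \<open>The functions of level 1 are biorthogonal, so the pairings of \<open>el\<close> are the
  pairings of the rows of the coefficient matrices.\<close>

lemma E_biorth: "biorth R.E Rt.E"
  unfolding biorth_def
proof (intro allI)
  fix i j
  have "Sum_any (\<lambda>k. R.E i k * cnj (Rt.E j k)) = L2_inner (R.el i) (Rt.el j)"
    unfolding ips_def[symmetric] R.el_def Rt.el_def
    by (rule lc_inner[symmetric, OF R.fsupp_E Rt.fsupp_E R.Lv_L2 Rt.Lv_L2 Lv_biorth[OF shifts_biorth]])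
  then show "Sum_any (\<lambda>k. R.E i k * cnj (Rt.E j k)) = (if i = j then 1 else 0)" by (simp only: el_biorth)
qed

text \<open>By density of the dual system, one copy of \<open>g\<close> in its squared norm can be
  replaced by a finite combination to which \<open>g\<close> is orthogonal.\<close>

lemma orthogonal_to_AS_zero:
  assumes g: "L2_fun g" and 0: "\<And>i. L2_inner g (Rt.AS i) = 0"
  shows "L2_norm g = 0"
proof -
  have "(L2_norm g)\<^sup>2 \<le> e" if e: "e > 0" for e
  proof -
    have n: "L2_norm g + 1 > 0" using L2_norm_nonneg[of g] by linarith
    have "riesz_basis_L2 Rt.AS" using brb by (simp add: biorthogonal_riesz_bases_def)
    then have "\<forall>f. L2_fun f \<longrightarrow> (\<forall>\<epsilon>>0. \<exists>c. fsupp c \<and> L2_norm (\<lambda>x. f x - lc c Rt.AS x) < \<epsilon>)"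
      unfolding riesz_basis_lc by (elim conjE)
    from this[rule_format, OF g divide_pos_pos[OF e n]]
    obtain c where c: "fsupp c" "L2_norm (\<lambda>x. g x - lc c Rt.AS x) < e / (L2_norm g + 1)" by (elim exE conjE)
    have cL: "L2_fun (lc c Rt.AS)" by (rule lc_L2[OF c(1) Rt.AS_L2])
    obtain S where S: "lc c Rt.AS = (\<lambda>x. \<Sum>\<kappa>\<in>S. c \<kappa> * Rt.AS \<kappa> x)" using ex_lc_sum[OF c(1), of Rt.AS] by blast
    have "L2_inner g (lc c Rt.AS) = 0"
      unfolding S by (subst L2_inner_sum_right) (auto simp: Rt.AS_L2 g 0)
    then have "L2_inner (lc c Rt.AS) g = 0" using L2_inner_commute[of "lc c Rt.AS" g] by simp
    then have "complex_of_real ((L2_norm g)\<^sup>2) = L2_inner g g - L2_inner (lc c Rt.AS) g" by (simp add: L2_inner_self)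
    also have "\<dots> = L2_inner (\<lambda>x. g x - lc c Rt.AS x) g" by (rule L2_inner_diff_left[symmetric]) (fact g cL)+
    finally have "cmod (complex_of_real ((L2_norm g)\<^sup>2)) \<le> L2_norm (\<lambda>x. g x - lc c Rt.AS x) * L2_norm g"
      using L2_cauchy_schwarz[OF L2_fun_diff[OF g cL] g] by simp
    also have "\<dots> \<le> e / (L2_norm g + 1) * L2_norm g" using c(2) by (intro mult_right_mono) auto
    also have "\<dots> \<le> e" using n e by (simp add: field_simps)
    finally show ?thesis by (simp add: norm_power)
  qed
  then have "(L2_norm g)\<^sup>2 \<le> 0" using field_le_epsilon[of "(L2_norm g)\<^sup>2" 0] by simp
  then show ?thesis by simp
qed

text \<open>A function of level 1 minus its biorthogonal expansion in \<open>R.el\<close> is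
  orthogonal to the whole dual system, hence zero. Reading off its coefficients at level 1 gives the
  identity.\<close>

lemma E_reproducing: "reproducing Rt.E R.E"
  unfolding reproducing_def
proof (intro allI)
  fix \<kappa>0 \<kappa>'
  define w where "w i = cnj (Rt.E i \<kappa>0)" for i
  have w: "fsupp w" using Rt.loc_fin unfolding loc_fin_def fsupp_def w_def complex_cnj_zero_iff by blast
  define h where "h = lc w R.el"
  have hL: "L2_fun h" unfolding h_def by (rule lc_L2[OF w R.el_L2])
  define g where "g x = R.Lv 1 \<kappa>0 x - h x" for x
  have gL: "L2_fun g" unfolding g_def by (intro L2_fun_diff R.Lv_L2 hL)
  note Lvb = Lv_biorth[OF shifts_biorth]
  \<comment> \<open>The entries of \<open>w\<close> are the pairings of
    \<open>R.Lv 1 \<kappa>0\<close> with the functions \<open>Rt.el i\<close>, so subtracting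
    \<open>h\<close> removes exactly these.\<close>
  have el0: "L2_inner g (Rt.el i) = 0" for i
  proof -
    have "L2_inner (R.Lv 1 \<kappa>0) (Rt.el i) = L2_inner (lc (kd \<kappa>0) (R.Lv 1)) (lc (Rt.E i) (Rt.Lv 1))"
      by (simp add: lc_kd Rt.el_def)
    also have "\<dots> = w i"
      by (subst lc_inner[OF fsupp_kd Rt.fsupp_E R.Lv_L2 Rt.Lv_L2 Lvb]) (simp add: ips_kd w_def)
    finally have 1: "L2_inner (R.Lv 1 \<kappa>0) (Rt.el i) = w i" .
    have "L2_inner h (Rt.el i) = L2_inner (lc w R.el) (lc (kd i) Rt.el)" by (simp add: lc_kd h_def)
    also have "\<dots> = w i"
      by (subst lc_inner[OF w fsupp_kd R.el_L2 Rt.el_L2 el_biorth]) (simp add: ips_kd)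
    finally show ?thesis
      unfolding g_def using L2_inner_diff_left[OF R.Lv_L2 hL Rt.el_L2] 1 by simp
  qed
  have "L2_inner g (Rt.AS i) = 0" for i
  proof (cases "\<exists>i'. i = ix i'")
    case True
    then obtain i' where "i = ix i'" by blast
    then have "L2_inner g (Rt.AS i) = L2_inner g (Rt.el i')"
      using L2_inner_cong_ae[OF gL Rt.AS_L2 _ el_AS_t] by simp
    then show ?thesis by (simp add: el0)
  next
    case False
    obtain l j k where i: "i = Inr (l, Suc j, k)"
    proof (cases i)
      case (Inl \<kappa>)
      then have "i = ix (Inr (fst \<kappa>), snd \<kappa>)" by (simp add: ix_def)
      with False show ?thesis by blast
    next
      case (Inr t)
      obtain l j k where t: "t = (l, j, k)" by (cases t)
      show ?thesis
      proof (cases j)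
        case 0
        then have "i = ix (Inl l, k)" by (simp add: ix_def Inr t)
        with False show ?thesis by blast
      next
        case (Suc j')
        then show ?thesis using that Inr t by blast
      qed
    qed
    \<comment> \<open>The remaining dual elements have positive scale. Undoing one dilation leaves
      the pairing of a shift with a wavelet of the next lower scale.\<close>
    have "L2_inner (R.Lv 1 \<kappa>0) (Rt.AS i) = L2_inner (R.Dj 1 (R.AS (Inl \<kappa>0))) (R.Dj 1 (Rt.AS (Inr (l, j, k))))"
      by (simp add: i R.Lv_def R.AS_simps Rt.AS_simps Rt.Dj_Dj)
    also have "\<dots> = 0" by (subst R.Dj_inner[OF R.AS_L2 Rt.AS_L2]) (simp add: AS_biorth)
    finally have 1: "L2_inner (R.Lv 1 \<kappa>0) (Rt.AS i) = 0" .
    have "L2_inner (R.el i') (Rt.AS i) = 0" for i'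
    proof -
      have "L2_inner (R.el i') (Rt.AS i) = L2_inner (R.AS (ix i')) (Rt.AS i)"
        by (rule L2_inner_cong_ae[symmetric, OF R.AS_L2 Rt.AS_L2 el_AS]) simp
      moreover have "ix i' \<noteq> i" using False by blast
      ultimately show ?thesis by (simp add: AS_biorth)
    qed
    moreover obtain S where S: "lc w R.el = (\<lambda>x. \<Sum>\<kappa>\<in>S. w \<kappa> * R.el \<kappa> x)" using ex_lc_sum[OF w, of R.el] by blast
    ultimately have "L2_inner h (Rt.AS i) = 0"
      unfolding h_def S by (subst L2_inner_sum_left) (auto simp: R.el_L2 Rt.AS_L2)
    then show ?thesis
      unfolding g_def using L2_inner_diff_left[OF R.Lv_L2 hL Rt.AS_L2] 1 by simp
  qed
  then have "L2_norm g = 0" by (rule orthogonal_to_AS_zero[OF gL])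
  then have "L2_inner g (Rt.Lv 1 \<kappa>') = 0"
    using L2_cauchy_schwarz[OF gL Rt.Lv_L2, of 1 \<kappa>'] by simp
  moreover have "L2_inner g (Rt.Lv 1 \<kappa>') = L2_inner (R.Lv 1 \<kappa>0) (Rt.Lv 1 \<kappa>') - L2_inner h (Rt.Lv 1 \<kappa>')"
    unfolding g_def by (rule L2_inner_diff_left[OF R.Lv_L2 hL Rt.Lv_L2])
  moreover have "L2_inner h (Rt.Lv 1 \<kappa>') = syn R.E w \<kappa>'"
  proof -
    have "h = lc (syn R.E w) (R.Lv 1)"
      by (simp add: h_def lc_syn[OF R.loc_fin w] R.el_def[abs_def])
    then have "L2_inner h (Rt.Lv 1 \<kappa>') = L2_inner (lc (syn R.E w) (R.Lv 1)) (lc (kd \<kappa>') (Rt.Lv 1))"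
      by (simp add: lc_kd)
    also have "\<dots> = syn R.E w \<kappa>'"
      by (subst lc_inner[OF fsupp_syn[OF R.loc_fin w] fsupp_kd R.Lv_L2 Rt.Lv_L2 Lvb]) (simp add: ips_kd)
    finally show ?thesis .
  qed
  ultimately have "syn R.E w \<kappa>' = (if \<kappa>0 = \<kappa>' then 1 else 0)" by (simp add: Lvb)
  then show "Sum_any (\<lambda>i. cnj (Rt.E i \<kappa>0) * R.E i \<kappa>') = (if \<kappa>0 = \<kappa>' then 1 else 0)"
    by (simp add: syn_def w_def)
qed

text \<open>A combination of level \<open>J\<close> has the norm of the corresponding combination of
  shifts, so the Riesz bounds compare it with \<open>nsq u\<close>. Expanded in the affine system,
  it is compared with \<open>nsq c\<close>, that is with \<open>ml\<close>. The bounds are those of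
  the dual system, because analysis with \<open>R.E\<close> is undone by synthesis with
  \<open>Rt.E\<close>; their quotients do not depend on \<open>J\<close>.\<close>

lemma finite_stability:
  "\<exists>c1>0. \<exists>c2>0. \<forall>J u. fsupp u \<longrightarrow> c1 * nsq u \<le> ml R.E J u \<and> ml R.E J u \<le> c2 * nsq u"
proof -
  have "riesz_basis_L2 Rt.AS" using brb by (simp add: biorthogonal_riesz_bases_def)
  then obtain A B where AB: "A > 0" "B > 0" and
    rb: "\<And>c. fsupp c \<Longrightarrow> A * nsq c \<le> (L2_norm (lc c Rt.AS))\<^sup>2" "\<And>c. fsupp c \<Longrightarrow> (L2_norm (lc c Rt.AS))\<^sup>2 \<le> B * nsq c"
    unfolding riesz_basis_lc by blast
  have "A / B * nsq u \<le> ml R.E J u \<and> ml R.E J u \<le> B / A * nsq u" if u: "fsupp u" for J u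
  proof -
    define c where "c = decomp R.E J u"
    have c: "fsupp c" unfolding c_def by (rule fsupp_decomp[OF R.loc_fin u])
    have c0: "c (Inr (l, j, k)) = 0" if "j \<ge> J" for l j k using that by (simp add: c_def decomp_def)
    have lev: "lev Rt.E c J = u"
      using lev_decomp[OF R.loc_fin Rt.loc_fin reproducing_commute[OF E_reproducing], of J J u] by (simp add: c_def)
    have ml: "ml R.E J u = nsq c"
      using ml_lev_nsq[where J=J, OF R.loc_fin Rt.loc_fin E_biorth c c0] by (simp add: lev)
    have ae: "AE x in lebesgue. lc u (Rt.Lv J) x = lc c Rt.AS x"
      using Rt.lc_lev[of c J, OF c c0] by (simp add: lev)
    have n1: "L2_norm (lc c Rt.AS) = L2_norm (lc u (Rt.Lv J))"
      by (rule L2_norm_cong_ae[OF L2_funD(1)[OF lc_L2[OF u Rt.Lv_L2]] ae, symmetric])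
    have "lc u (Rt.Lv J) = Rt.Dj J (lc u (shifts \<phi>t))"
      by (simp add: Rt.Dj_lc[OF u] Rt.Lv_def[abs_def])
    then have n2: "L2_norm (lc u (Rt.Lv J)) = L2_norm (lc u (shifts \<phi>t))"
      by (simp add: Rt.Dj_norm lc_L2[OF u Rt.shifts_L2])
    \<comment> \<open>The shifts belong to the affine system, so its Riesz bounds also apply to the
      coefficients \<open>u\<close>.\<close>
    define c' :: "('s, 'r, int ^ 'd) aindex \<Rightarrow> complex" where "c' i = (case i of Inl \<kappa> \<Rightarrow> u \<kappa> | _ \<Rightarrow> 0)" for i
    obtain S where S: "finite S" "\<And>\<kappa>. \<kappa> \<notin> S \<Longrightarrow> u \<kappa> = 0" using fsuppE[OF u] by blast
    have c'0: "c' i = 0" if "i \<notin> Inl ` S" for i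
      using that S(2) by (cases i) (auto simp: c'_def)
    have inj: "inj_on Inl S" by simp
    have c': "fsupp c'" by (rule fsuppI[of "Inl ` S"]) (use S c'0 in auto)
    have n3: "lc c' Rt.AS = lc u (shifts \<phi>t)"
      using lc_eq[of "Inl ` S" c' Rt.AS] lc_eq[of S u "shifts \<phi>t"] S c'0
      by (simp add: sum.reindex[OF inj]) (simp add: c'_def Rt.AS_simps)
    have n4: "nsq c' = nsq u"
      using nsq_eq[of "Inl ` S" c'] nsq_eq[of S u] S c'0
      by (simp add: sum.reindex[OF inj]) (simp add: c'_def)
    have 1: "A * nsq c \<le> B * nsq u" and 2: "A * nsq u \<le> B * nsq c"
      using rb[OF c] rb[OF c'] n1 n2 n3 n4 by simp_all
    then show ?thesis using AB by (simp add: ml field_simps)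
  qed
  then show ?thesis using AB by (intro exI[of _ "A / B"] conjI exI[of _ "B / A"]) auto
qed

end

end

section \<open>Averages over lattices\<close>

definition ibox :: "int \<Rightarrow> (int ^ 'd) set" where
  "ibox N = {n. \<forall>i. 0 \<le> n $ i \<and> n $ i < N}"

definition lat :: "int ^ 'd ^ 'd \<Rightarrow> (int ^ 'd) set" where
  "lat D = range ((*v) D)"

definition smul :: "int \<Rightarrow> int ^ 'd \<Rightarrow> int ^ 'd" where
  "smul N m = (\<chi> i. N * m $ i)"

definition chr :: "real ^ 'd \<Rightarrow> int ^ 'd \<Rightarrow> complex" where
  "chr \<omega> n = cis (- (2 * pi * (rvec n \<bullet> \<omega>)))"

lemma finite_ibox: "finite (ibox N :: (int ^ 'd) set)"
proof (rule finite_subset[OF _ finite_int_box[of N]])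
  show "ibox N \<subseteq> {m :: int ^ 'd. \<forall>i. \<bar>m $ i\<bar> \<le> N}"
  proof (intro subsetI CollectI allI)
    fix m :: "int ^ 'd" and i assume "m \<in> ibox N"
    then have "0 \<le> m $ i" "m $ i < N" by (auto simp: ibox_def)
    then show "\<bar>m $ i\<bar> \<le> N" by simp
  qed
qed

text \<open>The box is a complete residue system modulo \<open>N\<close>, and reduction modulo
  \<open>N\<close> turns the shift into a permutation of it.\<close>

lemma ibox_shift_sum:
  fixes G :: "int ^ 'd \<Rightarrow> complex"
  assumes N: "N > 0" and G: "\<And>n m. G (n + smul N m) = G n"
  shows "(\<Sum>n\<in>ibox N. G (n + t)) = (\<Sum>n\<in>ibox N. G n)"
proof (rule sum.reindex_bij_witness[of _ "\<lambda>n. \<chi> i. (n $ i - t $ i) mod N" "\<lambda>n. \<chi> i. (n $ i + t $ i) mod N"])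
  fix n :: "int ^ 'd" assume n: "n \<in> ibox N"
  show "(\<chi> i. ((\<chi> i. (n $ i + t $ i) mod N) $ i - t $ i) mod N) = n"
    using n by (simp add: vec_eq_iff mod_diff_left_eq ibox_def)
  show "(\<chi> i. ((\<chi> i. (n $ i - t $ i) mod N) $ i + t $ i) mod N) = n"
    using n by (simp add: vec_eq_iff mod_add_left_eq ibox_def)
  show "(\<chi> i. (n $ i + t $ i) mod N) \<in> ibox N" "(\<chi> i. (n $ i - t $ i) mod N) \<in> ibox N"
    using N by (auto simp: ibox_def)
  have "n + t = (\<chi> i. (n $ i + t $ i) mod N) + smul N (\<chi> i. (n $ i + t $ i) div N)"
    by (simp add: vec_eq_iff smul_def)
  then show "G (\<chi> i. (n $ i + t $ i) mod N) = G (n + t)" using G by simp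
qed

lemma lat_add: "a \<in> lat D \<Longrightarrow> b \<in> lat D \<Longrightarrow> a + b \<in> lat D" "a \<in> lat D \<Longrightarrow> b \<in> lat D \<Longrightarrow> a - b \<in> lat D"
proof -
  assume "a \<in> lat D" "b \<in> lat D"
  then obtain x y where "a = D *v x" "b = D *v y" by (auto simp: lat_def)
  then have "a + b = D *v (x + y)" "a - b = D *v (x - y)"
    by (simp_all add: matrix_vector_mult_def vec_eq_iff sum.distrib sum_subtractf distrib_left right_diff_distrib)
  then show "a + b \<in> lat D" "a - b \<in> lat D" by (auto simp: lat_def)
qed

text \<open>Cramer's rule: \<open>det D\<close> times the inverse of \<open>D\<close> has integer
  entries.\<close>

lemma smul_in_lat:
  fixes D :: "int ^ 'd ^ 'd"
  assumes D: "det (rmat D) \<noteq> 0" and N: "det D dvd N"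
  shows "smul N m \<in> lat D"
proof -
  obtain c where c: "N = det D * c" using N by (elim dvdE)
  let ?A = "\<lambda>k. \<chi> i j. if j = k then m $ i else D $ i $ j"
  define y where "y = (\<chi> k. c * det (?A k))"
  define x where "x = (\<chi> k. det (\<chi> i j. if j = k then rvec m $ i else rmat D $ i $ j) / det (rmat D))"
  have Dx: "rmat D *v x = rvec m" using cramer[OF D, of x "rvec m"] by (simp add: x_def)
  have det: "det (\<chi> i j. if j = k then rvec m $ i else rmat D $ i $ j) = real_of_int (det (?A k))" for k
  proof -
    have "rmat (?A k) = (\<chi> i j. if j = k then rvec m $ i else rmat D $ i $ j)"
      by (simp add: rmat_def rvec_def vec_eq_iff)
    then show ?thesis using det_rmat[of "?A k"] by simp
  qed
  have "rvec y = real_of_int N *\<^sub>R x"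
    using D by (simp add: vec_eq_iff y_def x_def det rvec_def c det_rmat)
  then have "rvec (D *v y) = real_of_int N *\<^sub>R rvec m"
    by (simp add: rmat_mult_rvec[symmetric] matrix_vector_mult_scaleR Dx)
  also have "\<dots> = rvec (smul N m)" by (simp add: rvec_def smul_def vec_eq_iff)
  finally have "smul N m = D *v y" by simp
  then show ?thesis by (simp add: lat_def)
qed

lemma det_rmat_transpose: "rmat (transpose D) = transpose (rmat D)"
  by (simp add: rmat_def transpose_def vec_eq_iff)

text \<open>Turns membership into integrality of \<open>transpose (rmat D) *v \<omega>\<close>, on
  which the values of the character on \<open>lat D\<close> depend.\<close>

lemma Omega_iff:
  fixes D :: "int ^ 'd ^ 'd"
  assumes D: "det (rmat D) \<noteq> 0" and \<omega>: "\<And>i. 0 \<le> \<omega> $ i \<and> \<omega> $ i < 1"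
  shows "\<omega> \<in> Omega D \<longleftrightarrow> (\<exists>z. transpose (rmat D) *v \<omega> = rvec z)"
proof
  assume "\<omega> \<in> Omega D"
  then obtain z where "\<omega> = inv_transp D *v rvec z" by (auto simp: Omega_def)
  then have "transpose (rmat D) *v \<omega> = rvec z" by (simp only: inv_transp(1)[OF D])
  then show "\<exists>z. transpose (rmat D) *v \<omega> = rvec z" ..
next
  assume "\<exists>z. transpose (rmat D) *v \<omega> = rvec z"
  then obtain z where "transpose (rmat D) *v \<omega> = rvec z" ..
  then have "\<omega> = inv_transp D *v rvec z" using inv_transp(2)[OF D, of \<omega>] by simp
  then show "\<omega> \<in> Omega D" using \<omega> by (auto simp: Omega_def)
qed

text \<open>Multiples of the determinant clear the denominators of \<open>\<omega>\<close>, by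
  \<open>smul_in_lat\<close> for the transpose.\<close>

lemma Omega_multiple:
  fixes D :: "int ^ 'd ^ 'd"
  assumes D: "det (rmat D) \<noteq> 0" and N: "det D dvd N" and \<omega>: "\<omega> \<in> Omega D"
  shows "\<exists>z. real_of_int N *\<^sub>R \<omega> = rvec z"
proof -
  obtain k where k: "\<omega> = inv_transp D *v rvec k" using \<omega> by (auto simp: Omega_def)
  have "smul N k \<in> lat (transpose D)"
    by (rule smul_in_lat) (use D N in \<open>simp_all add: det_rmat_transpose det_transpose\<close>)
  then obtain y where y: "smul N k = transpose D *v y" by (auto simp: lat_def)
  have "rvec (transpose D *v y) = transpose (rmat D) *v rvec y"
    by (simp only: rmat_mult_rvec[symmetric] det_rmat_transpose)
  then have "inv_transp D *v rvec (smul N k) = rvec y"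
    unfolding y by (simp only: inv_transp(2)[OF D])
  moreover have "rvec (smul N k) = real_of_int N *\<^sub>R rvec k" by (simp add: rvec_def smul_def vec_eq_iff)
  ultimately have "real_of_int N *\<^sub>R \<omega> = rvec y" by (simp add: k matrix_vector_mult_scaleR)
  then show ?thesis ..
qed

lemma chr_add: "chr \<omega> (a + b) = chr \<omega> a * chr \<omega> b"
  by (simp add: chr_def rvec_simps inner_add_left cis_mult distrib_left)

lemma rvec_inner: "rvec a \<bullet> rvec b = real_of_int (\<Sum>i\<in>UNIV. a $ i * b $ i)"
  by (simp add: inner_vec_def rvec_def)

lemma cis_int: "cis (- (2 * pi * real_of_int z)) = 1"
proof -
  have "cis (2 * pi * real_of_int (- z)) = 1" by (rule cis_multiple_2pi) simp
  then show ?thesis by simp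
qed

lemma chr_smul:
  assumes "real_of_int N *\<^sub>R \<omega> = rvec z"
  shows "chr \<omega> (smul N m) = 1"
proof -
  have "rvec (smul N m) \<bullet> \<omega> = rvec m \<bullet> (real_of_int N *\<^sub>R \<omega>)"
    by (simp add: inner_vec_def rvec_def smul_def sum_distrib_left ac_simps)
  also have "\<dots> = real_of_int (\<Sum>i\<in>UNIV. m $ i * z $ i)" unfolding assms by (rule rvec_inner)
  finally show ?thesis unfolding chr_def by (simp only: cis_int)
qed

lemma rvec_mult_inner: "rvec (D *v k) \<bullet> \<omega> = rvec k \<bullet> (transpose (rmat D) *v \<omega>)"
proof -
  have "rvec k \<bullet> (transpose (rmat D) *v \<omega>) = (rvec k v* transpose (rmat D)) \<bullet> \<omega>"
    by (rule dot_lmul_matrix[symmetric])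
  also have "rvec k v* transpose (rmat D) = rmat D *v rvec k" by simp
  finally show ?thesis by (simp add: rmat_mult_rvec)
qed

lemma half_open_cube_measure:
  "emeasure lborel {x :: real ^ 'd. \<forall>i. 0 \<le> x $ i \<and> x $ i < c} = ennreal (c ^ CARD('d))" if "c > 0"
proof -
  let ?C = "{x :: real ^ 'd. \<forall>i. 0 \<le> x $ i \<and> x $ i < c}" and ?u = "(\<chi> i. c) :: real ^ 'd"
  have sub: "box 0 ?u \<subseteq> ?C" "?C \<subseteq> cbox 0 ?u" by (auto simp: mem_box_cart less_imp_le)
  have meas: "?C \<in> sets borel"
  proof -
    have "?C = (\<Inter>i. {x. 0 \<le> x $ i} \<inter> {x. x $ i < c})" by auto
    also have "\<dots> \<in> sets borel"
      by (intro sets.finite_INT sets.Int) (auto intro!: borel_closed borel_open closed_halfspace_component_ge_cart open_halfspace_component_lt_cart)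
    finally show ?thesis .
  qed
  have Basis: "(Basis :: (real ^ 'd) set) = (\<lambda>i. axis i 1) ` UNIV" by (auto simp: Basis_vec_def)
  have inj: "inj (\<lambda>i. axis i 1 :: real ^ 'd)" by (simp add: inj_on_def axis_eq_axis)
  have p: "(\<Prod>b\<in>Basis. (?u - 0) \<bullet> b) = c ^ CARD('d)"
    unfolding Basis prod.reindex[OF inj] by (simp add: inner_axis)
  have le: "\<And>b. b \<in> Basis \<Longrightarrow> 0 \<bullet> b \<le> ?u \<bullet> b" unfolding Basis using that by (auto simp: inner_axis)
  have "emeasure lborel (box 0 ?u) = ennreal (c ^ CARD('d))"
    using emeasure_lborel_box[of 0 ?u] le p by simp
  moreover have "emeasure lborel (cbox 0 ?u) = ennreal (c ^ CARD('d))"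
    using emeasure_lborel_cbox[of 0 ?u] le p by simp
  moreover have "emeasure lborel (box 0 ?u) \<le> emeasure lborel ?C" "emeasure lborel ?C \<le> emeasure lborel (cbox 0 ?u)"
    using sub meas by (intro emeasure_mono; simp)+
  ultimately show ?thesis by (intro antisym) simp_all
qed

lemma half_open_cube_borel: "{x :: real ^ 'd. \<forall>i. 0 \<le> x $ i \<and> x $ i < c} \<in> sets borel"
proof -
  have "{x :: real ^ 'd. \<forall>i. 0 \<le> x $ i \<and> x $ i < c} = (\<Inter>i. {x. 0 \<le> x $ i} \<inter> {x. x $ i < c})" by auto
  also have "\<dots> \<in> sets borel"
    by (intro sets.finite_INT sets.Int) (auto intro!: borel_closed borel_open closed_halfspace_component_ge_cart open_halfspace_component_lt_cart)
  finally show ?thesis .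
qed

text \<open>The index of the lattice \<open>D\<int>\<^sup>d\<close>, by comparing the volumes of two fundamental domains:
  the translates of \<open>D[0,1)\<^sup>d\<close> by \<open>D\<int>\<^sup>d\<close> and those of \<open>[0,N)\<^sup>d\<close> by \<open>N\<int>\<^sup>d\<close> tile the space.\<close>

lemma card_lat_ibox:
  fixes D :: "int ^ 'd ^ 'd"
  assumes D: "det (rmat D) \<noteq> 0" and N: "det D dvd N" "N > 0"
  shows "abs_det D * real (card (ibox N \<inter> lat D)) = real_of_int N ^ CARD('d)"
proof -
  define Q where "Q c = {x :: real ^ 'd. \<forall>i. 0 \<le> x $ i \<and> x $ i < c}" for c
  define B where "B = matrix_inv (rmat D)"
  have DB: "rmat D *v (B *v x) = x" "B *v (rmat D *v x) = x" for x
    using matrix_inv_mult[OF D] by (simp_all add: B_def matrix_vector_mul_assoc)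
  define S where "S = ibox N \<inter> lat D"
  have S: "finite S" unfolding S_def using finite_ibox by blast
  have Qm [measurable]: "Q c \<in> sets borel" for c unfolding Q_def by (rule half_open_cube_borel)
  define u :: "real ^ 'd \<Rightarrow> ennreal" where "u = indicator (Q (real_of_int N))"
  define w :: "real ^ 'd \<Rightarrow> ennreal" where "w x = indicator (Q 1) (B *v x)" for x
  have [measurable]: "u \<in> borel_measurable borel" "w \<in> borel_measurable borel"
    unfolding u_def w_def by measurable
  have Nr: "real_of_int N > 0" using N by simp
  \<comment> \<open>Bounds the coordinates of all points of \<open>rmat D\<close> applied to the
    unit cube.\<close>
  define bd where "bd = \<lceil>(\<Sum>i\<in>UNIV. \<Sum>j\<in>UNIV. \<bar>rmat D $ i $ j\<bar>)\<rceil>"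
  have Pbound: "\<bar>y $ i\<bar> \<le> real_of_int bd" if "B *v y \<in> Q 1" for y i
  proof -
    have "y $ i = (\<Sum>j\<in>UNIV. rmat D $ i $ j * (B *v y) $ j)"
      using DB(1)[of y] by (metis matrix_vector_mul_component inner_vec_def inner_real_def vec_lambda_eta matrix_vector_mult_def vec_lambda_beta)
    also have "\<bar>\<dots>\<bar> \<le> (\<Sum>j\<in>UNIV. \<bar>rmat D $ i $ j * (B *v y) $ j\<bar>)" by (rule sum_abs)
    also have "\<dots> \<le> (\<Sum>j\<in>UNIV. \<bar>rmat D $ i $ j\<bar>)"
    proof (rule sum_mono)
      fix j
      have "\<bar>(B *v y) $ j\<bar> \<le> 1" using that by (simp add: Q_def less_imp_le)
      then show "\<bar>rmat D $ i $ j * (B *v y) $ j\<bar> \<le> \<bar>rmat D $ i $ j\<bar>"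
        using mult_left_mono[of "\<bar>(B *v y) $ j\<bar>" 1 "\<bar>rmat D $ i $ j\<bar>"] by (simp add: abs_mult)
    qed
    also have "\<dots> \<le> (\<Sum>i\<in>UNIV. \<Sum>j\<in>UNIV. \<bar>rmat D $ i $ j\<bar>)"
      by (rule member_le_sum[of i UNIV "\<lambda>i. \<Sum>j\<in>UNIV. \<bar>rmat D $ i $ j\<bar>"]) (auto intro: sum_nonneg)
    also have "\<dots> \<le> real_of_int bd" by (simp add: bd_def)
    finally show ?thesis .
  qed
  \<comment> \<open>Wide enough for both tilings: \<open>bd\<close> accounts for a cell of the
    lattice, and \<open>2 * N\<close> for a point of the box together with the representative
    \<open>n\<close>.\<close>
  define L where "L = {m :: int ^ 'd. \<forall>i. \<bar>m $ i\<bar> \<le> bd + 2 * N}"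
  have L: "finite L" unfolding L_def by (rule finite_int_box)
  have zN: "\<bar>z\<bar> \<le> b" if "\<bar>real_of_int N * real_of_int z\<bar> \<le> real_of_int b" for z b :: int
  proof -
    have "\<bar>N * z\<bar> \<le> b" using that by (simp only: of_int_mult[symmetric] of_int_abs[symmetric] of_int_le_iff)
    moreover have "\<bar>z\<bar> \<le> N * \<bar>z\<bar>" using N(2) mult_right_mono[of 1 N "\<bar>z\<bar>"] by simp
    ultimately show ?thesis using N(2) by (simp add: abs_mult)
  qed
  \<comment> \<open>The point \<open>x\<close> lies in exactly one cell, that of \<open>v\<close>,
    and \<open>v\<close> splits uniquely into residue and quotient modulo \<open>N\<close>.\<close>
  have tile1: "(\<Sum>n\<in>S. \<Sum>m\<in>L. w (x - (rvec n + rvec (smul N m)))) = 1" if x: "x \<in> Q (real_of_int N)" for x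
  proof -
    define k where "k = (\<chi> i. \<lfloor>(B *v x) $ i\<rfloor>)"
    define v where "v = D *v k"
    define n0 where "n0 = (\<chi> i. v $ i mod N)"
    define m0 where "m0 = (\<chi> i. v $ i div N)"
    have v: "v = n0 + smul N m0" by (simp add: n0_def m0_def smul_def vec_eq_iff)
    have wv: "w (x - rvec v') = (if v' = v then 1 else 0)" if v': "v' \<in> lat D" for v'
    proof -
      obtain k' where k': "v' = D *v k'" using v' by (auto simp: lat_def)
      have Bx: "B *v (x - rvec v') = B *v x - rvec k'"
        by (simp add: matrix_vector_mult_diff_distrib k' rmat_mult_rvec[symmetric] DB)
      have "w (x - rvec v') = (if \<forall>i. real_of_int (k' $ i) \<le> (B *v x) $ i \<and> (B *v x) $ i < real_of_int (k' $ i) + 1 then 1 else 0)"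
        unfolding w_def Bx by (auto simp: Q_def indicator_def rvec_def algebra_simps)
      also have "(\<forall>i. real_of_int (k' $ i) \<le> (B *v x) $ i \<and> (B *v x) $ i < real_of_int (k' $ i) + 1) \<longleftrightarrow> k' = k"
        by (auto simp: k_def vec_eq_iff floor_eq_iff intro: floor_unique[symmetric])
      also have "k' = k \<longleftrightarrow> v' = v"
        unfolding k' v_def using inj_int_matrix[OF D] by (auto dest: injD)
      finally show ?thesis .
    qed
    have n0: "n0 \<in> S"
    proof -
      have "n0 = v - smul N m0" using v by simp
      moreover have "v \<in> lat D" by (simp add: v_def lat_def)
      ultimately have "n0 \<in> lat D" using lat_add(2) smul_in_lat[OF D N(1)] by metis
      then show ?thesis using N(2) by (simp add: S_def ibox_def n0_def)
    qed
    have m0: "m0 \<in> L"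
    proof -
      have "v \<in> lat D" by (simp add: v_def lat_def)
      from wv[OF this] have "B *v (x - rvec v) \<in> Q 1" by (simp add: w_def indicator_def split: if_splits)
      then have y: "\<bar>(x - rvec v) $ i\<bar> \<le> real_of_int bd" for i by (rule Pbound)
      have "\<bar>m0 $ i\<bar> \<le> bd + 2 * N" for i
      proof (rule zN)
        have "real_of_int (v $ i) = real_of_int (n0 $ i) + real_of_int N * real_of_int (m0 $ i)"
          using arg_cong[OF v, of "\<lambda>v. v $ i"] by (simp add: smul_def)
        moreover have "0 \<le> n0 $ i" "n0 $ i < N" using n0 by (auto simp: S_def ibox_def)
        moreover have "0 \<le> x $ i" "x $ i < real_of_int N" using x by (auto simp: Q_def)
        ultimately show "\<bar>real_of_int N * real_of_int (m0 $ i)\<bar> \<le> real_of_int (bd + 2 * N)"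
          using y[of i] by (simp add: rvec_def)
      qed
      then show ?thesis by (simp add: L_def)
    qed
    have eq: "w (x - (rvec n + rvec (smul N m))) = (if n = n0 then if m = m0 then 1 else 0 else 0)" if n: "n \<in> S" for n m
    proof -
      have lt: "n + smul N m \<in> lat D" using n smul_in_lat[OF D N(1)] by (auto simp: S_def intro: lat_add)
      have iff: "n + smul N m = v \<longleftrightarrow> n = n0 \<and> m = m0"
      proof
        assume e: "n + smul N m = v"
        have b: "0 \<le> n $ i" "n $ i < N" for i using n by (auto simp: S_def ibox_def)
        have "n $ i = v $ i mod N" "m $ i = v $ i div N" for i
        proof -
          have ei: "v $ i = n $ i + N * m $ i" using arg_cong[OF e, of "\<lambda>v. v $ i"] by (simp add: smul_def)
          show "n $ i = v $ i mod N" using b[of i] by (simp add: ei)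
          show "m $ i = v $ i div N" using b[of i] N(2) by (simp add: ei)
        qed
        then show "n = n0 \<and> m = m0" by (simp add: n0_def m0_def vec_eq_iff)
      qed (simp add: v)
      have "w (x - (rvec n + rvec (smul N m))) = w (x - rvec (n + smul N m))" by (simp add: rvec_simps)
      also have "\<dots> = (if n + smul N m = v then 1 else 0)" by (rule wv[OF lt])
      finally show ?thesis unfolding iff by simp
    qed
    have "(\<Sum>n\<in>S. \<Sum>m\<in>L. w (x - (rvec n + rvec (smul N m)))) = (\<Sum>n\<in>S. \<Sum>m\<in>L. if n = n0 then if m = m0 then 1 else 0 else 0)"
      by (intro sum.cong refl eq)
    also have "\<dots> = (\<Sum>n\<in>S. if n = n0 then 1 else 0)"
      using L m0 by (intro sum.cong refl) simp
    also have "\<dots> = 1" using S n0 by simp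
    finally show ?thesis .
  qed
  have tile2: "(\<Sum>m\<in>L. u (y + (rvec n + rvec (smul N m)))) = 1" if y: "B *v y \<in> Q 1" and n: "n \<in> S" for y n
  proof -
    define m0 where "m0 = (\<chi> i. - \<lfloor>(y $ i + real_of_int (n $ i)) / real_of_int N\<rfloor>)"
    have iff: "y + (rvec n + rvec (smul N m)) \<in> Q (real_of_int N) \<longleftrightarrow> m = m0" for m
    proof -
      have "y + (rvec n + rvec (smul N m)) \<in> Q (real_of_int N)
        \<longleftrightarrow> (\<forall>i. real_of_int (- m $ i) \<le> (y $ i + real_of_int (n $ i)) / real_of_int N \<and>
              (y $ i + real_of_int (n $ i)) / real_of_int N < real_of_int (- m $ i) + 1)"
      proof -
        have "(0 \<le> a + (b + real_of_int N * z) \<and> a + (b + real_of_int N * z) < real_of_int N)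
          \<longleftrightarrow> (- z \<le> (a + b) / real_of_int N \<and> (a + b) / real_of_int N < - z + 1)" for a b z
          using Nr by (auto simp: field_simps)
        then show ?thesis by (simp add: Q_def rvec_def smul_def)
      qed
      also have "\<dots> \<longleftrightarrow> (\<forall>i. \<lfloor>(y $ i + real_of_int (n $ i)) / real_of_int N\<rfloor> = - m $ i)"
        by (simp only: floor_eq_iff)
      also have "\<dots> \<longleftrightarrow> m = m0" by (auto simp: m0_def vec_eq_iff)
      finally show ?thesis .
    qed
    have m0: "m0 \<in> L"
    proof -
      have q: "y + (rvec n + rvec (smul N m0)) \<in> Q (real_of_int N)" using iff by simp
      have "\<bar>m0 $ i\<bar> \<le> bd + 2 * N" for i
      proof (rule zN)
        have "0 \<le> y $ i + (real_of_int (n $ i) + real_of_int N * real_of_int (m0 $ i))"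
          "y $ i + (real_of_int (n $ i) + real_of_int N * real_of_int (m0 $ i)) < real_of_int N"
          using q by (auto simp: Q_def rvec_def smul_def)
        moreover have "0 \<le> n $ i" "n $ i < N" using n by (auto simp: S_def ibox_def)
        ultimately show "\<bar>real_of_int N * real_of_int (m0 $ i)\<bar> \<le> real_of_int (bd + 2 * N)"
          using Pbound[OF y, of i] by simp
      qed
      then show ?thesis by (simp add: L_def)
    qed
    have "(\<Sum>m\<in>L. u (y + (rvec n + rvec (smul N m)))) = (\<Sum>m\<in>L. if m = m0 then 1 else 0)"
      by (intro sum.cong refl) (simp add: u_def indicator_def iff)
    also have "\<dots> = 1" using L m0 by simp
    finally show ?thesis .
  qed
  have w1: "(\<integral>\<^sup>+x. w x \<partial>lborel) = ennreal (abs_det D)"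
  proof -
    have "(\<integral>\<^sup>+x. w x \<partial>lborel) = ennreal \<bar>det (rmat D)\<bar> * (\<integral>\<^sup>+x. w (rmat D *v x) \<partial>lborel)"
      by (rule nn_integral_linear[OF _ D]) simp
    also have "(\<integral>\<^sup>+x. w (rmat D *v x) \<partial>lborel) = emeasure lborel (Q 1)"
      by (simp add: w_def DB)
    also have "\<dots> = 1" unfolding Q_def by (subst half_open_cube_measure) auto
    finally show ?thesis by (simp add: abs_det_eq)
  qed
  \<comment> \<open>The volume of the box is computed through the cells that sum to 1 on it; each
    cell is then translated to the origin, where the translated boxes sum to 1 in turn.\<close>
  have "ennreal (real_of_int N ^ CARD('d)) = (\<integral>\<^sup>+x. u x \<partial>lborel)"
    using half_open_cube_measure[where 'd='d, OF Nr] by (simp add: u_def Q_def[symmetric])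
  also have "\<dots> = (\<integral>\<^sup>+x. (\<Sum>n\<in>S. \<Sum>m\<in>L. u x * w (x - (rvec n + rvec (smul N m)))) \<partial>lborel)"
  proof (rule nn_integral_cong)
    fix x
    show "u x = (\<Sum>n\<in>S. \<Sum>m\<in>L. u x * w (x - (rvec n + rvec (smul N m))))"
      unfolding sum_distrib_left[symmetric]
      by (cases "x \<in> Q (real_of_int N)") (simp_all add: tile1 u_def)
  qed
  also have "\<dots> = (\<Sum>n\<in>S. \<Sum>m\<in>L. (\<integral>\<^sup>+x. u x * w (x - (rvec n + rvec (smul N m))) \<partial>lborel))"
    by (subst nn_integral_sum, simp, rule sum.cong, simp, subst nn_integral_sum) auto
  also have "\<dots> = (\<Sum>n\<in>S. \<Sum>m\<in>L. (\<integral>\<^sup>+y. u (y + (rvec n + rvec (smul N m))) * w y \<partial>lborel))"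
  proof (intro sum.cong refl)
    fix n m :: "int ^ 'd"
    let ?t = "rvec n + rvec (smul N m)"
    have "(\<integral>\<^sup>+x. u x * w (x - ?t) \<partial>lborel) = (\<integral>\<^sup>+x. u x * w (x - ?t) \<partial>distr lborel borel ((+) ?t))"
      by (simp only: lborel_distr_plus)
    also have "\<dots> = (\<integral>\<^sup>+y. u (?t + y) * w (?t + y - ?t) \<partial>lborel)"
      by (rule nn_integral_distr) auto
    finally show "(\<integral>\<^sup>+x. u x * w (x - ?t) \<partial>lborel) = (\<integral>\<^sup>+y. u (y + ?t) * w y \<partial>lborel)"
      by (simp add: add.commute)
  qed
  also have "\<dots> = (\<Sum>n\<in>S. (\<integral>\<^sup>+y. (\<Sum>m\<in>L. u (y + (rvec n + rvec (smul N m))) * w y) \<partial>lborel))"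
    by (intro sum.cong refl nn_integral_sum[symmetric]) simp
  also have "\<dots> = (\<Sum>n\<in>S. (\<integral>\<^sup>+y. w y \<partial>lborel))"
  proof (intro sum.cong refl nn_integral_cong)
    fix n y assume n: "n \<in> S"
    show "(\<Sum>m\<in>L. u (y + (rvec n + rvec (smul N m))) * w y) = w y"
      unfolding sum_distrib_right[symmetric]
      by (cases "B *v y \<in> Q 1") (simp_all add: tile2[OF _ n] w_def)
  qed
  also have "\<dots> = ennreal (abs_det D * real (card S))"
    by (simp add: w1 ennreal_mult'' abs_det_def mult.commute ennreal_of_nat_eq_real_of_nat)
  finally have "real_of_int N ^ CARD('d) = abs_det D * real (card S)"
    using N(2) by (subst (asm) ennreal_inj) (auto simp: abs_det_def)
  then show ?thesis by (simp add: S_def)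
qed

text \<open>The character is trivial on the lattice exactly when \<open>\<omega>\<close> is in
  \<open>Omega D\<close>, and then lattice points are counted by \<open>card_lat_ibox\<close>.
  Otherwise a shift by some lattice vector multiplies the sum by a number other than 1, so the sum
  vanishes.\<close>

lemma character_sum_lat:
  fixes D :: "int ^ 'd ^ 'd"
  assumes D: "det (rmat D) \<noteq> 0" and N: "det D dvd N" "N > 0"
    and \<omega>: "\<And>i. 0 \<le> \<omega> $ i \<and> \<omega> $ i < 1" and N\<omega>: "real_of_int N *\<^sub>R \<omega> = rvec z"
  shows "abs_det D *\<^sub>R (\<Sum>n\<in>ibox N. if n - m \<in> lat D then chr \<omega> n else 0)
    = (real_of_int N ^ CARD('d) * indicat_real (Omega D) \<omega>) *\<^sub>R chr \<omega> m"
proof -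
  define G where "G n = (if n \<in> lat D then chr \<omega> n else 0)" for n
  define Z where "Z = (\<Sum>n\<in>ibox N. G n)"
  have lat_shift: "n + v \<in> lat D \<longleftrightarrow> n \<in> lat D" if "v \<in> lat D" for n v
    using lat_add(1)[of n D v] lat_add(2)[of "n + v" D v] that by auto
  have Gper: "G (n + smul N m) = G n" for n m
    using lat_shift[OF smul_in_lat[OF D N(1)]] by (simp add: G_def chr_add chr_smul[OF N\<omega>])
  have "(\<Sum>n\<in>ibox N. if n - m \<in> lat D then chr \<omega> n else 0) = (\<Sum>n\<in>ibox N. if (n + m) - m \<in> lat D then chr \<omega> (n + m) else 0)"
  proof (rule ibox_shift_sum[symmetric, OF N(2)])
    fix n m'
    have "n + smul N m' - m \<in> lat D \<longleftrightarrow> n - m \<in> lat D"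
      using lat_shift[OF smul_in_lat[OF D N(1)], of "n - m" m'] by (simp add: algebra_simps)
    then show "(if n + smul N m' - m \<in> lat D then chr \<omega> (n + smul N m') else 0) = (if n - m \<in> lat D then chr \<omega> n else 0)"
      by (simp add: chr_add chr_smul[OF N\<omega>])
  qed
  also have "\<dots> = chr \<omega> m * Z"
    unfolding Z_def G_def sum_distrib_left by (intro sum.cong refl) (simp add: chr_add mult.commute)
  finally have sum: "(\<Sum>n\<in>ibox N. if n - m \<in> lat D then chr \<omega> n else 0) = chr \<omega> m * Z" .
  have Z: "abs_det D *\<^sub>R Z = complex_of_real (real_of_int N ^ CARD('d) * indicat_real (Omega D) \<omega>)"
  proof (cases "\<omega> \<in> Omega D")
    case True
    then obtain y where y: "transpose (rmat D) *v \<omega> = rvec y" using Omega_iff[OF D \<omega>] by blast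
    have "G n = (if n \<in> lat D then 1 else 0)" for n
    proof (cases "n \<in> lat D")
      case True
      then obtain k where k: "n = D *v k" by (auto simp: lat_def)
      have "chr \<omega> n = 1"
        unfolding chr_def k rvec_mult_inner y rvec_inner by (rule cis_int)
      then show ?thesis using True by (simp add: G_def)
    qed (simp add: G_def)
    then have "Z = of_nat (card (ibox N \<inter> lat D))"
      unfolding Z_def using sum.inter_restrict[OF finite_ibox, of "\<lambda>_. 1 :: complex" N "lat D"] by simp
    then have "abs_det D *\<^sub>R Z = complex_of_real (abs_det D * real (card (ibox N \<inter> lat D)))"
      by (simp add: scaleR_conv_of_real)
    then show ?thesis using True card_lat_ibox[OF D N] by simp
  next
    case False
    have "\<exists>i. (transpose (rmat D) *v \<omega>) $ i \<notin> \<int>"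
    proof (rule ccontr)
      assume "\<not> ?thesis"
      then have "\<forall>i. \<exists>z. (transpose (rmat D) *v \<omega>) $ i = real_of_int z" by (auto elim!: Ints_cases)
      then obtain f where "\<And>i. (transpose (rmat D) *v \<omega>) $ i = real_of_int (f i)" by metis
      then have "transpose (rmat D) *v \<omega> = rvec (\<chi> i. f i)" by (simp only: vec_eq_iff rvec_def vec_lambda_beta) simp
      then show False using False Omega_iff[OF D \<omega>] by blast
    qed
    then obtain i where i: "(transpose (rmat D) *v \<omega>) $ i \<notin> \<int>" ..
    \<comment> \<open>A column of \<open>D\<close> on which the character differs from 1.\<close>
    define t where "t = D *v axis i 1"
    define \<zeta> where "\<zeta> = chr \<omega> t"
    have rax: "rvec (axis i 1) = axis i 1" by (simp add: rvec_def axis_def vec_eq_iff)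
    have \<zeta>: "\<zeta> \<noteq> 1"
    proof
      assume "\<zeta> = 1"
      then have "cis (- (2 * pi * (transpose (rmat D) *v \<omega>) $ i)) = 1"
        unfolding \<zeta>_def chr_def t_def rvec_mult_inner rax by (simp add: inner_axis')
      then have "cos (2 * pi * (transpose (rmat D) *v \<omega>) $ i) = 1" by (simp add: complex_eq_iff)
      then obtain j :: int where "2 * pi * (transpose (rmat D) *v \<omega>) $ i = real_of_int j * 2 * pi"
        using cos_one_2pi_int by blast
      then have "(transpose (rmat D) *v \<omega>) $ i = real_of_int j" by simp
      then show False using i by simp
    qed
    have "Z = (\<Sum>n\<in>ibox N. G (n + t))"
      unfolding Z_def by (rule ibox_shift_sum[OF N(2) Gper, symmetric])
    also have "\<dots> = \<zeta> * Z"
    proof -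
      have "t \<in> lat D" by (simp add: t_def lat_def)
      then show ?thesis
        unfolding Z_def sum_distrib_left \<zeta>_def
        by (intro sum.cong refl) (simp add: G_def lat_shift chr_add mult.commute)
    qed
    finally have "(\<zeta> - 1) * Z = 0" by (simp add: algebra_simps)
    then have "Z = 0" using \<zeta> by simp
    then show ?thesis using False by simp
  qed
  have "abs_det D *\<^sub>R (chr \<omega> m * Z) = chr \<omega> m * (abs_det D *\<^sub>R Z)" by simp
  then show ?thesis unfolding sum Z by (simp add: scaleR_conv_of_real mult.commute)
qed

section \<open>The dual framelet identity\<close>

text \<open>The reproducing identity, indexed by the filter position
  \<open>a = n - D \<iota> *v k\<close> and the offset \<open>g\<close> of the two columns. The
  shift \<open>k\<close> survives only as a lattice condition on \<open>n - a\<close>, which an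
  average over \<open>n\<close> can detect.\<close>

lemma reproducing_lat_sum:
  fixes D :: "'x :: finite \<Rightarrow> int ^ 'd ^ 'd" and f ft :: "'x \<Rightarrow> int ^ 'd \<Rightarrow> complex ^ 'r"
  assumes D: "\<And>\<iota>. det (rmat (D \<iota>)) \<noteq> 0"
    and A: "finite A" "\<And>\<iota> n. n \<notin> A \<Longrightarrow> f \<iota> n = 0"
    and rep: "reproducing (fcoef D f) (fcoef D ft)"
  shows "(\<Sum>\<iota>\<in>UNIV. \<Sum>a\<in>A. if n - a \<in> lat (D \<iota>) then of_real (abs_det (D \<iota>)) * (cnj (f \<iota> a $ p) * ft \<iota> (a + g) $ p') else 0)
    = (if p = p' \<and> g = 0 then 1 else 0)"
proof -
  define K where "K \<iota> = {k. n - D \<iota> *v k \<in> A}" for \<iota>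
  have K: "finite (K \<iota>)" for \<iota> unfolding K_def by (rule finite_lattice_preimage[OF D]) (use A in simp)
  let ?F = "\<lambda>i. cnj (fcoef D f i (p, n)) * fcoef D ft i (p', n + g)"
  let ?h = "\<lambda>\<iota> a. of_real (abs_det (D \<iota>)) * (cnj (f \<iota> a $ p) * ft \<iota> (a + g) $ p')"
  have F: "?F (\<iota>, k) = ?h \<iota> (n - D \<iota> *v k)" for \<iota> k
  proof -
    define c where "c = complex_of_real (sqrt (abs_det (D \<iota>)))"
    have cc: "c * c = of_real (abs_det (D \<iota>))"
      unfolding c_def by (simp only: of_real_mult[symmetric] real_sqrt_mult_self) (simp add: abs_det_def)
    have mv: "n + g - D \<iota> *v k = n - D \<iota> *v k + g" by simp
    have "?F (\<iota>, k) = cnj (c * f \<iota> (n - D \<iota> *v k) $ p) * (c * ft \<iota> (n - D \<iota> *v k + g) $ p')"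
      unfolding fcoef_def prod.case c_def mv ..
    also have "\<dots> = (c * c) * (cnj (f \<iota> (n - D \<iota> *v k) $ p) * ft \<iota> (n - D \<iota> *v k + g) $ p')"
      by (simp add: c_def ac_simps)
    finally show ?thesis unfolding cc .
  qed
  have "(if p = p' \<and> g = 0 then 1 else 0) = Sum_any ?F"
    using rep by (auto simp: reproducing_def)
  also have "\<dots> = (\<Sum>i\<in>Sigma UNIV K. ?F i)"
  proof (rule Sum_any_eq)
    show "finite (Sigma UNIV K)" using K by simp
    fix i :: "'x \<times> (int ^ 'd)" assume i: "i \<notin> Sigma UNIV K"
    obtain \<iota> k where ik: "i = (\<iota>, k)" by (cases i)
    have "f \<iota> (n - D \<iota> *v k) = 0" using i A(2) by (simp add: ik K_def)
    then show "?F i = 0" unfolding ik F by simp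
  qed
  also have "\<dots> = (\<Sum>\<iota>\<in>UNIV. \<Sum>k\<in>K \<iota>. ?F (\<iota>, k))"
    using K by (simp add: sum.Sigma)
  also have "\<dots> = (\<Sum>\<iota>\<in>UNIV. \<Sum>a\<in>A. if n - a \<in> lat (D \<iota>) then ?h \<iota> a else 0)"
  proof (rule sum.cong)
    fix \<iota>
    have "(\<Sum>a\<in>A. if n - a \<in> lat (D \<iota>) then ?h \<iota> a else 0) = sum (?h \<iota>) {a \<in> A. n - a \<in> lat (D \<iota>)}"
      using A(1) by (simp add: sum.inter_filter)
    also have "{a \<in> A. n - a \<in> lat (D \<iota>)} = (\<lambda>k. n - D \<iota> *v k) ` K \<iota>"
    proof
      show "{a \<in> A. n - a \<in> lat (D \<iota>)} \<subseteq> (\<lambda>k. n - D \<iota> *v k) ` K \<iota>"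
      proof
        fix a assume a: "a \<in> {a \<in> A. n - a \<in> lat (D \<iota>)}"
        then obtain k where "n - a = D \<iota> *v k" by (auto simp: lat_def)
        then have "a = n - D \<iota> *v k" by (simp add: algebra_simps)
        then show "a \<in> (\<lambda>k. n - D \<iota> *v k) ` K \<iota>" using a by (auto simp: K_def)
      qed
    qed (auto simp: K_def lat_def)
    also have "sum (?h \<iota>) ((\<lambda>k. n - D \<iota> *v k) ` K \<iota>) = (\<Sum>k\<in>K \<iota>. ?h \<iota> (n - D \<iota> *v k))"
      by (subst sum.reindex) (use inj_int_matrix[OF D] in \<open>auto simp: inj_on_def\<close>)
    finally show "(\<Sum>k\<in>K \<iota>. ?F (\<iota>, k)) = (\<Sum>a\<in>A. if n - a \<in> lat (D \<iota>) then ?h \<iota> a else 0)"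
      unfolding F by simp
  qed simp
  finally show ?thesis by simp
qed

text \<open>Multiplying by \<open>chr \<omega> n\<close> and averaging over a box replaces each
  lattice condition by membership of \<open>\<omega>\<close> in the matching \<open>Omega\<close>,
  and the right side by \<open>delta\<close>.\<close>

lemma framelet_coefficient:
  fixes D :: "'x :: finite \<Rightarrow> int ^ 'd ^ 'd" and f ft :: "'x \<Rightarrow> int ^ 'd \<Rightarrow> complex ^ 'r"
  assumes D: "\<And>\<iota>. det (rmat (D \<iota>)) \<noteq> 0"
    and A: "finite A" "\<And>\<iota> n. n \<notin> A \<Longrightarrow> f \<iota> n = 0"
    and rep: "reproducing (fcoef D f) (fcoef D ft)" and \<omega>: "\<omega> \<in> Omega (D \<iota>0)"
  shows "(\<Sum>\<iota>\<in>UNIV. \<Sum>a\<in>A. of_real (indicat_real (Omega (D \<iota>)) \<omega>) * (cnj (f \<iota> a $ p) * ft \<iota> (a + g) $ p') * chr \<omega> a)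
    = (if p = p' \<and> g = 0 then delta \<omega> else 0)"
proof -
  \<comment> \<open>Divisible by every determinant, so that one box is a period for all the
    lattices.\<close>
  define N where "N = \<bar>\<Prod>\<iota>\<in>UNIV. det (D \<iota>)\<bar>"
  have det0: "det (D \<iota>) \<noteq> 0" for \<iota> using D[of \<iota>] by (simp add: det_rmat)
  have N: "N > 0" "det (D \<iota>) dvd N" for \<iota>
    using det0 by (auto simp: N_def intro: dvd_prodI)
  have w01: "0 \<le> \<omega> $ i \<and> \<omega> $ i < 1" for i using \<omega> by (auto simp: Omega_def)
  obtain z where z: "real_of_int N *\<^sub>R \<omega> = rvec z" using Omega_multiple[OF D N(2) \<omega>] by blast
  define NN where "NN = real_of_int N ^ CARD('d)"
  have NN: "NN \<noteq> 0" using N(1) by (simp add: NN_def)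
  define X where "X \<iota> a = cnj (f \<iota> a $ p) * ft \<iota> (a + g) $ p'" for \<iota> a
  define c where "c = (if p = p' \<and> g = 0 then 1 else 0 :: complex)"
  have id: "(\<Sum>\<iota>\<in>UNIV. \<Sum>a\<in>A. if n - a \<in> lat (D \<iota>) then of_real (abs_det (D \<iota>)) * X \<iota> a else 0) = c" for n
    unfolding X_def c_def by (rule reproducing_lat_sum[OF D A rep])
  have "(\<Sum>n\<in>ibox N. c * chr \<omega> n)
      = (\<Sum>n\<in>ibox N. \<Sum>\<iota>\<in>UNIV. \<Sum>a\<in>A. X \<iota> a * (abs_det (D \<iota>) *\<^sub>R (if n - a \<in> lat (D \<iota>) then chr \<omega> n else 0)))"
  proof (rule sum.cong)
    fix n
    have "c * chr \<omega> n = (\<Sum>\<iota>\<in>UNIV. \<Sum>a\<in>A. if n - a \<in> lat (D \<iota>) then of_real (abs_det (D \<iota>)) * X \<iota> a else 0) * chr \<omega> n"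
      by (simp only: id)
    also have "\<dots> = (\<Sum>\<iota>\<in>UNIV. \<Sum>a\<in>A. X \<iota> a * (abs_det (D \<iota>) *\<^sub>R (if n - a \<in> lat (D \<iota>) then chr \<omega> n else 0)))"
      unfolding sum_distrib_right by (intro sum.cong refl) (simp add: scaleR_conv_of_real)
    finally show "c * chr \<omega> n = (\<Sum>\<iota>\<in>UNIV. \<Sum>a\<in>A. X \<iota> a * (abs_det (D \<iota>) *\<^sub>R (if n - a \<in> lat (D \<iota>) then chr \<omega> n else 0)))" .
  qed simp
  also have "\<dots> = (\<Sum>\<iota>\<in>UNIV. \<Sum>n\<in>ibox N. \<Sum>a\<in>A. X \<iota> a * (abs_det (D \<iota>) *\<^sub>R (if n - a \<in> lat (D \<iota>) then chr \<omega> n else 0)))"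
    by (rule sum.swap)
  also have "\<dots> = (\<Sum>\<iota>\<in>UNIV. \<Sum>a\<in>A. \<Sum>n\<in>ibox N. X \<iota> a * (abs_det (D \<iota>) *\<^sub>R (if n - a \<in> lat (D \<iota>) then chr \<omega> n else 0)))"
    by (intro sum.cong refl sum.swap)
  also have "\<dots> = (\<Sum>\<iota>\<in>UNIV. \<Sum>a\<in>A. X \<iota> a * (abs_det (D \<iota>) *\<^sub>R (\<Sum>n\<in>ibox N. if n - a \<in> lat (D \<iota>) then chr \<omega> n else 0)))"
    by (simp add: sum_distrib_left scaleR_sum_right)
  also have "\<dots> = (\<Sum>\<iota>\<in>UNIV. \<Sum>a\<in>A. X \<iota> a * ((NN * indicat_real (Omega (D \<iota>)) \<omega>) *\<^sub>R chr \<omega> a))"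
    unfolding NN_def by (subst character_sum_lat[OF D N(2,1) w01 z]) simp
  also have "\<dots> = of_real NN * (\<Sum>\<iota>\<in>UNIV. \<Sum>a\<in>A. of_real (indicat_real (Omega (D \<iota>)) \<omega>) * X \<iota> a * chr \<omega> a)"
    by (simp add: sum_distrib_left scaleR_conv_of_real ac_simps)
  finally have 1: "(\<Sum>n\<in>ibox N. c * chr \<omega> n)
      = of_real NN * (\<Sum>\<iota>\<in>UNIV. \<Sum>a\<in>A. of_real (indicat_real (Omega (D \<iota>)) \<omega>) * X \<iota> a * chr \<omega> a)" .
  \<comment> \<open>The same character sum for the full integer lattice, whose \<open>Omega\<close>
    is \<open>{0}\<close>.\<close>
  have "(\<Sum>n\<in>ibox N. chr \<omega> n) = of_real NN * delta \<omega>"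
  proof -
    let ?I = "mat 1 :: int ^ 'd ^ 'd"
    have I1: "det (rmat ?I) \<noteq> 0" by (simp add: det_rmat)
    have lat: "lat ?I = UNIV" by (auto simp: lat_def)
    have Om: "\<omega> \<in> Omega ?I \<longleftrightarrow> \<omega> = 0"
    proof -
      have "rmat ?I = mat 1" by (simp add: rmat_def mat_def vec_eq_iff)
      then have "\<omega> \<in> Omega ?I \<longleftrightarrow> (\<exists>z. \<omega> = rvec z)" using Omega_iff[OF I1 w01] by (simp add: transpose_mat)
      also have "\<dots> \<longleftrightarrow> \<omega> = 0"
      proof
        assume "\<exists>z. \<omega> = rvec z"
        then obtain z where z: "\<omega> = rvec z" ..
        have "z $ i = 0" for i using w01[of i] by (simp add: z rvec_def)
        then show "\<omega> = 0" by (simp add: z rvec_def vec_eq_iff)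
      next
        assume "\<omega> = 0"
        then show "\<exists>z. \<omega> = rvec z" by (intro exI[of _ 0]) (simp add: rvec_simps)
      qed
      finally show ?thesis .
    qed
    have "abs_det ?I = 1" by (simp add: abs_det_def)
    then have "(\<Sum>n\<in>ibox N. chr \<omega> n) = (NN * indicat_real (Omega ?I) \<omega>) *\<^sub>R chr \<omega> 0"
      using character_sum_lat[OF I1 _ N(1) w01 z, of 0] by (simp add: lat NN_def)
    also have "\<dots> = of_real NN * delta \<omega>"
      by (simp add: Om indicator_def delta_def chr_def rvec_simps scaleR_conv_of_real)
    finally show ?thesis .
  qed
  then have "of_real NN * (c * delta \<omega>)
      = of_real NN * (\<Sum>\<iota>\<in>UNIV. \<Sum>a\<in>A. of_real (indicat_real (Omega (D \<iota>)) \<omega>) * X \<iota> a * chr \<omega> a)"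
    using 1 by (simp add: sum_distrib_left[symmetric] ac_simps)
  then have "c * delta \<omega> = (\<Sum>\<iota>\<in>UNIV. \<Sum>a\<in>A. of_real (indicat_real (Omega (D \<iota>)) \<omega>) * X \<iota> a * chr \<omega> a)"
    using NN by simp
  moreover have "(if p = p' \<and> g = 0 then delta \<omega> else 0) = c * delta \<omega>" by (simp add: c_def)
  ultimately show ?thesis unfolding X_def by (simp only:)
qed

text \<open>One entry of the matrix identity. Sorted by the offset \<open>g\<close> between filter
  positions, the product of the two symbols has the coefficients computed in
  \<open>framelet_coefficient\<close>.\<close>

lemma framelet_symbol:
  fixes D :: "'x :: finite \<Rightarrow> int ^ 'd ^ 'd" and f ft :: "'x \<Rightarrow> int ^ 'd \<Rightarrow> complex ^ 'r"
  assumes D: "\<And>\<iota>. det (rmat (D \<iota>)) \<noteq> 0"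
    and A: "finite A" "\<And>\<iota> n. n \<notin> A \<Longrightarrow> f \<iota> n = 0" "\<And>\<iota> n. n \<notin> A \<Longrightarrow> ft \<iota> n = 0"
    and rep: "reproducing (fcoef D f) (fcoef D ft)" and \<omega>: "\<omega> \<in> Omega (D \<iota>0)"
  shows "(\<Sum>\<iota>\<in>UNIV. of_real (indicat_real (Omega (D \<iota>)) \<omega>)
      * (cnj (\<Sum>a\<in>A. f \<iota> a $ p * cis (- (rvec a \<bullet> \<xi>))) * (\<Sum>b\<in>A. ft \<iota> b $ p' * cis (- (rvec b \<bullet> (\<xi> + (2 * pi) *\<^sub>R \<omega>))))))
    = (if p = p' then delta \<omega> else 0)"
proof -
  define \<eta> where "\<eta> = \<xi> + (2 * pi) *\<^sub>R \<omega>"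
  \<comment> \<open>The offset 0 carries the right side and must be present even if \<open>A\<close>
    is empty.\<close>
  define G where "G = insert 0 ((\<lambda>(a, b). b - a) ` (A \<times> A))"
  have G: "finite G" using A(1) by (simp add: G_def)
  let ?h = "\<lambda>g. cis (- (rvec g \<bullet> \<eta>))"
  have inner: "(\<Sum>b\<in>A. ft \<iota> b $ p' * ?h b) = (\<Sum>g\<in>G. ft \<iota> (a + g) $ p' * ?h (a + g))" if a: "a \<in> A" for \<iota> a
  proof -
    have "(\<Sum>g\<in>G. ft \<iota> (a + g) $ p' * ?h (a + g)) = (\<Sum>b\<in>(\<lambda>g. a + g) ` G. ft \<iota> b $ p' * ?h b)"
      by (subst sum.reindex) (auto simp: inj_on_def)
    also have "\<dots> = (\<Sum>b\<in>A. ft \<iota> b $ p' * ?h b)"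
    proof (rule sum.mono_neutral_right)
      show "A \<subseteq> (\<lambda>g. a + g) ` G"
      proof
        fix b assume "b \<in> A"
        then have "b - a \<in> G" using a by (force simp: G_def)
        then show "b \<in> (\<lambda>g. a + g) ` G" by (intro image_eqI[of _ _ "b - a"]) auto
      qed
    qed (use G A(3) in auto)
    finally show ?thesis by simp
  qed
  \<comment> \<open>The frequency shift between the two symbols leaves behind the character at
    \<open>a\<close>.\<close>
  have ph: "cnj (cis (- (rvec a \<bullet> \<xi>))) * ?h (a + g) = ?h g * chr \<omega> a" for a g
    by (simp add: cis_cnj cis_mult chr_def \<eta>_def rvec_simps inner_add_left inner_add_right algebra_simps)
  have prod: "cnj (\<Sum>a\<in>A. f \<iota> a $ p * cis (- (rvec a \<bullet> \<xi>))) * (\<Sum>b\<in>A. ft \<iota> b $ p' * ?h b)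
      = (\<Sum>g\<in>G. ?h g * (\<Sum>a\<in>A. (cnj (f \<iota> a $ p) * ft \<iota> (a + g) $ p') * chr \<omega> a))" for \<iota>
  proof -
    have "cnj (\<Sum>a\<in>A. f \<iota> a $ p * cis (- (rvec a \<bullet> \<xi>))) * (\<Sum>b\<in>A. ft \<iota> b $ p' * ?h b)
        = (\<Sum>a\<in>A. cnj (f \<iota> a $ p) * cnj (cis (- (rvec a \<bullet> \<xi>))) * (\<Sum>b\<in>A. ft \<iota> b $ p' * ?h b))"
      by (simp add: sum_distrib_right)
    also have "\<dots> = (\<Sum>a\<in>A. \<Sum>g\<in>G. (cnj (f \<iota> a $ p) * ft \<iota> (a + g) $ p') * (cnj (cis (- (rvec a \<bullet> \<xi>))) * ?h (a + g)))"
      by (intro sum.cong refl) (simp add: inner sum_distrib_left ac_simps)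
    also have "\<dots> = (\<Sum>a\<in>A. \<Sum>g\<in>G. ?h g * ((cnj (f \<iota> a $ p) * ft \<iota> (a + g) $ p') * chr \<omega> a))"
      unfolding ph by (simp add: ac_simps)
    also have "\<dots> = (\<Sum>g\<in>G. \<Sum>a\<in>A. ?h g * ((cnj (f \<iota> a $ p) * ft \<iota> (a + g) $ p') * chr \<omega> a))"
      by (rule sum.swap)
    finally show ?thesis by (simp add: sum_distrib_left)
  qed
  have "(\<Sum>\<iota>\<in>UNIV. of_real (indicat_real (Omega (D \<iota>)) \<omega>)
      * (cnj (\<Sum>a\<in>A. f \<iota> a $ p * cis (- (rvec a \<bullet> \<xi>))) * (\<Sum>b\<in>A. ft \<iota> b $ p' * ?h b)))
    = (\<Sum>\<iota>\<in>UNIV. \<Sum>g\<in>G. ?h g * (\<Sum>a\<in>A. of_real (indicat_real (Omega (D \<iota>)) \<omega>) * (cnj (f \<iota> a $ p) * ft \<iota> (a + g) $ p') * chr \<omega> a))"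
    unfolding prod by (simp add: sum_distrib_left ac_simps)
  also have "\<dots> = (\<Sum>g\<in>G. \<Sum>\<iota>\<in>UNIV. ?h g * (\<Sum>a\<in>A. of_real (indicat_real (Omega (D \<iota>)) \<omega>) * (cnj (f \<iota> a $ p) * ft \<iota> (a + g) $ p') * chr \<omega> a))"
    by (rule sum.swap)
  also have "\<dots> = (\<Sum>g\<in>G. ?h g * (if p = p' \<and> g = 0 then delta \<omega> else 0))"
  proof (rule sum.cong)
    fix g
    have "(\<Sum>\<iota>\<in>UNIV. \<Sum>a\<in>A. of_real (indicat_real (Omega (D \<iota>)) \<omega>) * (cnj (f \<iota> a $ p) * ft \<iota> (a + g) $ p') * chr \<omega> a)
        = (if p = p' \<and> g = 0 then delta \<omega> else 0)"
      by (rule framelet_coefficient[OF D A(1,2) rep \<omega>])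
    then show "(\<Sum>\<iota>\<in>UNIV. ?h g * (\<Sum>a\<in>A. of_real (indicat_real (Omega (D \<iota>)) \<omega>) * (cnj (f \<iota> a $ p) * ft \<iota> (a + g) $ p') * chr \<omega> a))
        = ?h g * (if p = p' \<and> g = 0 then delta \<omega> else 0)"
      unfolding sum_distrib_left[symmetric] by (rule arg_cong)
  qed simp
  also have "\<dots> = (\<Sum>g\<in>G. if g = 0 then (if p = p' then delta \<omega> else 0) else 0)"
    by (intro sum.cong refl) (simp add: rvec_simps)
  also have "\<dots> = (if p = p' then delta \<omega> else 0)" using G by (simp add: G_def)
  finally show ?thesis by (simp add: \<eta>_def)
qed

lemma dual_framelet_of_reproducing:
  fixes M0 :: "int ^ 'd ^ 'd" and M :: "'s :: finite \<Rightarrow> int ^ 'd ^ 'd"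
    and b0 bt0 :: "int ^ 'd \<Rightarrow> complex ^ 'r ^ 'r" and b bt :: "'s \<Rightarrow> int ^ 'd \<Rightarrow> complex ^ 'r ^ 1"
  assumes "filters M0 M b0 b" "filters M0 M bt0 bt"
    and rep: "reproducing (filters.E M0 M b0 b) (filters.E M0 M bt0 bt)"
  shows "dual_framelet_filter_bank M0 M b0 b bt0 bt"
proof -
  interpret f: filters M0 M b0 b by fact
  interpret ft: filters M0 M bt0 bt by fact
  define D :: "'s + 'r \<Rightarrow> int ^ 'd ^ 'd" where "D = dil M0 M"
  define A where "A = {k. b0 k \<noteq> 0} \<union> {k. bt0 k \<noteq> 0} \<union> (\<Union>l. {k. b l k \<noteq> 0}) \<union> (\<Union>l. {k. bt l k \<noteq> 0})"
  have A: "finite A" unfolding A_def using f.fin0 ft.fin0 f.fin ft.fin by simp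
  have A0: "b0 n = 0" "bt0 n = 0" "b l n = 0" "bt l n = 0" if "n \<notin> A" for n l
    using that by (auto simp: A_def)
  have fA: "fil b0 b \<iota> n = 0" "fil bt0 bt \<iota> n = 0" if "n \<notin> A" for \<iota> n
    using A0[OF that] by (cases \<iota>; simp add: fil_def)+
  have D: "det (rmat (D \<iota>)) \<noteq> 0" for \<iota>
    by (cases \<iota>) (auto simp: D_def dil_def f.det_M0 f.det_M)
  have rep': "reproducing (fcoef D (fil b0 b)) (fcoef D (fil bt0 bt))"
    using rep by (simp add: f.E_def ft.E_def D_def)
  have ser: "fseries u \<xi> $ i $ j = (\<Sum>k\<in>A. u k $ i $ j * cis (- (rvec k \<bullet> \<xi>)))"
    if "\<And>n. n \<notin> A \<Longrightarrow> u n = 0" for u :: "int ^ 'd \<Rightarrow> complex ^ 'q ^ 'p" and \<xi> i j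
    unfolding fseries_def vec_lambda_beta
    by (rule sum.mono_neutral_left) (use A that in auto)
  show ?thesis
    unfolding dual_framelet_filter_bank_def
  proof (intro ballI AE_I2)
    fix \<omega> \<xi> assume "\<omega> \<in> Omega M0 \<union> (\<Union>l. Omega (M l))"
    then obtain \<iota>0 :: "'s + 'r" where \<omega>: "\<omega> \<in> Omega (D \<iota>0)"
    proof
      assume "\<omega> \<in> Omega M0"
      then show ?thesis using that[of "Inr undefined"] by (simp add: D_def dil_def)
    next
      assume "\<omega> \<in> (\<Union>l. Omega (M l))"
      then obtain l where "\<omega> \<in> Omega (M l)" by blast
      then show ?thesis using that[of "Inl l"] by (simp add: D_def dil_def)
    qed
    let ?\<eta> = "\<xi> + (2 * pi) *\<^sub>R \<omega>"
    let ?T = "indicat_real (Omega M0) \<omega> *\<^sub>R (conj_transpose (fseries b0 \<xi>) ** fseries bt0 ?\<eta>)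
        + (\<Sum>l\<in>UNIV. indicat_real (Omega (M l)) \<omega> *\<^sub>R (conj_transpose (fseries (b l) \<xi>) ** fseries (bt l) ?\<eta>))"
    have "?T $ p $ p' = mat (delta \<omega>) $ p $ p'" for p p'
    proof -
      let ?S = "\<lambda>\<iota>. of_real (indicat_real (Omega (D \<iota>)) \<omega>)
        * (cnj (\<Sum>a\<in>A. fil b0 b \<iota> a $ p * cis (- (rvec a \<bullet> \<xi>))) * (\<Sum>k\<in>A. fil bt0 bt \<iota> k $ p' * cis (- (rvec k \<bullet> ?\<eta>))))"
      have 1: "(indicat_real (Omega M0) \<omega> *\<^sub>R (conj_transpose (fseries b0 \<xi>) ** fseries bt0 ?\<eta>)) $ p $ p' = (\<Sum>q\<in>UNIV. ?S (Inr q))"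
        unfolding vector_scaleR_component
        by (simp add: matrix_matrix_mult_def conj_transpose_def ser A0 D_def dil_def fil_def scaleR_conv_of_real sum_distrib_left)
      have 2: "(indicat_real (Omega (M l)) \<omega> *\<^sub>R (conj_transpose (fseries (b l) \<xi>) ** fseries (bt l) ?\<eta>)) $ p $ p' = ?S (Inl l)" for l
        unfolding vector_scaleR_component
        by (simp add: matrix_matrix_mult_def conj_transpose_def ser A0 D_def dil_def fil_def scaleR_conv_of_real UNIV_1)
      have "?T $ p $ p' = (\<Sum>q\<in>UNIV. ?S (Inr q)) + (\<Sum>l\<in>UNIV. ?S (Inl l))"
        unfolding vector_add_component sum_component 1 2 ..
      also have "\<dots> = (\<Sum>\<iota>\<in>UNIV. ?S \<iota>)"
        by (subst UNIV_Plus_UNIV[symmetric], subst sum.Plus) (auto simp: add.commute)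
      also have "\<dots> = (if p = p' then delta \<omega> else 0)"
        by (rule framelet_symbol[OF D A fA rep' \<omega>])
      finally show ?thesis by (simp add: mat_def)
    qed
    then show "?T = mat (delta \<omega>)" by (simp add: vec_eq_iff)
  qed
qed

section \<open>Stability on all square-summable sequences\<close>

text \<open>Such functionals are defined on all sequences but see a finite part of each, so their
  values can be computed on truncations.\<close>

definition fin_dep :: "(('k \<Rightarrow> complex) \<Rightarrow> complex) \<Rightarrow> bool" where
  "fin_dep F \<longleftrightarrow> (\<exists>S g. finite S \<and> (\<forall>v. F v = (\<Sum>\<kappa>\<in>S. v \<kappa> * g \<kappa>)))"

lemma fin_dep_eval: "fin_dep (\<lambda>v. v \<kappa>)"
  unfolding fin_dep_def by (intro exI[of _ "{\<kappa>}"] exI[of _ "\<lambda>_. 1"]) simp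

lemma fin_dep_sum:
  assumes "finite S" "\<And>i. i \<in> S \<Longrightarrow> fin_dep (F i)"
  shows "fin_dep (\<lambda>v. \<Sum>i\<in>S. F i v * c i)"
proof -
  from assms(2) have "\<forall>i\<in>S. \<exists>T g. finite T \<and> (\<forall>v. F i v = (\<Sum>\<kappa>\<in>T. v \<kappa> * g \<kappa>))" by (auto simp: fin_dep_def)
  then obtain T g where Tg: "\<And>i. i \<in> S \<Longrightarrow> finite (T i)" "\<And>i v. i \<in> S \<Longrightarrow> F i v = (\<Sum>\<kappa>\<in>T i. v \<kappa> * g i \<kappa>)"
    by metis
  define U where "U = (\<Union>i\<in>S. T i)"
  have U: "finite U" using assms(1) Tg(1) by (simp add: U_def)
  have "(\<Sum>i\<in>S. F i v * c i) = (\<Sum>\<kappa>\<in>U. v \<kappa> * (\<Sum>i\<in>S. (if \<kappa> \<in> T i then g i \<kappa> else 0) * c i))" for v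
  proof -
    have "F i v = (\<Sum>\<kappa>\<in>U. v \<kappa> * (if \<kappa> \<in> T i then g i \<kappa> else 0))" if "i \<in> S" for i
      unfolding Tg(2)[OF that] by (rule sum.mono_neutral_cong_left[OF U]) (use that in \<open>auto simp: U_def\<close>)
    then have "(\<Sum>i\<in>S. F i v * c i) = (\<Sum>i\<in>S. \<Sum>\<kappa>\<in>U. v \<kappa> * ((if \<kappa> \<in> T i then g i \<kappa> else 0) * c i))"
      by (intro sum.cong refl) (simp add: sum_distrib_right mult.assoc)
    also have "\<dots> = (\<Sum>\<kappa>\<in>U. \<Sum>i\<in>S. v \<kappa> * ((if \<kappa> \<in> T i then g i \<kappa> else 0) * c i))" by (rule sum.swap)
    finally show ?thesis by (simp add: sum_distrib_left)
  qed
  then show ?thesis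
    unfolding fin_dep_def
    by (intro exI[of _ U] exI[of _ "\<lambda>\<kappa>. \<Sum>i\<in>S. (if \<kappa> \<in> T i then g i \<kappa> else 0) * c i"] conjI allI U)
qed

lemma fin_dep_ana:
  assumes "loc_fin E" "\<And>\<kappa>. fin_dep (\<lambda>v. G v \<kappa>)"
  shows "fin_dep (\<lambda>v. ana E (G v) i)"
proof -
  have S: "finite {\<kappa>. E i \<kappa> \<noteq> 0}" using assms(1) unfolding loc_fin_def by blast
  have "ana E (G v) i = (\<Sum>\<kappa>\<in>{\<kappa>. E i \<kappa> \<noteq> 0}. G v \<kappa> * cnj (E i \<kappa>))" for v
    unfolding ana_def by (rule Sum_any_eq[OF S]) simp
  then show ?thesis using fin_dep_sum[OF S, of "\<lambda>\<kappa> v. G v \<kappa>" "\<lambda>\<kappa>. cnj (E i \<kappa>)"] assms(2) by simp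
qed

lemma fin_dep_low_iter:
  assumes "loc_fin E"
  shows "fin_dep (\<lambda>v. (low E ^^ n) v \<kappa>)"
proof (induction n arbitrary: \<kappa>)
  case 0
  show ?case by (simp add: fin_dep_eval)
next
  case (Suc n)
  obtain q k where \<kappa>: "\<kappa> = (q, k)" by (cases \<kappa>)
  show ?case using fin_dep_ana[OF assms Suc] by (simp add: \<kappa> low_def[of E])
qed

lemma infsum_sum_real:
  fixes f :: "'i \<Rightarrow> 'k \<Rightarrow> real"
  assumes "finite I" "\<And>i. i \<in> I \<Longrightarrow> f i summable_on UNIV"
  shows "(\<Sum>\<^sub>\<infinity>k. \<Sum>i\<in>I. f i k) = (\<Sum>i\<in>I. \<Sum>\<^sub>\<infinity>k. f i k)"
proof -
  have "((\<lambda>k. \<Sum>i\<in>I. f i k) has_sum (\<Sum>i\<in>I. \<Sum>\<^sub>\<infinity>k. f i k)) UNIV"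
    using assms by (induction I rule: finite_induct) (auto intro!: has_sum_add)
  then show ?thesis by (rule infsumI)
qed

text \<open>Upper bound: a finite window of outputs is not affected by truncating \<open>v\<close>
  far enough out. Lower bound: \<open>v\<close> is a truncation plus a tail; the parallelogram
  estimate costs a factor 2, and the upper bound makes the contribution of the tail vanish in the
  limit.\<close>

lemma l2_extension:
  fixes Y :: "'m \<Rightarrow> 'z \<Rightarrow> ('k \<Rightarrow> complex) \<Rightarrow> complex"
  assumes MM: "finite MM" and dep: "\<And>m k. m \<in> MM \<Longrightarrow> fin_dep (Y m k)"
    and fs: "\<And>m u. m \<in> MM \<Longrightarrow> fsupp u \<Longrightarrow> fsupp (\<lambda>k. Y m k u)"
    and lo: "\<And>u. fsupp u \<Longrightarrow> c1 * nsq u \<le> (\<Sum>m\<in>MM. nsq (\<lambda>k. Y m k u))"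
    and hi: "\<And>u. fsupp u \<Longrightarrow> (\<Sum>m\<in>MM. nsq (\<lambda>k. Y m k u)) \<le> c2 * nsq u"
    and c: "c1 > 0" "c2 > 0" and v: "(\<lambda>\<kappa>. (cmod (v \<kappa>))\<^sup>2) summable_on UNIV"
  shows "\<And>m. m \<in> MM \<Longrightarrow> (\<lambda>k. (cmod (Y m k v))\<^sup>2) summable_on UNIV"
    and "(\<Sum>m\<in>MM. \<Sum>\<^sub>\<infinity>k. (cmod (Y m k v))\<^sup>2) \<le> c2 * (\<Sum>\<^sub>\<infinity>\<kappa>. (cmod (v \<kappa>))\<^sup>2)"
    and "c1 / 2 * (\<Sum>\<^sub>\<infinity>\<kappa>. (cmod (v \<kappa>))\<^sup>2) \<le> (\<Sum>m\<in>MM. \<Sum>\<^sub>\<infinity>k. (cmod (Y m k v))\<^sup>2)"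
proof -
  define NV where "NV v = (\<Sum>\<^sub>\<infinity>\<kappa>. (cmod (v \<kappa>))\<^sup>2)" for v :: "'k \<Rightarrow> complex"
  define TY where "TY v = (\<Sum>m\<in>MM. \<Sum>\<^sub>\<infinity>k. (cmod (Y m k v))\<^sup>2)" for v
  define cut where "cut S v = (\<lambda>\<kappa>. if \<kappa> \<in> S then v \<kappa> else 0)" for S and v :: "'k \<Rightarrow> complex"
  have cut: "fsupp (cut S v)" "nsq (cut S v) = (\<Sum>\<kappa>\<in>S. (cmod (v \<kappa>))\<^sup>2)" if "finite S" for S v
  proof -
    show "fsupp (cut S v)" by (rule fsuppI[OF that]) (simp add: cut_def)
    show "nsq (cut S v) = (\<Sum>\<kappa>\<in>S. (cmod (v \<kappa>))\<^sup>2)"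
      by (subst nsq_eq[OF that]) (auto simp: cut_def intro!: sum.cong)
  qed
  have partial: "(\<Sum>m\<in>MM. \<Sum>k\<in>K. (cmod (Y m k v))\<^sup>2) \<le> c2 * NV v"
    if K: "finite K" and v: "(\<lambda>\<kappa>. (cmod (v \<kappa>))\<^sup>2) summable_on UNIV" for K v
  proof -
    have "\<forall>m\<in>MM. \<forall>k. \<exists>S g. finite S \<and> (\<forall>v. Y m k v = (\<Sum>\<kappa>\<in>S. v \<kappa> * g \<kappa>))"
      using dep by (auto simp: fin_dep_def)
    then obtain S g where Sg: "\<And>m k. m \<in> MM \<Longrightarrow> finite (S m k)"
      "\<And>m k v. m \<in> MM \<Longrightarrow> Y m k v = (\<Sum>\<kappa>\<in>S m k. v \<kappa> * g m k \<kappa>)" by metis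
    \<comment> \<open>All input positions on which the outputs in the window \<open>K\<close>
      depend.\<close>
    define U where "U = (\<Union>m\<in>MM. \<Union>k\<in>K. S m k)"
    have U: "finite U" unfolding U_def using MM K Sg(1) by simp
    have Yc: "Y m k v = Y m k (cut U v)" if "m \<in> MM" "k \<in> K" for m k
      unfolding Sg(2)[OF that(1)] using that by (intro sum.cong refl) (auto simp: cut_def U_def)
    have "(\<Sum>m\<in>MM. \<Sum>k\<in>K. (cmod (Y m k v))\<^sup>2) = (\<Sum>m\<in>MM. \<Sum>k\<in>K. (cmod (Y m k (cut U v)))\<^sup>2)"
      by (intro sum.cong refl) (simp add: Yc)
    also have "\<dots> \<le> (\<Sum>m\<in>MM. nsq (\<lambda>k. Y m k (cut U v)))"
    proof (rule sum_mono)
      fix m assume m: "m \<in> MM"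
      obtain T where T: "finite T" "\<And>k. k \<notin> T \<Longrightarrow> Y m k (cut U v) = 0"
        using fsuppE[OF fs[OF m cut(1)[OF U]]] by blast
      have "nsq (\<lambda>k. Y m k (cut U v)) = (\<Sum>k\<in>T \<union> K. (cmod (Y m k (cut U v)))\<^sup>2)"
        by (rule nsq_eq) (use T K in auto)
      then show "(\<Sum>k\<in>K. (cmod (Y m k (cut U v)))\<^sup>2) \<le> nsq (\<lambda>k. Y m k (cut U v))"
        using T K by (auto intro!: sum_mono2)
    qed
    also have "\<dots> \<le> c2 * nsq (cut U v)" by (rule hi[OF cut(1)[OF U]])
    also have "\<dots> \<le> c2 * NV v"
      unfolding cut(2)[OF U] NV_def using c v U by (intro mult_left_mono finite_sum_le_infsum) auto
    finally show ?thesis .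
  qed
  have sm: "(\<lambda>k. (cmod (Y m k v))\<^sup>2) summable_on UNIV"
    if m: "m \<in> MM" and v: "(\<lambda>\<kappa>. (cmod (v \<kappa>))\<^sup>2) summable_on UNIV" for m v
  proof (rule nonneg_bdd_above_summable_on)
    show "bdd_above (sum (\<lambda>k. (cmod (Y m k v))\<^sup>2) ` {F. F \<subseteq> UNIV \<and> finite F})"
    proof (rule bdd_aboveI2)
      fix F assume F: "F \<in> {F. F \<subseteq> (UNIV :: 'z set) \<and> finite F}"
      have "(\<Sum>k\<in>F. (cmod (Y m k v))\<^sup>2) \<le> (\<Sum>m\<in>MM. \<Sum>k\<in>F. (cmod (Y m k v))\<^sup>2)"
        by (rule member_le_sum[OF m, of "\<lambda>m. \<Sum>k\<in>F. (cmod (Y m k v))\<^sup>2"]) (auto intro: sum_nonneg MM)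
      also have "\<dots> \<le> c2 * NV v" using partial[OF _ v, of F] F by simp
      finally show "(\<Sum>k\<in>F. (cmod (Y m k v))\<^sup>2) \<le> c2 * NV v" .
    qed
  qed simp
  have up: "TY v \<le> c2 * NV v" if v: "(\<lambda>\<kappa>. (cmod (v \<kappa>))\<^sup>2) summable_on UNIV" for v
  proof -
    have "((\<lambda>F. \<Sum>m\<in>MM. \<Sum>k\<in>F. (cmod (Y m k v))\<^sup>2) \<longlongrightarrow> TY v) (finite_subsets_at_top UNIV)"
      unfolding TY_def using infsum_tendsto[OF sm[OF _ v]] by (intro tendsto_sum) auto
    then show ?thesis
    proof (rule tendsto_upperbound)
      show "\<forall>\<^sub>F F in finite_subsets_at_top UNIV. (\<Sum>m\<in>MM. \<Sum>k\<in>F. (cmod (Y m k v))\<^sup>2) \<le> c2 * NV v"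
        by (rule eventually_finite_subsets_at_top_weakI) (rule partial[OF _ v])
    qed simp
  qed
  show "\<And>m. m \<in> MM \<Longrightarrow> (\<lambda>k. (cmod (Y m k v))\<^sup>2) summable_on UNIV" using sm v by blast
  show "(\<Sum>m\<in>MM. \<Sum>\<^sub>\<infinity>k. (cmod (Y m k v))\<^sup>2) \<le> c2 * (\<Sum>\<^sub>\<infinity>\<kappa>. (cmod (v \<kappa>))\<^sup>2)"
    using up[OF v] by (simp add: TY_def NV_def)
  have low: "c1 * (\<Sum>\<kappa>\<in>S. (cmod (v \<kappa>))\<^sup>2) \<le> 2 * TY v + 2 * (c2 * (NV v - (\<Sum>\<kappa>\<in>S. (cmod (v \<kappa>))\<^sup>2)))"
    if S: "finite S" for S
  proof -
    define w where "w = (\<lambda>\<kappa>. v \<kappa> - cut S v \<kappa>)"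
    have w: "w = (\<lambda>\<kappa>. if \<kappa> \<in> S then 0 else v \<kappa>)" by (auto simp: w_def cut_def)
    have wsq: "(\<lambda>\<kappa>. (cmod (w \<kappa>))\<^sup>2) = (\<lambda>\<kappa>. (cmod (v \<kappa>))\<^sup>2 - (cmod (cut S v \<kappa>))\<^sup>2)"
      by (auto simp: w cut_def)
    have hs: "((\<lambda>\<kappa>. (cmod (cut S v \<kappa>))\<^sup>2) has_sum (\<Sum>\<kappa>\<in>S. (cmod (v \<kappa>))\<^sup>2)) UNIV"
    proof -
      have "((\<lambda>\<kappa>. (cmod (v \<kappa>))\<^sup>2) has_sum (\<Sum>\<kappa>\<in>S. (cmod (v \<kappa>))\<^sup>2)) S" by (rule has_sum_finite[OF S])
      then show ?thesis by (subst (asm) has_sum_cong_neutral[where T=UNIV and g="\<lambda>\<kappa>. (cmod (cut S v \<kappa>))\<^sup>2"]) (auto simp: cut_def)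
    qed
    have hw: "((\<lambda>\<kappa>. (cmod (w \<kappa>))\<^sup>2) has_sum (NV v - (\<Sum>\<kappa>\<in>S. (cmod (v \<kappa>))\<^sup>2))) UNIV"
      unfolding wsq NV_def using has_sum_add[OF has_sum_infsum[OF v], of "\<lambda>\<kappa>. - (cmod (cut S v \<kappa>))\<^sup>2" "- (\<Sum>\<kappa>\<in>S. (cmod (v \<kappa>))\<^sup>2)"] hs
      by (simp add: has_sum_uminus)
    then have ws: "(\<lambda>\<kappa>. (cmod (w \<kappa>))\<^sup>2) summable_on UNIV" and NVw: "NV w = NV v - (\<Sum>\<kappa>\<in>S. (cmod (v \<kappa>))\<^sup>2)"
      by (auto simp: summable_on_def NV_def intro: infsumI)
    have cs: "(\<lambda>\<kappa>. (cmod (cut S v \<kappa>))\<^sup>2) summable_on UNIV" using hs by (auto simp: summable_on_def)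
    have pt: "(cmod (Y m k (cut S v)))\<^sup>2 \<le> 2 * (cmod (Y m k v))\<^sup>2 + 2 * (cmod (Y m k w))\<^sup>2" if m: "m \<in> MM" for m k
    proof -
      obtain T g where Tg: "\<And>v. Y m k v = (\<Sum>\<kappa>\<in>T. v \<kappa> * g \<kappa>)" using dep[OF m, of k] by (auto simp: fin_dep_def)
      have "Y m k (cut S v) = Y m k v + - Y m k w"
        unfolding Tg by (simp add: w_def left_diff_distrib sum_subtractf)
      then show ?thesis using norm_add_sq_le[of "Y m k v" "- Y m k w"] by simp
    qed
    have "nsq (\<lambda>k. Y m k (cut S v)) \<le> 2 * (\<Sum>\<^sub>\<infinity>k. (cmod (Y m k v))\<^sup>2) + 2 * (\<Sum>\<^sub>\<infinity>k. (cmod (Y m k w))\<^sup>2)" if m: "m \<in> MM" for m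
    proof -
      obtain T where T: "finite T" "\<And>k. k \<notin> T \<Longrightarrow> Y m k (cut S v) = 0"
        using fsuppE[OF fs[OF m cut(1)[OF S]]] by blast
      have "nsq (\<lambda>k. Y m k (cut S v)) = (\<Sum>k\<in>T. (cmod (Y m k (cut S v)))\<^sup>2)"
        by (rule nsq_eq) (use T in auto)
      also have "\<dots> \<le> (\<Sum>k\<in>T. 2 * (cmod (Y m k v))\<^sup>2 + 2 * (cmod (Y m k w))\<^sup>2)"
        by (rule sum_mono[OF pt[OF m]])
      also have "\<dots> = 2 * (\<Sum>k\<in>T. (cmod (Y m k v))\<^sup>2) + 2 * (\<Sum>k\<in>T. (cmod (Y m k w))\<^sup>2)"
        by (simp add: sum.distrib sum_distrib_left)
      also have "\<dots> \<le> 2 * (\<Sum>\<^sub>\<infinity>k. (cmod (Y m k v))\<^sup>2) + 2 * (\<Sum>\<^sub>\<infinity>k. (cmod (Y m k w))\<^sup>2)"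
        by (intro add_mono mult_left_mono finite_sum_le_infsum sm[OF m v] sm[OF m ws] T) auto
      finally show ?thesis .
    qed
    then have "(\<Sum>m\<in>MM. nsq (\<lambda>k. Y m k (cut S v))) \<le> (\<Sum>m\<in>MM. 2 * (\<Sum>\<^sub>\<infinity>k. (cmod (Y m k v))\<^sup>2) + 2 * (\<Sum>\<^sub>\<infinity>k. (cmod (Y m k w))\<^sup>2))"
      by (rule sum_mono)
    also have "\<dots> = 2 * TY v + 2 * TY w" by (simp add: TY_def sum.distrib sum_distrib_left)
    also have "\<dots> \<le> 2 * TY v + 2 * (c2 * NV w)" using up[OF ws] by simp
    finally show ?thesis using lo[OF cut(1)[OF S, of v]] by (simp add: cut(2)[OF S] NVw)
  qed
  have "((\<lambda>S. 2 * TY v + 2 * (c2 * (NV v - (\<Sum>\<kappa>\<in>S. (cmod (v \<kappa>))\<^sup>2)))) \<longlongrightarrow> 2 * TY v + 2 * (c2 * (NV v - NV v))) (finite_subsets_at_top UNIV)"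
    unfolding NV_def using infsum_tendsto[OF v] by (intro tendsto_intros)
  moreover have "((\<lambda>S. c1 * (\<Sum>\<kappa>\<in>S. (cmod (v \<kappa>))\<^sup>2)) \<longlongrightarrow> c1 * NV v) (finite_subsets_at_top UNIV)"
    unfolding NV_def using infsum_tendsto[OF v] by (intro tendsto_intros)
  ultimately have "c1 * NV v \<le> 2 * TY v + 2 * (c2 * (NV v - NV v))"
    by (rule tendsto_le[rotated 1]) (auto intro!: eventually_finite_subsets_at_top_weakI low)
  then show "c1 / 2 * (\<Sum>\<^sub>\<infinity>\<kappa>. (cmod (v \<kappa>))\<^sup>2) \<le> (\<Sum>m\<in>MM. \<Sum>\<^sub>\<infinity>k. (cmod (Y m k v))\<^sup>2)"
    by (simp add: TY_def NV_def)
qed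

lemma norm_vec_sq: "(norm x)\<^sup>2 = (\<Sum>\<iota>\<in>UNIV. (cmod (x $ \<iota>))\<^sup>2)" for x :: "complex ^ 'x"
  by (simp add: norm_vec_def L2_set_def sum_nonneg)

lemma l2_seq_flat:
  fixes v :: "int ^ 'd \<Rightarrow> complex ^ 'x"
  assumes "l2_seq v"
  shows "(\<lambda>\<kappa>. (cmod (flat v \<kappa>))\<^sup>2) summable_on UNIV" "l2_norm_sq v = (\<Sum>\<^sub>\<infinity>\<kappa>. (cmod (flat v \<kappa>))\<^sup>2)"
proof -
  have comp: "(\<lambda>k. (cmod (v k $ \<iota>))\<^sup>2) summable_on UNIV" for \<iota>
  proof (rule summable_on_comparison_test)
    show "(\<lambda>k. (norm (v k))\<^sup>2) summable_on UNIV" using assms by (simp add: l2_seq_def)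
    show "(cmod (v k $ \<iota>))\<^sup>2 \<le> (norm (v k))\<^sup>2" for k
      unfolding norm_vec_sq by (rule member_le_sum[of \<iota> UNIV "\<lambda>\<iota>. (cmod (v k $ \<iota>))\<^sup>2"]) auto
  qed auto
  have sum: "l2_norm_sq v = (\<Sum>\<iota>\<in>UNIV. \<Sum>\<^sub>\<infinity>k. (cmod (v k $ \<iota>))\<^sup>2)"
    unfolding l2_norm_sq_def norm_vec_sq by (rule infsum_sum_real[OF _ comp]) simp
  let ?f = "\<lambda>\<kappa>. (cmod (flat v \<kappa>))\<^sup>2"
  have inner: "((\<lambda>k. ?f (\<iota>, k)) has_sum (\<Sum>\<^sub>\<infinity>k. (cmod (v k $ \<iota>))\<^sup>2)) UNIV" for \<iota>
    using has_sum_infsum[OF comp[of \<iota>]] by (simp add: flat_def)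
  have outer: "((\<lambda>\<iota>. \<Sum>\<^sub>\<infinity>k. (cmod (v k $ \<iota>))\<^sup>2) has_sum l2_norm_sq v) UNIV"
    unfolding sum by (rule has_sum_finite) simp
  have "?f summable_on (SIGMA \<iota>:UNIV. UNIV)"
    by (rule summable_on_SigmaI[OF inner]) (use outer in \<open>auto simp: summable_on_def\<close>)
  then have "(?f has_sum l2_norm_sq v) (SIGMA \<iota>:UNIV. UNIV)"
    by (rule has_sum_SigmaI[OF inner outer])
  then have "(?f has_sum l2_norm_sq v) UNIV" by simp
  then show "?f summable_on UNIV" "l2_norm_sq v = (\<Sum>\<^sub>\<infinity>\<kappa>. ?f \<kappa>)"
    by (auto simp: summable_on_def intro: infsumI[symmetric])
qed

lemma nsq_split:
  fixes u :: "'x :: finite \<times> 'z \<Rightarrow> complex"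
  assumes "fsupp u"
  shows "nsq u = (\<Sum>\<iota>\<in>UNIV. nsq (\<lambda>k. u (\<iota>, k)))"
proof -
  obtain S where S: "finite S" "\<And>\<kappa>. \<kappa> \<notin> S \<Longrightarrow> u \<kappa> = 0" using fsuppE[OF assms] by blast
  define T where "T = snd ` S"
  have T: "finite T" using S by (simp add: T_def)
  have 0: "u (\<iota>, k) = 0" if "k \<notin> T" for \<iota> k by (rule S(2)) (use that in \<open>force simp: T_def\<close>)
  have "nsq u = (\<Sum>\<kappa>\<in>UNIV \<times> T. (cmod (u \<kappa>))\<^sup>2)" by (rule nsq_eq) (use T 0 in auto)
  also have "\<dots> = (\<Sum>\<iota>\<in>UNIV. \<Sum>k\<in>T. (cmod (u (\<iota>, k)))\<^sup>2)" by (simp add: sum.cartesian_product case_prod_beta')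
  also have "\<dots> = (\<Sum>\<iota>\<in>UNIV. nsq (\<lambda>k. u (\<iota>, k)))"
    by (intro sum.cong refl nsq_eq[symmetric] T 0)
  finally show ?thesis .
qed

context filters
begin

lemma l2_stable_lower:
  assumes "l2_stable M0 M b0 b"
  shows "\<exists>c>0. \<forall>J\<ge>1. \<forall>u. fsupp u \<longrightarrow> c * nsq u \<le> ml E J u"
proof -
  obtain c1 where c1: "c1 > 0" "\<And>J v. J \<ge> 1 \<Longrightarrow> l2_seq v \<Longrightarrow> c1 * l2_norm_sq v \<le> multilevel_norm_sq M0 M b0 b J v"
    using assms unfolding l2_stable_def by blast
  have "c1 * nsq u \<le> ml E J u" if "J \<ge> 1" "fsupp u" for J u
    using c1(2)[OF that(1), of "unflat u"] l2_norm_sq_flat[of "unflat u"] multilevel_flat[of "unflat u" J] that(2)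
    by simp
  then show ?thesis using c1(1) by blast
qed

lemma l2_stableI:
  assumes c: "c1 > 0" "c2 > 0" and st: "\<And>J u. fsupp u \<Longrightarrow> c1 * nsq u \<le> ml E J u \<and> ml E J u \<le> c2 * nsq u"
  shows "l2_stable M0 M b0 b"
proof -
  have bounds: "c1 / 2 * l2_norm_sq v \<le> multilevel_norm_sq M0 M b0 b J v \<and> multilevel_norm_sq M0 M b0 b J v \<le> c2 * l2_norm_sq v"
    if v: "l2_seq v" for v J
  proof -
    \<comment> \<open>One label per scalar output channel: the details by step and filter, and the
      components of the last low-pass sequence.\<close>
    define MM :: "((nat \<times> 's) + 'r) set" where "MM = {1..J} \<times> UNIV <+> UNIV"
    define Y :: "(nat \<times> 's) + 'r \<Rightarrow> int ^ 'd \<Rightarrow> ('r \<times> (int ^ 'd) \<Rightarrow> complex) \<Rightarrow> complex" where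
      "Y m k u = (case m of Inl (j, l) \<Rightarrow> high E ((low E ^^ (j - 1)) u) (l, k) | Inr q \<Rightarrow> (low E ^^ J) u (q, k))" for m k u
    have Y: "Y (Inl (j, l)) k u = high E ((low E ^^ (j - 1)) u) (l, k)" "Y (Inr q) k u = (low E ^^ J) u (q, k)" for j l q k u
      by (simp_all add: Y_def)
    have MM: "finite MM" by (simp add: MM_def)
    have sumMM: "(\<Sum>m\<in>MM. F m) = (\<Sum>j=1..J. \<Sum>l\<in>UNIV. F (Inl (j, l))) + (\<Sum>q\<in>UNIV. F (Inr q))" for F :: "_ \<Rightarrow> real"
      unfolding MM_def by (subst sum.Plus) (auto simp: sum.cartesian_product case_prod_beta')
    have dep: "fin_dep (Y m k)" for m k
    proof (cases m)
      case (Inl p)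
      obtain j l where p: "p = (j, l)" by (cases p)
      have "fin_dep (\<lambda>u. ana E ((low E ^^ (j - 1)) u) (Inl l, k))"
        by (rule fin_dep_ana[OF loc_fin fin_dep_low_iter[OF loc_fin]])
      moreover have "Y m k = (\<lambda>u. ana E ((low E ^^ (j - 1)) u) (Inl l, k))"
        by (rule ext) (simp add: Inl p Y high_def)
      ultimately show ?thesis by simp
    next
      case (Inr q)
      have "Y m k = (\<lambda>u. (low E ^^ J) u (q, k))" by (rule ext) (simp add: Inr Y)
      then show ?thesis using fin_dep_low_iter[OF loc_fin, of J "(q, k)"] by simp
    qed
    have hf: "fsupp (high E ((low E ^^ n) u))" "fsupp ((low E ^^ n) u)" if "fsupp u" for u n
      using fsupp_high[OF loc_fin fsupp_low_iter[OF loc_fin that]] fsupp_low_iter[OF loc_fin that] by auto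
    have inj: "inj (\<lambda>k. (\<iota>, k))" for \<iota> by (simp add: inj_on_def)
    have fs: "fsupp (\<lambda>k. Y m k u)" if u: "fsupp u" for m u
    proof (cases m)
      case (Inl p)
      obtain j l where p: "p = (j, l)" by (cases p)
      then show ?thesis using fsupp_comp_inj[OF hf(1)[OF u] inj] by (simp add: Inl Y)
    next
      case (Inr q)
      then show ?thesis using fsupp_comp_inj[OF hf(2)[OF u] inj] by (simp add: Y)
    qed
    have ml: "(\<Sum>m\<in>MM. nsq (\<lambda>k. Y m k u)) = ml E J u" if u: "fsupp u" for u
      unfolding sumMM Y ml_def by (simp add: nsq_split[OF hf(1)[OF u]] nsq_split[OF hf(2)[OF u]])
    have st1: "c1 * nsq u \<le> (\<Sum>m\<in>MM. nsq (\<lambda>k. Y m k u))" "(\<Sum>m\<in>MM. nsq (\<lambda>k. Y m k u)) \<le> c2 * nsq u" if "fsupp u" for u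
      using st[OF that, of J] ml[OF that] by auto
    note ext = l2_extension[OF MM dep fs st1(1) st1(2) c l2_seq_flat(1)[OF v]]
    have n1: "norm x = cmod (x $ 1)" for x :: "complex ^ 1"
      by (simp add: norm_vec_def L2_set_def UNIV_1)
    have "multilevel_norm_sq M0 M b0 b J v = (\<Sum>m\<in>MM. \<Sum>\<^sub>\<infinity>k. (cmod (Y m k (flat v)))\<^sup>2)"
    proof -
      have 1: "l2_norm_sq (transition (b l) (M l) ((transition b0 M0 ^^ (j - 1)) v)) = (\<Sum>\<^sub>\<infinity>k. (cmod (Y (Inl (j, l)) k (flat v)))\<^sup>2)" for l j
        unfolding l2_norm_sq_def n1 transition_high flat_transition_iter Y ..
      have comp: "((transition b0 M0 ^^ J) v) k $ q = Y (Inr q) k (flat v)" for q k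
        using fun_cong[OF flat_transition_iter[of J v], of "(q, k)"] by (simp add: flat_def[of "_ ^^ _"] Y) (simp add: flat_def)
      have 2: "l2_norm_sq ((transition b0 M0 ^^ J) v) = (\<Sum>q\<in>UNIV. \<Sum>\<^sub>\<infinity>k. (cmod (Y (Inr q) k (flat v)))\<^sup>2)"
        unfolding l2_norm_sq_def norm_vec_sq comp
        by (rule infsum_sum_real[OF finite]) (rule ext(1), auto simp: MM_def)
      show ?thesis unfolding multilevel_norm_sq_def sumMM 1 2 ..
    qed
    then show ?thesis using ext(2,3) l2_seq_flat(2)[OF v] by simp
  qed
  show ?thesis
    unfolding l2_stable_def
    by (rule exI[of _ "c1 / 2"], rule conjI, use c in simp, rule exI[of _ c2], rule conjI, use c in simp, use bounds in blast)
qed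

end

section \<open>Refinement equations in the time domain\<close>

lemma fourier_cong_ae:
  assumes "f \<in> borel_measurable lebesgue" "AE x in lebesgue. f x = g x"
  shows "fourier f \<xi> = fourier g \<xi>"
proof -
  have m: "g \<in> borel_measurable lebesgue" using borel_measurable_AE[OF assms] .
  have c: "(\<lambda>x. cis (- (x \<bullet> \<xi>))) \<in> borel_measurable lebesgue"
    by (intro borel_lebesgue borel_measurable_continuous_onI continuous_intros)
  show ?thesis
    unfolding fourier_def
  proof (rule integral_cong_AE)
    show "AE x in lebesgue. f x * cis (- (x \<bullet> \<xi>)) = g x * cis (- (x \<bullet> \<xi>))"
      using assms(2) by eventually_elim simp
  qed (use m c assms(1) in \<open>auto intro: borel_measurable_times\<close>)
qed

lemma integrable_cis:
  assumes "integrable lebesgue u"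
  shows "integrable lebesgue (\<lambda>x. u x * cis (- (x \<bullet> \<xi>)))"
proof (rule Bochner_Integration.integrable_bound[OF assms])
  have "(\<lambda>x. cis (- (x \<bullet> \<xi>))) \<in> borel_measurable lebesgue"
    by (intro borel_lebesgue borel_measurable_continuous_onI continuous_intros)
  then show "(\<lambda>x. u x * cis (- (x \<bullet> \<xi>))) \<in> borel_measurable lebesgue" using assms by auto
qed (auto simp: norm_mult)

text \<open>A change of variables; \<open>abs_det M\<close> is the normalisation that leaves no
  constant on the frequency side.\<close>

lemma fourier_dilate:
  fixes \<phi> :: "real ^ 'd \<Rightarrow> complex" and M :: "int ^ 'd ^ 'd"
  assumes det: "det (rmat M) \<noteq> 0" and \<phi>: "integrable lebesgue \<phi>"
  shows "fourier (\<lambda>x. of_real (abs_det M) * \<phi> (rmat M *v x - rvec n)) \<xi>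
    = cis (- (rvec n \<bullet> (inv_transp M *v \<xi>))) * fourier \<phi> (inv_transp M *v \<xi>)"
proof -
  define \<eta> where "\<eta> = inv_transp M *v \<xi>"
  have \<xi>: "\<xi> = transpose (rmat M) *v \<eta>" unfolding \<eta>_def by (simp only: inv_transp(1)[OF det])
  have inner: "x \<bullet> \<xi> = (rmat M *v x) \<bullet> \<eta>" for x
  proof -
    have "x \<bullet> (transpose (rmat M) *v \<eta>) = (x v* transpose (rmat M)) \<bullet> \<eta>" by (rule dot_lmul_matrix[symmetric])
    then show ?thesis by (simp only: \<xi> vector_transpose_matrix)
  qed
  let ?f = "\<lambda>y. \<phi> y * cis (- (y \<bullet> \<eta>))"
  have "fourier \<phi> \<eta> = abs_det M *\<^sub>R (LINT x|lebesgue. ?f (rmat M *v x - rvec n))"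
    unfolding fourier_def abs_det_eq
    by (rule integral_affine[OF det borel_measurable_integrable[OF integrable_cis[OF \<phi>]]])
  then have "cis (- (rvec n \<bullet> \<eta>)) * fourier \<phi> \<eta>
      = (LINT x|lebesgue. cis (- (rvec n \<bullet> \<eta>)) * (of_real (abs_det M) * ?f (rmat M *v x - rvec n)))"
    by (simp add: scaleR_conv_of_real)
  also have "\<dots> = fourier (\<lambda>x. of_real (abs_det M) * \<phi> (rmat M *v x - rvec n)) \<xi>"
    unfolding fourier_def
  proof (rule Bochner_Integration.integral_cong[OF refl])
    fix x
    have "cis (- (x \<bullet> \<xi>)) = cis (- (rvec n \<bullet> \<eta>)) * cis (- ((rmat M *v x - rvec n) \<bullet> \<eta>))"
      by (simp add: inner cis_mult inner_diff_left)
    then show "cis (- (rvec n \<bullet> \<eta>)) * (of_real (abs_det M) * ?f (rmat M *v x - rvec n))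
      = of_real (abs_det M) * \<phi> (rmat M *v x - rvec n) * cis (- (x \<bullet> \<xi>))"
      by (simp add: ac_simps)
  qed
  finally show ?thesis by (simp add: \<eta>_def)
qed

lemma fourier_lincomb:
  assumes "\<And>i. i \<in> S \<Longrightarrow> integrable lebesgue (f i)"
  shows "fourier (\<lambda>x. \<Sum>i\<in>S. c i * f i x) \<xi> = (\<Sum>i\<in>S. c i * fourier (f i) \<xi>)"
proof -
  have "fourier (\<lambda>x. \<Sum>i\<in>S. c i * f i x) \<xi> = (LINT x|lebesgue. (\<Sum>i\<in>S. c i * (f i x * cis (- (x \<bullet> \<xi>)))))"
    unfolding fourier_def by (simp add: sum_distrib_right mult.assoc)
  also have "\<dots> = (\<Sum>i\<in>S. (LINT x|lebesgue. c i * (f i x * cis (- (x \<bullet> \<xi>)))))"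
    by (rule Bochner_Integration.integral_sum) (intro integrable_mult_right integrable_cis assms)
  finally show ?thesis by (simp add: fourier_def)
qed

lemma supported_integrable:
  fixes f :: "real ^ 'd \<Rightarrow> complex"
  assumes "L2_fun f" "\<And>x. norm x > R \<Longrightarrow> f x = 0"
  shows "integrable lebesgue f"
proof -
  have "indicat_real (cball 0 R) x *\<^sub>R f x = f x" for x
    using assms(2)[of x] by (cases "norm x > R") (auto simp: indicator_def)
  then show ?thesis using truncation_integrable(2)[OF assms(1), of R] by simp
qed

text \<open>The time-domain function with transform \<open>c(\<eta>) \<phi>(\<eta>)\<close>, where \<open>\<eta>\<close> is the inverse transpose of
  \<open>M\<close> applied to the frequency.\<close>

definition refined :: "int ^ 'd ^ 'd \<Rightarrow> (int ^ 'd \<Rightarrow> complex ^ 'r) \<Rightarrow> ('r \<Rightarrow> real ^ 'd \<Rightarrow> complex) \<Rightarrow> real ^ 'd \<Rightarrow> complex" where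
  "refined M c \<phi> x = (\<Sum>n | c n \<noteq> 0. \<Sum>p\<in>UNIV. c n $ p * (of_real (abs_det M) * \<phi> p (rmat M *v x - rvec n)))"

locale L2_compact =
  fixes M :: "int ^ 'd ^ 'd" and \<phi> :: "'r :: finite \<Rightarrow> real ^ 'd \<Rightarrow> complex" and R :: real
  assumes det: "det (rmat M) \<noteq> 0" and phi_L2: "\<And>q. L2_fun (\<phi> q)"
    and supp: "\<And>q x. norm x > R \<Longrightarrow> \<phi> q x = 0"
begin

lemma term_L2: "L2_fun (\<lambda>x. of_real (abs_det M) * \<phi> p (rmat M *v x - rvec n))"
proof (rule L2_fun_cmul)
  show "L2_fun (\<lambda>x. \<phi> p (rmat M *v x - rvec n))"
    unfolding L2_fun_def
    using measurable_affine[OF det L2_funD(1)[OF phi_L2]] integrable_affine[OF det L2_funD(2)[OF phi_L2]] by auto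
qed

lemma refined_L2: "L2_fun (refined M c \<phi>)"
  unfolding refined_def[abs_def] by (intro L2_fun_sum L2_fun_cmul term_L2)

lemma term_supp: "\<exists>R'. \<forall>x. norm x > R' \<longrightarrow> \<phi> p (rmat M *v x - rvec n) = 0"
proof -
  define B where "B = matrix_inv (rmat M)"
  have B: "B *v (rmat M *v x) = x" for x
    using matrix_inv_mult[OF det] by (simp add: B_def matrix_vector_mul_assoc)
  define C where "C = onorm ((*v) B)"
  have C: "norm (B *v y) \<le> C * norm y" for y
    unfolding C_def by (rule onorm) (simp add: linear_conv_bounded_linear[symmetric])
  have C0: "C \<ge> 0" unfolding C_def by (rule onorm_pos_le) (simp add: linear_conv_bounded_linear[symmetric])
  show ?thesis
  proof (intro exI allI impI)
    fix x :: "real ^ 'd" assume x: "norm x > C * (\<bar>R\<bar> + norm (rvec n :: real ^ 'd))"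
    show "\<phi> p (rmat M *v x - rvec n) = 0"
    proof (rule supp, rule ccontr)
      assume "\<not> R < norm (rmat M *v x - rvec n)"
      then have "norm (rmat M *v x) \<le> \<bar>R\<bar> + norm (rvec n :: real ^ 'd)"
        using norm_triangle_sub[of "rmat M *v x" "rvec n"] by linarith
      then have "norm x \<le> C * (\<bar>R\<bar> + norm (rvec n :: real ^ 'd))"
        using C[of "rmat M *v x"] mult_left_mono[OF _ C0] by (metis B order_trans)
      then show False using x by simp
    qed
  qed
qed

lemma refined_supp: "\<exists>R'. \<forall>x. norm x > R' \<longrightarrow> refined M c \<phi> x = 0" if c: "finite {n. c n \<noteq> 0}"
proof -
  obtain R' where R': "\<And>p n x. norm x > R' p n \<Longrightarrow> \<phi> p (rmat M *v x - rvec n) = 0"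
    using term_supp by metis
  define S where "S = (UNIV :: 'r set) \<times> {n. c n \<noteq> 0}"
  have S: "finite S" using c by (simp add: S_def)
  define Rm where "Rm = (\<Sum>(p, n)\<in>S. \<bar>R' p n\<bar>)"
  have "R' p n \<le> Rm" if "c n \<noteq> 0" for p n
  proof -
    have "\<bar>R' p n\<bar> \<le> Rm"
      unfolding Rm_def using member_le_sum[of "(p, n)" S "\<lambda>(p, n). \<bar>R' p n\<bar>"] S that by (auto simp: S_def)
    then show ?thesis by linarith
  qed
  then have "refined M c \<phi> x = 0" if "norm x > Rm" for x
    unfolding refined_def using R' that by (intro sum.neutral ballI) (smt (verit) mem_Collect_eq mult_eq_0_iff)
  then show ?thesis by blast
qed

lemma fourier_refined:
  "fourier (refined M c \<phi>) \<xi> = (\<Sum>p\<in>UNIV. (\<Sum>n | c n \<noteq> 0. c n $ p * cis (- (rvec n \<bullet> (inv_transp M *v \<xi>)))) * fourier (\<phi> p) (inv_transp M *v \<xi>))"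
  if c: "finite {n. c n \<noteq> 0}"
proof -
  let ?g = "\<lambda>(n, p) x. of_real (abs_det M) * \<phi> p (rmat M *v x - rvec n)"
  have int: "integrable lebesgue (?g i)" for i
  proof (cases i)
    case (Pair n p)
    obtain R' where R': "\<forall>x. norm x > R' \<longrightarrow> \<phi> p (rmat M *v x - rvec n) = 0" using term_supp by blast
    show ?thesis unfolding Pair prod.case by (rule supported_integrable[OF term_L2, of R']) (use R' in simp)
  qed
  have \<phi>i: "integrable lebesgue (\<phi> p)" for p by (rule supported_integrable[OF phi_L2 supp])
  have "refined M c \<phi> = (\<lambda>x. \<Sum>i\<in>{n. c n \<noteq> 0} \<times> UNIV. (case i of (n, p) \<Rightarrow> c n $ p) * ?g i x)"
    by (rule ext) (simp add: refined_def sum.cartesian_product case_prod_beta')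
  then have "fourier (refined M c \<phi>) \<xi> = (\<Sum>i\<in>{n. c n \<noteq> 0} \<times> UNIV. (case i of (n, p) \<Rightarrow> c n $ p) * fourier (?g i) \<xi>)"
    using fourier_lincomb[of "{n. c n \<noteq> 0} \<times> UNIV" ?g, OF int] by simp
  also have "\<dots> = (\<Sum>n | c n \<noteq> 0. \<Sum>p\<in>UNIV. c n $ p * (cis (- (rvec n \<bullet> (inv_transp M *v \<xi>))) * fourier (\<phi> p) (inv_transp M *v \<xi>)))"
    by (simp add: sum.cartesian_product case_prod_beta' fourier_dilate[OF det \<phi>i])
  also have "\<dots> = (\<Sum>p\<in>UNIV. \<Sum>n | c n \<noteq> 0. c n $ p * (cis (- (rvec n \<bullet> (inv_transp M *v \<xi>))) * fourier (\<phi> p) (inv_transp M *v \<xi>)))"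
    by (rule sum.swap)
  finally show ?thesis by (simp add: sum_distrib_right mult.assoc)
qed

lemma refined_row:
  fixes a :: "int ^ 'd \<Rightarrow> complex ^ 'r ^ 'q"
  assumes a: "finite {n. a n \<noteq> 0}"
  shows "fourier (refined M (\<lambda>n. a n $ i) \<phi>) \<xi>
    = (fseries a (inv_transp M *v \<xi>) *v (\<chi> p. fourier (\<phi> p) (inv_transp M *v \<xi>))) $ i"
proof -
  have sub: "{n. a n $ i \<noteq> 0} \<subseteq> {n. a n \<noteq> 0}" by auto
  have c: "finite {n. a n $ i \<noteq> 0}" by (rule finite_subset[OF sub a])
  have "(\<Sum>n | a n $ i \<noteq> 0. a n $ i $ p * z n) = (\<Sum>n | a n \<noteq> 0. a n $ i $ p * z n)" for p and z :: "int ^ 'd \<Rightarrow> complex"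
    by (rule sum.mono_neutral_left[OF a sub]) auto
  then show ?thesis
    by (simp add: fourier_refined[OF c] matrix_vector_mult_def fseries_def)
qed

lemma refined_unique:
  assumes f: "L2_fun f" and c: "finite {n. c n \<noteq> 0}"
    and lim: "((\<lambda>R. \<integral>\<^sup>+\<xi>. ennreal ((cmod (fourier (\<lambda>x. indicat_real (cball 0 R) x *\<^sub>R f x) \<xi>
      - fourier (refined M c \<phi>) \<xi>))\<^sup>2) \<partial>lebesgue) \<longlongrightarrow> 0) at_top"
  shows "AE x in lebesgue. f x = refined M c \<phi> x"
proof -
  obtain R' where "\<And>x. norm x > R' \<Longrightarrow> refined M c \<phi> x = 0" using refined_supp[OF c] by blast
  from fourier_unique[OF f refined_L2 this lim] show ?thesis .
qed

text \<open>For a function of bounded support the truncations are eventually the function itself, so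
  equality of transforms suffices.\<close>

lemma refined_unique':
  assumes f: "L2_fun f" "\<And>x. norm x > R' \<Longrightarrow> f x = 0" and c: "finite {n. c n \<noteq> 0}"
    and eq: "\<And>\<xi>. fourier f \<xi> = fourier (refined M c \<phi>) \<xi>"
  shows "AE x in lebesgue. f x = refined M c \<phi> x"
proof (rule refined_unique[OF f(1) c])
  have "eventually (\<lambda>R. (\<integral>\<^sup>+\<xi>. ennreal ((cmod (fourier (\<lambda>x. indicat_real (cball 0 R) x *\<^sub>R f x) \<xi>
      - fourier (refined M c \<phi>) \<xi>))\<^sup>2) \<partial>lebesgue) = 0) at_top"
    using eventually_ge_at_top[of R']
  proof eventually_elim
    fix R assume R: "R' \<le> R"
    have "indicat_real (cball 0 R) x *\<^sub>R f x = f x" for x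
      using f(2)[of x] R by (cases "norm x > R") (auto simp: indicator_def)
    then show "(\<integral>\<^sup>+\<xi>. ennreal ((cmod (fourier (\<lambda>x. indicat_real (cball 0 R) x *\<^sub>R f x) \<xi>
      - fourier (refined M c \<phi>) \<xi>))\<^sup>2) \<partial>lebesgue) = 0" by (simp add: eq)
  qed
  then show "((\<lambda>R. \<integral>\<^sup>+\<xi>. ennreal ((cmod (fourier (\<lambda>x. indicat_real (cball 0 R) x *\<^sub>R f x) \<xi>
      - fourier (refined M c \<phi>) \<xi>))\<^sup>2) \<partial>lebesgue) \<longlongrightarrow> 0) at_top" by (rule tendsto_eventually)
qed

end

text \<open>A comparison of normalisations, stated without quotients: \<open>refined\<close> carries
  the whole determinant of \<open>M\<close>, \<open>dilate_shift\<close> its square root, and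
  \<open>fcoef\<close> the square root for the dilation of the channel.\<close>

lemma lc_fcoef_refined:
  fixes D :: "'x :: finite \<Rightarrow> int ^ 'd ^ 'd" and f :: "'x \<Rightarrow> int ^ 'd \<Rightarrow> complex ^ 'r"
  assumes f: "finite {n. f \<iota> n \<noteq> 0}" and M: "det (rmat M) \<noteq> 0"
  shows "of_real (sqrt (abs_det M)) * lc (fcoef D f (\<iota>, 0)) (\<lambda>\<kappa>. dilate_shift (rmat M) 0 (shifts \<phi> \<kappa>)) x
    = of_real (sqrt (abs_det (D \<iota>))) * refined M (f \<iota>) \<phi> x"
proof -
  let ?S = "UNIV \<times> {n. f \<iota> n \<noteq> 0}"
  have "lc (fcoef D f (\<iota>, 0)) (\<lambda>\<kappa>. dilate_shift (rmat M) 0 (shifts \<phi> \<kappa>)) x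
      = (\<Sum>\<kappa>\<in>?S. fcoef D f (\<iota>, 0) \<kappa> * dilate_shift (rmat M) 0 (shifts \<phi> \<kappa>) x)"
    by (subst lc_eq[of ?S]) (use f in \<open>auto simp: fcoef_def\<close>)
  also have "\<dots> = (\<Sum>p\<in>UNIV. \<Sum>n | f \<iota> n \<noteq> 0. of_real (sqrt (abs_det (D \<iota>))) * f \<iota> n $ p
      * (of_real (sqrt (abs_det M)) * \<phi> p (rmat M *v x - rvec n)))"
    unfolding sum.cartesian_product
    by (intro sum.cong refl) (auto simp: fcoef_def dilate_shift_def shifts_def abs_det_eq scaleR_conv_of_real)
  also have "\<dots> = (\<Sum>n | f \<iota> n \<noteq> 0. \<Sum>p\<in>UNIV. of_real (sqrt (abs_det (D \<iota>))) * f \<iota> n $ p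
      * (of_real (sqrt (abs_det M)) * \<phi> p (rmat M *v x - rvec n)))"
    by (rule sum.swap)
  finally have 1: "lc (fcoef D f (\<iota>, 0)) (\<lambda>\<kappa>. dilate_shift (rmat M) 0 (shifts \<phi> \<kappa>)) x
    = (\<Sum>n | f \<iota> n \<noteq> 0. \<Sum>p\<in>UNIV. of_real (sqrt (abs_det (D \<iota>))) * f \<iota> n $ p
      * (of_real (sqrt (abs_det M)) * \<phi> p (rmat M *v x - rvec n)))" .
  have cc: "complex_of_real (sqrt (abs_det M)) * (u * (complex_of_real (sqrt (abs_det M)) * v)) = u * (of_real (abs_det M) * v)" for u v
  proof -
    have "complex_of_real (sqrt (abs_det M)) * complex_of_real (sqrt (abs_det M)) = of_real (abs_det M)"
      by (simp only: of_real_mult[symmetric] real_sqrt_mult_self) (simp add: abs_det_def)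
    moreover have "c * (u * (c * v)) = u * ((c * c) * v)" for c :: complex by (simp add: ac_simps)
    ultimately show ?thesis by simp
  qed
  show ?thesis
    unfolding 1 refined_def sum_distrib_left
    by (intro sum.cong refl) (subst cc, simp only: mult.assoc)
qed

section \<open>Passing to representatives\<close>

lemma riesz_basis_ae:
  fixes e e' :: "'i \<Rightarrow> real ^ 'd \<Rightarrow> complex"
  assumes eq: "\<And>i. AE x in lebesgue. e i x = e' i x" and L: "\<And>i. L2_fun (e i)" and rb: "riesz_basis_L2 e"
  shows "riesz_basis_L2 e'"
proof -
  have L': "L2_fun (e' i)" for i by (rule L2_fun_ae[OF L eq])
  have n: "L2_norm (lc c e) = L2_norm (lc c e')" if "fsupp c" for c
    by (rule L2_norm_cong_ae[OF L2_funD(1)[OF lc_L2[OF that L]] lc_cong_ae[OF that eq]])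
  have n2: "L2_norm (\<lambda>x. f x - lc c e x) = L2_norm (\<lambda>x. f x - lc c e' x)" if "fsupp c" "L2_fun f" for c f
  proof (rule L2_norm_cong_ae[OF L2_funD(1)[OF L2_fun_diff[OF that(2) lc_L2[OF that(1) L]]]])
    show "AE x in lebesgue. f x - lc c e x = f x - lc c e' x"
      using lc_cong_ae[OF that(1) eq] by eventually_elim simp
  qed
  have "(\<forall>f. L2_fun f \<longrightarrow> (\<forall>\<epsilon>>0. \<exists>c. fsupp c \<and> L2_norm (\<lambda>x. f x - lc c e x) < \<epsilon>)) \<and>
     (\<exists>A>0. \<exists>B>0. \<forall>c. fsupp c \<longrightarrow> A * nsq c \<le> (L2_norm (lc c e))\<^sup>2 \<and> (L2_norm (lc c e))\<^sup>2 \<le> B * nsq c)"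
    using rb unfolding riesz_basis_lc by blast
  then show ?thesis
    unfolding riesz_basis_lc using L' n n2 by (simp cong: conj_cong imp_cong)
qed

lemma biorthogonal_riesz_bases_ae:
  fixes e e' et et' :: "'i \<Rightarrow> real ^ 'd \<Rightarrow> complex"
  assumes eq: "\<And>i. AE x in lebesgue. e i x = e' i x" "\<And>i. AE x in lebesgue. et i x = et' i x"
    and L: "\<And>i. L2_fun (e i)" "\<And>i. L2_fun (et i)"
  shows "biorthogonal_riesz_bases e et \<longleftrightarrow> biorthogonal_riesz_bases e' et'"
proof -
  have L': "L2_fun (e' i)" "L2_fun (et' i)" for i using L2_fun_ae[OF L(1) eq(1)] L2_fun_ae[OF L(2) eq(2)] by auto
  have eq': "\<And>i. AE x in lebesgue. e' i x = e i x" "\<And>i. AE x in lebesgue. et' i x = et i x"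
    using eq by (simp_all add: eq_commute)
  have "riesz_basis_L2 e \<longleftrightarrow> riesz_basis_L2 e'"
    using riesz_basis_ae[of e e', OF eq(1) L(1)] riesz_basis_ae[of e' e, OF eq'(1) L'(1)] by blast
  moreover have "riesz_basis_L2 et \<longleftrightarrow> riesz_basis_L2 et'"
    using riesz_basis_ae[of et et', OF eq(2) L(2)] riesz_basis_ae[of et' et, OF eq'(2) L'(2)] by blast
  moreover have "L2_inner (e i) (et j) = L2_inner (e' i) (et' j)" for i j
    by (rule L2_inner_cong_ae[OF L(1,2) eq])
  ultimately show ?thesis by (simp add: biorthogonal_riesz_bases_def)
qed

lemma L2_fun_component:
  fixes f :: "real ^ 'd \<Rightarrow> complex ^ 'r"
  assumes "L2_fun f"
  shows "L2_fun (\<lambda>x. f x $ q)"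
proof (rule L2_fun_bound[OF _ L2_funD(2)[OF assms]])
  show "(\<lambda>x. f x $ q) \<in> borel_measurable lebesgue"
    by (rule borel_measurable_continuous_on[OF _ L2_funD(1)[OF assms]]) (intro continuous_intros)
  show "(cmod (f x $ q))\<^sup>2 \<le> (norm (f x))\<^sup>2" for x
    using Finite_Cartesian_Product.norm_nth_le[of "f x" q] by (simp add: power_mono)
qed

text \<open>Fubini needs Borel functions, and the overlap count for shifts needs a support bound at
  every point. Both come from a change on a null set.\<close>

lemma compact_representative:
  fixes \<psi> :: "real ^ 'd \<Rightarrow> complex ^ 'r"
  assumes L: "L2_fun \<psi>" and cs: "compactly_supported \<psi>"
  shows "\<exists>\<phi> R. (\<forall>q. L2_fun (\<phi> q)) \<and> (\<forall>q. \<phi> q \<in> borel_measurable borel) \<and>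
    (\<forall>q x. norm x > R \<longrightarrow> \<phi> q x = 0) \<and> (\<forall>q. AE x in lebesgue. \<psi> x $ q = \<phi> q x)"
proof -
  obtain K where K: "compact K" "AE x in lebesgue. x \<notin> K \<longrightarrow> \<psi> x = 0"
    using cs by (auto simp: compactly_supported_def)
  obtain R where R: "\<And>x. x \<in> K \<Longrightarrow> norm x \<le> R" using compact_imp_bounded[OF K(1)] by (auto simp: bounded_iff)
  have "\<forall>q. \<exists>g. g \<in> borel_measurable borel \<and> L2_fun g \<and> (AE x in lebesgue. \<psi> x $ q = g x)"
    using L2_borel_rep[OF L2_fun_component[OF L]] by blast
  then obtain g where g: "\<And>q. g q \<in> borel_measurable borel" "\<And>q. L2_fun (g q)" "\<And>q. AE x in lebesgue. \<psi> x $ q = g q x"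
    by metis
  define \<phi> where "\<phi> q x = indicat_real (cball 0 R) x *\<^sub>R g q x" for q x
  have "L2_fun (\<phi> q)" for q unfolding \<phi>_def by (rule truncation_integrable(1)[OF g(2)])
  moreover have "\<phi> q \<in> borel_measurable borel" for q
    unfolding \<phi>_def by (intro borel_measurable_scaleR borel_measurable_indicator g(1)) simp
  moreover have "\<phi> q x = 0" if "norm x > R" for q x using that by (simp add: \<phi>_def)
  moreover have "AE x in lebesgue. \<psi> x $ q = \<phi> q x" for q
    using K(2) g(3)[of q]
  proof eventually_elim
    fix x assume *: "x \<notin> K \<longrightarrow> \<psi> x = 0" "\<psi> x $ q = g q x"
    show "\<psi> x $ q = \<phi> q x"
    proof (cases "x \<in> K")
      case True
      then show ?thesis using * R[OF True] by (simp add: \<phi>_def)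
    next
      case False
      then have "g q x = 0" using * by simp
      then show ?thesis using * by (simp add: \<phi>_def)
    qed
  qed
  ultimately show ?thesis by blast
qed

text \<open>A component passes through the Bochner integral once the matrix valued function is
  integrable, which a sum of moduli of the entries dominates.\<close>

lemma outer_integral_component:
  fixes f :: "real ^ 'd \<Rightarrow> complex ^ 'm" and g :: "real ^ 'd \<Rightarrow> complex ^ 'n"
  assumes f: "L2_fun f" and g: "L2_fun g"
  shows "L2_inner_mat f g $ i $ j = L2_inner (\<lambda>x. f x $ i) (\<lambda>x. g x $ j)"
proof -
  have m: "(\<lambda>x. outer (f x) (g x)) \<in> borel_measurable lebesgue"
  proof (rule borel_measurable_continuous_Pair[OF L2_funD(1)[OF f] L2_funD(1)[OF g]])
    show "continuous_on UNIV (\<lambda>x. outer (fst x) (snd x) :: complex ^ 'n ^ 'm)"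
      unfolding outer_def by (intro continuous_intros continuous_on_vec_lambda)
  qed
  have le: "norm (outer x y) \<le> (\<Sum>i\<in>UNIV. \<Sum>j\<in>UNIV. cmod (x $ i) * cmod (y $ j))" for x :: "complex ^ 'm" and y :: "complex ^ 'n"
  proof -
    have "norm (outer x y) \<le> (\<Sum>i\<in>UNIV. norm (outer x y $ i))"
      unfolding norm_vec_def[of "outer x y"] by (rule L2_set_le_sum) simp
    also have "\<dots> \<le> (\<Sum>i\<in>UNIV. \<Sum>j\<in>UNIV. cmod (outer x y $ i $ j))"
      by (rule sum_mono) (simp add: norm_vec_def L2_set_le_sum)
    finally show ?thesis by (simp add: outer_def norm_mult)
  qed
  have int: "integrable lebesgue (\<lambda>x. outer (f x) (g x))"
  proof (rule Bochner_Integration.integrable_bound[OF _ m])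
    show "integrable lebesgue (\<lambda>x. \<Sum>i\<in>UNIV. \<Sum>j\<in>UNIV. cmod (f x $ i) * cmod (g x $ j))"
      by (intro Bochner_Integration.integrable_sum L2_integrable_mult(1) L2_fun_component f g)
    show "AE x in lebesgue. norm (outer (f x) (g x)) \<le> norm (\<Sum>i\<in>UNIV. \<Sum>j\<in>UNIV. cmod (f x $ i) * cmod (g x $ j))"
    proof (rule AE_I2)
      fix x show "norm (outer (f x) (g x)) \<le> norm (\<Sum>i\<in>UNIV. \<Sum>j\<in>UNIV. cmod (f x $ i) * cmod (g x $ j))"
        using le[of "f x" "g x"] by simp
    qed
  qed
  have "bounded_linear (\<lambda>A :: complex ^ 'n ^ 'm. A $ i $ j)"
    using bounded_linear_compose[OF bounded_linear_vec_nth[of j] bounded_linear_vec_nth[of i]] by simp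
  from integral_bounded_linear[OF this int]
  show ?thesis by (simp add: L2_inner_mat_def L2_inner_def outer_def)
qed

text \<open>Uniqueness of transforms turns the frequency domain hypotheses into time domain
  identities. Pointwise equality serves the compactly supported generators; for the wavelets the
  limit over truncations in \<open>has_fourier_L2\<close> is used directly.\<close>

lemma refinable_representative:
  fixes M0 :: "int ^ 'd ^ 'd" and M :: "'s :: finite \<Rightarrow> int ^ 'd ^ 'd"
    and b0 :: "int ^ 'd \<Rightarrow> complex ^ 'r ^ 'r" and b :: "'s \<Rightarrow> int ^ 'd \<Rightarrow> complex ^ 'r ^ 1"
    and \<psi>0 :: "real ^ 'd \<Rightarrow> complex ^ 'r" and \<psi> :: "'s \<Rightarrow> real ^ 'd \<Rightarrow> complex"
  assumes "filters M0 M b0 b" and L: "L2_fun \<psi>0" and cs: "compactly_supported \<psi>0"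
    and ref: "\<And>\<xi>. fourier_vec \<psi>0 (transpose (rmat M0) *v \<xi>) = fseries b0 \<xi> *v fourier_vec \<psi>0 \<xi>"
    and \<psi>: "\<And>l. has_fourier_L2 (\<psi> l)
           (\<lambda>\<xi>. (fseries (b l) (inv_transp M0 *v \<xi>) *v fourier_vec \<psi>0 (inv_transp M0 *v \<xi>)) $ 1)"
  obtains \<phi> R where "refinable M0 M b0 b \<phi> R" "\<And>q. AE x in lebesgue. \<psi>0 x $ q = \<phi> q x"
    "\<And>i. AE x in lebesgue. affine_system M0 M \<psi>0 \<psi> i x = refinable.AS M0 M b0 b \<phi> i x"
    "\<And>q. fourier_vec \<psi>0 0 $ q = (LINT x|lebesgue. \<phi> q x)"
proof -
  interpret filters M0 M b0 b by fact
  obtain \<phi> R where phi: "\<And>q. L2_fun (\<phi> q)" "\<And>q. \<phi> q \<in> borel_measurable borel"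
      "\<And>q x. norm x > R \<Longrightarrow> \<phi> q x = 0" and ae: "\<And>q. AE x in lebesgue. \<psi>0 x $ q = \<phi> q x"
    using compact_representative[OF L cs] by blast
  have fv: "fourier_vec \<psi>0 \<eta> = (\<chi> p. fourier (\<phi> p) \<eta>)" for \<eta>
  proof -
    have "fourier (\<lambda>x. \<psi>0 x $ p) \<eta> = fourier (\<phi> p) \<eta>" for p
      by (rule fourier_cong_ae[OF L2_funD(1)[OF L2_fun_component[OF L]] ae])
    then show ?thesis by (simp add: fourier_vec_def)
  qed
  interpret C: L2_compact M0 \<phi> R by unfold_locales (use det_M0 phi in auto)
  have sq0: "complex_of_real (sqrt (abs_det M0)) \<noteq> 0" using det_M0 by (simp add: abs_det_eq)
  have "AE x in lebesgue. \<phi> q x = refined M0 (\<lambda>n. b0 n $ q) \<phi> x" for q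
  proof (rule C.refined_unique'[OF phi(1) phi(3)[of _ q]])
    show "finite {n. b0 n $ q \<noteq> 0}" by (rule finite_subset[OF _ fin0]) auto
    fix \<xi>
    have "fourier (refined M0 (\<lambda>n. b0 n $ q) \<phi>) \<xi> = (fseries b0 (inv_transp M0 *v \<xi>) *v fourier_vec \<psi>0 (inv_transp M0 *v \<xi>)) $ q"
      by (simp only: C.refined_row[OF fin0] fv)
    also have "\<dots> = fourier_vec \<psi>0 \<xi> $ q" by (simp only: ref[symmetric] inv_transp(1)[OF det_M0])
    finally show "fourier (\<phi> q) \<xi> = fourier (refined M0 (\<lambda>n. b0 n $ q) \<phi>) \<xi>" by (simp add: fv)
  qed
  moreover have "refined M0 (\<lambda>n. b0 n $ q) \<phi> x = lc (E (Inr q, 0)) (\<lambda>\<kappa>. dilate_shift (rmat M0) 0 (shifts \<phi> \<kappa>)) x" for q x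
  proof -
    have f: "finite {n. fil b0 b (Inr q) n \<noteq> 0}"
      by (rule finite_subset[OF _ fin0]) (auto simp: fil_def)
    show ?thesis
      using lc_fcoef_refined[of "fil b0 b" "Inr q", OF f det_M0, of "dil M0 M" \<phi> x] sq0 by (simp add: E_def dil_def) (simp add: fil_def)
  qed
  ultimately have "refinable M0 M b0 b \<phi> R" using phi by unfold_locales auto
  then interpret R: refinable M0 M b0 b \<phi> R .
  have L1: "R.Lv 1 = (\<lambda>\<kappa>. dilate_shift (rmat M0) 0 (shifts \<phi> \<kappa>))"
    by (rule ext) (simp add: R.Lv_def R.Dj_def mat_pow_def)
  have \<psi>ae: "AE x in lebesgue. \<psi> l x = refined M0 (\<lambda>n. b l n $ 1) \<phi> x" for l
  proof (rule C.refined_unique)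
    show "L2_fun (\<psi> l)" using \<psi>[of l] by (simp add: has_fourier_L2_def)
    show "finite {n. b l n $ 1 \<noteq> 0}" by (rule finite_subset[OF _ fin[of l]]) auto
    show "((\<lambda>R. \<integral>\<^sup>+\<xi>. ennreal ((cmod (fourier (\<lambda>x. indicat_real (cball 0 R) x *\<^sub>R \<psi> l x) \<xi>
      - fourier (refined M0 (\<lambda>n. b l n $ 1) \<phi>) \<xi>))\<^sup>2) \<partial>lebesgue) \<longlongrightarrow> 0) at_top"
      using \<psi>[of l] by (simp only: has_fourier_L2_def C.refined_row[OF fin] fv)
  qed
  have AS: "AE x in lebesgue. affine_system M0 M \<psi>0 \<psi> i x = R.AS i x" for i
  proof (cases i)
    case (Inl \<kappa>)
    obtain q k where \<kappa>: "\<kappa> = (q, k)" by (cases \<kappa>)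
    from AE_affine[of "mat 1", OF _ ae[of q], of "rvec k"]
    show ?thesis by (simp add: Inl \<kappa> R.AS_simps shifts_def)
  next
    case (Inr t)
    obtain l j k where t: "t = (l, j, k)" by (cases t)
    \<comment> \<open>As \<open>rmat M0 ** A\<close> is \<open>rmat (M l)\<close>, the shift by
      \<open>A *v rvec k\<close> becomes integral after one dilation, and the determinants combine
      to the normalisation of channel \<open>l\<close>.\<close>
    define A where "A = matrix_inv (rmat M0) ** rmat (M l)"
    have M0A: "rmat M0 ** A = rmat (M l)"
      using matrix_inv_mult[OF det_M0] by (simp add: A_def matrix_mul_assoc)
    have "\<bar>det (rmat M0)\<bar> * \<bar>det A\<bar> = \<bar>det (rmat (M l))\<bar>"
      unfolding M0A[symmetric] by (simp add: det_mul abs_mult)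
    then have sq: "sqrt (abs_det M0) * sqrt \<bar>det A\<bar> = sqrt (abs_det (M l))"
      by (simp add: abs_det_eq real_sqrt_mult[symmetric])
    have f: "finite {n. fil b0 b (Inl l) n \<noteq> 0}"
      by (rule finite_subset[OF _ fin[of l]]) (auto simp: fil_def)
    have scal: "sqrt \<bar>det A\<bar> *\<^sub>R refined M0 (\<lambda>n. b l n $ 1) \<phi> x = R.el (Inl l, 0) x" for x
    proof -
      have "complex_of_real (sqrt (abs_det M0)) * R.el (Inl l, 0) x = of_real (sqrt (abs_det (M l))) * refined M0 (\<lambda>n. b l n $ 1) \<phi> x"
        using lc_fcoef_refined[of "fil b0 b" "Inl l", OF f det_M0, of "dil M0 M" \<phi> x]
        unfolding R.el_def L1 E_def by (simp add: dil_def) (simp add: fil_def)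
      also have "\<dots> = complex_of_real (sqrt (abs_det M0)) * (sqrt \<bar>det A\<bar> *\<^sub>R refined M0 (\<lambda>n. b l n $ 1) \<phi> x)"
        by (simp add: sq[symmetric] scaleR_conv_of_real)
      finally show ?thesis using sq0 by (metis mult_left_cancel)
    qed
    have shift: "R.el (Inl l, 0) (y - A *v rvec k) = R.el (Inl l, k) y" for y
    proof -
      have "mat_pow (rmat M0) 1 *v (A *v rvec k) = rvec (M l *v k)"
        by (simp add: mat_pow_def matrix_vector_mul_assoc M0A rmat_mult_rvec)
      from R.translate_lc_Lv[OF R.fsupp_E this]
      have "R.el (Inl l, 0) (y - A *v rvec k) = lc (\<lambda>(p, n). E (Inl l, 0) (p, n - M l *v k)) (R.Lv 1) y"
        by (simp add: R.el_def)
      also have "(\<lambda>(p, n). E (Inl l, 0) (p, n - M l *v k)) = E (Inl l, k)"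
        by (auto simp: E_def fcoef_def dil_def fil_def)
      finally show ?thesis by (simp add: R.el_def)
    qed
    from AE_affine[OF R.det_pow \<psi>ae[of l], of j "A *v rvec k"]
    show ?thesis
    proof eventually_elim
      fix x
      let ?y = "mat_pow (rmat M0) j *v x"
      assume eq: "\<psi> l (?y - A *v rvec k) = refined M0 (\<lambda>n. b l n $ 1) \<phi> (?y - A *v rvec k)"
      have "affine_system M0 M \<psi>0 \<psi> i x = sqrt \<bar>det (mat_pow (rmat M0) j)\<bar> *\<^sub>R (sqrt \<bar>det A\<bar> *\<^sub>R \<psi> l (?y - A *v rvec k))"
        by (simp add: Inr t A_def[symmetric] Let_def dilate_shift_def scaleR_left_commute)
      also have "\<dots> = sqrt \<bar>det (mat_pow (rmat M0) j)\<bar> *\<^sub>R R.el (Inl l, k) ?y"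
        by (simp only: eq scal shift)
      also have "\<dots> = R.AS i x" by (simp add: Inr t R.AS_simps R.Dj_def dilate_shift_def)
      finally show "affine_system M0 M \<psi>0 \<psi> i x = R.AS i x" .
    qed
  qed
  have "fourier_vec \<psi>0 0 $ q = (LINT x|lebesgue. \<phi> q x)" for q by (simp add: fv fourier_def)
  with \<open>refinable M0 M b0 b \<phi> R\<close> ae AS show thesis by (rule that)
qed

lemma mat_delta_component: "(mat (delta k) :: complex ^ 'r ^ 'r) $ i $ j = (if i = j then delta k else 0)"
  by (simp add: mat_def)

context refinable_pair
begin

text \<open>Translating both functions by one integer vector leaves pairings unchanged, so only the
  difference of the shifts matters. The conjugation arises because the matrix pairing has the dual
  function first.\<close>

lemma shifts_biorth_iff:
  fixes \<psi>0 \<psi>t0 :: "real ^ 'd \<Rightarrow> complex ^ 'r"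
  assumes L: "L2_fun \<psi>0" "L2_fun \<psi>t0"
    and ae: "\<And>q. AE x in lebesgue. \<psi>0 x $ q = \<phi> q x" "\<And>q. AE x in lebesgue. \<psi>t0 x $ q = \<phi>t q x"
  shows "(\<forall>k. L2_inner_mat \<psi>t0 (\<lambda>x. \<psi>0 (x - rvec k)) = mat (delta k))
    \<longleftrightarrow> (\<forall>\<kappa> \<kappa>'. L2_inner (shifts \<phi> \<kappa>) (shifts \<phi>t \<kappa>') = (if \<kappa> = \<kappa>' then 1 else 0))"
proof -
  have comp: "L2_inner_mat \<psi>t0 (\<lambda>x. \<psi>0 (x - rvec k)) $ i $ j = L2_inner (\<phi>t i) (shifts \<phi> (j, k))" for k i j
  proof -
    have Lk: "L2_fun (\<lambda>x. \<psi>0 (x - rvec k))"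
      unfolding L2_fun_def
      using measurable_affine[of "mat 1" \<psi>0 "rvec k", OF _ L2_funD(1)[OF L(1)]]
        integrable_affine[of "mat 1" "\<lambda>x. (norm (\<psi>0 x))\<^sup>2" "rvec k", OF _ L2_funD(2)[OF L(1)]] by simp
    have "AE x in lebesgue. \<psi>0 (x - rvec k) $ j = shifts \<phi> (j, k) x"
      using AE_affine[of "mat 1", OF _ ae(1)[of j], of "rvec k"] by (simp add: shifts_def)
    from L2_inner_cong_ae[OF L2_fun_component[OF L(2)] L2_fun_component[OF Lk] ae(2)[of i] this]
    show ?thesis by (simp add: outer_integral_component[OF L(2) Lk])
  qed
  have tr: "L2_inner (shifts \<phi> (q, k)) (shifts \<phi>t (q', k')) = cnj (L2_inner (\<phi>t q') (shifts \<phi> (q, k - k')))" for q k q' k'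
  proof -
    have rv: "rvec (k - k') = rvec k - (rvec k' :: real ^ 'd)" by (simp add: rvec_def vec_eq_iff)
    have "L2_inner (\<phi>t q') (shifts \<phi> (q, k - k'))
      = L2_inner (dilate_shift (mat 1) (rvec k') (\<phi>t q')) (dilate_shift (mat 1) (rvec k') (shifts \<phi> (q, k - k')))"
      by (rule L2_inner_dilate_shift[symmetric]) (auto simp: Rt.phi_L2 R.shifts_L2)
    also have "\<dots> = L2_inner (shifts \<phi>t (q', k')) (shifts \<phi> (q, k))"
      by (simp add: dilate_shift_def[abs_def] shifts_def[abs_def] rv)
    finally show ?thesis by (simp add: L2_inner_commute[of "shifts \<phi> (q, k)"])
  qed
  show ?thesis
  proof
    assume *: "\<forall>k. L2_inner_mat \<psi>t0 (\<lambda>x. \<psi>0 (x - rvec k)) = mat (delta k)"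
    have "L2_inner (\<phi>t i) (shifts \<phi> (j, k)) = (if i = j then delta k else 0)" for i j k
      unfolding comp[symmetric] using * by (simp add: mat_delta_component)
    then show "\<forall>\<kappa> \<kappa>'. L2_inner (shifts \<phi> \<kappa>) (shifts \<phi>t \<kappa>') = (if \<kappa> = \<kappa>' then 1 else 0)"
      by (auto simp: tr delta_def)
  next
    assume *: "\<forall>\<kappa> \<kappa>'. L2_inner (shifts \<phi> \<kappa>) (shifts \<phi>t \<kappa>') = (if \<kappa> = \<kappa>' then 1 else 0)"
    have "L2_inner (\<phi>t i) (shifts \<phi> (j, k)) = (if i = j then delta k else 0)" for i j k
    proof -
      have "L2_inner (\<phi>t i) (shifts \<phi> (j, k)) = cnj (L2_inner (shifts \<phi> (j, k)) (shifts \<phi>t (i, 0)))" by (simp add: tr)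
      also have "\<dots> = (if i = j then delta k else 0)" using * by (auto simp: delta_def)
      finally show ?thesis .
    qed
    then show "\<forall>k. L2_inner_mat \<psi>t0 (\<lambda>x. \<psi>0 (x - rvec k)) = mat (delta k)"
      by (simp add: vec_eq_iff comp mat_delta_component)
  qed
qed

theorem biorthogonal_riesz_bases_AS_iff:
  assumes M0: "dilation_matrix M0"
    and a: "(LINT x|lebesgue. \<phi> q x) \<noteq> 0" "(LINT x|lebesgue. \<phi>t qt x) \<noteq> 0"
  shows "biorthogonal_riesz_bases R.AS Rt.AS \<longleftrightarrow>
    biorthogonal_wavelet_filter_bank M0 M b0 b bt0 bt \<and> l2_stable M0 M b0 b \<and> l2_stable M0 M bt0 bt \<and>
    (\<forall>\<kappa> \<kappa>'. L2_inner (shifts \<phi> \<kappa>) (shifts \<phi>t \<kappa>') = (if \<kappa> = \<kappa>' then 1 else 0))"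
proof
  assume *: "biorthogonal_wavelet_filter_bank M0 M b0 b bt0 bt \<and> l2_stable M0 M b0 b \<and> l2_stable M0 M bt0 bt \<and>
    (\<forall>\<kappa> \<kappa>'. L2_inner (shifts \<phi> \<kappa>) (shifts \<phi>t \<kappa>') = (if \<kappa> = \<kappa>' then 1 else 0))"
  have fb: "biorth R.E Rt.E" "reproducing R.E Rt.E"
    using biorthogonal_filter_bankD[OF R.filters_axioms Rt.filters_axioms] * by auto
  obtain c1 where c1: "c1 > 0" "\<And>J u. J \<ge> 1 \<Longrightarrow> fsupp u \<Longrightarrow> c1 * nsq u \<le> ml R.E J u"
    using R.l2_stable_lower * by blast
  obtain c2 where c2: "c2 > 0" "\<And>J u. J \<ge> 1 \<Longrightarrow> fsupp u \<Longrightarrow> c2 * nsq u \<le> ml Rt.E J u"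
    using Rt.l2_stable_lower * by blast
  show "biorthogonal_riesz_bases R.AS Rt.AS"
    by (rule biorthogonal_wavelet_AS[OF _ fb M0 a c1 c2]) (use * in blast)+
next
  assume brb: "biorthogonal_riesz_bases R.AS Rt.AS"
  \<comment> \<open>Conjugation shows that the hypothesis is symmetric, so stability of the second
    bank follows by exchanging the systems.\<close>
  have "L2_inner (Rt.AS i) (R.AS j) = (if i = j then 1 else 0)" for i j
    using brb L2_inner_commute[of "Rt.AS i" "R.AS j"] by (simp add: biorthogonal_riesz_bases_def)
  then have brb': "biorthogonal_riesz_bases Rt.AS R.AS"
    using brb by (simp add: biorthogonal_riesz_bases_def)
  have bi: "biorth R.E Rt.E" by (rule E_biorth[OF brb])
  have rep: "reproducing R.E Rt.E" by (rule reproducing_commute[OF E_reproducing[OF brb]])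
  have "biorthogonal_wavelet_filter_bank M0 M b0 b bt0 bt"
    unfolding biorthogonal_wavelet_filter_bank_def
    using dual_framelet_of_reproducing[OF R.filters_axioms Rt.filters_axioms rep]
      analysis_synthesis_id[OF R.filters_axioms Rt.filters_axioms bi rep] by blast
  moreover have "l2_stable M0 M b0 b"
    using finite_stability[OF brb] R.l2_stableI by blast
  moreover have "l2_stable M0 M bt0 bt"
    using refinable_pair.finite_stability[OF swapped brb'] Rt.l2_stableI by blast
  moreover have "\<forall>\<kappa> \<kappa>'. L2_inner (shifts \<phi> \<kappa>) (shifts \<phi>t \<kappa>') = (if \<kappa> = \<kappa>' then 1 else 0)"
    using shifts_biorth[OF brb] by blast
  ultimately show "biorthogonal_wavelet_filter_bank M0 M b0 b bt0 bt \<and> l2_stable M0 M b0 b \<and> l2_stable M0 M bt0 bt \<and>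
    (\<forall>\<kappa> \<kappa>'. L2_inner (shifts \<phi> \<kappa>) (shifts \<phi>t \<kappa>') = (if \<kappa> = \<kappa>' then 1 else 0))" by blast
qed

end

theorem theorem5p10:
  fixes M0 :: "int ^ 'd ^ 'd" and M :: "'s :: finite \<Rightarrow> int ^ 'd ^ 'd"
    and b0 bt0 :: "int ^ 'd \<Rightarrow> complex ^ 'r ^ 'r"
    and b bt :: "'s \<Rightarrow> int ^ 'd \<Rightarrow> complex ^ 'r ^ 1"
    and \<psi>0 \<psi>t0 :: "real ^ 'd \<Rightarrow> complex ^ 'r"
    and \<psi> \<psi>t :: "'s \<Rightarrow> real ^ 'd \<Rightarrow> complex"
  assumes "finitely_supported b0" and "finitely_supported bt0"
    and "\<And>l. finitely_supported (b l)" and "\<And>l. finitely_supported (bt l)"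
    and "dilation_matrix M0" and "\<And>l. dilation_matrix (M l)"
    and "L2_fun \<psi>0" and "L2_fun \<psi>t0"
    and "compactly_supported \<psi>0" and "compactly_supported \<psi>t0"
    and "standard_refinable M0 b0 \<psi>0" and "standard_refinable M0 bt0 \<psi>t0"
    and "\<And>\<xi>. fourier_vec \<psi>0 (transpose (rmat M0) *v \<xi>) = fseries b0 \<xi> *v fourier_vec \<psi>0 \<xi>"
    and "\<And>\<xi>. fourier_vec \<psi>t0 (transpose (rmat M0) *v \<xi>) = fseries bt0 \<xi> *v fourier_vec \<psi>t0 \<xi>"
    and "(\<Sum>q\<in>UNIV. cnj (fourier_vec \<psi>0 0 $ q) * fourier_vec \<psi>t0 0 $ q) = 1"
    and "\<And>l. has_fourier_L2 (\<psi> l)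
           (\<lambda>\<xi>. (fseries (b l) (inv_transp M0 *v \<xi>) *v fourier_vec \<psi>0 (inv_transp M0 *v \<xi>)) $ 1)"
    and "\<And>l. has_fourier_L2 (\<psi>t l)
           (\<lambda>\<xi>. (fseries (bt l) (inv_transp M0 *v \<xi>) *v fourier_vec \<psi>t0 (inv_transp M0 *v \<xi>)) $ 1)"
  shows "(biorthogonal_wavelet_filter_bank M0 M b0 b bt0 bt
          \<and> l2_stable M0 M b0 b \<and> l2_stable M0 M bt0 bt
          \<and> (\<forall>k. L2_inner_mat \<psi>t0 (\<lambda>x. \<psi>0 (x - rvec k)) = mat (delta k))
          \<longrightarrow> biorthogonal_wavelet M0 M \<psi>0 \<psi> \<psi>t0 \<psi>t)
       \<and> (biorthogonal_wavelet M0 M \<psi>0 \<psi> \<psi>t0 \<psi>t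
          \<and> (\<exists>C'>0. (AE \<xi> in lebesgue.
                loewner_ge (bracket (fourier_vec \<psi>0) (fourier_vec \<psi>0) \<xi>) (mat (complex_of_real C')))
              \<and> (AE \<xi> in lebesgue.
                loewner_ge (bracket (fourier_vec \<psi>t0) (fourier_vec \<psi>t0) \<xi>) (mat (complex_of_real C'))))
          \<longrightarrow> biorthogonal_wavelet_filter_bank M0 M b0 b bt0 bt
            \<and> l2_stable M0 M b0 b \<and> l2_stable M0 M bt0 bt
            \<and> (\<forall>k. L2_inner_mat \<psi>t0 (\<lambda>x. \<psi>0 (x - rvec k)) = mat (delta k)))"
proof -
  have f: "filters M0 M b0 b" "filters M0 M bt0 bt"
    using assms(1-6) by (auto simp: filters_def dilation_matrix_det finitely_supported_def)
  obtain \<phi> R where R: "refinable M0 M b0 b \<phi> R" "\<And>q. AE x in lebesgue. \<psi>0 x $ q = \<phi> q x"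
    "\<And>i. AE x in lebesgue. affine_system M0 M \<psi>0 \<psi> i x = refinable.AS M0 M b0 b \<phi> i x"
    "\<And>q. fourier_vec \<psi>0 0 $ q = (LINT x|lebesgue. \<phi> q x)"
    using refinable_representative[OF f(1) assms(7,9,13,16)] by blast
  obtain \<phi>t Rt where Rt: "refinable M0 M bt0 bt \<phi>t Rt" "\<And>q. AE x in lebesgue. \<psi>t0 x $ q = \<phi>t q x"
    "\<And>i. AE x in lebesgue. affine_system M0 M \<psi>t0 \<psi>t i x = refinable.AS M0 M bt0 bt \<phi>t i x"
    "\<And>q. fourier_vec \<psi>t0 0 $ q = (LINT x|lebesgue. \<phi>t q x)"
    using refinable_representative[OF f(2) assms(8,10,14,17)] by blast
  interpret refinable_pair M0 M b0 b bt0 bt \<phi> \<phi>t R Rt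
    by (intro refinable_pair.intro R(1) Rt(1))
  have "AE x in lebesgue. R.AS i x = affine_system M0 M \<psi>0 \<psi> i x" for i
    using R(3)[of i] by eventually_elim simp
  moreover have "AE x in lebesgue. Rt.AS i x = affine_system M0 M \<psi>t0 \<psi>t i x" for i
    using Rt(3)[of i] by eventually_elim simp
  ultimately have "biorthogonal_riesz_bases R.AS Rt.AS
    \<longleftrightarrow> biorthogonal_riesz_bases (affine_system M0 M \<psi>0 \<psi>) (affine_system M0 M \<psi>t0 \<psi>t)"
    by (rule biorthogonal_riesz_bases_ae[OF _ _ R.AS_L2 Rt.AS_L2])
  then have wav: "biorthogonal_wavelet M0 M \<psi>0 \<psi> \<psi>t0 \<psi>t \<longleftrightarrow> biorthogonal_riesz_bases R.AS Rt.AS"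
    by (simp add: biorthogonal_wavelet_def)
  \<comment> \<open>The sum is 1, so some component has nonzero integral for both refinable
    functions at once; these integrals drive the density argument for each system.\<close>
  have "(\<Sum>q\<in>UNIV. cnj (fourier_vec \<psi>0 0 $ q) * fourier_vec \<psi>t0 0 $ q) \<noteq> 0" using assms(15) by simp
  then obtain q where "cnj (fourier_vec \<psi>0 0 $ q) * fourier_vec \<psi>t0 0 $ q \<noteq> 0"
    by (rule sum.not_neutral_contains_not_neutral)
  then have "(LINT x|lebesgue. \<phi> q x) \<noteq> 0" "(LINT x|lebesgue. \<phi>t q x) \<noteq> 0"
    unfolding R(4)[symmetric] Rt(4)[symmetric] by auto
  from biorthogonal_riesz_bases_AS_iff[OF assms(5) this] show ?thesis
    unfolding wav shifts_biorth_iff[OF assms(7,8) R(2) Rt(2)] by blast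
qed

end
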